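(* Let $M \subset \mathbb{C}^N$ be a connected real analytic generic submanifold of (real) codimension 2 through the origin. The following are equivalent: (i) There exists a Levi-flat $C^\infty$ hypersurface $H$ with boundary, such that $0 \in \partial H \subset M$. (ii) There exists a real analytic Levi-flat hypersurface (submanifold) $H$ defined in a neighbourhood $U$ of the origin such that $M \cap U \subset H$. (iii) There exist local holomorphic coordinates $(z,w) \in \mathbb{C}^{N-2}\times\mathbb{C}^2$ near the origin such that $M$ is defined near the origin by equations of the form $$\operatorname{Im} w_1 = \varphi(z,\bar z,\operatorname{Re} w), \qquad \operatorname{Im} w_2 = 0,$$ for some real-valued real analytic $\varphi$ such that $\varphi(0,\bar z,s)\equiv\varphi(z,0,s)\equiv 0$. (iv) There exists a real analytic foliation of codimension 1 in $M$, defined in a neighbourhood of the origin, such that the leaves are unions of (representatives of) local CR orbits of $M$.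
   Context: "Submanifold" means embedded submanifold; "hypersurface" means a submanifold of real codimension 1. Let $J$ be the complex structure on $\mathbb{C}^N$. For a real submanifold $M$, $T_p^cM = J(T_pM)\cap T_pM$. $M$ is CR if $\dim T_p^cM$ is constant in $p \in M$. $M$ is generic if $T_pM + J(T_pM) = T_p\mathbb{C}^N$ for all $p \in M$. The local CR orbit of a CR submanifold $M$ at $p$ is the smallest (in dimension) germ at $p$ of a CR submanifold $N \subset M$ through $p$ such that $T_q^cN = T_q^cM$ for $q\in N$. $C^k$ hypersurface with boundary: a set $H \subset \mathbb{C}^N$ with a subset $\partial H \subset H$ such that $H^o := H\setminus\partial H$ is a $C^k$ hypersurface and for each $p \in \partial H$ there are a neighbourhood $U \subset \mathbb{C}^N$ of $p$ and a $C^k$ diffeomorphism $\varphi\colon U \to \mathbb{R}^{2N}$ with $\varphi(H\cap U) = \{x \mid x_{2N-1}\ge 0,\ x_{2N}=0\}$ and $\varphi(\partial H\cap U) = \{x \mid x_{2N-1}=0,\ x_{2N}=0\}$. A $C^k$ ($k\geq 2$) hypersurface $H$ is Levi-flat if the bundle $T^cH$ is involutive; equivalently, near every point $H$ is foliated by a one-parameter family of complex hypersurfaces. A hypersurface with boundary $H$ is Levi-flat if $H^o$ is Levi-flat. In (iii), $\varphi(z,\bar z, s)$ is given near $0$ by a convergent power series in $(z,\bar z,s)$; the expressions $\varphi(0,\bar z,s)$ and $\varphi(z,0,s)$ are obtained by treating $z$ and $\bar z$ as independent variables in that series. *)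

theory Defs
  imports "HOL-Analysis.Analysis" "HOL-Library.Disjoint_Sets"
begin

section \<open>Regularity classes\<close>

text \<open>
  For an open set \<open>S\<close> in a finite-dimensional space, \<open>Ck_on k f S\<close> says that all directional
  derivatives of \<open>f\<close> up to order \<open>k\<close> exist and are continuous on \<open>S\<close>.  It is meaningful for
  open \<open>S\<close> only, and is used below for open \<open>S\<close> only.
\<close>

primrec Ck_on ::
  "nat \<Rightarrow> ('a::real_normed_vector \<Rightarrow> 'b::real_normed_vector) \<Rightarrow> 'a set \<Rightarrow> bool" where
  "Ck_on 0 f S \<longleftrightarrow> continuous_on S f"
| "Ck_on (Suc k) f S \<longleftrightarrow>
     (\<forall>x\<in>S. f differentiable (at x)) \<and>
     (\<forall>v. Ck_on k (\<lambda>x. frechet_derivative f (at x) v) S)"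

text \<open>
  A multi-index over \<open>I\<close> is a function set to \<open>0\<close> off \<open>I\<close>.  In finite dimension, unordered
  summation (\<open>has_sum\<close>) is absolute convergence.
\<close>

definition multi_indices :: "'i set \<Rightarrow> ('i \<Rightarrow> nat) set" where
  "multi_indices I = {\<alpha>. \<forall>i. i \<notin> I \<longrightarrow> \<alpha> i = 0}"

definition real_analytic_on ::
  "('a::euclidean_space \<Rightarrow> 'b::real_normed_vector) \<Rightarrow> 'a set \<Rightarrow> bool" where
  "real_analytic_on f S \<longleftrightarrow>
     (\<forall>p\<in>S. \<exists>r>0. \<exists>c. \<forall>x\<in>ball p r.
        ((\<lambda>\<alpha>. (\<Prod>b\<in>Basis. ((x - p) \<bullet> b) ^ \<alpha> b) *\<^sub>R c \<alpha>) has_sum f x) (multi_indices Basis))"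

datatype regularity = C_fin nat | C_infinity | C_omega

fun of_class ::
  "regularity \<Rightarrow> ('a::euclidean_space \<Rightarrow> 'b::real_normed_vector) \<Rightarrow> 'a set \<Rightarrow> bool" where
  "of_class (C_fin k) f S \<longleftrightarrow> Ck_on k f S"
| "of_class C_infinity f S \<longleftrightarrow> (\<forall>k. Ck_on k f S)"
| "of_class C_omega f S \<longleftrightarrow> real_analytic_on f S"

definition diffeo ::
  "regularity \<Rightarrow> 'a::euclidean_space set \<Rightarrow> 'b::euclidean_space set \<Rightarrow> ('a \<Rightarrow> 'b) \<Rightarrow> bool" where
  "diffeo r U V f \<longleftrightarrow>
     open U \<and> open V \<and> bij_betw f U V \<and> of_class r f U \<and> of_class r (inv_into U f) V"


section \<open>Embedded submanifolds and foliations\<close>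

text \<open>
  The model space is the ambient space itself with its orthonormal basis; for \<^typ>\<open>complex^'n\<close> this is
  the real space of dimension \<open>2N\<close>, and the basis elements play the role of the real coordinates.
  The set \<open>B\<close> selects the coordinates that vanish on the submanifold, in no particular order.
\<close>

definition slice_chart ::
  "regularity \<Rightarrow> 'a::euclidean_space set \<Rightarrow> 'a set \<Rightarrow> 'a set \<Rightarrow> ('a \<Rightarrow> 'a) \<Rightarrow> bool" where
  "slice_chart r M B V \<phi> \<longleftrightarrow>
     diffeo r V (\<phi> ` V) \<phi> \<and> B \<subseteq> Basis \<and>
     \<phi> ` (M \<inter> V) = {y \<in> \<phi> ` V. \<forall>b\<in>B. y \<bullet> b = 0}"

definition submanifold :: "regularity \<Rightarrow> nat \<Rightarrow> 'a::euclidean_space set \<Rightarrow> bool" where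
  "submanifold r codim M \<longleftrightarrow>
     (\<forall>p\<in>M. \<exists>V \<phi> B. p \<in> V \<and> card B = codim \<and> slice_chart r M B V \<phi>)"

definition hypersurface :: "regularity \<Rightarrow> 'a::euclidean_space set \<Rightarrow> bool" where
  "hypersurface r H \<longleftrightarrow> submanifold r 1 H"

definition hypersurface_with_boundary ::
  "regularity \<Rightarrow> 'a::euclidean_space set \<Rightarrow> 'a set \<Rightarrow> bool" where
  "hypersurface_with_boundary r H bd \<longleftrightarrow>
     bd \<subseteq> H \<and> hypersurface r (H - bd) \<and>
     (\<forall>p\<in>bd. \<exists>U \<phi>. \<exists>b1\<in>Basis. \<exists>b2\<in>Basis. b1 \<noteq> b2 \<and> p \<in> U \<and> diffeo r U (UNIV :: 'a set) \<phi> \<and>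
        \<phi> ` (H \<inter> U) = {x. x \<bullet> b1 \<ge> 0 \<and> x \<bullet> b2 = 0} \<and>
        \<phi> ` (bd \<inter> U) = {x. x \<bullet> b1 = 0 \<and> x \<bullet> b2 = 0})"

definition tangent_space :: "'a::real_normed_vector set \<Rightarrow> 'a \<Rightarrow> 'a set" where
  "tangent_space M p =
     {v. \<exists>\<gamma> \<epsilon>. \<epsilon> > 0 \<and> \<gamma> 0 = p \<and> (\<forall>t::real. \<bar>t\<bar> < \<epsilon> \<longrightarrow> \<gamma> t \<in> M) \<and>
           (\<gamma> has_vector_derivative v) (at 0)}"

text \<open>
  A foliation of codimension \<open>q\<close> of a submanifold \<open>M\<close>, given by its set of leaves: in suitable
  charts the components of every leaf are the slices on which \<open>q\<close> of the coordinates of \<open>M\<close> are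
  constant.  Since components of \<open>L \<inter> V\<close> are single slices, a path in \<open>L\<close> is also continuous for
  the leaf topology; thus \<open>path_connected L\<close> is connectedness in the leaf topology, whereas
  \<open>connected L\<close> would also allow certain unions of several dense leaves.
\<close>

definition foliation ::
  "regularity \<Rightarrow> nat \<Rightarrow> 'a::euclidean_space set \<Rightarrow> 'a set set \<Rightarrow> bool" where
  "foliation r q M \<L> \<longleftrightarrow>
     partition_on M \<L> \<and> (\<forall>L\<in>\<L>. path_connected L) \<and>
     (\<forall>p\<in>M. \<exists>V \<phi> B B'. p \<in> V \<and> slice_chart r M B V \<phi> \<and>
        B' \<subseteq> Basis - B \<and> card B' = q \<and>
        (\<forall>L\<in>\<L>. \<forall>C\<in>components (L \<inter> V).
           \<exists>c :: 'a \<Rightarrow> real. C = {x \<in> M \<inter> V. \<forall>b\<in>B'. \<phi> x \<bullet> b = c b}))"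


section \<open>CR geometry\<close>

definition J :: "complex^'n \<Rightarrow> complex^'n" where
  "J v = \<i> *s v"

definition complex_tangent_space :: "(complex^'n) set \<Rightarrow> complex^'n \<Rightarrow> (complex^'n) set" where
  "complex_tangent_space M p = J ` tangent_space M p \<inter> tangent_space M p"

definition CR :: "(complex^'n) set \<Rightarrow> bool" where
  "CR M \<longleftrightarrow> (\<exists>d. \<forall>p\<in>M. dim (complex_tangent_space M p) = d)"

definition generic :: "(complex^'n) set \<Rightarrow> bool" where
  "generic M \<longleftrightarrow>
     (\<forall>p\<in>M. {u + v |u v. u \<in> tangent_space M p \<and> v \<in> J ` tangent_space M p} = UNIV)"

text \<open>
  The candidates among which a local CR orbit of \<open>M\<close> at \<open>p\<close> has the least dimension, that is, the
  greatest codimension in the ambient space.  A germ is given by any of its representatives.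
\<close>

definition CR_orbit_candidate ::
  "(complex^'n) set \<Rightarrow> complex^'n \<Rightarrow> nat \<Rightarrow> (complex^'n) set \<Rightarrow> bool" where
  "CR_orbit_candidate M p codim S \<longleftrightarrow>
     submanifold C_infinity codim S \<and> CR S \<and> p \<in> S \<and> S \<subseteq> M \<and>
     (\<forall>q\<in>S. complex_tangent_space S q = complex_tangent_space M q)"

definition represents_local_CR_orbit ::
  "(complex^'n) set \<Rightarrow> complex^'n \<Rightarrow> (complex^'n) set \<Rightarrow> bool" where
  "represents_local_CR_orbit M p S \<longleftrightarrow>
     (\<exists>d. CR_orbit_candidate M p d S \<and> (\<forall>d' S'. CR_orbit_candidate M p d' S' \<longrightarrow> d' \<le> d))"

text \<open>
  Sections of the bundle are given by local extensions to the ambient space, and their bracket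
  is the one of the extensions.  For fields tangent to \<open>M\<close>, its values on \<open>M\<close> do not depend on
  the extensions.
\<close>

definition involutive ::
  "'a::real_normed_vector set \<Rightarrow> ('a \<Rightarrow> 'a set) \<Rightarrow> bool" where
  "involutive M E \<longleftrightarrow>
     (\<forall>U X Y. open U \<and> Ck_on 1 X U \<and> Ck_on 1 Y U \<and> (\<forall>q\<in>M \<inter> U. X q \<in> E q \<and> Y q \<in> E q) \<longrightarrow>
        (\<forall>q\<in>M \<inter> U.
           frechet_derivative Y (at q) (X q) - frechet_derivative X (at q) (Y q) \<in> E q))"

definition Levi_flat :: "(complex^'n) set \<Rightarrow> bool" where
  "Levi_flat H \<longleftrightarrow> involutive H (complex_tangent_space H)"


section \<open>Holomorphic coordinates\<close>

definition holomorphic_map_on ::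
  "(complex^'m \<Rightarrow> complex^'n) \<Rightarrow> (complex^'m) set \<Rightarrow> bool" where
  "holomorphic_map_on f S \<longleftrightarrow>
     (\<forall>x\<in>S. \<exists>f'. (f has_derivative f') (at x) \<and> (\<forall>c v. f' (c *s v) = c *s f' v))"

definition biholomorphic ::
  "(complex^'n) set \<Rightarrow> (complex^'n) set \<Rightarrow> (complex^'n \<Rightarrow> complex^'n) \<Rightarrow> bool" where
  "biholomorphic U V f \<longleftrightarrow>
     open U \<and> open V \<and> bij_betw f U V \<and>
     holomorphic_map_on f U \<and> holomorphic_map_on (inv_into U f) V"

text \<open>
  Power series in \<open>(z, \<zeta>, s)\<close> with \<open>z\<close>, \<open>\<zeta>\<close> complex and \<open>s = (s1, s2)\<close> real, where \<open>\<zeta>\<close> is the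
  independent variable in place of the conjugate of \<open>z\<close>.  Only the coordinates of \<open>z\<close> and \<open>\<zeta>\<close> in
  \<open>I\<close> enter; \<open>I\<close> will have \<open>N - 2\<close> elements and may be empty.
\<close>

type_synonym 'n series_coeffs = "('n \<Rightarrow> nat) \<Rightarrow> ('n \<Rightarrow> nat) \<Rightarrow> nat \<Rightarrow> nat \<Rightarrow> complex"

definition series_term ::
  "'n set \<Rightarrow> 'n series_coeffs \<Rightarrow> complex^'n \<Rightarrow> complex^'n \<Rightarrow> real \<times> real \<Rightarrow>
   ('n \<Rightarrow> nat) \<times> ('n \<Rightarrow> nat) \<times> nat \<times> nat \<Rightarrow> complex" where
  "series_term I c z \<zeta> s = (\<lambda>(\<alpha>, \<beta>, k, l).
     c \<alpha> \<beta> k l * (\<Prod>i\<in>I. (z $ i) ^ \<alpha> i) * (\<Prod>i\<in>I. (\<zeta> $ i) ^ \<beta> i) *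
     of_real (fst s ^ k * snd s ^ l))"

definition has_series ::
  "'n set \<Rightarrow> 'n series_coeffs \<Rightarrow> real \<Rightarrow>
   (complex^'n \<Rightarrow> complex^'n \<Rightarrow> real \<times> real \<Rightarrow> complex) \<Rightarrow> bool" where
  "has_series I c \<rho> \<Phi> \<longleftrightarrow>
     (\<forall>z \<zeta> s. (\<forall>i\<in>I. norm (z $ i) < \<rho> \<and> norm (\<zeta> $ i) < \<rho>) \<and> \<bar>fst s\<bar> < \<rho> \<and> \<bar>snd s\<bar> < \<rho> \<longrightarrow>
        (series_term I c z \<zeta> s has_sum \<Phi> z \<zeta> s)
          (multi_indices I \<times> multi_indices I \<times> UNIV \<times> UNIV))"

definition cnj_vec :: "complex^'n \<Rightarrow> complex^'n" where
  "cnj_vec z = (\<chi> i. cnj (z $ i))"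

text \<open>
  The coordinates are the components of \<open>\<Psi>\<close>: \<open>w\<^sub>1\<close> and \<open>w\<^sub>2\<close> are those with index \<open>i1\<close> and \<open>i2\<close>,
  and \<open>z\<close> consists of the remaining ones.  \<open>\<Phi> z \<zeta> s\<close> is the series with \<open>z\<close> and \<open>\<zeta>\<close>
  independent, so that \<open>\<Phi> z (cnj_vec z) s\<close> is the defining function itself.
\<close>

definition in_normal_coordinates ::
  "(complex^'n) set \<Rightarrow> (complex^'n) set \<Rightarrow> (complex^'n \<Rightarrow> complex^'n) \<Rightarrow> 'n \<Rightarrow> 'n \<Rightarrow> bool" where
  "in_normal_coordinates M U \<Psi> i1 i2 \<longleftrightarrow>
     (\<exists>c \<rho> \<Phi> \<phi>. \<rho> > 0 \<and> has_series (- {i1, i2}) c \<rho> \<Phi> \<and>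
        (\<forall>z s. (\<forall>i\<in>- {i1, i2}. norm (z $ i) < \<rho>) \<and> \<bar>fst s\<bar> < \<rho> \<and> \<bar>snd s\<bar> < \<rho> \<longrightarrow>
           \<Phi> z (cnj_vec z) s = of_real (\<phi> z s) \<and>
           \<Phi> 0 (cnj_vec z) s = 0 \<and>
           \<Phi> z 0 s = 0) \<and>
        (\<forall>x\<in>U. (\<forall>i\<in>- {i1, i2}. norm (\<Psi> x $ i) < \<rho>) \<and>
                \<bar>Re (\<Psi> x $ i1)\<bar> < \<rho> \<and> \<bar>Re (\<Psi> x $ i2)\<bar> < \<rho>) \<and>
        M \<inter> U = {x \<in> U. Im (\<Psi> x $ i1) = \<phi> (\<Psi> x) (Re (\<Psi> x $ i1), Re (\<Psi> x $ i2)) \<and>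
                         Im (\<Psi> x $ i2) = 0})"

end

(* In normal coordinates the complexification of M carries two families of germs W and T (the
   w-coordinates read from either side), and a germ g of two variables with g(W) = g(T) is a CR
   function real on M. Such a g with nonvanishing differential straightens M as in (iii), which
   gives explicit hypersurfaces and leaves. Conversely, a Levi-flat hypersurface, on one side only,
   has a conormal ratio K that is CR on M up to the boundary; where the Levi form of M does not
   vanish identically K is a smooth quotient of analytic functions, hence analytic, and K = K(W),
   so g is a first integral of the complex vector field defined by K. For a foliation as in (iv)
   the leaf function is itself CR and real. *)
theory Submission imports Defs "HOL-Complex_Analysis.Complex_Analysis"
begin

text \<open>A hypersurface given on one side only yields smooth data on M, so the ratio K has no
  reason to be analytic at the outset. Let l_k be the derivative of w_k along a (1,0) field. The
  function l_b - K l_a is CR, and a (0,1) field applied to it gives K m_a = m_b, where m_a and m_b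
  are coefficients of the Levi form. The divisor m_a may vanish at the origin, hence a division
  theorem by homogeneous parts with a convergence estimate. If every m_a vanishes identically, so
  does every m_b, and w_b itself is the wanted function. Normality closes the argument: every value
  of the w-side is attained on zeta = 0, where W = T. So a CR function that vanishes there is zero,
  and a reality condition restricted to zeta = 0 becomes an equation that removes the dependence on
  z. Real analytic statements are transferred to holomorphic germs on the doubled space, where the
  points (x, conj x) form a set of uniqueness. In the direction from (iii) only a shear is used; it
  flattens the normal equations and leaves the coordinate w_2 holomorphic, so Im w_2 = 0 and the
  levels of Re w_2 do all the work.\<close>

no_notation fps_nth (infixl "$" 75)

abbreviation near0 :: "('a::{zero,topological_space} => bool) => bool" (binder "NEAR " 10) where
 "near0 P == eventually P (nhds 0)"

lemmas evo = eventually_nhds_in_open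
lemmas blhd = bounded_linear_imp_has_derivative
lemmas hdbl = has_derivative_bounded_linear
lemmas fdw = frechet_derivative_works
lemmas bllin = bounded_linear.linear
lemmas lincont = linear_continuous_at
lemmas ev_x = eventually_nhds_x_imp_x
lemmas evm = eventually_mono
lemmas hdc = has_derivative_compose
lemmas veq = vec_eq_iff
lemmas lcb = linear_conv_bounded_linear
lemmas ceq = complex_eq_iff
lemmas cts_def = complex_tangent_space_def

abbreviation (input) iff_bool (infixr "<->" 25) where "A <-> B == A = B"
abbreviation (input) mis where "mis == multi_indices"
abbreviation (input) con where "con == continuous_on"
abbreviation (input) cts where "cts == complex_tangent_space"
abbreviation (input) tsp where "tsp == tangent_space"
abbreviation (input) blin where "blin == bounded_linear"
abbreviation (input) has_der (infix "HD" 50) where "f HD g == (f has_derivative g)"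
abbreviation (input) scale_real (infixr "*R" 75) where "x *R y == x *\<^sub>R y"
abbreviation (input) inner_real (infixl "~~" 70) where "x ~~ y == x \<bullet> y"

section \<open>Complex differentiability\<close>

definition cdiff :: "(complex^'m => complex) => complex^'m => bool" where
 "cdiff f x <-> (EX f'. (f HD f') (at x) & (ALL c v. f' (c *s v) = c * f' v))"

abbreviation dd :: "('a::real_normed_vector => 'b::real_normed_vector) => 'a => 'a => 'b" where
 "dd f x v \<equiv> frechet_derivative f (at x) v"

abbreviation ax :: "'m => complex^'m" where "ax i \<equiv> axis i 1"

text \<open>Componentwise, so that closure properties reduce to \<open>cdiff\<close>. The form with
  one complex linear derivative, which \<open>holomorphic_map_on\<close> uses, is recovered in
  \<open>vdiff_alt\<close>.\<close>

definition vdiff :: "(complex^'m => complex^'k) => complex^'m => bool" where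
 "vdiff F x <-> (ALL i. cdiff (%x. F x$i) x)"

lemma norm_vector_scalar_mult: "norm (c *s (v::complex^'m)) = norm c * norm v"
 unfolding norm_vec_def by (simp add: norm_mult L2_set_right_distrib)

lemma bounded_linear_vsmult: "blin (%c. c *s (v::complex^'m))"
 by (rule bounded_linear_intro[where K="norm v"])
 (simp_all add: veq algebra_simps norm_vector_scalar_mult)

lemma continuous_on_vsmult[continuous_intros]:
 assumes "con S f" "con S g"
 shows "con S (%x. f x *s (g x :: complex^'m))"
 unfolding continuous_on_componentwise
 unfolding continuous_on_def
 by (intro ballI vec_tendstoI, simp)
 (use assms in "simp add: continuous_on_def tendsto_mult tendsto_vec_nth")

lemma vec_lambda_continuous[continuous_intros]:
 "(!!i. con S (%x. f x i)) ==> con S (%x. \<chi> i. f x i)"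
 unfolding continuous_on_def by (intro ballI vec_tendstoI) simp

lemma cdiffI: "(f HD f') (at x) ==> (!!c v. f' (c *s v) = c * f' v) ==> cdiff f x"
 unfolding cdiff_def by blast

lemma dd_eqI: "(f HD f') (at x) ==> dd f x v = f' v"
 using frechet_derivative_at by metis

lemma cdiffD: "cdiff f x ==> (f HD dd f x) (at x)"
 unfolding cdiff_def using frechet_derivative_at by metis

lemma cdiff_scale: "cdiff f x ==> dd f x (c *s v) = c * dd f x v"
 unfolding cdiff_def using frechet_derivative_at by metis

lemma cdiff_differentiable: "cdiff f x ==> f differentiable (at x)"
 using cdiffD differentiableI by blast

lemma cdiff_linear: "cdiff f x ==> blin (dd f x)"
 using cdiffD hdbl by blast

lemma cdiff_iscont: "cdiff f x ==> isCont f x"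
 using cdiffD has_derivative_continuous by blast

lemma hol_continuous: "ALL x:S. cdiff f x ==> con S f"
 by (meson cdiff_iscont continuous_at_imp_continuous_on)

lemma dd_add_vec: "cdiff f x ==> dd f x (u+v) = dd f x u+dd f x v"
 using cdiff_linear linear_add bllin by blast

lemma dd_zero_vec: "cdiff f x ==> dd f x 0 = 0"
 using cdiff_linear linear_0 bllin by blast

lemma vec_basis_expansion: "x = (SUM i:UNIV. (x$i) *s ax i)" for x :: "complex^'m"
 by (simp add: basis_expansion)

lemma dd_expand: assumes "cdiff f x" shows "dd f x v = (SUM i:UNIV. v$i * dd f x (ax i))"
proof -
 have "dd f x v = dd f x (SUM i:UNIV. (v$i) *s ax i)" by (simp add: basis_expansion)
 also have "\<dots> = (SUM i:UNIV. dd f x ((v$i) *s ax i))"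
 using assms cdiff_linear bllin linear_sum by blast
 finally show ?thesis by (simp add: cdiff_scale[OF assms])
qed

lemma cdiff_const[simp, intro]: "cdiff (%x. c) x"
 by (rule cdiffI[of _ "%_. 0"]) auto

lemma nth_has_derivative: "((%x. x$i) HD (%v. v$i)) (at (x::complex^'m))"
 using bounded_linear_vec_nth blhd by blast

lemma cdiff_nth[simp, intro]: "cdiff (%x. x$i) x"
 by (rule cdiffI[OF nth_has_derivative]) simp

lemma cdiff_add[intro]: assumes "cdiff f x" "cdiff g x" shows "cdiff (%x. f x+g x) x"
 by (rule cdiffI[OF has_derivative_add[OF assms[THEN cdiffD]]])
 (simp add: assms[THEN cdiff_scale] algebra_simps)

lemma cdiff_minus[intro]: assumes "cdiff f x" shows "cdiff (%x. - f x) x"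
 by (rule cdiffI[OF has_derivative_minus[OF assms[THEN cdiffD]]]) (simp add: assms[THEN cdiff_scale])

lemma cdiff_diff[intro]: assumes "cdiff f x" "cdiff g x" shows "cdiff (%x. f x - g x) x"
 by (rule cdiffI[OF has_derivative_diff[OF assms[THEN cdiffD]]])
 (simp add: assms[THEN cdiff_scale] algebra_simps)

lemma cdiff_mult[intro]:
 assumes "cdiff f x" "cdiff g x" shows "cdiff (%x. f x * g x) x"
 by (rule cdiffI[OF has_derivative_mult[OF assms[THEN cdiffD]]])
 (simp add: assms[THEN cdiff_scale] algebra_simps)

lemma cdiff_field_compose:
 assumes "cdiff f x" "h field_differentiable (at (f x))" shows "cdiff (%x. h (f x)) x"
proof -
 obtain h' where "(h has_field_derivative h') (at (f x))"
 using assms(2) field_differentiable_def by blast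
 hence "((%x. h (f x)) HD (%v. h' * dd f x v)) (at x)"
 using hdc[OF cdiffD[OF assms(1)]] has_field_derivative_def by blast
 thus ?thesis by (rule cdiffI) (simp add: assms(1)[THEN cdiff_scale])
qed

lemma cdiff_inverse[intro]: "cdiff f x ==> f x ~= 0 ==> cdiff (%x. inverse (f x)) x"
 by (rule cdiff_field_compose) (auto simp: field_differentiable_inverse field_differentiable_ident)

lemma cdiff_divide[intro]: "cdiff f x ==> cdiff g x ==> g x ~= 0 ==> cdiff (%x. f x / g x) x"
 unfolding divide_inverse by auto

lemma cdiff_sum[intro]: "(!!i. i:I ==> cdiff (f i) x) ==> cdiff (%x. SUM i:I. f i x) x"
 by (induction I rule: infinite_finite_induct) auto

lemma cdiff_prod[intro]: "(!!i. i:I ==> cdiff (f i) x) ==> cdiff (%x. PROD i:I. f i x) x"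
 by (induction I rule: infinite_finite_induct) auto

lemma cdiff_power[intro]: "cdiff f x ==> cdiff (%x. f x ^ n) x"
 by (induction n) auto

lemma cdiff_if[intro]: "(b ==> cdiff f x) ==> (\<not> b ==> cdiff g x) ==> cdiff (%x. if b then f x else g x) x"
 by (cases b) auto

lemma cdiff_transform:
 assumes "cdiff f x" "open S" "x:S" "!!y. y:S ==> f y = g y" shows "cdiff g x"
proof (rule cdiffI)
 show "(g HD dd f x) (at x)"
 by (rule has_derivative_transform_within_open[OF cdiffD[OF assms(1)] assms(2,3,4)])
qed (rule cdiff_scale[OF assms(1)])

lemma cdiff_cong_ev:
 assumes "cdiff f x" "\<forall>\<^sub>F y in nhds x. f y = g y" shows "cdiff g x"
proof -
 obtain S where "open S" "x:S" "ALL y:S. f y = g y" using assms(2) unfolding eventually_nhds by auto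
 thus ?thesis using cdiff_transform[OF assms(1)] by auto
qed

lemma dd_transform:
 assumes "open S" "x:S" "!!y. y:S ==> f y = g y" shows "dd f x = dd g x"
proof -
 have "(f HD f') (at x) <-> (g HD f') (at x)" for f'
 using has_derivative_transform_within_open[OF _ assms(1,2), of f f' UNIV g]
 has_derivative_transform_within_open[OF _ assms(1,2), of g f' UNIV f] assms(3) by auto
 thus ?thesis unfolding frechet_derivative_def by simp
qed

lemma has_derivative_vec_iff:
 "(F HD F') (at x) <-> (ALL i. ((%x. F x$i :: complex) HD (%v. F' v$i)) (at x))"
 (is "?L <-> ?R")
proof
 assume ?L thus ?R
 by (intro allI hdc[OF _ blhd[OF bounded_linear_vec_nth]])
next
 assume R: ?R
 show ?L
 proof (subst has_derivative_componentwise_within, rule ballI)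
 fix b :: "complex^'b" assume "b:Basis"
 then obtain i u where b: "b = axis i u" "u:Basis" unfolding Basis_vec_def by auto
 thus "((%x. F x ~~ b) HD (%x. F' x ~~ b)) (at x)"
 using R by (simp add: inner_axis has_derivative_inner_left)
 qed
qed

lemma vdiffD: assumes "vdiff F x"
 shows "(F HD dd F x) (at x)" "dd F x v$i = dd (%x. F x$i) x v"
 "dd F x (c *s v) = c *s dd F x v"
proof -
 have 1: "(F HD (%v. \<chi> i. dd (%x. F x$i) x v)) (at x)"
 using assms unfolding has_derivative_vec_iff vdiff_def by (simp add: cdiffD)
 have e: "dd F x = (%v. \<chi> i. dd (%x. F x$i) x v)" using frechet_derivative_at[OF 1] by simp
 show "(F HD dd F x) (at x)" "dd F x v$i = dd (%x. F x$i) x v"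
 using 1 e by auto
 show "dd F x (c *s v) = c *s dd F x v" unfolding e
 using assms by (simp add: veq vdiff_def cdiff_scale)
qed

lemma vdiff_alt: "vdiff F x <-> (EX F'. (F HD F') (at x) & (ALL c v. F' (c *s v) = c *s F' v))"
proof
 assume "vdiff F x" thus "EX F'. (F HD F') (at x) & (ALL c v. F' (c *s v) = c *s F' v)"
 by (intro exI[of _ "dd F x"]) (simp add: vdiffD)
next
 assume "EX F'. (F HD F') (at x) & (ALL c v. F' (c *s v) = c *s F' v)"
 then obtain F' where F: "(F HD F') (at x)" "ALL c v. F' (c *s v) = c *s F' v" by (elim exE conjE)
 have 1: "((%x. F x$i) HD (%v. F' v$i)) (at x)" for i
 using F(1) unfolding has_derivative_vec_iff by (rule spec)
 have 2: "F' (c *s v)$i = c * F' v$i" for c v i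
 using F(2) by simp
 show "vdiff F x" unfolding vdiff_def by (rule allI) (rule cdiffI[OF 1 2])
qed

lemma vdiff_iscont: "vdiff F x ==> isCont F x"
 by (rule has_derivative_continuous[OF vdiffD(1)])

lemma vdiff_id[simp, intro]: "vdiff (%x. x) x" by (simp add: vdiff_def)
lemma vdiff_const[simp, intro]: "vdiff (%x. c) x" by (simp add: vdiff_def)
lemma vdiff_lambda[intro]: "(!!i. cdiff (%x. f x i) x) ==> vdiff (%x. \<chi> i. f x i) x" by (simp add: vdiff_def)
lemma vdiff_add[intro]: "vdiff f x ==> vdiff g x ==> vdiff (%x. f x+g x) x" by (simp add: vdiff_def cdiff_add)
lemma vdiff_smult[intro]: "cdiff f x ==> vdiff g x ==> vdiff (%x. f x *s g x) x" by (simp add: vdiff_def cdiff_mult)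
lemma vdiff_nth[intro]: "vdiff f x ==> cdiff (%x. f x$i) x" by (simp add: vdiff_def)

lemma cdiff_compose:
 assumes "vdiff F x" "cdiff g (F x)"
 shows "cdiff (%x. g (F x)) x" "dd (%x. g (F x)) x v = dd g (F x) (dd F x v)"
proof -
 have 1: "((%x. g (F x)) HD (%v. dd g (F x) (dd F x v))) (at x)"
 by (rule hdc[OF vdiffD(1)[OF assms(1)] cdiffD[OF assms(2)]])
 show "cdiff (%x. g (F x)) x"
 by (rule cdiffI[OF 1]) (simp add: vdiffD[OF assms(1)] cdiff_scale[OF assms(2)])
 show "dd (%x. g (F x)) x v = dd g (F x) (dd F x v)" using dd_eqI[OF 1] .
qed

lemma vdiff_compose:
 assumes "vdiff F x" "vdiff G (F x)"
 shows "vdiff (%x. G (F x)) x" "dd (%x. G (F x)) x v = dd G (F x) (dd F x v)"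
proof -
 show 1: "vdiff (%x. G (F x)) x"
 unfolding vdiff_def using assms(2)[unfolded vdiff_def] by (intro allI cdiff_compose(1)[OF assms(1)]) blast
 have "((%x. G (F x)) HD (%v. dd G (F x) (dd F x v))) (at x)"
 by (rule hdc[OF vdiffD(1)[OF assms(1)] vdiffD(1)[OF assms(2)]])
 thus "dd (%x. G (F x)) x v = dd G (F x) (dd F x v)" using dd_eqI by blast
qed

section \<open>Cauchy integrals on complex lines, Osgood's lemma, local inverses\<close>

lemma cdiff_line:
 assumes "cdiff f (a+z *s v)"
 shows "((%z. f (a+z *s v)) has_field_derivative dd f (a+z *s v) v) (at z)"
proof -
 have "((%z. a+z *s v) HD (%h. h *s v)) (at z)"
 using blhd[OF bounded_linear_vsmult] by (auto intro!: derivative_eq_intros)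
 from hdc[OF this cdiffD[OF assms]]
 have "((%z. f (a+z *s v)) HD (%h. h * dd f (a+z *s v) v)) (at z)"
 by (simp add: cdiff_scale[OF assms])
 moreover have "(%h. h * dd f (a+z *s v) v) = (*) (dd f (a+z *s v) v)" by (auto simp: mult.commute)
 ultimately show ?thesis unfolding has_field_derivative_def by simp
qed

lemma line_holomorphic:
 assumes "!!z. z:T ==> cdiff f (a+z *s v)"
 shows "(%z. f (a+z *s v)) holomorphic_on T"
 using cdiff_line[OF assms] by (meson field_differentiable_def field_differentiable_at_within holomorphic_on_def)

text \<open>Cauchy's formula for the first derivative, with the circle parametrized over the fixed
  interval \<open>{0..1}\<close> and the factor 2 pi i cancelled. In this form derivatives are
  parameter integrals over a compact interval.\<close>

lemma deriv_circle:
 assumes g: "g holomorphic_on ball 0 R" and r: "0 < r" "r < R"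
 defines "c \<equiv> %t::real. complex_of_real r * exp (2 * of_real pi * \<i> * of_real t)"
 shows "((%t. g (c t) / c t) has_integral deriv g 0) {0..1}"
proof -
 have c0: "c t ~= 0" for t using r by (simp add: c_def)
 have cb: "cball 0 r <= ball (0::complex) R" using r by auto
 have "((%u. g u / (u - 0) ^ Suc 1) has_contour_integral 2 * pi * \<i> / fact 1 * (deriv ^^ 1) g 0) (circlepath 0 r)"
 proof (rule Cauchy_has_contour_integral_higher_derivative_circlepath)
 have "g holomorphic_on cball 0 r" using holomorphic_on_subset[OF g cb] .
 thus "con (cball 0 r) g" "g holomorphic_on ball 0 r"
 using holomorphic_on_imp_continuous_on holomorphic_on_subset[OF _ ball_subset_cball] by blast+
 show "(0::complex):ball 0 r" using r by simp
 qed
 hence "((%t. g (circlepath 0 r t) / (circlepath 0 r t - 0) ^ Suc 1 * vector_derivative (circlepath 0 r) (at t))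
 has_integral (2 * pi * \<i> / fact 1 * (deriv ^^ 1) g 0)) {0..1}"
 unfolding has_contour_integral .
 moreover have "circlepath 0 r = c" unfolding circlepath c_def by simp
 moreover have "vector_derivative (circlepath 0 r) (at t) = 2 * pi * \<i> * c t" for t
 unfolding vector_derivative_circlepath c_def by simp
 ultimately have "((%t. g (c t) / (c t)^2 * (2 * pi * \<i> * c t)) has_integral (2 * pi * \<i> * deriv g 0)) {0..1}"
 by (simp add: numeral_2_eq_2)
 hence "((%t. 1/(2*pi*\<i>) * (g (c t) / (c t)^2 * (2 * pi * \<i> * c t))) has_integral 1/(2*pi*\<i>) * (2 * pi * \<i> * deriv g 0)) {0..1}"
 by (rule has_integral_mult_right)
 moreover have "1/(2*pi*\<i>) * (g (c t) / (c t)^2 * (2 * pi * \<i> * c t)) = g (c t) / c t" for t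
 using c0[of t] by (simp add: power2_eq_square)
 moreover have "1/(2*pi*\<i>) * (2 * pi * \<i> * deriv g 0) = deriv g 0" by simp
 ultimately show ?thesis by (simp only:)
qed

definition circ :: "real => real => complex" where
 "circ r t = complex_of_real r * exp (2 * of_real pi * \<i> * of_real t)"

lemma norm_circ[simp]: "norm (circ r t) = \<bar>r\<bar>"
proof -
 have "norm (exp (2 * of_real pi * \<i> * of_real t)) = 1"
 using norm_exp_i_times[of "2*pi*t"] by (simp add: mult_ac)
 thus ?thesis by (simp add: circ_def norm_mult)
qed

lemma circ_nz[simp]: "r ~= 0 ==> circ r t ~= 0" by (simp add: circ_def)

lemma continuous_on_circ[continuous_intros]: "con S f ==> con S (%x. circ r (f x))"
 unfolding circ_def by (intro continuous_intros)

lemma dd_circle: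
 assumes "!!z. z:ball 0 R ==> cdiff f (x+z *s v)" "0 < r" "r < R"
 shows "((%t. f (x+circ r t *s v) / circ r t) has_integral dd f x v) {0..1}"
proof -
 have h: "(%z. f (x+z *s v)) holomorphic_on ball 0 R" using line_holomorphic assms(1) by metis
 have "deriv (%z. f (x+z *s v)) 0 = dd f x v"
 using DERIV_imp_deriv[OF cdiff_line[OF assms(1)[of 0]]] assms(2,3) by simp
 thus ?thesis using deriv_circle[OF h assms(2,3)] unfolding circ_def by simp
qed

lemma norm_ax[simp]: "norm (ax i :: complex^'m) = 1"
 by (rule norm_Basis) (simp add: axis_in_Basis_iff Basis_complex_def)

lemma line_field_differentiable_shift:
 assumes "(%z. f ((x+w *s v)+z *s v)) field_differentiable (at 0)"
 shows "(%z. f (x+z *s (v::complex^'m))) field_differentiable (at w)"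
proof -
 obtain D where "((%z. f ((x+w *s v)+z *s v)) has_field_derivative D) (at 0)"
 using assms field_differentiable_def by blast
 moreover have "(x+w *s v)+z *s v = x+(z+w) *s v" for z by (simp add: veq algebra_simps)
 ultimately have "((%z. f (x+(z+w) *s v)) has_field_derivative D) (at 0)" by simp
 hence "((%z. f (x+z *s v)) has_field_derivative D) (at (0+w))"
 by (subst DERIV_shift)
 thus ?thesis unfolding field_differentiable_def by auto
qed

text \<open>The axis derivatives are circle integrals of \<open>f\<close>, hence continuous. The
  increment of \<open>f\<close> is then telescoped coordinate by coordinate, and each single step is
  controlled by the one-variable mean value bound.\<close>

lemma osgood:
 fixes f :: "complex^'m => complex"
 assumes S: "open S" and cont: "con S f"
 and axd: "!!x j. x:S ==> (%z. f (x+z *s ax j)) field_differentiable (at 0)"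
 and x0: "x0:S"
 shows "cdiff f x0"
proof -
 obtain r where r: "r > 0" "ball x0 (2*r) <= S"
 proof -
 obtain e where "e > 0" "ball x0 e <= S" using S x0 openE by blast
 thus ?thesis using that[of "e/2"] by auto
 qed
 have inS: "x+z *s ax j:S" if "x:ball x0 r" "norm z < r" for x z and j :: 'm
 proof -
 have "dist x0 (x+z *s ax j) <= dist x0 x+norm (z *s ax j :: complex^'m)"
 by (metis add_diff_cancel_left' dist_norm dist_triangle norm_minus_commute)
 also have "\<dots> < 2*r" using that by (simp add: norm_vector_scalar_mult norm_ax)
 finally show ?thesis using r by auto
 qed
 define d where "d j x = deriv (%z. f (x+z *s ax j)) 0" for j x
 have fd: "(%z. f (x+z *s ax j)) field_differentiable (at w)" if "x:ball x0 r" "norm w < r" for x w j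
 by (rule line_field_differentiable_shift, rule axd, rule inS[OF that])
 have hol: "(%z. f (x+z *s ax j)) holomorphic_on ball 0 r" if "x:ball x0 r" for x j
 unfolding holomorphic_on_def by (rule ballI, rule field_differentiable_at_within, rule fd[OF that]) simp
 have dint: "((%t. f (x+circ (r/2) t *s ax j) / circ (r/2) t) has_integral d j x) {0..1}"
 if "x:ball x0 r" for x j
 unfolding d_def using deriv_circle[OF hol[OF that], of "r/2"] r(1) unfolding circ_def by simp
 have dcont: "con (ball x0 r) (d j)" for j
 proof -
 have "con (ball x0 r) (%x. integral (cbox 0 1) (%t. f (x+circ (r/2) t *s ax j) / circ (r/2) t))"
 proof (rule integral_continuous_on_param)
 have "con (ball x0 r \<times> cbox 0 1) (%y. f (fst y+circ (r/2) (snd y) *s ax j))"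
 by (rule continuous_on_compose2[OF cont]) (use r inS in "auto intro!: continuous_intros")
 thus "con (ball x0 r \<times> cbox 0 1) (%(x, t). f (x+circ (r/2) t *s ax j) / circ (r/2) t)"
 unfolding case_prod_unfold using r(1) by (auto intro!: continuous_intros)
 qed
 moreover have "integral (cbox 0 1) (%t. f (x+circ (r/2) t *s ax j) / circ (r/2) t) = d j x"
 if "x:ball x0 r" for x
 using dint[OF that, of j] by (simp add: integral_unique)
 ultimately show ?thesis by (simp cong: continuous_on_cong_simp)
 qed
 have der: "((%z. f (x+z *s ax j)) has_field_derivative d j (x+w *s ax j)) (at w)"
 if "x:ball x0 r" "norm w < r" "x+w *s ax j:ball x0 r" for x w j
 proof -
 have "((%z. f ((x+w *s ax j)+z *s ax j)) has_field_derivative d j (x+w *s ax j)) (at 0)"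
 unfolding d_def using fd[OF that(3), of 0] r(1) by (simp add: field_differentiable_derivI)
 moreover have "(x+w *s ax j)+z *s ax j = x+(z+w) *s ax j" for z by (simp add: veq algebra_simps)
 ultimately have "((%z. f (x+(z+w) *s ax j)) has_field_derivative d j (x+w *s ax j)) (at 0)" by simp
 hence "((%z. f (x+z *s ax j)) has_field_derivative d j (x+w *s ax j)) (at (0+w))"
 by (subst DERIV_shift)
 thus ?thesis by simp
 qed
 let ?f' = "%v. SUM j:UNIV. v$j * d j x0"
 have bl: "blin ?f'"
 by (intro bounded_linear_sum bounded_linear_mult_const bounded_linear_vec_nth)
 have "(f HD ?f') (at x0)"
 unfolding has_derivative_at_alt
 proof (intro conjI bl allI impI)
 fix e :: real assume e: "e > 0"
 define qv where "qv = e / CARD('m)"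
 have eps: "qv > 0" using e by (simp add: qv_def)
 have "\<forall>\<^sub>F x in at x0. ALL j. dist (d j x) (d j x0) < qv"
 proof (rule eventually_all_finite)
 fix j show "\<forall>\<^sub>F x in at x0. dist (d j x) (d j x0) < qv"
 using dcont[of j] r(1) eps unfolding continuous_on_eq_continuous_at[OF open_ball]
 by (metis centre_in_ball isCont_def tendstoD)
 qed
 then obtain qx0 where d0: "qx0 > 0" "!!x j. x ~= x0 ==> dist x x0 < qx0 ==> dist (d j x) (d j x0) < qv"
 unfolding eventually_at by auto
 define qx where "qx = min qx0 r"
 have dl: "qx > 0" "qx <= r" using d0 r by (auto simp: qx_def)
 have dn: "norm (d j x - d j x0) <= qv" if "dist x x0 < qx" for x j
 using d0(2)[of x j] that eps by (cases "x = x0") (auto simp: qx_def dist_norm)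
 \<comment> \<open>\<open>Q\<close> is the set of coordinates already moved. Each new one adds an
   error of at most \<open>qv * norm h\<close>; since \<open>qv\<close> is e divided by the number
   of coordinates, the total is at most e times the norm of h.\<close>
 have tele: "norm (f (x0+(\<chi> i. if i:Q then h$i else 0)) - f x0 - (SUM j:Q. h$j * d j x0)) <= card Q * qv * norm h"
 if "norm h < qx" "finite Q" for h :: "complex^'m" and Q
 using that(2)
 proof (induction Q)
 case empty
 have "x0+(\<chi> i. 0) = x0" by (simp add: veq)
 thus ?case by simp
 next
 case (insert j Q)
 define y where "y = x0+(\<chi> i. if i:Q then h$i else 0)"
 have ball: "dist (y+z *s ax j) x0 < qx" if z: "norm z <= norm (h$j)" for z
 proof -
 have "norm ((\<chi> i. if i:Q then h$i else 0)+z *s ax j) <= norm h"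
 by (rule norm_le_componentwise_cart) (use z insert.hyps in "auto simp: axis_def")
 moreover have "y+z *s ax j - x0 = (\<chi> i. if i:Q then h$i else 0)+z *s ax j" by (simp add: y_def)
 ultimately have "dist (y+z *s ax j) x0 <= norm h" by (simp only: dist_norm)
 thus ?thesis using `norm h < qx` by linarith
 qed
 have hj: "norm (h$j) < r" using `norm h < qx` dl
 using Finite_Cartesian_Product.norm_nth_le[of h j] by linarith
 have yb: "y:ball x0 r" using ball[of 0] dl by (simp add: dist_commute)
 have "norm ((f (y+(h$j) *s ax j) - (h$j) * d j x0) - (f (y+0 *s ax j) - 0 * d j x0)) <= qv * norm (h$j - 0)"
 proof (rule field_differentiable_bound[where f="%z. f (y+z *s ax j) - z * d j x0" and S="cball 0 (norm (h$j))"
 and f'="%z. d j (y+z *s ax j) - d j x0"])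
 fix z :: complex assume z: "z:cball 0 (norm (h$j))"
 have "((%z. f (y+z *s ax j)) has_field_derivative d j (y+z *s ax j)) (at z)"
 by (rule der[OF yb]) (use z hj ball[of z] dl in "auto simp: dist_commute")
 hence "((%z. f (y+z *s ax j) - z * d j x0) has_field_derivative d j (y+z *s ax j) - d j x0) (at z)"
 by (auto intro!: derivative_eq_intros)
 thus "((%z. f (y+z *s ax j) - z * d j x0) has_field_derivative d j (y+z *s ax j) - d j x0)
 (at z within cball 0 (norm (h$j)))" by (rule has_field_derivative_at_within)
 show "norm (d j (y+z *s ax j) - d j x0) <= qv" using dn[OF ball] z by simp
 qed auto
 moreover have "x0+(\<chi> i. if i:insert j Q then h$i else 0) = y+(h$j) *s ax j"
 using insert.hyps by (auto simp: y_def veq axis_def)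
 ultimately have "norm (f (x0+(\<chi> i. if i:insert j Q then h$i else 0)) - f y - h$j * d j x0) <= qv * norm (h$j)"
 by (simp add: algebra_simps)
 moreover have "norm (h$j) <= norm h" by (rule Finite_Cartesian_Product.norm_nth_le)
 hence "qv * norm (h$j) <= qv * norm h" using eps by simp
 ultimately have A: "norm (f (x0+(\<chi> i. if i:insert j Q then h$i else 0)) - f y - h$j * d j x0) <= qv * norm h"
 by linarith
 have B: "norm (f y - f x0 - (SUM j:Q. h$j * d j x0)) <= card Q * qv * norm h"
 using insert.IH by (simp add: y_def)
 have "f (x0+(\<chi> i. if i:insert j Q then h$i else 0)) - f x0 - (SUM j:insert j Q. h$j * d j x0)
 = (f (x0+(\<chi> i. if i:insert j Q then h$i else 0)) - f y - h$j * d j x0)+(f y - f x0 - (SUM j:Q. h$j * d j x0))"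
 using insert.hyps by simp
 also have "norm \<dots> \<le> qv * norm h+card Q * qv * norm h"
 using norm_triangle_mono[OF A B] .
 also have "\<dots> = card (insert j Q) * qv * norm h" using insert.hyps by (simp add: algebra_simps)
 finally show ?case .
 qed
 show "\<exists>da>0. ALL y. norm (y - x0) < da --> norm (f y - f x0 - ?f' (y - x0)) <= e * norm (y - x0)"
 proof (intro exI[of _ qx] conjI dl allI impI)
 fix y assume "norm (y - x0) < qx"
 moreover have "x0+(\<chi> i. y$i - x0$i) = y" by (simp add: veq)
 ultimately show "norm (f y - f x0 - ?f' (y - x0)) <= e * norm (y - x0)"
 using tele[of "y - x0" UNIV] by (simp add: qv_def)
 qed
 qed
 thus ?thesis
 by (rule cdiffI) (simp add: sum_distrib_left mult.assoc)
qed

lemma line_in_ball: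
 fixes x v :: "complex^'m"
 assumes "x:ball x0 r" "norm z * norm v <= s" "r+s <= R"
 shows "x+z *s v:ball x0 R"
proof -
 have "dist x0 (x+z *s v) <= dist x0 x+norm (z *s v)"
 by (metis add_diff_cancel_left' dist_norm dist_triangle norm_minus_commute)
 thus ?thesis using assms by (simp add: norm_vector_scalar_mult)
qed

text \<open>By \<open>osgood\<close> one complex variable at a time suffices. There the Leibniz rule
  asks for joint continuity of the derivative, which holds because that derivative is a circle
  integral of the jointly continuous \<open>F\<close>.\<close>

lemma hol_integral:
 fixes F :: "complex^'m => real => complex"
 assumes S: "open S" and cont: "con (S \<times> {0..1}) (%(x, t). F x t)"
 and hol: "!!x t. x:S ==> t:{0..1} ==> cdiff (%x. F x t) x"
 and x: "x:S"
 shows "cdiff (%x. integral {0..1} (F x)) x"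
proof (rule osgood[OF S _ _ x])
 show "con S (%x. integral {0..1} (F x))"
 using integral_continuous_on_param[of S 0 1 F] cont by simp
next
 fix x j assume x: "x:S"
 obtain R where R: "R > 0" "ball x R <= S" using S x openE by blast
 have inS: "x+z *s ax j:S" if "norm z < R" for z
 using R(2) that by (auto simp: dist_norm norm_vector_scalar_mult norm_ax)
 \<comment> \<open>The point moves in a disc of radius r and the auxiliary disc of
   \<open>dd_circle\<close> has radius 2r, so sums of the two stay within R = 3r.\<close>
 define r where "r = R/3"
 have r: "r > 0" "r+r < R" using R by (auto simp: r_def)
 let ?fx = "%z t. dd (%x. F x t) (x+z *s ax j) (ax j)"
 have "(%z. integral (cbox 0 1) (F (x+z *s ax j))) holomorphic_on ball 0 r"
 proof (rule leibniz_rule_holomorphic)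
 fix z t assume z: "z:ball (0::complex) r" and t: "t:cbox 0 (1::real)"
 have "cdiff (%x. F x t) (x+z *s ax j)" by (rule hol) (use z t r in "auto intro!: inS")
 from cdiff_line[OF this] show "((%z. F (x+z *s ax j) t) has_field_derivative ?fx z t) (at z within ball 0 r)"
 by (rule has_field_derivative_at_within)
 next
 fix z assume z: "z:ball (0::complex) r"
 have "con {0..1} (%t. (%(x,t). F x t) (x+z *s ax j, t))"
 by (rule continuous_on_compose2[OF cont]) (use z r in "auto intro!: continuous_intros inS")
 thus "F (x+z *s ax j) integrable_on cbox 0 1" by (simp add: integrable_continuous_real)
 next
 have "con (ball 0 r \<times> cbox 0 1)
 (%p. integral (cbox 0 1) (%s. F (x+(fst p+circ r s) *s ax j) (snd p) / circ r s))"
 proof (rule integral_continuous_on_param)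
 have "norm (a+circ r b) < R" if "norm a < r" for a b
 proof -
 have "norm (a+circ r b) <= norm a+norm (circ r b)" by (rule norm_triangle_ineq)
 thus ?thesis using that r by simp
 qed
 hence in2: "x+(a *s ax j+circ r b *s ax j):S" if "norm a < r" for a b
 using inS[of "a+circ r b"] that by (simp add: vector_sadd_rdistrib)
 have "con ((ball 0 r \<times> cbox 0 1) \<times> cbox 0 1)
 (%q. (%(x,t). F x t) (x+(fst (fst q)+circ r (snd q)) *s ax j, snd (fst q)))"
 by (intro continuous_on_compose2[OF cont]) (use r in "auto intro!: continuous_intros in2 simp: vector_sadd_rdistrib")
 thus "con ((ball 0 r \<times> cbox 0 1) \<times> cbox 0 1)
 (%(p, s). F (x+(fst p+circ r s) *s ax j) (snd p) / circ r s)"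
 unfolding case_prod_unfold using r(1) by (auto intro!: continuous_intros)
 qed
 moreover have "integral (cbox 0 1) (%s. F (x+(z+circ r s) *s ax j) t / circ r s) = ?fx z t"
 if "z:ball 0 r" "t:cbox 0 1" for z t
 proof -
 have "((%s. F ((x+z *s ax j)+circ r s *s ax j) t / circ r s) has_integral ?fx z t) {0..1}"
 proof (rule dd_circle[where R="2*r"])
 fix w :: complex assume w: "w:ball 0 (2*r)"
 have "norm (z+w) < R" using norm_triangle_ineq[of z w] that w by (simp add: r_def)
 from inS[OF this] have "(x+z *s ax j)+w *s ax j:S"
 by (simp add: vector_sadd_rdistrib add.assoc)
 thus "cdiff (%x. F x t) ((x+z *s ax j)+w *s ax j)" using hol that by simp
 qed (use r in auto)
 thus ?thesis by (simp add: integral_unique vector_sadd_rdistrib add.assoc)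
 qed
 ultimately show "con (ball 0 r \<times> cbox 0 1) (%(z, t). ?fx z t)"
 unfolding case_prod_unfold by (auto cong: continuous_on_cong_simp elim!: continuous_on_eq)
 qed simp
 thus "(%z. integral {0..1} (F (x+z *s ax j))) field_differentiable at 0"
 using r(1) by (simp add: holomorphic_on_open field_differentiable_def)
qed

text \<open>The directional derivative is an integral of translates of \<open>f\<close> over a
  circle, so it inherits holomorphy from \<open>hol_integral\<close>.\<close>

lemma hol_dd:
 fixes f :: "complex^'m => complex"
 assumes S: "open S" and hol: "!!x. x:S ==> cdiff f x" and x0: "x0:S"
 shows "cdiff (%x. dd f x v) x0"
proof -
 obtain R where R: "R > 0" "ball x0 R <= S" using S x0 openE by blast
 \<comment> \<open>Chosen so that 2 r times the norm of v is at most R/2; the added 1 covers v =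
   0.\<close>
 define r where "r = R / (4 * (1+norm v))"
 have v0: "1+norm v > 0" by (simp add: add_pos_nonneg)
 have r: "r > 0" using R v0 by (auto simp: r_def)
 have rv: "2 * r * norm v <= R/2"
 using R v0 by (simp add: r_def field_simps)
 have inS: "x+z *s v:S" if "x:ball x0 (R/2)" "norm z < 2*r" for x z
 proof -
 have "norm z * norm v <= R/2" using mult_right_mono[of "norm z" "2*r" "norm v"] that rv by simp
 from line_in_ball[OF that(1) this, of R] R show ?thesis by auto
 qed
 have "cdiff (%x. integral {0..1} (%t. f (x+circ r t *s v) / circ r t)) x0"
 proof (rule hol_integral[OF open_ball])
 have "con (ball x0 (R/2) \<times> {0..1}) (%p. f (fst p+circ r (snd p) *s v))"
 by (rule continuous_on_compose2[OF hol_continuous[of S f]])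
 (use hol r in "auto intro!: continuous_intros inS")
 thus "con (ball x0 (R/2) \<times> {0..1}) (%(x, t). f (x+circ r t *s v) / circ r t)"
 unfolding case_prod_unfold using r by (auto intro!: continuous_intros)
 fix x :: "complex^'m" and t :: real assume "x:ball x0 (R/2)"
 hence "cdiff f (x+circ r t *s v)" using r by (auto intro!: hol inS)
 moreover have "vdiff (%x. x+circ r t *s v) x" by (rule vdiff_add[OF vdiff_id vdiff_const])
 ultimately have "cdiff (%x. f (x+circ r t *s v)) x" by (rule cdiff_compose(1)[rotated])
 thus "cdiff (%x. f (x+circ r t *s v) / circ r t) x"
 by (rule cdiff_divide[OF _ cdiff_const]) (use r in auto)
 qed (use R in auto)
 moreover have "integral {0..1} (%t. f (x+circ r t *s v) / circ r t) = dd f x v" if "x:ball x0 (R/2)" for x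
 proof -
 have "((%t. f (x+circ r t *s v) / circ r t) has_integral dd f x v) {0..1}"
 by (rule dd_circle[of "2*r"]) (use r that in "auto intro!: hol inS")
 thus ?thesis by (simp add: integral_unique)
 qed
 ultimately show ?thesis using cdiff_transform[of _ x0 "ball x0 (R/2)"] R by auto
qed

lemma hol_uniform_limit:
 fixes f :: "'i => complex^'m => complex"
 assumes S: "open S" and hol: "\<forall>\<^sub>F n in F. ALL x:S. cdiff (f n) x" and lim: "uniform_limit S f g F"
 and F: "F ~= bot" and x: "x:S"
 shows "cdiff g x"
proof (rule osgood[OF S _ _ x])
 show "con S g"
 by (rule uniform_limit_theorem[OF _ lim F], rule evm[OF hol]) (rule hol_continuous)
next
 fix x j assume x: "x:S"
 obtain R where R: "R > 0" "ball x R <= S" using S x openE by blast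
 have inS: "x+z *s ax j:S" if "norm z < R" for z
 using R(2) that by (auto simp: dist_norm norm_vector_scalar_mult norm_ax)
 define r where "r = R/2"
 have r: "r > 0" "r < R" using R by (auto simp: r_def)
 obtain "(%z. g (x+z *s ax j)) holomorphic_on ball 0 r"
 proof (rule holomorphic_uniform_limit[where f="%n z. f n (x+z *s ax j)" and z=0 and r=r and F=F])
 show "\<forall>\<^sub>F n in F. con (cball 0 r) (%z. f n (x+z *s ax j)) & (%z. f n (x+z *s ax j)) holomorphic_on ball 0 r"
 using hol
 proof eventually_elim
 case (elim n)
 have "(%z. f n (x+z *s ax j)) holomorphic_on cball 0 r"
 by (rule line_holomorphic) (use elim r in "auto intro!: inS")
 thus ?case using holomorphic_on_imp_continuous_on holomorphic_on_subset ball_subset_cball by metis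
 qed
 show "uniform_limit (cball 0 r) (%n z. f n (x+z *s ax j)) (%z. g (x+z *s ax j)) F"
 unfolding uniform_limit_iff
 proof (intro allI impI)
 fix e :: real assume "e > 0"
 hence "\<forall>\<^sub>F n in F. ALL x:S. dist (f n x) (g x) < e" using lim unfolding uniform_limit_iff by simp
 thus "\<forall>\<^sub>F n in F. ALL z:cball 0 r. dist (f n (x+z *s ax j)) (g (x+z *s ax j)) < e"
 by eventually_elim (use r in "auto intro!: inS")
 qed
 qed (use F in auto)
 thus "(%z. g (x+z *s ax j)) field_differentiable at 0"
 using r(1) by (simp add: holomorphic_on_open field_differentiable_def)
qed

lemma hol_infsum:
 fixes f :: "'i => complex^'m => complex"
 assumes S: "open S" and hol: "!!a x. a:A ==> x:S ==> cdiff (f a) x"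
 and le: "!!a x. a:A ==> x:S ==> norm (f a x) <= M a" and M: "M summable_on A" and x: "x:S"
 shows "cdiff (%x. \<Sum>\<^sub>\<infinity>a\<in>A. f a x) x"
proof (rule hol_uniform_limit[OF S _ Weierstrass_m_test_general[OF le M] _ x])
 show "\<forall>\<^sub>F X in finite_subsets_at_top A. ALL x:S. cdiff (%y. SUM a:X. f a y) x"
 by (rule eventually_finite_subsets_at_top_weakI) (use hol in "auto intro!: cdiff_sum")
qed auto

lemma continuous_on_dd_blinfun:
 fixes F :: "complex^'m => complex^'k"
 assumes S: "open S" and hol: "!!x. x:S ==> vdiff F x"
 shows "con S (%x. Blinfun (dd F x))"
proof (rule continuous_on_blinfun_componentwise)
 fix i :: "complex^'m"
 have "con S (%x. dd F x i)"
 proof -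
 have "con S (%x. dd F x i$k)" for k
 proof -
 have "con S (%x. dd (%x. F x$k) x i)"
 proof (intro hol_continuous ballI)
 fix x assume "x:S" thus "cdiff (%x. dd (%x. F x$k) x i) x"
 by (rule hol_dd[OF S, rotated]) (use hol in "auto simp: vdiff_def")
 qed
 thus ?thesis
 by (rule continuous_on_eq) (simp add: vdiffD(2)[OF hol])
 qed
 hence "con S (%x. \<chi> k. dd F x i$k)" by (rule vec_lambda_continuous)
 thus ?thesis by simp
 qed
 thus "con S (%x. blinfun_apply (Blinfun (dd F x)) i)"
 by (rule continuous_on_eq)
 (simp add: bounded_linear_Blinfun_apply hdbl[OF vdiffD(1)[OF hol]])
qed

text \<open>The real inverse function theorem supplies the inverse map. Its derivative is the
  inverse of a complex linear bijection, hence complex linear, so the inverse map is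
  holomorphic.\<close>

lemma local_inverse:
 fixes F :: "complex^'m => complex^'m"
 assumes S: "open S" "x0:S" and hol: "!!x. x:S ==> vdiff F x" and inj: "inj (dd F x0)"
 obtains U V G where "open U" "x0:U" "U <= S" "open V" "F x0:V" "homeomorphism U V F G" "!!y. y:V ==> vdiff G y"
proof -
 have bl: "blin (dd F x)" if "x:S" for x
 using hdbl[OF vdiffD(1)[OF hol[OF that]]] .
 obtain g where g: "linear g" "g \<circ> dd F x0 = id"
 using linear_injective_left_inverse[OF bllin[OF bl[OF S(2)]] inj] by blast
 have bg: "blin g" using g(1) by (simp add: lcb)
 have 5: "Blinfun g o\<^sub>L Blinfun (dd F x0) = id_blinfun"
 by (rule blinfun_eqI)
 (use g(2) in "simp add: bounded_linear_Blinfun_apply bg bl S(2) pointfree_idE")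
 have 2: "(F HD blinfun_apply (Blinfun (dd F x))) (at x)" if "x:S" for x
 using vdiffD(1)[OF hol[OF that]] by (simp add: bounded_linear_Blinfun_apply bl that)
 obtain U V G G' where 6: "open U" "U <= S" "x0:U" "open V" "F x0:V" "homeomorphism U V F G"
 "!!y. y:V ==> (G HD (G' y)) (at y)"
 "!!y. y:V ==> G' y = inv (blinfun_apply (Blinfun (dd F (G y))))"
 "!!y. y:V ==> bij (blinfun_apply (Blinfun (dd F (G y))))"
 using inverse_function_theorem[OF S(1) 2 continuous_on_dd_blinfun[OF S(1) hol] S(2) 5] by metis
 have "vdiff G y" if y: "y:V" for y
 unfolding vdiff_alt
 proof (intro exI conjI allI)
 show "(G HD G' y) (at y)" using 6(7)[OF y] .
 have GyS: "G y:S" using 6(2,6) y unfolding homeomorphism_def by blast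
 have ap: "blinfun_apply (Blinfun (dd F (G y))) = dd F (G y)" by (simp add: bounded_linear_Blinfun_apply bl GyS)
 have bij: "bij (dd F (G y))" using 6(9)[OF y] ap by simp
 fix c v
 have "dd F (G y) (c *s inv (dd F (G y)) v) = c *s v"
 using vdiffD(3)[OF hol[OF GyS]] bij by (simp add: surj_f_inv_f bij_is_surj)
 from inv_f_eq[OF bij_is_inj[OF bij] this]
 show "G' y (c *s v) = c *s G' y v" using 6(8)[OF y] ap by simp
 qed
 thus ?thesis using that[OF 6(1,3,2,4,5,6)] by blast
qed

section \<open>Germs at the origin\<close>

definition ger :: "(complex^'m => complex) => bool" where
 "ger f <-> (NEAR x. cdiff f x)"

definition vger :: "(complex^'m => complex^'k) => bool" where
 "vger F <-> (NEAR x. vdiff F x)"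

text \<open>Polydiscs instead of balls, because replacing a single coordinate by another small
  value, or by 0, does not leave them.\<close>

definition PD :: "real => (complex^'m) set" where
 "PD r = {x. ALL j. norm (x$j) < r}"

lemma open_PD: "open (PD r :: (complex^'m) set)"
proof -
 have "PD r = (\<Inter>j. (%x::complex^'m. x$j) -` ball 0 r)" unfolding PD_def by auto
 thus ?thesis by (simp add: open_INT open_vimage_vec_nth)
qed

lemma convex_PD: "convex (PD r :: (complex^'m) set)"
proof -
 have "PD r = (\<Inter>j. (%x::complex^'m. x$j) -` ball 0 r)" unfolding PD_def by auto
 thus ?thesis
 by (simp add: convex_INT convex_linear_vimage bllin[OF bounded_linear_vec_nth])
qed

lemma ball_subset_PD: "ball 0 r <= PD r"
proof
 fix x :: "complex^'m" assume "x:ball 0 r"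
 thus "x:PD r" unfolding PD_def using Finite_Cartesian_Product.norm_nth_le[of x] by (auto intro: le_less_trans)
qed

lemma PD_subset_ball:
 assumes "e > 0" obtains r where "r > 0" "PD r <= (ball 0 e :: (complex^'m) set)"
proof
 show "e / CARD('m) > 0" using assms by simp
 show "PD (e / CARD('m)) <= (ball 0 e :: (complex^'m) set)"
 proof
 fix x :: "complex^'m" assume x: "x:PD (e / CARD('m))"
 have "norm x <= (SUM j:UNIV. norm (x$j))" unfolding norm_vec_def by (rule L2_set_le_sum) simp
 also have "\<dots> < (SUM j:(UNIV::'m set). e / CARD('m))" by (rule sum_strict_mono) (use x in "auto simp: PD_def")
 finally show "x:ball 0 e" by simp
 qed
qed

lemma eventually_nhds_PD:
 "(\<forall>\<^sub>F x in nhds (0::complex^'m). P x) <-> (\<exists>r>0. ALL x:PD r. P x)"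
proof
 assume "\<forall>\<^sub>F x in nhds (0::complex^'m). P x"
 then obtain e where "e > 0" "ALL x:ball 0 e. P x" unfolding eventually_nhds_metric by (auto simp: dist_commute)
 moreover from PD_subset_ball[OF this(1)] obtain r where "r > 0" "PD r <= (ball 0 e :: (complex^'m) set)" .
 ultimately show "\<exists>r>0. ALL x:PD r. P x" by blast
next
 assume "\<exists>r>0. ALL x:PD r. P x"
 then obtain r where "r > 0" "ALL x:PD r. P x" by blast
 thus "\<forall>\<^sub>F x in nhds (0::complex^'m). P x"
 unfolding eventually_nhds by (intro exI[of _ "PD r"]) (auto simp: open_PD, auto simp: PD_def)
qed

text \<open>Equality of germs at 0 implies equality of germs at all nearby points; this is what
  allows derivatives to be compared near 0 and not only at 0.\<close>

lemma ev_nhds_nested: "(\<forall>\<^sub>F x in nhds a. P x) ==> \<forall>\<^sub>F x in nhds a. \<forall>\<^sub>F y in nhds x. P y"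
 by (simp add: eventually_eventually)

lemma ev_nhds_compose:
 assumes "isCont F a" "F a = b" "\<forall>\<^sub>F x in nhds b. P x" shows "\<forall>\<^sub>F x in nhds a. P (F x)"
proof -
 have "filterlim F (nhds b) (nhds a)"
 using assms(1,2) unfolding isCont_def tendsto_at_iff_tendsto_nhds by simp
 thus ?thesis using assms(3) unfolding filterlim_iff by blast
qed

lemma gerD0: "ger f ==> cdiff f 0" unfolding ger_def by (rule ev_x)
lemma vgerD0: "vger f ==> vdiff f 0" unfolding vger_def by (rule ev_x)
lemma ger_isCont: "ger f ==> isCont f 0" by (rule cdiff_iscont[OF gerD0])
lemma vger_isCont: "vger f ==> isCont f 0" by (rule vdiff_iscont[OF vgerD0])

lemma ger_nested: "ger f ==> NEAR x. \<forall>\<^sub>F y in nhds x. cdiff f y"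
 unfolding ger_def by (rule ev_nhds_nested)

lemma vger_iff: "vger F <-> (ALL i. ger (%x. F x$i))"
 unfolding vger_def ger_def vdiff_def
 by (auto intro: eventually_all_finite elim: evm)

lemma vger_nth: "vger F ==> ger (%x. F x$i)" by (simp add: vger_iff)

lemma ger_const[simp]: "ger (%x. c)" by (simp add: ger_def)
lemma ger_nth[simp]: "ger (%x. x$i)" by (simp add: ger_def)
lemma ger_add: assumes "ger f" "ger g" shows "ger (%x. f x+g x)"
 using assms unfolding ger_def by eventually_elim (rule cdiff_add)
lemma ger_diff: assumes "ger f" "ger g" shows "ger (%x. f x - g x)"
 using assms unfolding ger_def by eventually_elim (rule cdiff_diff)
lemma ger_minus: assumes "ger f" shows "ger (%x. - f x)"
 using assms unfolding ger_def by eventually_elim (rule cdiff_minus)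
lemma ger_mult: assumes "ger f" "ger g" shows "ger (%x. f x * g x)"
 using assms unfolding ger_def by eventually_elim (rule cdiff_mult)
lemma ger_sum: "finite I ==> (!!i. i:I ==> ger (f i)) ==> ger (%x. SUM i:I. f i x)"
 by (induction I rule: finite_induct) (simp_all add: ger_add)
lemma ger_if: "(b ==> ger f) ==> (\<not> b ==> ger g) ==> ger (%x. if b then f x else g x)"
 by (cases b) simp_all

lemma ger_nz: assumes "ger f" "f 0 ~= 0" shows "NEAR x. f x ~= 0"
proof -
 have "filterlim f (nhds (f 0)) (nhds 0)"
 using ger_isCont[OF assms(1)] unfolding isCont_def tendsto_at_iff_tendsto_nhds .
 moreover have "\<forall>\<^sub>F y in nhds (f 0). y ~= 0" using assms(2) by (rule t1_space_nhds)
 ultimately show ?thesis unfolding filterlim_iff by blast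
qed

lemma ger_divide: assumes "ger f" "ger g" "g 0 ~= 0" shows "ger (%x. f x / g x)"
 using assms(1,2) ger_nz[OF assms(2,3)] unfolding ger_def
 by eventually_elim (rule cdiff_divide)

lemma ger_cong: assumes "ger f" "NEAR x. f x = g x" shows "ger g"
 using assms(1) ev_nhds_nested[OF assms(2)] unfolding ger_def
 by eventually_elim (rule cdiff_cong_ev)

lemma dd_cong_ev: assumes "\<forall>\<^sub>F y in nhds x. f y = g y" shows "dd f x v = dd g x v"
proof -
 obtain S where "open S" "x:S" "ALL y:S. f y = g y" using assms unfolding eventually_nhds by auto
 hence "dd f x = dd g x" by (intro dd_transform) auto
 thus ?thesis by simp
qed

lemma dd_cong_germ: assumes "\<forall>\<^sub>F y in nhds a. f y = g y"
 shows "\<forall>\<^sub>F x in nhds a. ALL v. dd f x v = dd g x v"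
 using ev_nhds_nested[OF assms] by eventually_elim (auto intro: dd_cong_ev)

lemma ger_dd: assumes "ger f" shows "ger (%x. dd f x v)"
proof -
 obtain S where S: "open S" "0:S" "ALL x:S. cdiff f x" using assms unfolding ger_def eventually_nhds by auto
 hence "ALL x:S. cdiff (%x. dd f x v) x" using hol_dd by blast
 thus ?thesis unfolding ger_def eventually_nhds using S by blast
qed

lemma ger_dd_vec:
 assumes "ger f" "vger v" shows "ger (%x. dd f x (v x))"
proof (rule ger_cong)
 show "ger (%x. SUM i:UNIV. v x$i * dd f x (ax i))"
 by (intro ger_sum ger_mult ger_dd vger_nth assms finite)
 show "NEAR x. (SUM i:UNIV. v x$i * dd f x (ax i)) = dd f x (v x)"
 using assms(1) unfolding ger_def by eventually_elim (simp add: dd_expand)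
qed

lemma vger_lambda: "(!!i. ger (%x. f x i)) ==> vger (%x. \<chi> i. f x i)" by (simp add: vger_iff)
lemma vger_id[simp]: "vger (%x. x)" by (simp add: vger_iff)
lemma vger_const[simp]: "vger (%x. c)" by (simp add: vger_iff)

lemma ger_compose:
 assumes "vger F" "F 0 = 0" "ger g" shows "ger (%x. g (F x))"
 using assms(1)[unfolded vger_def] ev_nhds_compose[OF vger_isCont[OF assms(1)] assms(2) assms(3)[unfolded ger_def]]
 unfolding ger_def by eventually_elim (rule cdiff_compose(1))

lemma dd_compose_germ:
 assumes "vger F" "F 0 = 0" "ger g"
 shows "NEAR x. ALL v. dd (%x. g (F x)) x v = dd g (F x) (dd F x v)"
 using assms(1)[unfolded vger_def] ev_nhds_compose[OF vger_isCont[OF assms(1)] assms(2) assms(3)[unfolded ger_def]]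
 by eventually_elim (simp add: cdiff_compose(2))

lemma vger_compose:
 assumes "vger F" "F 0 = 0" "vger G" shows "vger (%x. G (F x))"
 using ger_compose[OF assms(1,2)] assms(3) unfolding vger_iff by blast

lemma ev_compose:
 assumes "vger F" "F 0 = 0" "NEAR x. P x" shows "NEAR x. P (F x)"
 by (rule ev_nhds_compose[OF vger_isCont[OF assms(1)] assms(2,3)])

lemma germ_inverse:
 fixes F :: "complex^'m => complex^'m"
 assumes "vger F" "F 0 = 0" "inj (dd F 0)"
 obtains G where "vger G" "G 0 = 0" "NEAR x. G (F x) = x" "NEAR y. F (G y) = y"
proof -
 obtain S where S: "open S" "0:S" "ALL x:S. vdiff F x" using assms(1) unfolding vger_def eventually_nhds by auto
 then obtain U V G where "open U" "0:U" "U <= S" "open V" "F 0:V" "homeomorphism U V F G" "!!y. y:V ==> vdiff G y"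
 using local_inverse[of S 0 F] assms(3) by metis
 note UV = this
 show ?thesis
 proof
 show "vger G" unfolding vger_def eventually_nhds using UV(4,5,7) assms(2) by auto
 show "G 0 = 0" using UV(2,6) assms(2) unfolding homeomorphism_def by auto
 show "NEAR x. G (F x) = x" unfolding eventually_nhds using UV unfolding homeomorphism_def by blast
 show "NEAR y. F (G y) = y" unfolding eventually_nhds using UV assms(2) unfolding homeomorphism_def by metis
 qed
qed

text \<open>On the complex line through x and y the derivative is a combination of axis derivatives
  in directions from \<open>A\<close>, since y - x has no other components. It vanishes along the
  segment, so the values at the ends agree.\<close>

lemma indep_convex:
 fixes F :: "complex^'m => complex"
 assumes "convex S" "!!x. x:S ==> cdiff F x" "!!x j. x:S ==> j:A ==> dd F x (ax j) = 0"
 "x:S" "y:S" "!!i. i ~: A ==> x$i = y$i"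
 shows "F x = F y"
proof -
 have seg: "x+z *s (y - x):S" if z: "z:closed_segment 0 1" for z :: complex
 proof -
 obtain u where u: "0 <= u" "u <= 1" "z = of_real u" using z by (auto simp: closed_segment_def scaleR_conv_of_real)
 have "x+z *s (y - x) = (1 - u) *R x+u *R y"
 unfolding u by (simp add: veq) (simp add: algebra_simps scaleR_conv_of_real)
 thus ?thesis using convexD[OF assms(1,4,5), of "1-u" u] u by simp
 qed
 have "EX c. ALL z:closed_segment 0 1. F (x+z *s (y - x)) = c"
 proof (rule has_field_derivative_zero_constant)
 fix z :: complex assume z: "z:closed_segment 0 1"
 have cd: "cdiff F (x+z *s (y - x))" using assms(2) seg[OF z] .
 have "dd F (x+z *s (y - x)) (y - x) = 0"
 unfolding dd_expand[OF cd, of "y - x"]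
 by (rule sum.neutral) (metis assms(3,6) seg[OF z] mult_eq_0_iff vector_minus_component right_minus_eq)
 thus "((%z. F (x+z *s (y - x))) has_field_derivative 0) (at z within closed_segment 0 1)"
 using has_field_derivative_at_within[OF cdiff_line[OF cd]] by simp
 qed simp
 then obtain c where c: "!!z. z:closed_segment 0 1 ==> F (x+z *s (y - x)) = c" by blast
 from c[of 0] c[of 1] show ?thesis by (simp add: ends_in_segment)
qed

lemma indep_germ:
 fixes F :: "complex^'m => complex"
 assumes "ger F" "!!j. j:A ==> NEAR x. dd F x (ax j) = 0"
 shows "NEAR x. F x = F (\<chi> i. if i:A then 0 else x$i)"
proof -
 have "NEAR x. cdiff F x & (ALL j:A. dd F x (ax j) = 0)"
 using assms(2) by (intro eventually_conj assms(1)[unfolded ger_def] eventually_ball_finite) auto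
 then obtain r where r: "r > 0" "!!x. x:PD r ==> cdiff F x & (ALL j:A. dd F x (ax j) = 0)"
 unfolding eventually_nhds_PD by blast
 show ?thesis unfolding eventually_nhds_PD
 proof (intro exI[of _ r] conjI r(1) ballI)
 fix x :: "complex^'m" assume x: "x:PD r"
 show "F x = F (\<chi> i. if i:A then 0 else x$i)"
 by (rule indep_convex[OF convex_PD, of r _ A]) (use r x in "auto simp: PD_def")
 qed
qed

text \<open>Coordinates are released from real to complex one at a time. In the released coordinate
  the zeros fill a real diameter and accumulate at 0, so the one-variable identity theorem
  applies.\<close>

lemma real_identity:
 fixes G :: "complex^'m => complex"
 assumes "r > 0" "!!x. x:PD r ==> cdiff G x"
 and zero: "!!x. x:PD r ==> (!!j. Im (x$j) = 0) ==> G x = 0" and x: "x:PD r"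
 shows "G x = 0"
proof -
 have "ALL x:PD r. (ALL j. j ~: A --> Im (x$j) = 0) --> G x = 0" if "finite A" for A :: "'m set"
 using that
 proof (induction A)
 case empty thus ?case using zero by auto
 next
 case (insert j A)
 show ?case
 proof (intro ballI impI)
 fix x :: "complex^'m" assume x: "x:PD r" and im: "ALL i. i ~: insert j A --> Im (x$i) = 0"
 define y where "y = x - (x$j) *s ax j"
 have yj: "y+z *s ax j = (\<chi> i. if i = j then z else x$i)" for z
 by (auto simp: y_def veq axis_def)
 have yPD: "y+z *s ax j:PD r" if "norm z < r" for z using x that by (auto simp: yj PD_def)
 have "(%z. G (y+z *s ax j)) holomorphic_on ball 0 r"
 by (rule line_holomorphic) (use yPD assms(2) in auto)
 moreover have "G (y+z *s ax j) = 0" if z: "z:ball 0 r Int \<real>" for z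
 proof -
 have "ALL i. i ~: A --> Im ((y+z *s ax j)$i) = 0" unfolding yj using im z by (auto simp: complex_is_Real_iff)
 thus ?thesis using insert.IH yPD z by auto
 qed
 moreover have "0 islimpt (ball 0 r Int \<real> :: complex set)"
 unfolding islimpt_approachable
 proof (intro allI impI)
 fix e :: real assume "e > 0"
 thus "EX x':ball 0 r Int \<real>. x' ~= (0::complex) & dist x' 0 < e"
 using assms(1) by (intro bexI[of _ "of_real (min e r / 2)"]) auto
 qed
 ultimately have "G (y+z *s ax j) = 0" if "z:ball 0 r" for z
 using analytic_continuation[of "%z. G (y+z *s ax j)" "ball 0 r" "ball 0 r Int \<real>" 0 z] that assms(1) by auto
 moreover have "x$j:ball 0 r" using x by (auto simp: PD_def)
 ultimately show "G x = 0" by (force simp: y_def)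
 qed
 qed
 from this[of UNIV] show ?thesis using x by simp
qed

section \<open>The doubled space and its real points\<close>

definition cpl :: "complex^'n::finite => complex^'n => complex^('n+'n)" where
 "cpl x y = (\<chi> k. case k of Inl i => x$i | Inr i => y$i)"
definition lc :: "complex^('n::finite+'n) => complex^'n" where "lc X = (\<chi> i. X$Inl i)"
definition rc :: "complex^('n::finite+'n) => complex^'n" where "rc X = (\<chi> i. X$Inr i)"
abbreviation rl :: "complex^'n::finite => complex^('n+'n)" where "rl x \<equiv> cpl x (cnj_vec x)"
text \<open>The antiholomorphic involution whose fixed points are exactly the points
  \<open>rl x\<close>. Complex conjugation of functions of x corresponds to F |->
  \<open>cnj (F (cj X))\<close> on the doubled space.\<close>

definition cj :: "complex^('n::finite+'n) => complex^('n+'n)" where "cj X = cpl (cnj_vec (rc X)) (cnj_vec (lc X))"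

lemma cpl_nth[simp]: "cpl x y$Inl i = x$i" "cpl x y$Inr i = y$i" by (simp_all add: cpl_def)
lemma lc_nth[simp]: "lc X$i = X$Inl i" by (simp add: lc_def)
lemma rc_nth[simp]: "rc X$i = X$Inr i" by (simp add: rc_def)
lemma cnj_vec_nth[simp]: "cnj_vec x$i = cnj (x$i)" by (simp add: cnj_vec_def)
lemma cj_nth[simp]: "cj X$Inl i = cnj (X$Inr i)" "cj X$Inr i = cnj (X$Inl i)" by (simp_all add: cj_def)
lemma veq2: "X = Y <-> (ALL i. X$Inl i = Y$Inl i) & (ALL i. X$Inr i = Y$Inr i)"
 for X Y :: "complex^('n::finite+'n)"
 unfolding veq by (metis sumE)
lemma lc_cpl[simp]: "lc (cpl x y) = x" and rc_cpl[simp]: "rc (cpl x y) = y" by (simp_all add: veq)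
lemma cpl_lc_rc[simp]: "cpl (lc X) (rc X) = X" by (simp add: veq2)
lemma cj_cj[simp]: "cj (cj X) = X" by (simp add: veq2)
lemma cj_rl[simp]: "cj (rl x) = rl x" by (simp add: veq2)
lemma cpl_0[simp]: "cpl 0 0 = 0" by (simp add: veq2)
lemma cnj_vec_0[simp]: "cnj_vec 0 = 0" by (simp add: veq)
lemma cnj_vec_cnj_vec[simp]: "cnj_vec (cnj_vec x) = x" by (simp add: veq)
lemma lc_0[simp]: "lc 0 = 0" and rc_0[simp]: "rc 0 = 0" by (simp_all add: veq)
lemma cj_0[simp]: "cj 0 = 0" by (simp add: veq2)

text \<open>The linear change L, (u, v) |-> (u + i v, u - i v), carries real points to points
  \<open>rl y\<close>, so the claim reduces to \<open>real_identity\<close>.\<close>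

lemma germ_identity:
 fixes F :: "complex^('n::finite+'n) => complex"
 assumes "ger F" "NEAR y. F (rl y) = 0"
 shows "NEAR X. F X = 0"
proof -
 define L :: "complex^('n+'n) => complex^('n+'n)" where
 "L U = cpl (\<chi> i. U$Inl i+\<i> * U$Inr i) (\<chi> i. U$Inl i - \<i> * U$Inr i)" for U
 define M :: "complex^('n+'n) => complex^('n+'n)" where
 "M X = cpl (\<chi> i. (X$Inl i+X$Inr i)/2) (\<chi> i. (X$Inl i - X$Inr i)/(2*\<i>))" for X
 have LM: "L (M X) = X" for X by (simp add: L_def M_def veq2 field_simps)
 have gL: "vger L" unfolding vger_iff
 proof
 fix k show "ger (%x. L x$k)" by (cases k) (simp_all add: L_def ger_add ger_diff ger_mult)
 qed
 have gM: "vger M" unfolding vger_iff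
 proof
 fix k show "ger (%x. M x$k)" by (cases k) (simp_all add: M_def ger_add ger_diff ger_divide ger_minus ger_mult)
 qed
 have z: "L 0 = 0" "M 0 = 0" by (simp_all add: L_def M_def veq2)
 have y: "vger (%U::complex^('n+'n). (\<chi> i. U$Inl i+\<i> * U$Inr i)::complex^'n)"
 by (intro vger_lambda ger_add ger_mult ger_nth ger_const)
 have "NEAR U. cdiff (%U. F (L U)) U & F (rl (\<chi> i. U$Inl i+\<i> * U$Inr i)) = 0"
 using ger_compose[OF gL z(1) assms(1), unfolded ger_def]
 by (intro eventually_conj ev_compose[OF y _ assms(2)]) (simp_all add: veq)
 then obtain r where r: "r > 0" "!!U. U:PD r ==> cdiff (%U. F (L U)) U"
 "!!U. U:PD r ==> F (rl (\<chi> i. U$Inl i+\<i> * U$Inr i)) = 0"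
 unfolding eventually_nhds_PD by blast
 have "F (L U) = 0" if "U:PD r" for U
 proof (rule real_identity[OF r(1) r(2) _ that])
 fix V :: "complex^('n+'n)" assume V: "V:PD r" "!!j. Im (V$j) = 0"
 have "L V = rl (\<chi> i. V$Inl i+\<i> * V$Inr i)"
 using V(2) by (simp add: L_def veq2 ceq)
 thus "F (L V) = 0" using r(3)[OF V(1)] by simp
 qed
 hence "NEAR U. F (L U) = 0" unfolding eventually_nhds_PD using r(1) by blast
 from ev_compose[OF gM z(2) this] show ?thesis by (simp add: LM)
qed

section \<open>Power series of holomorphic germs\<close>

lemma summable_on_product_nonneg:
 fixes f :: "'a => real" and g :: "'b => real"
 assumes "f summable_on A" "g summable_on B" "!!x. x:A ==> f x >= 0" "!!y. y:B ==> g y >= 0"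
 shows "(%(x,y). f x * g y) summable_on A \<times> B"
proof (rule nonneg_bdd_above_summable_on)
 show "bdd_above (sum (%(x, y). f x * g y) ` {F. F <= A \<times> B & finite F})"
 proof (rule bdd_aboveI2)
 fix F assume F: "F:{F. F <= A \<times> B & finite F}"
 have "sum (%(x, y). f x * g y) F <= sum (%(x, y). f x * g y) (fst ` F \<times> snd ` F)"
 proof (rule sum_mono2)
 show "finite (fst ` F \<times> snd ` F)" "F <= fst ` F \<times> snd ` F" using F by (auto simp: rev_image_eqI)
 fix p assume "p:fst ` F \<times> snd ` F - F"
 hence "fst p:A" "snd p:B" using F by auto
 thus "0 <= (case p of (x, y) => f x * g y)" using assms(3,4) by (simp add: case_prod_unfold)
 qed
 also have "\<dots> = sum f (fst ` F) * sum g (snd ` F)"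
 by (simp add: sum_product sum.cartesian_product)
 also have "\<dots> \<le> infsum f A * infsum g B"
 using F by (intro mult_mono finite_sum_le_infsum assms sum_nonneg infsum_nonneg) auto
 finally show "sum (%(x, y). f x * g y) F <= infsum f A * infsum g B" .
 qed
qed (use assms in auto)

lemma bij_multi_insert:
 assumes "j ~: Q"
 shows "bij_betw (%(qw, k). qw(j := k)) (mis Q \<times> UNIV) (mis (insert j Q))"
 by (rule bij_betwI[where g="%qk. (qk(j := 0), qk j)"])
 (use assms in "auto simp: multi_indices_def fun_eq_iff")

lemma multi_indices_empty: "mis {} = {%_. 0}" by (auto simp: multi_indices_def)

lemma geom_multi_summable:
 fixes q :: "'i => real"
 assumes "finite Q" "!!j. j:Q ==> 0 <= q j & q j < 1"
 shows "(%qw. PROD j:Q. q j ^ qw j) summable_on mis Q"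
 using assms
proof (induction Q)
 case empty thus ?case by (simp add: multi_indices_empty)
next
 case (insert j Q)
 have "(%k. q j ^ k) summable_on UNIV"
 by (rule summable_nonneg_imp_summable_on) (use insert.prems in "auto intro: summable_geometric")
 hence "(%(qw, k). (PROD i:Q. q i ^ qw i) * q j ^ k) summable_on mis Q \<times> UNIV"
 by (intro summable_on_product_nonneg insert.IH) (use insert.prems in "auto intro!: prod_nonneg")
 also have "(%(qw, k). (PROD i:Q. q i ^ qw i) * q j ^ k) = (%x. PROD i:insert j Q. q i ^ ((%(qw, k). qw(j := k)) x i))"
 proof
 fix x :: "('i => nat) \<times> nat"
 obtain qw k where x: "x = (qw, k)" by (cases x)
 have "(PROD i:Q. q i ^ (qw(j := k)) i) = (PROD i:Q. q i ^ qw i)"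
 by (rule prod.cong) (use insert.hyps in auto)
 thus "(case x of (qw, k) => (PROD i:Q. q i ^ qw i) * q j ^ k) = (PROD i:insert j Q. q i ^ ((%(qw, k). qw(j := k)) x i))"
 using insert.hyps by (simp add: x mult.commute)
 qed
 finally show ?case using summable_on_reindex_bij_betw[OF bij_multi_insert[OF insert.hyps(2)]] by blast
qed

definition zj :: "'m => complex^'m => complex^'m" where
 "zj j x = (\<chi> i. if i = j then 0 else x$i)"
definition Dk :: "'m => nat => (complex^'m => complex) => complex^'m => complex" where
 "Dk j k h = ((%h x. dd h x (ax j)) ^^ k) h"
text \<open>The k-th Taylor coefficient in the coordinate j at x_j = 0, kept as a function of the
  remaining coordinates.\<close>

definition tcf :: "'m => nat => (complex^'m => complex) => complex^'m => complex" where
 "tcf j k h x = Dk j k h (zj j x) / fact k"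

lemma vdiff_zj: "vdiff (zj j) x"
 unfolding zj_def by (rule vdiff_lambda) (rule cdiff_if; simp)

lemma zj_line: "zj j x+z *s ax j = (\<chi> i. if i = j then z else x$i)"
 by (auto simp: zj_def veq axis_def)

lemma Dk_cdiff:
 assumes "open S" "!!x. x:S ==> cdiff h x" "x:S" shows "cdiff (Dk j k h) x"
 using assms(3)
proof (induction k arbitrary: x)
 case 0 thus ?case using assms(2) by (simp add: Dk_def)
next
 case (Suc k)
 have "cdiff (%x. dd (Dk j k h) x (ax j)) x" by (rule hol_dd[OF assms(1) Suc.IH Suc.prems])
 thus ?case by (simp add: Dk_def)
qed

lemma tcf_props:
 fixes h :: "complex^'m => complex"
 assumes qj: "0 < qj" "qj < r" and h: "!!x. x:PD r ==> cdiff h x" and B: "!!x. x:PD r ==> norm (h x) <= B"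
 and x: "x:PD r"
 shows "cdiff (tcf j k h) x" "norm (tcf j k h x) <= B / qj^k"
 "norm (x$j) < qj ==> ((%k. tcf j k h x * x$j ^ k) has_sum h x) UNIV"
proof -
 have zPD: "zj j x:PD r" if "x:PD r" for x using that qj by (auto simp: PD_def zj_def)
 have lPD: "zj j x+z *s ax j:PD r" if "norm z < r" for z using that x by (auto simp: zj_line PD_def)
 have "cdiff (%x. Dk j k h (zj j x)) x"
 by (rule cdiff_compose(1)[OF vdiff_zj]) (rule Dk_cdiff[OF open_PD h zPD[OF x]])
 hence "cdiff (%x. Dk j k h (zj j x) / fact k) x" by (rule cdiff_divide[OF _ cdiff_const]) simp
 thus "cdiff (tcf j k h) x" by (rule cdiff_transform[OF _ open_UNIV UNIV_I]) (simp add: tcf_def)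
 let ?g = "%z. h (zj j x+z *s ax j)"
 have hol: "?g holomorphic_on ball 0 r" by (rule line_holomorphic) (use lPD h in auto)
 have der: "(deriv ^^ k) ?g z = Dk j k h (zj j x+z *s ax j)" if "z:ball 0 r" for z k
 using that
 proof (induction k arbitrary: z)
 case 0 thus ?case by (simp add: Dk_def)
 next
 case (Suc k)
 have "\<forall>\<^sub>F w in nhds z. w:ball 0 r" using Suc.prems by (intro evo) auto
 hence "\<forall>\<^sub>F w in nhds z. (deriv ^^ k) ?g w = Dk j k h (zj j x+w *s ax j)"
 by eventually_elim (rule Suc.IH)
 hence "(deriv ^^ Suc k) ?g z = deriv (%w. Dk j k h (zj j x+w *s ax j)) z"
 by (simp add: deriv_cong_ev)
 also have "\<dots> = dd (Dk j k h) (zj j x+z *s ax j) (ax j)"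
 by (rule DERIV_imp_deriv, rule cdiff_line, rule Dk_cdiff[OF open_PD h])
 (use lPD Suc.prems in auto)
 finally show ?case by (simp add: Dk_def)
 qed
 have tc: "tcf j k h x = (deriv ^^ k) ?g 0 / fact k" for k
 using der[of 0 k] qj by (simp add: tcf_def)
 have bd: "norm (tcf j k h x) <= B / qj^k" for k
 proof -
 have sub: "cball 0 qj <= ball (0::complex) r" using qj by auto
 have "norm ((deriv ^^ k) ?g 0) <= fact k * B / qj^k"
 proof (rule Cauchy_inequality)
 show "?g holomorphic_on ball 0 qj" by (rule holomorphic_on_subset[OF hol]) (use qj in auto)
 show "con (cball 0 qj) ?g"
 using holomorphic_on_imp_continuous_on[OF hol] continuous_on_subset sub by blast
 fix z :: complex assume "norm (0 - z) = qj" thus "norm (?g z) <= B" using lPD B qj by auto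
 qed (rule qj)
 thus ?thesis by (simp add: tc norm_divide field_simps)
 qed
 show "norm (tcf j k h x) <= B / qj^k" by (rule bd)
 show "((%k. tcf j k h x * x$j ^ k) has_sum h x) UNIV" if xj: "norm (x$j) < qj"
 proof (rule norm_summable_imp_has_sum)
 have xr: "x$j:ball 0 r" using xj qj by simp
 have "zj j x+(x$j) *s ax j = x" by (auto simp: zj_line veq)
 thus "(%k. tcf j k h x * x$j ^ k) sums h x"
 using holomorphic_power_series[OF hol xr] by (simp add: tc)
 have B0: "B >= 0" using B[OF x] norm_ge_zero order_trans by blast
 show "summable (%n. norm (tcf j n h x * x$j ^ n))"
 proof (rule summable_comparison_test')
 show "summable (%n. B * (norm (x$j) / qj)^n)"
 using xj qj by (intro summable_mult summable_geometric) (simp add: field_simps)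
 fix n show "norm (norm (tcf j n h x * x$j ^ n)) <= B * (norm (x$j) / qj)^n"
 using mult_right_mono[OF bd[of n], of "norm (x$j) ^ n"] by (simp add: norm_mult norm_power power_divide)
 qed
 qed
qed

text \<open>Variables are expanded one after the other. The coefficients \<open>c qw\<close> are
  functions of the coordinates outside \<open>Q\<close>; keeping them holomorphic with Cauchy bounds
  allows the next coordinate to be expanded by \<open>tcf\<close>.\<close>

lemma power_series_aux:
 fixes f :: "complex^'m => complex"
 assumes "finite Q" and qj: "0 < qj" "qj < r" and f: "ALL x:PD r. cdiff f x" and B: "ALL x:PD r. norm (f x) <= B"
 shows "EX c. (ALL qw:mis Q. ALL x:PD r. cdiff (c qw) x & norm (c qw x) <= B / (PROD j:Q. qj ^ qw j) &
 (ALL y:PD r. (ALL i. i ~: Q --> x$i = y$i) --> c qw x = c qw y)) &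
 (ALL x:PD qj. ((%qw. c qw x * (PROD j:Q. x$j ^ qw j)) has_sum f x) (mis Q))"
 using assms(1)
proof (induction Q)
 case empty
 have "x = y" if "ALL i. x$i = y$i" for x y :: "complex^'m" using that by (simp add: veq)
 thus ?case by (intro exI[of _ "%_. f"]) (use f B in "auto simp: multi_indices_empty intro!: has_sum_finiteI")
next
 case (insert j Q)
 obtain c where cc: "(ALL qw:mis Q. ALL x:PD r. cdiff (c qw) x & norm (c qw x) <= B / (PROD j:Q. qj ^ qw j) &
 (ALL y:PD r. (ALL i. i ~: Q --> x$i = y$i) --> c qw x = c qw y)) &
 (ALL x:PD qj. ((%qw. c qw x * (PROD j:Q. x$j ^ qw j)) has_sum f x) (mis Q))"
 using insert.IH by (rule exE)
 have c: "!!qw x. qw:mis Q ==> x:PD r ==> cdiff (c qw) x"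
 "!!qw x. qw:mis Q ==> x:PD r ==> norm (c qw x) <= B / (PROD j:Q. qj ^ qw j)"
 "!!qw x y. qw:mis Q ==> x:PD r ==> y:PD r ==> (!!i. i ~: Q ==> x$i = y$i) ==> c qw x = c qw y"
 "!!x. x:PD qj ==> ((%qw. c qw x * (PROD j:Q. x$j ^ qw j)) has_sum f x) (mis Q)"
 using cc by blast+
 define d where "d qk = tcf j (qk j) (c (qk(j := 0)))" for qk
 have mi: "qk(j := 0):mis Q" if "qk:mis (insert j Q)" for qk
 using that by (auto simp: multi_indices_def)
 have prq: "(PROD i:insert j Q. u i ^ qk i) = (PROD i:Q. u i ^ (qk(j := 0)) i) * u j ^ qk j" for u :: "'m => 'c::comm_ring_1" and qk :: "'m => nat"
 proof -
 have "(PROD i:Q. u i ^ (qk(j := 0)) i) = (PROD i:Q. u i ^ qk i)" by (rule prod.cong) (use insert.hyps in auto)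
 thus ?thesis using insert.hyps by (simp add: mult.commute)
 qed
 have zPD: "zj j x:PD r" if "x:PD r" for x using that qj by (auto simp: PD_def zj_def)
 show ?case
 proof (intro exI[of _ d] conjI ballI impI)
 fix qk and x :: "complex^'m" assume b: "qk:mis (insert j Q)" and x: "x:PD r"
 note tp = tcf_props(1,2)[OF qj c(1)[OF mi[OF b]] c(2)[OF mi[OF b]] x, of j "qk j"]
 show "cdiff (d qk) x" unfolding d_def by (rule tp)
 show "norm (d qk x) <= B / (PROD i:insert j Q. qj ^ qk i)"
 using tp(2) unfolding d_def prq by simp
 fix y :: "complex^'m" assume y: "y:PD r" and xy: "ALL i. i ~: insert j Q --> x$i = y$i"
 define h where "h = c (qk(j := 0))"
 have h1: "!!x. x:PD r ==> cdiff h x" unfolding h_def by (rule c(1)[OF mi[OF b]])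
 have h3: "h x = h y" if "x:PD r" "y:PD r" "!!i. i ~: Q ==> x$i = y$i" for x y
 unfolding h_def by (rule c(3)[OF mi[OF b] that])
 \<comment> \<open>Two points that agree outside \<open>Q\<close> differ by a translation that does
   not change h nearby, so all derivatives in the direction j agree as well.\<close>
 have Dh: "Dk j k h x = Dk j k h y" if "x:PD r" "y:PD r" "!!i. i ~: Q ==> x$i = y$i" for x y k
 using that
 proof (induction k arbitrary: x y)
 case 0 thus ?case using h3[OF 0] by (simp add: Dk_def)
 next
 case (Suc k)
 let ?t = "y - x"
 have ev: "\<forall>\<^sub>F u in nhds x. u:PD r & u+?t:PD r"
 by (intro eventually_conj evo open_PD Suc.prems)
 (rule ev_nhds_compose[where b=y and F="%u. u+?t" and P="%v. v:PD r"], auto intro!: evo open_PD Suc.prems)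
 have "\<forall>\<^sub>F u in nhds x. Dk j k h u = Dk j k h (u+?t)"
 using ev by eventually_elim (rule Suc.IH, use Suc.prems in auto)
 hence "dd (Dk j k h) x (ax j) = dd (%u. Dk j k h (u+?t)) x (ax j)" by (rule dd_cong_ev)
 also have "\<dots> = dd (Dk j k h) (x+?t) (dd (%u. u+?t) x (ax j))"
 by (rule cdiff_compose(2)) (use Suc.prems in "auto intro!: Dk_cdiff[OF open_PD h1]")
 also have "dd (%u. u+?t) x (ax j) = ax j"
 by (rule dd_eqI) (auto intro!: derivative_eq_intros)
 finally show ?case by (simp add: Dk_def)
 qed
 show "d qk x = d qk y" unfolding d_def tcf_def h_def[symmetric]
 using Dh[OF zPD[OF x] zPD[OF y]] xy by (simp add: zj_def)
 next
 fix x :: "complex^'m" assume x: "x:PD qj"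
 have xr: "x:PD r" using x qj by (auto simp: PD_def intro: less_trans)
 have B0: "B >= 0" using bspec[OF B xr] norm_ge_zero order_trans by blast
 let ?F = "%qk. d qk x * (PROD i:insert j Q. x$i ^ qk i)"
 \<comment> \<open>Absolute summability is settled first, by a product of geometric series. The
   value is identified afterwards by summing over the new exponent first and over the old
   multi-index second.\<close>
 have "(%qk. norm (?F qk)) summable_on mis (insert j Q)"
 proof (rule Infinite_Sum.abs_summable_on_comparison_test')
 show "(%qk. B * (PROD i:insert j Q. (norm (x$i) / qj) ^ qk i)) summable_on mis (insert j Q)"
 using insert.hyps x qj by (intro summable_on_cmult_right geom_multi_summable) (auto simp: PD_def)
 fix qk assume b: "qk:mis (insert j Q)"
 have "norm (d qk x) <= B / (PROD i:insert j Q. qj ^ qk i)"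
 using tcf_props(2)[OF qj c(1)[OF mi[OF b]] c(2)[OF mi[OF b]] xr, of j "qk j"] unfolding d_def prq by simp
 from mult_right_mono[OF this, of "PROD i:insert j Q. norm (x$i) ^ qk i"]
 show "norm (?F qk) <= B * (PROD i:insert j Q. (norm (x$i) / qj) ^ qk i)"
 by (simp add: norm_mult prod_norm[symmetric] norm_power power_divide prod_dividef prod_nonneg del: prod.insert)
 qed
 hence "?F summable_on mis (insert j Q)" by (rule abs_summable_summable)
 then obtain T where T: "(?F has_sum T) (mis (insert j Q))" by (auto simp: summable_on_def)
 hence "((%p. ?F ((%(qw, k). qw(j := k)) p)) has_sum T) (mis Q \<times> UNIV)"
 using has_sum_reindex_bij_betw[OF bij_multi_insert[OF insert.hyps(2)], of ?F T] by simp
 moreover have "((%k. ?F ((%(qw, k). qw(j := k)) (qw, k))) has_sum c qw x * (PROD i:Q. x$i ^ qw i)) UNIV" if a: "qw:mis Q" for qw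
 proof -
 have "qw j = 0" using a insert.hyps by (auto simp: multi_indices_def)
 hence e: "qw(j := k, j := 0) = qw" for k by (simp add: fun_upd_idem)
 have *: "((%k. tcf j k (c qw) x * x$j ^ k) has_sum c qw x) UNIV"
 by (rule tcf_props(3)[OF qj c(1)[OF a] c(2)[OF a] xr]) (use x in "auto simp: PD_def")
 have t: "?F (qw(j := k)) = (PROD i:Q. x$i ^ qw i) * (tcf j k (c qw) x * x$j ^ k)" for k
 by (simp only: prq d_def e fun_upd_same mult_ac)
 have "(%k. ?F ((%(qw, k). qw(j := k)) (qw, k))) = (%k. (PROD i:Q. x$i ^ qw i) * (tcf j k (c qw) x * x$j ^ k))"
 by (simp only: t case_prod_conv)
 thus ?thesis using has_sum_cmult_right[OF *, of "PROD i:Q. x$i ^ qw i"] by (simp only: mult.commute)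
 qed
 ultimately have "((%qw. c qw x * (PROD i:Q. x$i ^ qw i)) has_sum T) (mis Q)"
 by (rule has_sum_SigmaD)
 hence "T = f x" using has_sum_unique c(4)[OF x] by blast
 thus "(?F has_sum f x) (mis (insert j Q))" using T by simp
 qed
qed

text \<open>Once the coordinates outside \<open>Q\<close> are set to 0, the coefficient functions of
  \<open>power_series_aux\<close> become constants.\<close>

lemma germ_power_series:
 fixes f :: "complex^'m => complex"
 assumes "ger f"
 shows "\<exists>qj>0. EX c. ALL x:PD qj. (ALL i. i ~: Q --> x$i = 0) -->
 ((%qw. c qw * (PROD j:Q. x$j ^ qw j)) has_sum f x) (mis Q)"
proof -
 have "NEAR x. norm (f x) < norm (f 0)+1"
 proof -
 have "filterlim f (nhds (f 0)) (nhds 0)"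
 using ger_isCont[OF assms(1)] unfolding isCont_def tendsto_at_iff_tendsto_nhds .
 hence "((%x. norm (f x)) \<longlongrightarrow> norm (f 0)) (nhds 0)" by (rule tendsto_norm)
 thus ?thesis by (rule order_tendstoD) simp
 qed
 hence "NEAR x. cdiff f x & norm (f x) < norm (f 0)+1"
 using assms unfolding ger_def by (rule eventually_conj[rotated])
 then obtain r where r: "r > 0" "ALL x:PD r. cdiff f x" "ALL x:PD r. norm (f x) <= norm (f 0)+1"
 unfolding eventually_nhds_PD by (meson less_imp_le)
 have "0 < r/2" "r/2 < r" using r by auto
 from power_series_aux[OF finite[of Q] this r(2,3)]
 obtain c where cc: "(ALL qw:mis Q. ALL x:PD r. cdiff (c qw) x & norm (c qw x) <= (norm (f 0)+1) / (PROD j:Q. (r/2) ^ qw j) &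
 (ALL y:PD r. (ALL i. i ~: Q --> x$i = y$i) --> c qw x = c qw y)) &
 (ALL x:PD (r/2). ((%qw. c qw x * (PROD j:Q. x$j ^ qw j)) has_sum f x) (mis Q))"
 by (rule exE)
 have c: "!!qw x y. qw:mis Q ==> x:PD r ==> y:PD r ==> (!!i. i ~: Q ==> x$i = y$i) ==> c qw x = c qw y"
 "!!x. x:PD (r/2) ==> ((%qw. c qw x * (PROD j:Q. x$j ^ qw j)) has_sum f x) (mis Q)"
 using cc by blast+
 show ?thesis
 proof (intro exI[of _ "r/2"] conjI exI[of _ "%qw. c qw 0"] ballI impI)
 fix x :: "complex^'m" assume x: "x:PD (r/2)" "ALL i. i ~: Q --> x$i = 0"
 have "norm (x$j) < r/2" for j using x(1) unfolding PD_def by simp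
 hence "norm (x$j) < r" for j using r(1) by (meson `r/2 < r` less_trans)
 hence z: "0:PD r" "x:PD r" using r(1) by (auto simp: PD_def)
 have "c qw x = c qw 0" if "qw:mis Q" for qw
 by (rule c(1)[OF that z(2,1)]) (simp add: x(2))
 thus "((%qw. c qw 0 * (PROD j:Q. x$j ^ qw j)) has_sum f x) (mis Q)"
 using c(2)[OF x(1)] by (simp cong: has_sum_cong)
 qed (use r in auto)
qed

section \<open>Calculus of C^k functions\<close>

lemma Ck_on_Suc_D: "Ck_on (Suc k) f S ==> Ck_on k f S"
proof (induction k arbitrary: f)
 case 0 thus ?case
 by (simp add: differentiable_imp_continuous_on differentiable_on_def differentiable_at_withinI)
next
 case (Suc k)
 have "Ck_on k (%x. dd f x v) S" for v by (rule Suc.IH) (use Suc.prems in simp)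
 thus ?case using Suc.prems by simp
qed

lemma Ck_on_mono: "Ck_on k f S ==> T <= S ==> Ck_on k f T"
 by (induction k arbitrary: f) (auto intro: continuous_on_subset)

lemma Ck_on_cong:
 assumes "open S" "Ck_on k f S" "!!x. x:S ==> f x = g x" shows "Ck_on k g S"
 using assms(2,3)
proof (induction k arbitrary: f g)
 case 0 thus ?case by (simp cong: continuous_on_cong)
next
 case (Suc k)
 have e: "dd f x = dd g x" if "x:S" for x by (rule dd_transform[OF assms(1) that Suc.prems(2)])
 have "g differentiable (at x)" if x: "x:S" for x
 proof -
 have "(f HD dd f x) (at x)" using Suc.prems(1) x by (simp add: fdw[symmetric])
 from has_derivative_transform_within_open[OF this assms(1) x Suc.prems(2)] show ?thesis by (rule differentiableI)
 qed
 moreover have "Ck_on k (%x. dd g x v) S" for v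
 by (rule Suc.IH[of "%x. dd f x v"]) (use Suc.prems(1) e in auto)
 ultimately show ?case by simp
qed

lemma Ck_on_const: "Ck_on k (%x. c) S"
proof (induction k arbitrary: c)
 case (Suc k)
 have "dd (%x. c) x v = 0" for x v by (rule dd_eqI[of _ "%_. 0"]) (rule has_derivative_const)
 thus ?case using Suc.IH by simp
qed simp

lemma Ck_has_derivative: "Ck_on (Suc k) f S ==> x:S ==> (f HD dd f x) (at x)"
 by (simp add: fdw[symmetric])

text \<open>Lets the inductive proofs below give the derivative by a formula, although
  \<open>Ck_on\<close> speaks of \<open>frechet_derivative\<close>.\<close>

lemma Ck_on_SucI:
 assumes "open S" "!!x. x:S ==> (f HD f' x) (at x)" "!!v. Ck_on k (%x. f' x v) S"
 shows "Ck_on (Suc k) f S"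
proof -
 have "Ck_on k (%x. dd f x v) S" for v
 by (rule Ck_on_cong[OF assms(1) assms(3)[of v]]) (simp add: dd_eqI[OF assms(2)])
 thus ?thesis using assms(2) by (auto intro: differentiableI)
qed

lemma Ck_on_linear:
 assumes "open S" "blin h" "Ck_on k f S" shows "Ck_on k (%x. h (f x)) S"
 using assms(3)
proof (induction k arbitrary: f)
 case 0 thus ?case using assms(2) by (simp add: bounded_linear.continuous_on)
next
 case (Suc k)
 show ?case
 proof (rule Ck_on_SucI[OF assms(1)])
 fix x assume "x:S"
 show "((%x. h (f x)) HD (%v. h (dd f x v))) (at x)"
 by (rule hdc[OF Ck_has_derivative[OF Suc.prems `x:S`] blhd[OF assms(2)]])
 next
 show "Ck_on k (%x. h (dd f x v)) S" for v by (rule Suc.IH) (use Suc.prems in simp)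
 qed
qed

lemma Ck_on_add:
 assumes "open S" "Ck_on k f S" "Ck_on k g S" shows "Ck_on k (%x. f x+g x) S"
 using assms(2,3)
proof (induction k arbitrary: f g)
 case 0 thus ?case by (simp add: continuous_on_add)
next
 case (Suc k)
 show ?case
 proof (rule Ck_on_SucI[OF assms(1)])
 fix x assume "x:S"
 show "((%x. f x+g x) HD (%v. dd f x v+dd g x v)) (at x)"
 by (rule has_derivative_add[OF Ck_has_derivative[OF Suc.prems(1) `x:S`] Ck_has_derivative[OF Suc.prems(2) `x:S`]])
 next
 show "Ck_on k (%x. dd f x v+dd g x v) S" for v by (rule Suc.IH) (use Suc.prems in simp_all)
 qed
qed

lemma Ck_on_sum:
 assumes "open S" "!!i. i:A ==> Ck_on k (f i) S" shows "Ck_on k (%x. SUM i:A. f i x) S"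
 using assms(2) by (induction A rule: infinite_finite_induct) (simp_all add: Ck_on_const Ck_on_add[OF assms(1)])

lemma Ck_on_bilinear:
 assumes "open S" "bounded_bilinear pr" "Ck_on k f S" "Ck_on k g S" shows "Ck_on k (%x. pr (f x) (g x)) S"
 using assms(3,4)
proof (induction k arbitrary: f g)
 case 0 thus ?case using bounded_bilinear.continuous_on[OF assms(2)] by simp
next
 case (Suc k)
 show ?case
 proof (rule Ck_on_SucI[OF assms(1)])
 fix x assume "x:S"
 show "((%x. pr (f x) (g x)) HD (%v. pr (f x) (dd g x v)+pr (dd f x v) (g x))) (at x)"
 by (rule bounded_bilinear.FDERIV[OF assms(2) Ck_has_derivative[OF Suc.prems(1) `x:S`] Ck_has_derivative[OF Suc.prems(2) `x:S`]])
 next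
 show "Ck_on k (%x. pr (f x) (dd g x v)+pr (dd f x v) (g x)) S" for v
 by (rule Ck_on_add[OF assms(1)]; rule Suc.IH) (use Suc.prems Ck_on_Suc_D in auto)
 qed
qed

lemmas Ck_on_mult = Ck_on_bilinear[OF _ bounded_bilinear_mult]
lemmas Ck_on_scaleR = Ck_on_bilinear[OF _ bounded_bilinear_scaleR]

lemma Ck_on_inverse:
 fixes f :: "'a::real_normed_vector => complex"
 assumes "open S" "Ck_on k f S" "!!x. x:S ==> f x ~= 0" shows "Ck_on k (%x. inverse (f x)) S"
 using assms(2)
proof (induction k)
 case 0 thus ?case using assms(3) by (simp add: continuous_on_inverse)
next
 case (Suc k)
 show ?case
 proof (rule Ck_on_SucI[OF assms(1)])
 fix x assume "x:S"
 show "((%x. inverse (f x)) HD (%v. - (inverse (f x) * dd f x v * inverse (f x)))) (at x)"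
 by (rule Deriv.has_derivative_inverse[OF assms(3)[OF `x:S`] Ck_has_derivative[OF Suc.prems `x:S`]])
 next
 fix v
 have "Ck_on k (%x. inverse (f x)) S" by (rule Suc.IH[OF Ck_on_Suc_D[OF Suc.prems]])
 thus "Ck_on k (%x. - (inverse (f x) * dd f x v * inverse (f x))) S"
 using Suc.prems by (intro Ck_on_linear[OF assms(1) bounded_linear_minus[OF bounded_linear_ident]] Ck_on_mult[OF assms(1)]) auto
 qed
qed

text \<open>\<open>Ck_on\<close> only knows derivatives in fixed directions, while the chain rule
  produces the moving direction \<open>dd g x v\<close>; expanding it in the basis turns the
  derivative into a sum of products of C^k functions.\<close>

lemma Ck_on_compose:
 fixes f :: "'b::euclidean_space => 'c::real_normed_vector" and g :: "'a::real_normed_vector => 'b"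
 assumes "open S" "open T" "Ck_on k f T" "Ck_on k g S" "!!x. x:S ==> g x:T" shows "Ck_on k (%x. f (g x)) S"
 using assms(3,4)
proof (induction k arbitrary: f)
 case 0
 have "g ` S <= T" using assms(5) by blast
 thus ?case using 0 continuous_on_compose2[of T f S g] by simp
next
 case (Suc k)
 show ?case
 proof (rule Ck_on_SucI[OF assms(1)])
 fix x assume x: "x:S"
 have df: "(f HD dd f (g x)) (at (g x))" by (rule Ck_has_derivative[OF Suc.prems(1) assms(5)[OF x]])
 have "((%x. f (g x)) HD (%v. dd f (g x) (dd g x v))) (at x)"
 by (rule hdc[OF Ck_has_derivative[OF Suc.prems(2) x] df])
 moreover have "dd f (g x) (dd g x v) = (SUM b:Basis. (dd g x v ~~ b) *R dd f (g x) b)" for v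
 proof -
 have lin: "linear (dd f (g x))" using has_derivative_linear[OF df] .
 have "dd f (g x) (dd g x v) = dd f (g x) (SUM b:Basis. (dd g x v ~~ b) *R b)" by (simp add: euclidean_representation)
 also have "\<dots> = (SUM b:Basis. (dd g x v ~~ b) *R dd f (g x) b)"
 by (simp add: linear_sum[OF lin] linear_scale[OF lin])
 finally show ?thesis .
 qed
 ultimately show "((%x. f (g x)) HD (%v. SUM b:Basis. (dd g x v ~~ b) *R dd f (g x) b)) (at x)" by simp
 next
 fix v
 show "Ck_on k (%x. SUM b:Basis. (dd g x v ~~ b) *R dd f (g x) b) S"
 proof (intro Ck_on_sum[OF assms(1)] Ck_on_scaleR[OF assms(1)])
 fix b :: 'b
 show "Ck_on k (%x. dd g x v ~~ b) S"
 by (rule Ck_on_linear[OF assms(1) bounded_linear_inner_left]) (use Suc.prems in simp)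
 show "Ck_on k (%x. dd f (g x) b) S"
 by (rule Suc.IH) (use Suc.prems Ck_on_Suc_D in auto)
 qed
 qed
qed

section \<open>Real analyticity as restriction of holomorphic germs\<close>

lemma bounded_linear_rl: "blin (rl :: complex^'n::finite => _)"
 unfolding lcb[symmetric]
 by (rule linearI) (simp_all add: veq2)

lemma bounded_linear_cj: "blin (cj :: complex^('n::finite+'n) => _)"
 unfolding lcb[symmetric]
 by (rule linearI) (simp_all add: veq2)

lemma bounded_linear_lc: "blin (lc :: complex^('n::finite+'n) => _)"
 unfolding lcb[symmetric]
 by (rule linearI) (simp_all add: veq)

lemma rl_add: "rl (x+y) = rl x+rl y" by (simp add: veq2)

lemma isCont_rl: "isCont rl x" using bounded_linear_rl lincont by blast
lemma isCont_cj: "isCont cj x" using bounded_linear_cj lincont by blast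
lemma isCont_lc: "isCont lc x" using bounded_linear_lc lincont by blast

lemma ev_rl: "NEAR X. P X ==> NEAR x. P (rl x)"
 by (rule ev_nhds_compose[OF isCont_rl]) auto
lemma ev_cj: "NEAR X. P X ==> NEAR X. P (cj X)"
 by (rule ev_nhds_compose[OF isCont_cj]) auto

lemma cj_smult: "cj (c *s v) = cnj c *s cj v" by (simp add: veq2)

lemma cdiff_cj:
 assumes "cdiff F (cj X)"
 shows "cdiff (%X. cnj (F (cj X))) X" "dd (%X. cnj (F (cj X))) X v = cnj (dd F (cj X) (cj v))"
proof -
 have "((%X. F (cj X)) HD (%v. dd F (cj X) (cj v))) (at X)"
 by (rule hdc[OF blhd[OF bounded_linear_cj] cdiffD[OF assms]])
 from hdc[OF this blhd[OF bounded_linear_cnj]]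
 have 1: "((%X. cnj (F (cj X))) HD (%v. cnj (dd F (cj X) (cj v)))) (at X)" by simp
 show "cdiff (%X. cnj (F (cj X))) X"
 by (rule cdiffI[OF 1]) (simp add: cj_smult cdiff_scale[OF assms])
 show "dd (%X. cnj (F (cj X))) X v = cnj (dd F (cj X) (cj v))" by (rule dd_eqI[OF 1])
qed

lemma ger_cj: assumes "ger F" shows "ger (%X. cnj (F (cj X)))"
 using ev_cj[OF assms[unfolded ger_def]] unfolding ger_def by eventually_elim (rule cdiff_cj(1))

text \<open>Real analyticity at p in the form used throughout: near p, f is a holomorphic germ of
  the doubled space restricted to the points \<open>rl x\<close>.\<close>

definition cpx :: "(complex^'n::finite => complex) => complex^'n => bool" where
 "cpx f p <-> (EX F. ger F & (NEAR x. f (p+x) = F (rl x)))"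

lemma cpxI: "ger F ==> NEAR x. f (p+x) = F (rl x) ==> cpx f p" unfolding cpx_def by (intro exI conjI)

lemma cpxE: assumes "cpx f p" obtains F where "ger F" "NEAR x. f (p+x) = F (rl x)" "F 0 = f p"
proof -
 obtain F where F: "ger F & (NEAR x. f (p+x) = F (rl x))" using assms unfolding cpx_def ..
 hence "f (p+0) = F (rl 0)" using ev_x by fast
 thus ?thesis using that[of F] F by simp
qed

lemma ev_shift: "(\<forall>\<^sub>F x in nhds (p::'a::real_normed_vector). P x) <-> (NEAR x. P (p+x))"
proof
 assume "\<forall>\<^sub>F x in nhds p. P x" thus "NEAR x. P (p+x)"
 by (rule ev_nhds_compose[where F="%x. p+x", rotated 2]) auto
next
 assume "NEAR x. P (p+x)"
 hence "\<forall>\<^sub>F x in nhds p. P (p+(x - p))"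
 by (rule ev_nhds_compose[where F="%x. x - p", rotated 2]) auto
 thus "\<forall>\<^sub>F x in nhds p. P x" by simp
qed

lemma cpx_cong: assumes "cpx f p" "\<forall>\<^sub>F x in nhds p. f x = g x" shows "cpx g p"
proof -
 obtain F where F: "ger F" "NEAR x. f (p+x) = F (rl x)" using cpxE[OF assms(1)] .
 have "NEAR x. g (p+x) = F (rl x)"
 using assms(2)[unfolded ev_shift[of _ p]] F(2) by eventually_elim simp
 thus ?thesis using F(1) by (intro cpxI)
qed

lemma cpx_hol: assumes "\<forall>\<^sub>F x in nhds p. cdiff f x" shows "cpx f p"
proof (rule cpxI)
 have "isCont (%X. p+lc X) 0" using isCont_lc by (intro continuous_intros)
 hence "NEAR X. cdiff f (p+lc X)"
 by (rule ev_nhds_compose) (use assms in auto)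
 thus "ger (%X. f (p+lc X))" unfolding ger_def
 proof eventually_elim
 case (elim X)
 have "vdiff (%X. p+lc X) X"
 by (rule vdiff_add[OF vdiff_const]) (simp add: vdiff_def)
 thus ?case by (rule cdiff_compose(1)[where F="%X. p+lc X" and g=f]) (rule elim)
 qed
qed simp

lemma cpx_const[simp]: "cpx (%x. c) p" by (rule cpx_hol) simp
lemma cpx_nth[simp]: "cpx (%x. x$i) p" by (rule cpx_hol) simp

lemma cpx_cnj: assumes "cpx f p" shows "cpx (%x. cnj (f x)) p"
proof -
 obtain F where F: "ger F" "NEAR x. f (p+x) = F (rl x)" using cpxE[OF assms(1)] .
 show ?thesis by (rule cpxI[OF ger_cj[OF F(1)]]) (use F(2) in eventually_elim, simp)
qed

lemma cpx_add: assumes "cpx f p" "cpx g p" shows "cpx (%x. f x+g x) p"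
proof -
 obtain F where F: "ger F" "NEAR x. f (p+x) = F (rl x)" using cpxE[OF assms(1)] .
 obtain G where G: "ger G" "NEAR x. g (p+x) = G (rl x)" using cpxE[OF assms(2)] .
 show ?thesis by (rule cpxI[OF ger_add[OF F(1) G(1)]]) (use F(2) G(2) in eventually_elim, simp)
qed

lemma cpx_mult: assumes "cpx f p" "cpx g p" shows "cpx (%x. f x * g x) p"
proof -
 obtain F where F: "ger F" "NEAR x. f (p+x) = F (rl x)" using cpxE[OF assms(1)] .
 obtain G where G: "ger G" "NEAR x. g (p+x) = G (rl x)" using cpxE[OF assms(2)] .
 show ?thesis by (rule cpxI[OF ger_mult[OF F(1) G(1)]]) (use F(2) G(2) in eventually_elim, simp)
qed

lemma cpx_diff: assumes "cpx f p" "cpx g p" shows "cpx (%x. f x - g x) p"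
 using cpx_add[OF assms(1) cpx_mult[OF cpx_const[of "-1"] assms(2)]] by simp

lemma cpx_isCont: assumes "cpx f p" shows "isCont f p"
proof -
 obtain F where F: "ger F" "NEAR x. f (p+x) = F (rl x)" "F 0 = f p" using cpxE[OF assms(1)] .
 have ev: "\<forall>\<^sub>F x in nhds p. F (rl (x - p)) = f x" unfolding ev_shift[of _ p] using F(2) by eventually_elim simp
 have c: "isCont F (rl (p - p))" using ger_isCont[OF F(1)] by simp
 have "isCont (%x. rl (x - p)) p"
 by (rule isCont_o2[where g=rl and f="%x. x - p", OF _ isCont_rl]) (intro continuous_intros)
 hence "isCont (%x. F (rl (x - p))) p"
 by (rule isCont_o2[where g=F and f="%x. rl (x - p)"]) (rule c)
 thus ?thesis by (rule isCont_cong[OF ev, THEN iffD1])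
qed

lemma cpx_compose:
 fixes f :: "complex^'n::finite => complex^'k::finite"
 assumes f: "!!i. cpx (%x. f x$i) p" and g: "cpx g (f p)" shows "cpx (%x. g (f x)) p"
proof -
 have "EX F. ger F & (NEAR x. f (p+x)$i = F (rl x)) & F 0 = f p$i" for i
 proof -
 obtain F where "ger F" "NEAR x. f (p+x)$i = F (rl x)" "F 0 = f p$i" using cpxE[OF f[of i]] .
 thus ?thesis by (intro exI[of _ F] conjI)
 qed
 hence "ALL i. EX F. ger F & (NEAR x. f (p+x)$i = F (rl x)) & F 0 = f p$i" by (rule allI)
 from choice[OF this] obtain F where F0: "ALL i. ger (F i) & (NEAR x. f (p+x)$i = F i (rl x)) & F i 0 = f p$i" ..
 have F: "!!i. ger (F i)" "!!i. NEAR x. f (p+x)$i = F i (rl x)" "!!i. F i 0 = f p$i"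
 using F0 by simp_all
 obtain G where G: "ger G" "NEAR x. g (f p+x) = G (rl x)" using cpxE[OF g] .
 \<comment> \<open>The inner map is extended together with its conjugate, so \<open>H\<close> sends
   points \<open>rl x\<close> to points of the same kind. The shift by f p is needed because
   \<open>G\<close> is a germ at 0 that describes g near f p.\<close>
 define H where "H X = cpl (\<chi> i. F i X - f p$i) (\<chi> i. cnj (F i (cj X)) - cnj (f p$i))" for X
 have H: "vger H" unfolding vger_iff
 proof
 fix k show "ger (%x. H x$k)" by (cases k) (simp_all add: H_def ger_diff ger_cj F)
 qed
 have H0: "H 0 = 0" by (simp add: H_def veq2 F)
 have 1: "NEAR x. ALL i. f (p+x)$i = F i (rl x)" by (rule eventually_all_finite[OF F(2)])
 have "isCont (%x. H (rl x)) 0"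
 by (rule isCont_o2[where g=H and f=rl, OF isCont_rl]) (use vger_isCont[OF H] in simp)
 hence "isCont (%x. lc (H (rl x))) 0"
 by (rule isCont_o2[where g=lc and f="%x. H (rl x)", OF _ isCont_lc])
 hence 2: "NEAR x. g (f p+lc (H (rl x))) = G (rl (lc (H (rl x))))"
 by (rule ev_nhds_compose) (simp add: H0, rule G(2))
 show ?thesis
 proof (rule cpxI[OF ger_compose[OF H H0 G(1)]])
 show "NEAR x. g (f (p+x)) = G (H (rl x))"
 using 1 2
 proof eventually_elim
 case (elim x)
 have "f p+lc (H (rl x)) = f (p+x)" by (simp add: veq H_def elim(1)[rule_format, symmetric])
 moreover have "rl (lc (H (rl x))) = H (rl x)" by (simp add: veq2 H_def)
 ultimately show ?case using elim(2) by simp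
 qed
 qed
qed

lemma cpx_has_derivative:
 assumes "ger F" "NEAR x. f (p+x) = F (rl x)"
 shows "NEAR x. (f HD (%v. dd F (rl x) (rl v))) (at (p+x))"
 using ev_nhds_nested[OF assms(2)] ev_rl[OF assms(1)[unfolded ger_def]]
proof eventually_elim
 case (elim x)
 have "rl ((p+x) - p) = rl x" by simp
 hence cd: "cdiff F (rl ((p+x) - p))" using elim(2) by simp
 have "((%y. rl (y - p)) HD rl) (at (p+x))"
 proof -
 have "((%y. y - p) HD (%y. y)) (at (p+x))" by (auto intro!: derivative_eq_intros)
 from hdc[OF this blhd[OF bounded_linear_rl]]
 show ?thesis .
 qed
 from hdc[OF this cdiffD[OF cd]]
 have 1: "((%y. F (rl (y - p))) HD (%v. dd F (rl x) (rl v))) (at (p+x))" by simp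
 have "\<forall>\<^sub>F y in nhds (p+x). f (p+(y - p)) = F (rl (y - p))"
 by (rule ev_nhds_compose[OF _ _ elim(1), where F="%y. y - p"]) (auto intro!: continuous_intros)
 then obtain S where "open S" "p+x:S" "!!y. y:S ==> F (rl (y - p)) = f y" unfolding eventually_nhds by auto
 thus ?case by (rule has_derivative_transform_within_open[OF 1])
qed

lemma cpx_differentiable: assumes "cpx f p" shows "f differentiable (at p)" "cpx (%x. dd f x v) p"
proof -
 obtain F where F: "ger F" "NEAR x. f (p+x) = F (rl x)" using cpxE[OF assms] .
 note d = cpx_has_derivative[OF F]
 from ev_x[OF d] show "f differentiable (at p)" by (auto intro: differentiableI)
 show "cpx (%x. dd f x v) p"
 by (rule cpxI[OF ger_dd[OF F(1), of "rl v"]]) (use d in eventually_elim, simp add: dd_eqI)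
qed

lemma cpx_Ck_on: assumes "!!p. p:S ==> cpx f p" shows "Ck_on k f S"
 using assms
proof (induction k arbitrary: f)
 case 0 thus ?case using cpx_isCont by (auto intro: continuous_at_imp_continuous_on)
next
 case (Suc k)
 have "Ck_on k (%x. dd f x v) S" for v by (rule Suc.IH) (rule cpx_differentiable(2)[OF Suc.prems])
 thus ?case using cpx_differentiable(1)[OF Suc.prems] by simp
qed

lemma Ck_on_vec:
 fixes f :: "'a::real_normed_vector => complex^'k::finite"
 assumes "open S" "!!i. Ck_on k (%x. f x$i) S" shows "Ck_on k f S"
 using assms(2)
proof (induction k arbitrary: f)
 case 0
 hence "con S (%x. \<chi> i. f x$i)" by (intro vec_lambda_continuous) simp
 thus ?case by simp
next
 case (Suc k)
 have d: "(f HD (%v. \<chi> i. dd (%x. f x$i) x v)) (at x)" if "x:S" for x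
 unfolding has_derivative_vec_iff
 proof
 fix i have "(%x. f x$i) differentiable (at x)" using Suc.prems[of i] that by simp
 thus "((%x. f x$i) HD (%v. (\<chi> i. dd (%x. f x$i) x v)$i)) (at x)"
 by (simp add: fdw[symmetric])
 qed
 have "Ck_on k (%x. dd f x v) S" for v
 proof (rule Suc.IH)
 fix i
 have e: "dd f x v$i = dd (%x. f x$i) x v" if "x:S" for x using dd_eqI[OF d[OF that]] by simp
 show "Ck_on k (%x. dd f x v$i) S"
 by (rule Ck_on_cong[OF assms(1), of k "%x. dd (%x. f x$i) x v"]) (use Suc.prems[of i] e in auto)
 qed
 thus ?case using d by (auto intro: differentiableI)
qed

lemma real_analytic_linear:
 assumes "real_analytic_on f S" "blin h" shows "real_analytic_on (%x. h (f x)) S"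
 unfolding real_analytic_on_def
proof
 fix p assume "p:S"
 then obtain r c where r: "r > 0" "ALL x:ball p r. ((%qw. (PROD b:Basis. ((x - p) ~~ b) ^ qw b) *R c qw) has_sum f x) (mis Basis)"
 using assms(1) unfolding real_analytic_on_def by fast
 show "\<exists>r>0. EX c. ALL x:ball p r. ((%qw. (PROD b:Basis. ((x - p) ~~ b) ^ qw b) *R c qw) has_sum h (f x)) (mis Basis)"
 proof (intro exI[of _ r] conjI r(1) exI[of _ "%qw. h (c qw)"] ballI)
 fix x assume "x:ball p r"
 from has_sum_bounded_linear[OF assms(2) bspec[OF r(2) this]]
 show "((%qw. (PROD b:Basis. ((x - p) ~~ b) ^ qw b) *R h (c qw)) has_sum h (f x)) (mis Basis)"
 by (simp add: linear_scale[OF bllin[OF assms(2)]])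
 qed
qed

text \<open>The holomorphic extension of the real coordinate of x in the direction b; see
  \<open>ell_rl\<close>.\<close>

definition ell :: "complex^'n::finite => complex^('n+'n) => complex" where
 "ell b X = (SUM i:UNIV. X$Inl i * cnj (b$i)+X$Inr i * b$i) / 2"

lemma ell_rl: "ell b (rl x) = of_real (x ~~ b)"
proof -
 have "x$i * cnj (b$i)+cnj (x$i) * b$i = of_real (2 * (x$i ~~ b$i))" for i
 by (simp add: ceq inner_complex_def)
 hence "ell b (rl x) = (SUM i:UNIV. of_real (2 * (x$i ~~ b$i))) / 2" by (simp add: ell_def)
 also have "\<dots> = of_real (SUM i:UNIV. x$i ~~ b$i)" by (simp flip: sum_distrib_left)
 finally show ?thesis by (simp add: inner_vec_def)
qed

lemma cdiff_ell: "cdiff (ell b) X"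
proof -
 have "cdiff (%X. (SUM i:UNIV. X$Inl i * cnj (b$i)+X$Inr i * b$i) / 2) X"
 by (rule cdiff_divide[OF cdiff_sum cdiff_const]) (auto intro!: cdiff_add cdiff_mult)
 thus ?thesis by (rule cdiff_transform[OF _ open_UNIV UNIV_I]) (simp add: ell_def)
qed

lemma real_analytic_cpx:
 fixes f :: "complex^'n::finite => complex"
 assumes "real_analytic_on f S" "p:S" shows "cpx f p"
proof -
 obtain r c where r: "r > 0" "ALL x:ball p r. ((%qw. (PROD b:Basis. ((x - p) ~~ b) ^ qw b) *R c qw) has_sum f x) (mis Basis)"
 using assms unfolding real_analytic_on_def by fast
 \<comment> \<open>At the point p + t e every real coordinate of the displacement equals t.
   Convergence at this one point gives the summable majorant on the region where all extended
   coordinates \<open>ell b\<close> are smaller than t.\<close>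
 define e :: "complex^'n" where "e = (SUM b:Basis. b)"
 define t where "t = r / (2 * (norm e+1))"
 have t: "t > 0" using r by (simp add: t_def add_nonneg_pos)
 have te: "t * norm e < r"
 proof -
 have "norm e+1 ~= 0" using norm_ge_zero[of e] by linarith
 hence "t * (2 * (norm e+1)) = r" by (simp add: t_def)
 hence "2 * (t * norm e)+2 * t = r" by (simp add: algebra_simps)
 moreover have "t * norm e >= 0" using t by simp
 ultimately show ?thesis using t by linarith
 qed
 have eb: "e ~~ b = 1" if "b:Basis" for b
 unfolding e_def inner_sum_left using that by (simp add: inner_Basis sum.delta)
 have "p+t *R e:ball p r" using te t by (simp add: dist_norm)
 from bspec[OF r(2) this]
 have "(%qw. (PROD b:Basis. (((p+t *R e) - p) ~~ b) ^ qw b) *R c qw) summable_on mis Basis"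
 unfolding summable_on_def by blast
 hence sm: "(%qw. (PROD b:(Basis::(complex^'n) set). t ^ qw b) * norm (c qw)) summable_on mis Basis"
 using t unfolding summable_on_iff_abs_summable_on_complex
 by (simp add: eb prod_nonneg abs_of_nonneg cong: prod.cong)
 define F where "F X = (\<Sum>\<^sub>\<infinity>qw\<in>mis Basis. c qw * (PROD b:Basis. ell b X ^ qw b))" for X
 define T where "T = (\<Inter>b\<in>(Basis::(complex^'n) set). {X. norm (ell b X) < t})"
 have oT: "open T" unfolding T_def
 by (intro open_INT finite_Basis ballI open_Collect_less continuous_on_norm continuous_on_const hol_continuous) (auto simp: cdiff_ell)
 have T0: "0:T" using t by (simp add: T_def ell_def)
 have gF: "ger F" unfolding ger_def eventually_nhds
 proof (intro exI[of _ T] conjI oT T0 ballI)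
 fix X assume X: "X:T"
 show "cdiff F X" unfolding F_def
 proof (rule hol_infsum[OF oT _ _ sm X])
 fix qw X show "cdiff (%X. c qw * (PROD b:Basis. ell b X ^ qw b)) X"
 by (intro cdiff_mult cdiff_const cdiff_prod cdiff_power cdiff_ell)
 next
 fix qw X assume "X:T"
 hence "(PROD b:Basis. norm (ell b X) ^ qw b) <= (PROD b:Basis. t ^ qw b)"
 by (intro prod_mono conjI power_mono) (auto simp: T_def less_imp_le)
 thus "norm (c qw * (PROD b:Basis. ell b X ^ qw b)) <= (PROD b:Basis. t ^ qw b) * norm (c qw)"
 by (simp add: norm_mult prod_norm[symmetric] norm_power mult.commute mult_left_mono)
 qed
 qed
 show ?thesis
 proof (rule cpxI[OF gF])
 have "NEAR x. x:ball 0 r" using r(1) by (intro evo) auto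
 thus "NEAR x. f (p+x) = F (rl x)"
 proof eventually_elim
 case (elim x)
 hence "p+x:ball p r" by (simp add: dist_norm)
 from infsumI[OF bspec[OF r(2) this]] show ?case
 by (simp add: F_def ell_rl scaleR_conv_of_real mult.commute)
 qed
 qed
qed

text \<open>An enumeration of the real basis by the index type of the doubled space, which matches
  the multi-indices over \<open>Basis\<close> with those over the doubled coordinates.\<close>

definition bs :: "'n+'n => complex^'n::finite" where
 "bs k = (case k of Inl i => axis i 1 | Inr i => axis i \<i>)"

lemma bij_bs: "bij_betw bs UNIV Basis"
proof (rule bij_betwI')
 fix x y :: "'a+'a" show "(bs x = bs y) = (x = y)"
 by (cases x; cases y) (auto simp: bs_def axis_eq_axis ceq)
 show "bs x:Basis" by (cases x) (auto simp: bs_def axis_in_Basis_iff Basis_complex_def)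
next
 fix b :: "complex^'a" assume "b:Basis"
 then obtain i u where "b = axis i u" "u:Basis" unfolding Basis_vec_def by auto
 hence "b = bs (Inl i) | b = bs (Inr i)" by (auto simp: bs_def Basis_complex_def)
 thus "EX x:UNIV. b = bs x" by blast
qed

lemma germ_power_seriesE:
 fixes f :: "complex^'m => complex"
 assumes "ger f"
 obtains qj c where "qj > 0" "ALL x:PD qj. (ALL i. i ~: Q --> x$i = 0) -->
 ((%qw. c qw * (PROD j:Q. x$j ^ qw j)) has_sum f x) (mis Q)"
proof -
 obtain qj where r: "qj > 0 & (EX c. ALL x:PD qj. (ALL i. i ~: Q --> x$i = 0) -->
 ((%qw. c qw * (PROD j:Q. x$j ^ qw j)) has_sum f x) (mis Q))"
 using germ_power_series[OF assms, of Q] by (rule exE)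
 obtain c where "ALL x:PD qj. (ALL i. i ~: Q --> x$i = 0) -->
 ((%qw. c qw * (PROD j:Q. x$j ^ qw j)) has_sum f x) (mis Q)"
 using conjunct2[OF r] by (rule exE)
 with conjunct1[OF r] show ?thesis by (rule that)
qed

text \<open>The map L sends the list \<open>u x\<close> of real coordinates to \<open>rl x\<close>,
  so the power series of the extension in the variables \<open>u x\<close> is the real power series.
  The radius is the minimum over the finitely many components of f.\<close>

lemma cpx_real_analytic:
 fixes f :: "complex^'n::finite => complex^'k::finite"
 assumes "!!p i. p:S ==> cpx (%x. f x$i) p" shows "real_analytic_on f S"
 unfolding real_analytic_on_def
proof
 fix p assume p: "p:S"
 define L :: "complex^('n+'n) => complex^('n+'n)" where
 "L U = cpl (\<chi> i. U$Inl i+\<i> * U$Inr i) (\<chi> i. U$Inl i - \<i> * U$Inr i)" for U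
 have gL: "vger L" unfolding vger_iff
 proof
 fix k show "ger (%x. L x$k)" by (cases k) (simp_all add: L_def ger_add ger_diff ger_mult)
 qed
 have L0: "L 0 = 0" by (simp add: L_def veq2)
 define u :: "complex^'n => complex^('n+'n)" where "u y = (\<chi> k. of_real (y ~~ bs k))" for y
 have Lu: "L (u y) = rl y" for y
 by (simp add: L_def u_def veq2 bs_def inner_axis ceq inner_complex_def)
 have ex: "EX rc. fst rc > 0 & (ALL x:PD (fst rc). ((%qw. snd rc qw * (PROD k:UNIV. u x$k ^ qw k)) has_sum f (p+x)$i) (mis UNIV))" for i
 proof -
 obtain F where F: "ger F" "NEAR x. f (p+x)$i = F (rl x)" using cpxE[OF assms[OF p]] .
 obtain qj c where rc: "qj > 0" "ALL x:PD qj. (ALL i. i ~: UNIV --> x$i = 0) -->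
 ((%qw. c qw * (PROD j:UNIV. x$j ^ qw j)) has_sum F (L x)) (mis UNIV)"
 using germ_power_seriesE[OF ger_compose[OF gL L0 F(1)], of UNIV] .
 have "linear u" by (rule linearI) (simp_all add: u_def veq inner_add_left scaleR_conv_of_real[of _ "complex_of_real _"])
 hence cu: "isCont u 0" using lcb lincont by blast
 have "NEAR U. U:(PD qj :: (complex^('n+'n)) set)"
 unfolding eventually_nhds_PD using rc(1) by blast
 hence "NEAR x. u x:PD qj" by (rule ev_nhds_compose[OF cu, rotated]) (simp add: u_def veq)
 hence "NEAR x. u x:PD qj & f (p+x)$i = F (rl x)" using F(2) by (rule eventually_conj)
 then obtain qj' where r': "qj' > 0" "ALL x:PD qj'. u x:PD qj & f (p+x)$i = F (rl x)"
 unfolding eventually_nhds_PD by blast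
 show ?thesis
 proof (intro exI[of _ "(qj', c)"] conjI ballI, unfold fst_conv snd_conv)
 show "qj' > 0" by (rule r'(1))
 next
 fix x :: "complex^'n" assume "x:PD qj'"
 hence ux: "u x:PD qj" and fx: "f (p+x)$i = F (rl x)" using r' by auto
 show "((%qw. c qw * (PROD k:UNIV. u x$k ^ qw k)) has_sum f (p+x)$i) (mis UNIV)"
 using bspec[OF rc(2) ux] fx by (simp add: Lu)
 qed
 qed
 from choice[OF allI[OF ex]] obtain R where R: "ALL i. fst (R i) > 0 & (ALL x:PD (fst (R i)). ((%qw. snd (R i) qw * (PROD k:UNIV. u x$k ^ qw k)) has_sum f (p+x)$i) (mis UNIV))" ..
 define qj where "qj i = fst (R i)" for i
 define c where "c i = snd (R i)" for i
 have rc: "qj i > 0" "x:PD (qj i) ==> ((%qw. c i qw * (PROD k:UNIV. u x$k ^ qw k)) has_sum f (p+x)$i) (mis UNIV)" for i x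
 using R unfolding qj_def c_def by simp_all
 define r where "r = Min (range qj)"
 have r: "r > 0" "r <= qj i" for i unfolding r_def using rc(1) by auto
 define C :: "(complex^'n => nat) => complex^'k" where "C qw = (\<chi> i. c i (qw \<circ> bs))" for qw
 have bij: "bij_betw (%qw. qw \<circ> bs) (mis Basis) (mis (UNIV::('n+'n) set))"
 proof (rule bij_betwI[where g="%qk b. if b:Basis then qk (inv_into UNIV bs b) else 0"])
 show "(%qw. qw \<circ> bs):mis Basis \<rightarrow> mis UNIV" by (auto simp: multi_indices_def)
 show "(%qk b. if b:Basis then qk (inv_into UNIV bs b) else 0):mis UNIV \<rightarrow> mis Basis"
 by (auto simp: multi_indices_def)
 show "(%b. if b:Basis then (qw \<circ> bs) (inv_into UNIV bs b) else 0) = qw" if "qw:mis Basis" for qw :: "complex^'n => nat"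
 using that bij_betw_inv_into_right[OF bij_bs[where 'a='n]] by (auto simp: multi_indices_def fun_eq_iff)
 show "(%b. if b:Basis then qk (inv_into UNIV bs b) else 0) \<circ> bs = qk" for qk :: "'n+'n => nat"
 using bij_betw_inv_into_left[OF bij_bs[where 'a='n]] bij_bs[where 'a='n] by (auto simp: fun_eq_iff bij_betw_def)
 qed
 show "\<exists>r>0. EX c. ALL x:ball p r. ((%qw. (PROD b:Basis. ((x - p) ~~ b) ^ qw b) *R c qw) has_sum f x) (mis Basis)"
 proof (intro exI[of _ r] conjI r(1) exI[of _ C] ballI)
 fix x assume "x:ball p r"
 hence "x - p:ball 0 r" by (simp add: dist_norm norm_minus_commute)
 hence "x - p:PD r" using ball_subset_PD by blast
 hence xp: "x - p:PD (qj i)" for i using r(2)[of i] unfolding PD_def by (auto intro: less_le_trans)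
 have comp: "((%qw. ((PROD b:Basis. ((x - p) ~~ b) ^ qw b) *R C qw)$i) has_sum f x$i) (mis Basis)" for i
 proof -
 have "((%qw. c i (qw \<circ> bs) * (PROD k:UNIV. u (x - p)$k ^ (qw \<circ> bs) k)) has_sum f x$i) (mis Basis)"
 using rc(2)[OF xp[of i]] has_sum_reindex_bij_betw[OF bij, of "%qw. c i qw * (PROD k:UNIV. u (x - p)$k ^ qw k)"] by simp
 moreover have "(PROD k:UNIV. u (x - p)$k ^ (qw \<circ> bs) k) = of_real (PROD b:Basis. ((x - p) ~~ b) ^ qw b)" for qw
 proof -
 have "(PROD b:Basis. ((x - p) ~~ b) ^ qw b) = (PROD k:UNIV. ((x - p) ~~ bs k) ^ qw (bs k))"
 by (rule prod.reindex_bij_betw[OF bij_bs, symmetric])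
 thus ?thesis by (simp add: u_def)
 qed
 ultimately show ?thesis by (simp add: C_def scaleR_conv_of_real[of _ "c i _"] mult.commute)
 qed
 show "((%qw. (PROD b:Basis. ((x - p) ~~ b) ^ qw b) *R C qw) has_sum f x) (mis Basis)"
 unfolding has_sum_def
 proof (rule vec_tendstoI)
 fix i show "((%Y. sum (%qw. (PROD b:Basis. ((x - p) ~~ b) ^ qw b) *R C qw) Y$i) \<longlongrightarrow> f x$i) (finite_subsets_at_top (mis Basis))"
 using comp[of i] unfolding has_sum_def by (simp add: sum_component)
 qed
 qed
qed

section \<open>First integrals of holomorphic vector fields\<close>

definition upd :: "complex^'m => 'm => complex => complex^'m" where
 "upd x b s = (\<chi> i. if i = b then s else x$i)"

lemma upd_nth[simp]: "upd x b s$i = (if i = b then s else x$i)" by (simp add: upd_def)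
lemma upd_same[simp]: "upd x b (x$b) = x" by (simp add: veq)

lemma vdiff_upd:
 assumes "vdiff f x" "cdiff g x" shows "vdiff (%x. upd (f x) b (g x)) x"
 unfolding upd_def by (rule vdiff_lambda, rule cdiff_if) (use assms in "auto simp: vdiff_def")

lemma upd_line: "upd x b s = upd x b 0+s *s ax b"
 by (auto simp: veq axis_def)

lemma upd_PD: "x:PD r ==> norm s < r ==> upd x b s:PD r" by (auto simp: PD_def)

lemma continuous_on_upd[continuous_intros]:
 "con S f ==> con S g ==> con S (%x. upd (f x) b (g x))"
 unfolding upd_def by (rule vec_lambda_continuous, rename_tac i, case_tac "i = b") (auto intro!: continuous_intros)

lemma PD_mono: "r <= s ==> PD r <= PD s" by (auto simp: PD_def intro: less_le_trans)

lemma germ_bounds: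
 assumes "ger K"
 obtains r B where "r > 0" "B > 0" "!!x. x:PD r ==> cdiff K x" "!!x. x:PD r ==> norm (K x) <= B"
proof -
 have "filterlim K (nhds (K 0)) (nhds 0)"
 using ger_isCont[OF assms(1)] unfolding isCont_def tendsto_at_iff_tendsto_nhds .
 hence "((%x. norm (K x)) \<longlongrightarrow> norm (K 0)) (nhds 0)" by (rule tendsto_norm)
 hence "NEAR x. norm (K x) < norm (K 0)+1" by (rule order_tendstoD) simp
 hence "NEAR x. cdiff K x & norm (K x) < norm (K 0)+1"
 using assms unfolding ger_def by (rule eventually_conj[rotated])
 then obtain r where "r > 0" "ALL x:PD r. cdiff K x & norm (K x) < norm (K 0)+1"
 unfolding eventually_nhds_PD by blast
 thus ?thesis using that[of r "norm (K 0)+1"] by (simp add: add_nonneg_pos less_imp_le)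
qed

text \<open>Picard iteration for \<open>u' = K\<close>, written on rays so that the iterates are integrals over a fixed interval.\<close>

lemma picard:
 fixes K :: "complex^'m => complex"
 assumes K: "ger K" and ab: "a ~= b"
 obtains u where "ger u" "NEAR x. dd u x (ax a) = K (upd x b (u x))" "NEAR x. x$a = 0 --> u x = x$b"
proof -
 obtain r0 B where r0: "r0 > 0" "B > 0" "!!x. x:PD r0 ==> cdiff K x" "!!x. x:PD r0 ==> norm (K x) <= B"
 using germ_bounds[OF K] by metis
 obtain r1 L where r1: "r1 > 0" "L > 0" "!!x. x:PD r1 ==> norm (dd K x (ax b)) <= L"
 using germ_bounds[OF ger_dd[OF K, of "ax b"]] by metis
 define r where "r = min r0 r1"
 have r: "r > 0" and Kd: "!!x. x:PD r ==> cdiff K x" and KB: "!!x. x:PD r ==> norm (K x) <= B"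
 and KL: "!!x. x:PD r ==> norm (dd K x (ax b)) <= L"
 using r0 r1 PD_mono[of r r0] PD_mono[of r r1] by (auto simp: r_def)
 define qx where "qx = min (r / (2 * (1+B))) (1 / (2 * L))"
 have d: "qx > 0" using r r0 r1 by (auto simp: qx_def)
 have "qx <= r / (2 * (1+B))" by (simp add: qx_def)
 hence "qx * (2 * (1+B)) <= r" using r0(2) by (simp add: pos_le_divide_eq)
 hence dB: "qx+qx * B < r" using r by (simp add: algebra_simps)
 have "qx <= 1 / (2 * L)" by (simp add: qx_def)
 hence dL: "qx * L <= 1/2" using r1(2) by (simp add: field_simps)
 have dr: "qx < r" using dB mult_pos_pos[OF d r0(2)] by linarith
 have Lip: "norm (K (upd x b s) - K (upd x b s')) <= L * norm (s - s')" if "x:PD r" "norm s < r" "norm s' < r" for x s s'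
 proof -
 have "norm (K (upd x b 0+s *s ax b) - K (upd x b 0+s' *s ax b)) <= L * norm (s - s')"
 proof (rule field_differentiable_bound[where S="ball 0 r" and f="%z. K (upd x b 0+z *s ax b)"])
 fix z :: complex assume z: "z:ball 0 r"
 have p: "upd x b 0+z *s ax b:PD r" unfolding upd_line[symmetric] by (rule upd_PD) (use that z in auto)
 show "((%z. K (upd x b 0+z *s ax b)) has_field_derivative dd K (upd x b 0+z *s ax b) (ax b)) (at z within ball 0 r)"
 by (rule has_field_derivative_at_within[OF cdiff_line[OF Kd[OF p]]])
 show "norm (dd K (upd x b 0+z *s ax b) (ax b)) <= L" by (rule KL[OF p])
 qed (use that in auto)
 thus ?thesis unfolding upd_line[symmetric] .
 qed
 define wv where "wv t x = upd x a (of_real t * x$a)" for t :: real and x :: "complex^'m"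
 have tPD: "wv t x:PD qx" if "x:PD qx" "t:{0..1}" for t x
 proof -
 have "norm (of_real t * x$a) <= norm (x$a)" using that(2) mult_right_mono[of t 1 "norm (x$a)"] by (simp add: norm_mult)
 also have "\<dots> < qx" using that(1) by (simp add: PD_def)
 finally show ?thesis unfolding wv_def by (rule upd_PD[OF that(1)])
 qed
 have PDr: "x:PD r" if "x:PD qx" for x :: "complex^'m" using that PD_mono[of qx r] dr by auto
 define T where "T v x = x$b+integral {0..1} (%t. x$a * K (upd (wv t x) b (v (wv t x))))" for v x
 define good :: "(complex^'m => complex) => bool" where "good v <-> (ALL x:PD qx. cdiff v x & norm (v x) <= qx+qx * B)" for v
 have cint: "con (PD qx \<times> {0..1}) (%(x, t). x$a * K (upd (wv t x) b (v (wv t x))))"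
 and hint: "!!x t. x:PD qx ==> t:{0..1} ==> cdiff (%x. x$a * K (upd (wv t x) b (v (wv t x)))) x"
 and vPD: "!!x. x:PD qx ==> upd x b (v x):PD r" if v: "good v" for v :: "complex^'m => complex"
 proof -
 show vPD: "upd x b (v x):PD r" if "x:PD qx" for x
 by (rule upd_PD[OF PDr[OF that]]) (use v that dB in "auto simp: good_def")
 have tc: "con (PD qx \<times> {0..1}) (%p. wv (snd p) (fst p))"
 unfolding wv_def by (intro continuous_intros)
 have vc: "con (PD qx \<times> {0..1}) (%p. v (wv (snd p) (fst p)))"
 by (rule continuous_on_compose2[OF hol_continuous[of "PD qx" v] tc]) (use v tPD in "auto simp: good_def")
 have "con (PD qx \<times> {0..1}) (%p. K (upd (wv (snd p) (fst p)) b (v (wv (snd p) (fst p)))))"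
 by (rule continuous_on_compose2[OF hol_continuous[of "PD r" K] continuous_on_upd[OF tc vc]])
 (use Kd vPD tPD in auto)
 thus "con (PD qx \<times> {0..1}) (%(x, t). x$a * K (upd (wv t x) b (v (wv t x))))"
 unfolding case_prod_unfold by (intro continuous_intros)
 fix x :: "complex^'m" and t :: real assume x: "x:PD qx" "t:{0..1}"
 have vt: "vdiff (wv t) x" unfolding wv_def
 by (rule vdiff_upd[OF vdiff_id]) (rule cdiff_mult[OF cdiff_const cdiff_nth])
 have "cdiff (%x. v (wv t x)) x" by (rule cdiff_compose(1)[OF vt]) (use v tPD[OF x] in "simp add: good_def")
 hence "vdiff (%x. upd (wv t x) b (v (wv t x))) x" by (rule vdiff_upd[OF vt])
 hence "cdiff (%x. K (upd (wv t x) b (v (wv t x)))) x"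
 by (rule cdiff_compose(1)) (rule Kd[OF vPD[OF tPD[OF x]]])
 thus "cdiff (%x. x$a * K (upd (wv t x) b (v (wv t x)))) x" by (rule cdiff_mult[OF cdiff_nth])
 qed
 have cint1: "con {0..1} (%t. x$a * K (upd (wv t x) b (v (wv t x))))" if "good v" "x:PD qx" for v and x :: "complex^'m"
 proof -
 have "con {0..1} (%t. (%(x, t). x$a * K (upd (wv t x) b (v (wv t x)))) (x, t))"
 by (rule continuous_on_compose2[OF cint[OF that(1)]]) (use that in "auto intro!: continuous_intros")
 thus ?thesis by simp
 qed
 have inti: "(%t. x$a * K (upd (wv t x) b (v (wv t x)))) integrable_on {0..1}" if "good v" "x:PD qx" for v and x :: "complex^'m"
 by (rule integrable_continuous_real[OF cint1[OF that]])
 have goodT: "good (T v)" if v: "good v" for v :: "complex^'m => complex"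
 unfolding good_def
 proof (intro ballI conjI)
 fix x :: "complex^'m" assume x: "x:PD qx"
 show "cdiff (T v) x" unfolding T_def
 by (rule cdiff_add[OF cdiff_nth hol_integral[OF open_PD cint[OF v] hint[OF v] x]])
 have xa: "norm (x$a) < qx" "norm (x$b) < qx" using x by (auto simp: PD_def)
 have "norm (integral {0..1} (%t. x$a * K (upd (wv t x) b (v (wv t x))))) <= (qx * B) * (1 - 0)"
 proof (rule integral_bound[OF _ _])
 show "con {0..1} (%t. x$a * K (upd (wv t x) b (v (wv t x))))"
 by (rule cint1[OF v x])
 fix t :: real assume t: "t:{0..1}"
 show "norm (x$a * K (upd (wv t x) b (v (wv t x)))) <= qx * B"
 unfolding norm_mult by (rule mult_mono) (use xa d KB[OF vPD[OF v tPD[OF x t]]] in auto)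
 qed simp
 thus "norm (T v x) <= qx+qx * B" unfolding T_def using norm_triangle_le[of "x$b"] xa by fastforce
 qed
 have contr: "norm (T v x - T w x) <= (1/2) * e" if v: "good v" "good w" "!!x. x:PD qx ==> norm (v x - w x) <= e" "x:PD qx" for v w and x :: "complex^'m" and e
 proof -
 have e0: "e >= 0" using that(3)[OF that(4)] norm_ge_zero order_trans by blast
 have xa: "norm (x$a) < qx" using that(4) by (auto simp: PD_def)
 let ?F = "%v t. x$a * K (upd (wv t x) b (v (wv t x)))"
 have "T v x - T w x = integral {0..1} (%t. ?F v t - ?F w t)"
 unfolding T_def by (simp add: integral_diff inti[OF v(1) v(4)] inti[OF v(2) v(4)])
 also have "norm \<dots> \<le> ((1/2) * e) * (1 - 0)"
 proof (rule integral_bound)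
 show "con {0..1} (%t. ?F v t - ?F w t)"
 by (rule continuous_on_diff[OF cint1[OF v(1,4)] cint1[OF v(2,4)]])
 fix t :: real assume t: "t:{0..1}"
 let ?y = "wv t x"
 have y: "?y:PD qx" by (rule tPD[OF v(4) t])
 have nv: "norm (v ?y) < r" "norm (w ?y) < r" using v(1,2) y dB unfolding good_def by force+
 have "norm (K (upd ?y b (v ?y)) - K (upd ?y b (w ?y))) <= L * e"
 using Lip[OF PDr[OF y] nv] mult_left_mono[OF that(3)[OF y], of L] r1(2) by linarith
 hence "norm (x$a * (K (upd ?y b (v ?y)) - K (upd ?y b (w ?y)))) <= qx * (L * e)"
 unfolding norm_mult by (intro mult_mono) (use xa d in auto)
 also have "\<dots> \<le> 1/2 * e" using mult_right_mono[OF dL e0] by (simp add: mult.assoc)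
 finally show "norm (?F v t - ?F w t) <= (1/2) * e" by (simp add: right_diff_distrib)
 qed simp
 finally show ?thesis by simp
 qed
 define u0 :: "complex^'m => complex" where "u0 x = x$b" for x
 define U where "U n = (T ^^ n) u0" for n
 have U0: "good u0" unfolding good_def u0_def using d r0(2) by (auto simp: PD_def less_imp_le intro!: add_increasing2)
 have gU: "good (U n)" for n by (induction n) (simp_all add: U_def U0 goodT)
 \<comment> \<open>Twice the common bound of the iterates, hence a bound for the first
   difference.\<close>
 define C where "C = 2 * (qx+qx * B)"
 have dU: "norm (U (Suc n) x - U n x) <= C * (1/2)^n" if "x:PD qx" for n and x :: "complex^'m"
 using that
 proof (induction n arbitrary: x)
 case 0
 have "norm (U 1 x - U 0 x) <= norm (U 1 x)+norm (U 0 x)" by (rule norm_triangle_ineq4)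
 also have "\<dots> \<le> C" using gU[of 0] gU[of 1] 0 unfolding good_def C_def by force
 finally show ?case by simp
 next
 case (Suc n)
 have "norm (T (U (Suc n)) x - T (U n) x) <= (1/2) * (C * (1/2)^n)" by (rule contr[OF gU gU Suc.IH Suc.prems])
 thus ?case by (simp add: U_def)
 qed
 define u where "u x = u0 x+(\<Sum>i. U (Suc i) x - U i x)" for x
 have ul0: "uniform_limit (PD qx) (%n x. \<Sum>i<n. U (Suc i) x - U i x) (%x. \<Sum>i. U (Suc i) x - U i x) sequentially"
 by (rule Weierstrass_m_test[OF dU]) (auto intro!: summable_mult summable_geometric)
 have tele: "(\<Sum>i<n. U (Suc i) x - U i x) = U n x - u0 x" for n x
 by (induction n) (simp_all add: U_def)
 have ul: "uniform_limit (PD qx) U u sequentially"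
 using ul0 unfolding tele u_def uniform_limit_iff by (simp add: dist_norm algebra_simps)
 have gu: "good u" unfolding good_def
 proof (intro ballI conjI)
 fix x :: "complex^'m" assume x: "x:PD qx"
 show "cdiff u x"
 by (rule hol_uniform_limit[OF open_PD _ ul _ x]) (use gU in "auto simp: good_def")
 have "(%n. U n x) \<longlonglongrightarrow> u x" by (rule tendsto_uniform_limitI[OF ul x])
 from tendsto_norm[OF this] show "norm (u x) <= qx+qx * B"
 by (rule LIMSEQ_le_const2) (use gU x in "auto simp: good_def")
 qed
 have fx: "T u x = u x" if x: "x:PD qx" for x :: "complex^'m"
 proof -
 have "(%n. T (U n) x) \<longlonglongrightarrow> T u x"
 unfolding tendsto_iff
 proof (intro allI impI)
 fix e :: real assume e: "e > 0"
 have "\<forall>\<^sub>F n in sequentially. ALL x:PD qx. dist (U n x) (u x) < e" using ul e unfolding uniform_limit_iff by simp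
 thus "\<forall>\<^sub>F n in sequentially. dist (T (U n) x) (T u x) < e"
 proof eventually_elim
 case (elim n)
 have "norm (T (U n) x - T u x) <= 1/2 * e"
 by (rule contr[OF gU gu _ x]) (use elim in "auto simp: dist_norm less_imp_le")
 thus ?case using e by (simp add: dist_norm)
 qed
 qed
 moreover have "(%n. T (U n) x) \<longlonglongrightarrow> u x"
 using LIMSEQ_Suc[OF tendsto_uniform_limitI[OF ul x]] by (simp add: U_def)
 ultimately show ?thesis by (rule LIMSEQ_unique)
 qed
 have zero: "u x = x$b" if "x:PD qx" "x$a = 0" for x :: "complex^'m"
 using fx[OF that(1)] that(2) by (simp add: T_def)
 have der: "dd u x (ax a) = K (upd x b (u x))" if x: "x:PD qx" for x :: "complex^'m"
 proof -
 let ?l = "%z. upd x a z"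
 have lPD: "?l z:PD qx" if "norm z < qx" for z by (rule upd_PD[OF x that])
 define h where "h z = K (upd (?l z) b (u (?l z)))" for z
 have cu: "cdiff (%y. K (upd y b (u y))) y" if "y:PD qx" for y
 proof (rule cdiff_compose(1)[where F="%y. upd y b (u y)" and g=K])
 show "vdiff (%y. upd y b (u y)) y" by (rule vdiff_upd[OF vdiff_id]) (use gu that in "simp add: good_def")
 show "cdiff K (upd y b (u y))" by (rule Kd[OF vPD[OF gu that]])
 qed
 have "(%z. K (upd (upd x a 0+z *s ax a) b (u (upd x a 0+z *s ax a)))) holomorphic_on ball 0 qx"
 by (rule line_holomorphic[where f="%y. K (upd y b (u y))"]) (rule cu, unfold upd_line[symmetric], use lPD in simp)
 hence hh: "h holomorphic_on ball 0 qx" unfolding h_def upd_line[symmetric] .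
 obtain H where H: "ALL z:ball 0 qx. (H has_field_derivative h z) (at z within ball 0 qx)"
 proof (rule holomorphic_convex_primitive'[OF convex_ball open_ball hh])
 fix g assume "!!x. x:ball 0 qx ==> (g has_field_derivative h x) (at x within ball 0 qx)"
 thus ?thesis by (intro that[of g] ballI)
 qed
 have H': "(H has_field_derivative h z) (at z)" if "z:ball 0 qx" for z
 using bspec[OF H that] unfolding at_within_open[OF that open_ball] .
 have "u (?l z) = x$b+(H z - H 0)" if z: "norm z < qx" for z
 proof -
 have "((%t. z * h (of_real t * z)) has_integral (H (of_real 1 * z) - H (of_real 0 * z))) {0..1}"
 proof (rule fundamental_theorem_of_calculus)
 fix t :: real assume t: "t:{0..1}"
 have "norm (of_real t * z) < qx" using t z mult_right_mono[of t 1 "norm z"] by (simp add: norm_mult)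
 hence 1: "(H has_field_derivative h (of_real t * z)) (at (of_real t * z))" using H' by simp
 have "((%t. of_real t * z) has_vector_derivative z) (at t within {0..1})"
 by (auto intro!: derivative_eq_intros simp: has_vector_derivative_def scaleR_conv_of_real)
 from field_vector_diff_chain_within[OF this has_field_derivative_at_within[OF 1]]
 show "((%t. H (of_real t * z)) has_vector_derivative z * h (of_real t * z)) (at t within {0..1})"
 by (simp add: o_def mult.commute)
 qed simp
 hence "integral {0..1} (%t. z * h (of_real t * z)) = H (of_real 1 * z) - H (of_real 0 * z)" by (rule integral_unique)
 moreover have "u (?l z) = T u (?l z)" using fx[OF lPD[OF z]] by simp
 moreover have "upd (upd x a z) a w = upd x a w" for w by (simp add: veq)
 hence "T u (?l z) = x$b+integral {0..1} (%t. z * h (of_real t * z))"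
 using ab by (simp add: T_def h_def wv_def)
 ultimately show ?thesis by simp
 qed
 note ueq = this
 have xa: "norm (x$a) < qx" using x by (simp add: PD_def)
 have "((%z. x$b+(H z - H 0)) has_field_derivative h (x$a)) (at (x$a))"
 using H'[of "x$a"] xa by (auto intro!: derivative_eq_intros)
 hence 1: "((%z. u (?l z)) has_field_derivative h (x$a)) (at (x$a))"
 by (rule has_field_derivative_transform_within_open[of _ _ _ "ball 0 qx"]) (use xa ueq in auto)
 have "cdiff u (upd x a 0+(x$a) *s ax a)" unfolding upd_line[symmetric] using gu x by (simp add: good_def)
 from cdiff_line[OF this] have "((%z. u (?l z)) has_field_derivative dd u x (ax a)) (at (x$a))"
 unfolding upd_line[symmetric] by simp
 from DERIV_unique[OF this 1] show ?thesis by (simp add: h_def)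
 qed
 show ?thesis
 proof
 show "ger u" unfolding ger_def eventually_nhds_PD using gu d by (auto simp: good_def)
 show "NEAR x. dd u x (ax a) = K (upd x b (u x))" unfolding eventually_nhds_PD using der d by blast
 show "NEAR x. x$a = 0 --> u x = x$b" unfolding eventually_nhds_PD using zero d by blast
 qed
qed

text \<open>The flow map \<open>wj\<close> sends the initial value x_b to the value
  \<open>u x\<close> of the solution at time x_a. The b-coordinate of its inverse recovers the
  initial value, which is constant along the field d/da + K d/db.\<close>

lemma first_integral:
 fixes K :: "complex^'m => complex"
 assumes K: "ger K" and ab: "a ~= b"
 obtains g where "ger g" "g 0 = 0" "NEAR x. dd g x (ax a)+K x * dd g x (ax b) = 0" "dd g 0 (ax b) ~= 0"
proof -
 obtain u where u: "ger u" "NEAR x. dd u x (ax a) = K (upd x b (u x))" "NEAR x. x$a = 0 --> u x = x$b"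
 using picard[OF K ab] .
 have u0: "u 0 = 0" using ev_x[OF u(3)] by simp
 have ub: "dd u 0 (ax b) = 1"
 proof -
 have 1: "((%z. u (0+z *s ax b)) has_field_derivative dd u (0+0 *s ax b) (ax b)) (at 0)"
 by (rule cdiff_line) (use gerD0[OF u(1)] in simp)
 have "isCont (%z. z *s ax b) (0::complex)" using bounded_linear_vsmult lincont by blast
 from ev_nhds_compose[OF this _ u(3)] have "NEAR z. (z *s ax b)$a = 0 --> u (z *s ax b) = (z *s ax b)$b" by simp
 hence "NEAR z. u (0+z *s ax b) = z" by eventually_elim (use ab in "simp add: axis_def")
 hence "deriv (%z. u (0+z *s ax b)) 0 = deriv (%z. z) 0" by (rule deriv_cong_ev) simp
 thus ?thesis using DERIV_imp_deriv[OF 1] by simp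
 qed
 define wj where "wj = (%x. upd x b (u x))"
 have vPh: "vger wj" unfolding vger_def using u(1)[unfolded ger_def] by eventually_elim (simp add: wj_def vdiff_upd)
 have Ph0: "wj 0 = 0" by (simp add: wj_def u0 veq)
 have ddPh: "NEAR x. ALL v. dd wj x v = upd v b (dd u x v)"
 using u(1)[unfolded ger_def] vPh[unfolded vger_def]
 proof eventually_elim
 case (elim x)
 show ?case
 proof
 fix v show "dd wj x v = upd v b (dd u x v)"
 proof (subst veq, rule allI)
 fix i show "dd wj x v$i = upd v b (dd u x v)$i"
 unfolding vdiffD(2)[OF elim(2)] by (cases "i = b") (simp_all add: wj_def dd_eqI[OF nth_has_derivative])
 qed
 qed
 qed
 have injP: "inj (dd wj 0)"
 proof -
 have lin: "linear (dd wj 0)" using has_derivative_linear[OF vdiffD(1)[OF vgerD0[OF vPh]]] .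
 show ?thesis unfolding linear_injective_0[OF lin]
 proof (intro allI impI)
 fix v assume "dd wj 0 v = 0"
 hence e: "upd v b (dd u 0 v) = 0" using ev_x[OF ddPh] by simp
 have vi: "v$i = 0" if "i ~= b" for i using arg_cong[OF e, of "%x. x$i"] that by simp
 have "dd u 0 v = 0" using arg_cong[OF e, of "%x. x$b"] by simp
 moreover have "v = (v$b) *s ax b" using vi by (auto simp: veq axis_def)
 ultimately have "v$b * dd u 0 (ax b) = 0" using cdiff_scale[OF gerD0[OF u(1)], of "v$b" "ax b"] by simp
 hence "v$b = 0" using ub by simp
 thus "v = 0" using vi by (metis veq zero_index)
 qed
 qed
 obtain G where G: "vger G" "G 0 = 0" "NEAR x. G (wj x) = x" "NEAR y. wj (G y) = y"
 using germ_inverse[OF vPh Ph0 injP] .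
 define g where "g y = G y$b" for y
 have gg: "ger g" unfolding g_def using vger_nth[OF G(1)] .
 have "NEAR x. g (wj x) = x$b" using G(3) by eventually_elim (simp add: g_def)
 hence "NEAR x. ALL v. dd (%x. g (wj x)) x v = dd (%x. x$b) x v" by (rule dd_cong_germ[where f="%x. g (wj x)" and g="%x. x$b"])
 hence ev: "NEAR x. ALL v. dd g (wj x) (upd v b (dd u x v)) = v$b"
 using dd_compose_germ[OF vPh Ph0 gg] ddPh
 proof eventually_elim
 case (elim x)
 show ?case
 proof
 fix v
 have "dd g (wj x) (upd v b (dd u x v)) = dd g (wj x) (dd wj x v)" unfolding elim(3)[rule_format] ..
 also have "\<dots> = dd (%x. g (wj x)) x v" by (rule elim(2)[rule_format, symmetric])
 also have "\<dots> = dd (%x. x$b) x v" by (rule elim(1)[rule_format])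
 also have "\<dots> = v$b" by (rule dd_eqI[OF nth_has_derivative])
 finally show "dd g (wj x) (upd v b (dd u x v)) = v$b" .
 qed
 qed
 have ua: "upd (ax a) b s = ax a+s *s ax b" for s using ab by (auto simp: veq axis_def)
 have "NEAR x. dd g (wj x) (ax a)+K (wj x) * dd g (wj x) (ax b) = 0"
 using ev u(2) ev_compose[OF vPh Ph0 gg[unfolded ger_def]]
 proof eventually_elim
 case (elim x)
 have "dd g (wj x) (ax a+K (wj x) *s ax b) = 0"
 using elim(1)[rule_format, of "ax a"] ab unfolding elim(2) ua by (simp add: wj_def axis_def)
 thus ?case by (simp add: dd_add_vec[OF elim(3)] cdiff_scale[OF elim(3)])
 qed
 from ev_compose[OF G(1,2) this] G(4)
 have 3: "NEAR x. dd g x (ax a)+K x * dd g x (ax b) = 0" by eventually_elim simp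
 have "dd g (wj 0) (upd (ax b) b (dd u 0 (ax b))) = ax b$b" using ev_x[OF ev] by blast
 moreover have "upd (ax b) b (dd u 0 (ax b)) = ax b" unfolding ub by (auto simp: veq axis_def)
 ultimately have "dd g 0 (ax b) = 1" by (simp add: Ph0)
 hence 4: "dd g 0 (ax b) ~= 0" by simp
 show ?thesis by (rule that[OF gg _ 3 4]) (simp add: g_def G(2))
qed

section \<open>Homogeneous parts, flat functions, Taylor approximation\<close>

definition hk :: "nat => (complex^'m => complex) => complex^'m => complex" where
 "hk k H X = (deriv ^^ k) (%t. H (t *s X)) 0 / fact k"

lemma smult_PD: "X:PD r ==> norm t * r <= s ==> t ~= 0 ==> t *s X:PD s"
 unfolding PD_def by (auto simp: norm_mult intro: less_le_trans[OF mult_strict_left_mono])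

lemma smult_PD0: assumes "X:PD r" "norm t * r <= s" "s > 0" shows "t *s X:PD s"
 using smult_PD[OF assms(1,2)] assms(3) by (cases "t = 0") (auto simp: PD_def)

lemma line_hol0:
 assumes "!!X. X:PD r ==> cdiff H X" "X:PD s" "R * s <= r" "r > 0" "s > 0"
 shows "(%t. H (t *s X)) holomorphic_on ball 0 R"
proof -
 have "t *s X:PD r" if "t:ball 0 R" for t
 proof (rule smult_PD0[OF assms(2) _ assms(4)])
 have "norm t * s <= R * s" using that assms(5) by (intro mult_right_mono) auto
 thus "norm t * s <= r" using assms(3) by linarith
 qed
 hence "(%t. H (0+t *s X)) holomorphic_on ball 0 R"
 by (intro line_holomorphic) (simp add: assms(1))
 thus ?thesis by simp
qed

lemma in_PD_norm: "X:PD (norm X+1)" for X :: "complex^'m"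
proof -
 have "norm (X$j) < norm X+1" for j using Finite_Cartesian_Product.norm_nth_le[of X j] by linarith
 thus ?thesis by (simp add: PD_def)
qed

lemma germ_line_hol:
 assumes "ger H" shows "\<exists>R>0. (%t. H (t *s X)) holomorphic_on ball 0 R"
proof -
 obtain r where r: "r > 0" "ALL x:PD r. cdiff H x" using assms unfolding ger_def eventually_nhds_PD by blast
 define s where "s = norm X+1"
 have s: "s > 0" by (simp add: s_def add_nonneg_pos)
 have "X:PD s" unfolding s_def by (rule in_PD_norm)
 from line_hol0[OF _ this, of r H "r/s"] r s show ?thesis by (intro exI[of _ "r/s"]) simp
qed

text \<open>\<open>hk k H\<close> is the homogeneous part of degree k of the expansion of H at 0.
  The scaling law carries information near 0 to all points and converts bounds on one polydisc into
  bounds on a smaller one.\<close>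

lemma hk_scale: assumes "ger H" shows "hk k H (c *s X) = c ^ k * hk k H X"
proof -
 obtain R where R: "R > 0" "(%t. H (t *s X)) holomorphic_on ball 0 R" using germ_line_hol[OF assms] by blast
 show ?thesis
 proof (cases "c = 0")
 case True
 have z: "(deriv ^^ k) (%t. H 0) 0 = (if k = 0 then H 0 else 0)" by simp
 show ?thesis unfolding hk_def True by (cases k) (auto simp: power_0_left)
 next
 case False
 have "(deriv ^^ k) (%w. (%t. H (t *s X)) (c * w)) 0 = c ^ k * (deriv ^^ k) (%t. H (t *s X)) (c * 0)"
 proof (rule higher_deriv_compose_linear[OF R(2), of "ball 0 (R / norm c)"])
 show "c * w:ball 0 R" if "w:ball 0 (R / norm c)" for w
 using that False by (simp add: norm_mult field_simps)
 qed (use R False in auto)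
 moreover have "(%w. H ((c * w) *s X)) = (%t. H (t *s (c *s X)))"
 by (simp add: mult.commute)
 ultimately show ?thesis unfolding hk_def by simp
 qed
qed

lemma hk_circle:
 assumes H: "!!X. X:PD r ==> cdiff H X" and r: "r > 0" and X: "X:PD (r/2)"
 shows "((%t. H (circ 1 t *s X) / circ 1 t ^ k) has_integral hk k H X) {0..1}"
proof -
 let ?g = "%t. H (t *s X)"
 have hol: "?g holomorphic_on ball 0 2" by (rule line_hol0[OF H X]) (use r in auto)
 have cb: "cball 0 1 <= ball (0::complex) 2" by auto
 have "((%u. ?g u / (u - 0) ^ Suc k) has_contour_integral 2 * pi * \<i> / fact k * (deriv ^^ k) ?g 0) (circlepath 0 1)"
 proof (rule Cauchy_has_contour_integral_higher_derivative_circlepath)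
 have "?g holomorphic_on cball 0 1" using holomorphic_on_subset[OF hol cb] .
 thus "con (cball 0 1) ?g" "?g holomorphic_on ball 0 1"
 using holomorphic_on_imp_continuous_on holomorphic_on_subset[OF _ ball_subset_cball] by blast+
 show "(0::complex):ball 0 1" by simp
 qed
 hence "((%t. ?g (circlepath 0 1 t) / (circlepath 0 1 t - 0) ^ Suc k * vector_derivative (circlepath 0 1) (at t))
 has_integral (2 * pi * \<i> / fact k * (deriv ^^ k) ?g 0)) {0..1}"
 unfolding has_contour_integral .
 moreover have "circlepath 0 1 = circ 1" unfolding circlepath circ_def by simp
 moreover have "vector_derivative (circlepath 0 1) (at t) = 2 * pi * \<i> * circ 1 t" for t
 unfolding vector_derivative_circlepath circ_def by simp
 ultimately have 1: "((%t. ?g (circ 1 t) / (circ 1 t) ^ Suc k * (2 * pi * \<i> * circ 1 t)) has_integral (2 * pi * \<i> / fact k * (deriv ^^ k) ?g 0)) {0..1}"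
 by simp
 have 2: "1/(2*pi*\<i>) * (?g (circ 1 t) / (circ 1 t) ^ Suc k * (2 * pi * \<i> * circ 1 t)) = H (circ 1 t *s X) / circ 1 t ^ k" for t
 using circ_nz[of 1 t] by simp
 have 3: "1/(2*pi*\<i>) * (2 * pi * \<i> / fact k * (deriv ^^ k) ?g 0) = hk k H X" by (simp add: hk_def)
 show ?thesis using has_integral_mult_right[OF 1, of "1/(2*pi*\<i>)"] by (simp only: 2 3)
qed

text \<open>Near 0 the homogeneous part is a circle integral of H, hence holomorphic. Homogeneity
  transports this to every X, although H itself is only a germ.\<close>

lemma hk_cdiff:
 fixes H :: "complex^'m => complex"
 assumes "ger H" shows "cdiff (hk k H) X"
proof -
 obtain r where r: "r > 0" "!!x. x:PD r ==> cdiff H x" using assms unfolding ger_def eventually_nhds_PD by blast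
 have cPD: "circ 1 t *s X:PD r" if "X:PD (r/2)" for t and X :: "complex^'m"
 by (rule smult_PD0[OF that]) (use r in auto)
 have 1: "cdiff (hk k H) X" if X: "X:PD (r/2)" for X
 proof (rule cdiff_transform[OF _ open_PD X])
 show "cdiff (%X. integral {0..1} (%t. H (circ 1 t *s X) / circ 1 t ^ k)) X"
 proof (rule hol_integral[OF open_PD _ _ X])
 have "con (PD (r/2) \<times> {0..1}) (%p. H (circ 1 (snd p) *s fst p))"
 by (rule continuous_on_compose2[OF hol_continuous[of "PD r" H]])
 (use r(2) cPD in "auto intro!: continuous_intros")
 thus "con (PD (r/2) \<times> {0..1}) (%(X, t). H (circ 1 t *s X) / circ 1 t ^ k)"
 unfolding case_prod_unfold by (intro continuous_on_divide continuous_intros) auto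
 fix X :: "complex^'m" and t :: real assume X: "X:PD (r/2)"
 have "vdiff (%X. circ 1 t *s X) X" by (rule vdiff_smult[OF cdiff_const vdiff_id])
 hence "cdiff (%X. H (circ 1 t *s X)) X"
 by (rule cdiff_compose(1)[where g=H]) (rule r(2)[OF cPD[OF X]])
 thus "cdiff (%X. H (circ 1 t *s X) / circ 1 t ^ k) X"
 by (rule cdiff_divide[OF _ cdiff_const]) simp
 qed
 show "integral {0..1} (%t. H (circ 1 t *s Y) / circ 1 t ^ k) = hk k H Y" if "Y:PD (r/2)" for Y
 using hk_circle[OF r(2) r(1) that, of k] by (rule integral_unique)
 qed
 define s where "s = norm X+1"
 have s: "s > 0" by (simp add: s_def add_nonneg_pos)
 have Xs: "X:PD s" unfolding s_def by (rule in_PD_norm)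
 define c where "c = complex_of_real (r / (2 * s))"
 have c: "c ~= 0" "norm c * s = r/2" using r s by (auto simp: c_def norm_divide norm_mult)
 have "cdiff (%X. hk k H (c *s X) / c ^ k) X"
 proof (rule cdiff_divide[OF _ cdiff_const])
 have "vdiff (%X. c *s X) X" by (rule vdiff_smult[OF cdiff_const vdiff_id])
 thus "cdiff (%X. hk k H (c *s X)) X"
 by (rule cdiff_compose(1)[where g="hk k H"]) (rule 1, rule smult_PD0[OF Xs], use c r in auto)
 qed (use c in simp)
 thus ?thesis by (rule cdiff_transform[OF _ open_UNIV UNIV_I]) (simp add: hk_scale[OF assms] c)
qed

lemma hk_sums:
 assumes "!!X. X:PD r ==> cdiff H X" "r > 0" "X:PD (r/2)"
 shows "(%k. hk k H X) sums H X"
proof -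
 have "(%t. H (t *s X)) holomorphic_on ball 0 2" by (rule line_hol0[OF assms(1,3)]) (use assms in auto)
 from holomorphic_power_series[OF this, of 1] show ?thesis by (simp add: hk_def)
qed

lemma hk_bound:
 assumes "!!X. X:PD r ==> cdiff H X" "!!X. X:PD r ==> norm (H X) <= B" "r > 0" "X:PD (r/2)"
 shows "norm (hk k H X) <= B"
proof -
 have hol: "(%t. H (t *s X)) holomorphic_on ball 0 2" by (rule line_hol0[OF assms(1,4)]) (use assms in auto)
 have cb: "cball 0 1 <= ball (0::complex) 2" by auto
 have "norm ((deriv ^^ k) (%t. H (t *s X)) 0) <= fact k * B / 1 ^ k"
 proof (rule Cauchy_inequality)
 show "(%t. H (t *s X)) holomorphic_on ball 0 1" by (rule holomorphic_on_subset[OF hol]) auto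
 show "con (cball 0 1) (%t. H (t *s X))"
 using holomorphic_on_imp_continuous_on[OF holomorphic_on_subset[OF hol cb]] .
 fix x :: complex assume "norm (0 - x) = 1"
 thus "norm (H (x *s X)) <= B" using assms(3) by (intro assms(2) smult_PD0[OF assms(4)]) auto
 qed simp
 thus ?thesis by (simp add: hk_def norm_divide field_simps)
qed

lemma hk_mult:
 assumes "ger F" "ger G" shows "hk k (%X. F X * G X) X = (\<Sum>i\<le>k. hk i F X * hk (k - i) G X)"
proof -
 obtain R where R: "R > 0" "(%t. F (t *s X)) holomorphic_on ball 0 R" using germ_line_hol[OF assms(1)] by blast
 obtain S where S: "S > 0" "(%t. G (t *s X)) holomorphic_on ball 0 S" using germ_line_hol[OF assms(2)] by blast
 have "(deriv ^^ k) (%w. F (w *s X) * G (w *s X)) 0 =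
 (\<Sum>i = 0..k. of_nat (k choose i) * (deriv ^^ i) (%t. F (t *s X)) 0 * (deriv ^^ (k - i)) (%t. G (t *s X)) 0)"
 by (rule higher_deriv_mult[of _ "ball 0 (min R S)"])
 (use R S in "auto intro: holomorphic_on_subset[OF R(2)] holomorphic_on_subset[OF S(2)]")
 also have "\<dots> / fact k = (\<Sum>i = 0..k. hk i F X * hk (k - i) G X)"
 unfolding sum_divide_distrib hk_def
 by (rule sum.cong) (auto simp: binomial_fact field_simps)
 finally show ?thesis by (simp add: hk_def atMost_atLeast0)
qed

lemma hk_diff:
 assumes "ger F" "ger G" shows "hk k (%X. F X - G X) X = hk k F X - hk k G X"
proof -
 obtain R where R: "R > 0" "(%t. F (t *s X)) holomorphic_on ball 0 R" using germ_line_hol[OF assms(1)] by blast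
 obtain S where S: "S > 0" "(%t. G (t *s X)) holomorphic_on ball 0 S" using germ_line_hol[OF assms(2)] by blast
 have "(deriv ^^ k) (%w. F (w *s X) - G (w *s X)) 0 = (deriv ^^ k) (%w. F (w *s X)) 0 - (deriv ^^ k) (%w. G (w *s X)) 0"
 by (rule higher_deriv_diff[of _ "ball 0 (min R S)"])
 (use R S in "auto intro: holomorphic_on_subset[OF R(2)] holomorphic_on_subset[OF S(2)]")
 thus ?thesis by (simp add: hk_def diff_divide_distrib)
qed

text \<open>When the coefficients below k vanish, g(t)/t^k tends to the k-th one, while the estimate
  along positive t forces the limit 0.\<close>

lemma flat_coeff_zero:
 fixes g :: "complex => complex"
 assumes g: "g holomorphic_on ball 0 R" and R: "R > 0"
 and b: "e > 0" "!!t::real. 0 < t ==> t < e ==> norm (g (of_real t)) <= C * t ^ Suc d"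
 and k: "k <= d"
 shows "(deriv ^^ k) g 0 = 0"
 using k
proof (induction k rule: less_induct)
 case (less k)
 define a where "a n = (deriv ^^ n) g 0 / fact n" for n
 have az: "a j = 0" if "j < k" for j using less.IH[OF that] less.prems that by (simp add: a_def)
 define q where "q t = g t / t ^ k" for t
 have "(%n. a (n+k) * t ^ n) sums q t" if "t ~= 0" "norm t < R" for t
 proof -
 have "(%n. a n * t ^ n) sums g t"
 using holomorphic_power_series[OF g, of t] that by (simp add: a_def)
 hence "(%n. a (n+k) * t ^ (n+k)) sums (g t - (\<Sum>i<k. a i * t ^ i))" by (rule sums_split_initial_segment)
 hence "(%n. a (n+k) * t ^ (n+k)) sums g t" by (simp add: az)
 from sums_divide[OF this, of "t ^ k"] show ?thesis using that by (simp add: q_def power_add)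
 qed
 hence "(q \<longlongrightarrow> a (0+k)) (at 0)"
 by (rule powser_limit_0_strong[OF R]) auto
 hence lim: "((%t. q (of_real t)) \<longlongrightarrow> a k) (at_right (0::real))"
 proof -
 assume q: "(q \<longlongrightarrow> a (0+k)) (at 0)"
 have "filterlim (%t::real. complex_of_real t) (at 0) (at_right 0)"
 unfolding filterlim_at
 proof
 show "((%t::real. complex_of_real t) \<longlongrightarrow> 0) (at_right 0)"
 using tendsto_of_real[OF tendsto_ident_at, of 0 "{0<..}"] by simp
 show "\<forall>\<^sub>F x in at_right (0::real). complex_of_real x:UNIV & complex_of_real x ~= 0"
 using eventually_at_right_less[of "0::real"] by eventually_elim auto
 qed
 from filterlim_compose[OF q this] show ?thesis by simp
 qed
 have "((%t. q (of_real t)) \<longlongrightarrow> 0) (at_right (0::real))"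
 proof (rule Lim_null_comparison)
 have "\<forall>\<^sub>F t in at_right 0. t:{0<..<min e 1}" using b(1) by (intro eventually_at_right_real) simp
 thus "\<forall>\<^sub>F t in at_right 0. norm (q (of_real t)) <= C * t"
 proof eventually_elim
 case (elim t)
 hence t: "0 < t" "t < e" "t < 1" by auto
 have C0: "C >= 0"
 proof -
 have "0 <= C * t ^ Suc d" using b(2)[OF t(1,2)] norm_ge_zero order_trans by blast
 moreover have "t ^ Suc d > 0" using t(1) by simp
 ultimately show ?thesis using mult_neg_pos[of C "t ^ Suc d"] by linarith
 qed
 have "norm (q (of_real t)) = norm (g (of_real t)) / t ^ k" using t by (simp add: q_def norm_divide norm_power)
 also have "\<dots> \<le> C * t ^ Suc d / t ^ k" using b(2)[OF t(1,2)] t(1) by (intro divide_right_mono) auto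
 also have "\<dots> = C * (t * t ^ (d - k))" using t(1) less.prems by (simp add: power_diff)
 also have "\<dots> \<le> C * (t * 1)" using t C0 by (intro mult_left_mono power_le_one) auto
 finally show ?case by simp
 qed
 show "((%t. C * t) \<longlongrightarrow> 0) (at_right (0::real))"
 using tendsto_mult_left[OF tendsto_ident_at, of C 0 "{0<..}"] by simp
 qed
 from tendsto_unique[OF _ lim this] show ?case by (simp add: a_def)
qed

text \<open>On the ray through each point \<open>rl x\<close> the coefficients vanish by
  \<open>flat_coeff_zero\<close>. The identity theorem extends this to a neighbourhood of 0, and
  homogeneity to all X.\<close>

lemma hk_flat:
 fixes H :: "complex^('n::finite+'n) => complex"
 assumes H: "ger H" and fl: "NEAR x. norm (H (rl x)) <= C * norm x ^ Suc d" and k: "k <= d"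
 shows "hk k H X = 0"
proof -
 obtain e where e: "e > 0" "!!x. norm x < e ==> norm (H (rl x)) <= C * norm x ^ Suc d"
 using fl unfolding eventually_nhds_metric by (auto simp: dist_norm)
 have 1: "hk k H (rl x) = 0" for x
 proof -
 obtain R where R: "R > 0" "(%t. H (t *s rl x)) holomorphic_on ball 0 R" using germ_line_hol[OF H] by blast
 have n1: "norm x+1 > 0" by (simp add: add_nonneg_pos)
 have "(deriv ^^ k) (%t. H (t *s rl x)) 0 = 0"
 proof (rule flat_coeff_zero[OF R(2,1) _ _ k])
 show "e / (norm x+1) > 0" using e(1) n1 by simp
 fix t :: real assume t: "0 < t" "t < e / (norm x+1)"
 have eq: "of_real t *s rl x = rl (t *R x)" by (simp add: veq2 scaleR_conv_of_real[of t "_ :: complex"])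
 have "t * (norm x+1) < e" using t(2) n1 by (simp add: pos_less_divide_eq)
 hence "norm (t *R x) < e" using t(1) by (simp add: algebra_simps)
 from e(2)[OF this] show "norm (H (of_real t *s rl x)) <= (C * norm x ^ Suc d) * t ^ Suc d"
 unfolding eq using t(1) by (simp add: power_mult_distrib mult_ac)
 qed
 thus ?thesis by (simp add: hk_def)
 qed
 have "ger (hk k H)" by (simp add: ger_def hk_cdiff[OF H])
 from germ_identity[OF this] 1 have "NEAR X. hk k H X = 0" by simp
 then obtain r where r: "r > 0" "!!X. X:PD r ==> hk k H X = 0" unfolding eventually_nhds_PD by blast
 have n1: "norm X+1 > 0" by (simp add: add_nonneg_pos)
 define c where "c = complex_of_real (r / (norm X+1))"
 have "c *s X:PD r" by (rule smult_PD0[OF in_PD_norm _ r(1)]) (use r n1 in "simp add: c_def norm_divide")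
 hence "c ^ k * hk k H X = 0" using r(2) hk_scale[OF H] by metis
 moreover have "r / (norm X+1) ~= 0" using r(1) n1 by simp
 hence "c ~= 0" unfolding c_def by (simp only: of_real_eq_0_iff not_False_eq_True)
 ultimately show ?thesis by simp
qed

text \<open>In place of a Taylor polynomial, T is an entire function on the doubled space. The value
  b x is b 0 plus the integral of the derivative along the ray to x; the derivative in each basis
  direction is approximated one order lower by induction, and integrating these approximations gains
  the missing order.\<close>

lemma taylor_approx:
 fixes b :: "complex^'n::finite => complex"
 assumes "open S" "0:S" "Ck_on (Suc d) b S"
 shows "EX T. (ALL X. cdiff T X) & (EX C. NEAR x. norm (b x - T (rl x)) <= C * norm x ^ Suc d)"
 using assms(3)
proof (induction d arbitrary: b)
 case 0
 have "(b HD dd b 0) (at 0)" using Ck_has_derivative[OF 0 assms(2)] .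
 hence bl: "blin (dd b 0)" and "\<forall>e>0. \<exists>d>0. ALL y. norm (y - 0) < d --> norm (b y - b 0 - dd b 0 (y - 0)) <= e * norm (y - 0)"
 unfolding has_derivative_at_alt by blast+
 then obtain qx where qx: "qx > 0" "!!y. norm y < qx ==> norm (b y - b 0 - dd b 0 y) <= norm y"
 by (metis diff_zero mult_1 zero_less_one)
 obtain K where K: "!!x. norm (dd b 0 x) <= norm x * K" using bounded_linear.bounded[OF bl] by blast
 have "NEAR x. norm (b x - b 0) <= (1+K) * norm x ^ Suc 0"
 unfolding eventually_nhds_metric
 proof (intro exI[of _ qx] conjI qx(1) allI impI)
 fix x :: "complex^'n" assume "dist x 0 < qx"
 hence "norm (b x - b 0 - dd b 0 x) <= norm x" using qx(2) by simp
 moreover have "norm (b x - b 0) <= norm (b x - b 0 - dd b 0 x)+norm (dd b 0 x)"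
 using norm_triangle_ineq[of "b x - b 0 - dd b 0 x" "dd b 0 x"] by simp
 ultimately show "norm (b x - b 0) <= (1+K) * norm x ^ Suc 0" using K[of x] by (simp add: algebra_simps)
 qed
 thus ?case by (intro exI[of _ "%_. b 0"] conjI exI[of _ "1+K"]) simp_all
next
 case (Suc d)
 have "EX T. (ALL X. cdiff T X) & (EX C. NEAR x. norm (dd b x v - T (rl x)) <= C * norm x ^ Suc d)" for v
 by (rule Suc.IH) (use Suc.prems in simp)
 from choice[OF allI[OF this]] obtain T where T0: "ALL v. (ALL X. cdiff (T v) X) & (EX C. NEAR x. norm (dd b x v - T v (rl x)) <= C * norm x ^ Suc d)" ..
 hence T: "cdiff (T v) X" and "EX C. NEAR x. norm (dd b x v - T v (rl x)) <= C * norm x ^ Suc d" for v X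
 by simp_all
 from choice[OF allI[OF this(2)]] obtain C where C: "ALL v. NEAR x. norm (dd b x v - T v (rl x)) <= C v * norm x ^ Suc d" ..
 have tc: "con (UNIV \<times> {0..1}) (%p. T v (of_real (snd p) *s fst p))" for v
 by (rule continuous_on_compose2[OF hol_continuous[of UNIV "T v"]]) (auto simp: T intro!: continuous_intros)
 define V where "V v X = integral {0..1} (%t. T v (of_real t *s X))" for v X
 have Vc: "cdiff (V v) X" for v X unfolding V_def
 proof (rule hol_integral[OF open_UNIV])
 show "con (UNIV \<times> {0..1}) (%(X, t). T v (of_real t *s X))" using tc[of v] by (simp add: case_prod_unfold)
 fix X :: "complex^('n+'n)" and t :: real
 have "vdiff (%X. of_real t *s X) X" by (rule vdiff_smult[OF cdiff_const vdiff_id])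
 thus "cdiff (%X. T v (of_real t *s X)) X" by (rule cdiff_compose(1)[where g="T v"]) (rule T)
 qed simp
 define TT where "TT X = b 0+(SUM v:Basis. ell v X * V v X)" for X
 have TTc: "cdiff TT X" for X unfolding TT_def
 by (rule cdiff_add[OF cdiff_const cdiff_sum]) (rule cdiff_mult[OF cdiff_ell Vc])
 define CC where "CC = (SUM v:(Basis::(complex^'n) set). \<bar>C v\<bar>)"
 have "NEAR x. x:S & (ALL v:Basis. norm (dd b x v - T v (rl x)) <= C v * norm x ^ Suc d)"
 using C by (intro eventually_conj evo assms(1,2) eventually_ball_finite) auto
 then obtain e where e: "e > 0" "!!x. norm x < e ==> x:S"
 "!!x v. norm x < e ==> v:Basis ==> norm (dd b x v - T v (rl x)) <= C v * norm x ^ Suc d"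
 unfolding eventually_nhds_metric by (auto simp: dist_norm)
 have "norm (b x - TT (rl x)) <= CC * norm x ^ Suc (Suc d)" if x: "norm x < e" for x
 proof -
 have tx: "norm (t *R x) <= norm x" "norm (t *R x) < e" if "t:{0..1}" for t
 proof -
 show 1: "norm (t *R x) <= norm x" using that mult_right_mono[of t 1 "norm x"] by simp
 show "norm (t *R x) < e" using 1 x by linarith
 qed
 have db: "(b HD dd b (t *R x)) (at (t *R x))" if "t:{0..1}" for t
 using Ck_has_derivative[OF Suc.prems e(2)[OF tx(2)[OF that]]] .
 have "((%t. dd b (t *R x) x) has_integral (b (1 *R x) - b (0 *R x))) {0..1}"
 proof (rule fundamental_theorem_of_calculus)
 fix t :: real assume t: "t:{0..1}"
 have "((%t. t *R x) HD (%h. h *R x)) (at t within {0..1})" by (auto intro!: derivative_eq_intros)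
 from hdc[OF this db[OF t]]
 have "((%t. b (t *R x)) HD (%h. dd b (t *R x) (h *R x))) (at t within {0..1})" .
 thus "((%t. b (t *R x)) has_vector_derivative dd b (t *R x) x) (at t within {0..1})"
 unfolding has_vector_derivative_def
 by (simp add: linear_scale[OF has_derivative_linear[OF db[OF t]]])
 qed simp
 hence i1: "((%t. dd b (t *R x) x) has_integral (b x - b 0)) {0..1}" by simp
 have Vi: "((%t. T v (of_real t *s rl x)) has_integral V v (rl x)) {0..1}" for v
 unfolding V_def
 proof (rule integrable_integral, rule integrable_continuous_real)
 show "con {0..1} (%t. T v (of_real t *s rl x))"
 by (rule continuous_on_compose2[OF hol_continuous[of UNIV "T v"]]) (auto simp: T intro!: continuous_intros)
 qed
 have "((%t. SUM v:Basis. of_real (x ~~ v) * T v (of_real t *s rl x)) has_integral (SUM v:Basis. of_real (x ~~ v) * V v (rl x))) {0..1}"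
 by (intro has_integral_sum finite_Basis has_integral_mult_right Vi)
 from has_integral_diff[OF i1 this]
 have i2: "((%t. dd b (t *R x) x - (SUM v:Basis. of_real (x ~~ v) * T v (of_real t *s rl x))) has_integral (b x - TT (rl x))) (cbox 0 1)"
 by (simp add: TT_def ell_rl algebra_simps)
 have CC0: "CC >= 0" unfolding CC_def by (intro sum_nonneg) simp
 have "norm (b x - TT (rl x)) <= (CC * norm x ^ Suc (Suc d)) * measure lborel (cbox 0 (1::real))"
 proof (rule has_integral_bound[OF _ i2])
 show "0 <= CC * norm x ^ Suc (Suc d)" using CC0 by simp
 fix t :: real assume "t:cbox 0 1"
 hence t: "t:{0..1}" by simp
 have eq: "of_real t *s rl x = rl (t *R x)" by (simp add: veq2 scaleR_conv_of_real[of t "_ :: complex"])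
 have lin: "linear (dd b (t *R x))" using has_derivative_linear[OF db[OF t]] .
 have "dd b (t *R x) x = dd b (t *R x) (SUM v:Basis. (x ~~ v) *R v)" by (simp add: euclidean_representation)
 also have "\<dots> = (SUM v:Basis. of_real (x ~~ v) * dd b (t *R x) v)"
 by (simp only: linear_sum[OF lin] linear_scale[OF lin]) (simp only: scaleR_conv_of_real)
 finally have "dd b (t *R x) x - (SUM v:Basis. of_real (x ~~ v) * T v (of_real t *s rl x))
 = (SUM v:Basis. of_real (x ~~ v) * (dd b (t *R x) v - T v (rl (t *R x))))"
 by (simp add: eq right_diff_distrib sum_subtractf)
 also have "norm \<dots> \<le> (SUM v:Basis. norm x * (\<bar>C v\<bar> * norm x ^ Suc d))"
 proof (rule sum_norm_le)
 fix v :: "complex^'n" assume v: "v:Basis"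
 have "norm (dd b (t *R x) v - T v (rl (t *R x))) <= C v * norm (t *R x) ^ Suc d"
 by (rule e(3)[OF tx(2)[OF t] v])
 also have "\<dots> \<le> \<bar>C v\<bar> * norm (t *R x) ^ Suc d" by (intro mult_right_mono) auto
 also have "\<dots> \<le> \<bar>C v\<bar> * norm x ^ Suc d" by (intro mult_left_mono power_mono tx(1)[OF t]) auto
 finally have 1: "norm (dd b (t *R x) v - T v (rl (t *R x))) <= \<bar>C v\<bar> * norm x ^ Suc d" .
 have "norm (complex_of_real (x ~~ v)) <= norm x" using Basis_le_norm[OF v] by simp
 thus "norm (of_real (x ~~ v) * (dd b (t *R x) v - T v (rl (t *R x)))) <= norm x * (\<bar>C v\<bar> * norm x ^ Suc d)"
 unfolding norm_mult by (rule mult_mono) (use 1 in auto)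
 qed
 also have "\<dots> = CC * norm x ^ Suc (Suc d)" by (simp add: CC_def sum_distrib_left sum_distrib_right mult_ac)
 finally show "norm (dd b (t *R x) x - (SUM v:Basis. of_real (x ~~ v) * T v (of_real t *s rl x))) <= CC * norm x ^ Suc (Suc d)" .
 qed
 thus ?thesis by simp
 qed
 hence "NEAR x. norm (b x - TT (rl x)) <= CC * norm x ^ Suc (Suc d)"
 unfolding eventually_nhds_metric using e(1) by (auto simp: dist_norm)
 thus ?case using TTc by (intro exI[of _ TT] conjI exI[of _ CC] allI)
qed

text \<open>The identity theorem at the point \<open>rl x\<close>, followed by continuation along
  the complex line to Y. The parameters for which this line stays in the polydisc form a convex,
  hence connected, set.\<close>

lemma germ_zero_spread:
 fixes G :: "complex^('n::finite+'n) => complex"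
 assumes G: "!!X. X:PD r ==> cdiff G X" and x: "rl x:PD r" and z: "\<forall>\<^sub>F y in nhds x. G (rl y) = 0" and Y: "Y:PD r"
 shows "G Y = 0"
proof -
 have "ger (%X. G (rl x+X))" unfolding ger_def
 proof -
 have "NEAR X. rl x+X:PD r"
 by (rule ev_nhds_compose[where F="%X. rl x+X" and P="%X. X:PD r" and b="rl x"])
 (auto intro!: continuous_intros evo open_PD x)
 thus "NEAR X. cdiff (%X. G (rl x+X)) X"
 proof eventually_elim
 case (elim X)
 show ?case by (rule cdiff_compose(1)[where F="%X. rl x+X" and g=G, OF vdiff_add[OF vdiff_const vdiff_id] G[OF elim]])
 qed
 qed
 moreover have "NEAR y. G (rl x+rl y) = 0"
 using z[unfolded ev_shift[of _ x]] by eventually_elim (simp add: rl_add)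
 ultimately have ev: "NEAR X. G (rl x+X) = 0" by (rule germ_identity)
 let ?v = "Y - rl x"
 define T where "T = {t. rl x+t *s ?v:PD r}"
 have "isCont (%t. t *s ?v) (0::complex)" using bounded_linear_vsmult lincont by blast
 from ev_nhds_compose[OF this _ ev] have "NEAR t. G (rl x+t *s ?v) = 0" by simp
 then obtain U where U: "open U" "0:U" "!!t. t:U ==> G (rl x+t *s ?v) = 0" unfolding eventually_nhds by blast
 have cont: "con UNIV (%t. rl x+t *s ?v)" by (intro continuous_intros)
 have oT: "open T" using open_vimage[OF open_PD cont, of r] by (simp add: T_def vimage_def)
 have cT: "convex T"
 proof (rule convexI)
 fix s t :: complex and u v :: real assume st: "s:T" "t:T" "0 <= u" "0 <= v" "u+v = 1"
 have "rl x+(u *R s+v *R t) *s ?v = u *R (rl x+s *s ?v)+v *R (rl x+t *s ?v)"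
 proof -
 have "u *R rl x+v *R rl x = rl x" using st(5) by (metis scaleR_left_distrib scaleR_one)
 thus ?thesis by (simp add: veq scaleR_add_right algebra_simps)
 qed
 also have "\<dots>:PD r" using convexD[OF convex_PD _ _ st(3-5)] st(1,2) by (simp add: T_def)
 finally show "u *R s+v *R t:T" by (simp add: T_def)
 qed
 have hol: "(%t. G (rl x+t *s ?v)) holomorphic_on T" by (rule line_holomorphic) (simp add: T_def G)
 have T01: "0:T" "1:T" using x Y by (simp_all add: T_def)
 have op: "open (T Int U)" "0:T Int U" using oT U T01 by auto
 have "(%t. G (rl x+t *s ?v)) 1 = 0"
 proof (rule analytic_continuation[OF hol oT convex_connected[OF cT], of "T Int U" 0 1])
 show "0 islimpt T Int U" by (rule interior_limit_point) (simp only: interior_open[OF op(1)] op(2))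
 qed (use T01 U in auto)
 thus ?thesis by simp
qed

section \<open>Smooth quotients of real analytic functions are analytic\<close>

theorem analytic_quotient:
 fixes b :: "complex^'n::finite => complex"
 assumes S: "open S" "0:S" "!!k. Ck_on k b S" and F: "ger F" and G: "ger G"
 and bG: "NEAR x. b x * G (rl x) = F (rl x)" and nz: "\<not> (NEAR X. G X = 0)"
 shows "EX B. ger B & (NEAR x. b x = B (rl x))"
proof -
 have "EX T. (ALL X. cdiff T X) & (EX C. NEAR x. norm (b x - T (rl x)) <= C * norm x ^ Suc d)" for d
 by (rule taylor_approx[OF S(1,2,3)])
 from choice[OF allI[OF this]] obtain T where T0: "ALL d. (ALL X. cdiff (T d) X) & (EX C. NEAR x. norm (b x - T d (rl x)) <= C * norm x ^ Suc d)" ..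
 hence T: "cdiff (T d) X" and "EX C. NEAR x. norm (b x - T d (rl x)) <= C * norm x ^ Suc d" for d X
 by simp_all
 from choice[OF allI[OF this(2)]] obtain K where K: "ALL d. NEAR x. norm (b x - T d (rl x)) <= K d * norm x ^ Suc d" ..
 have gT: "ger (T d)" for d by (simp add: ger_def T)
 obtain r1 C1 where r1: "r1 > 0" "C1 > 0" "!!X. X:PD r1 ==> cdiff F X" "!!X. X:PD r1 ==> norm (F X) <= C1" by (rule germ_bounds[OF F]) (rule that)
 obtain r2 C2 where r2: "r2 > 0" "C2 > 0" "!!X. X:PD r2 ==> cdiff G X" "!!X. X:PD r2 ==> norm (G X) <= C2" by (rule germ_bounds[OF G]) (rule that)
 define r where "r = min r1 r2"
 define C where "C = max C1 C2"
 have r: "r > 0" and C: "C > 0" using r1 r2 by (auto simp: r_def C_def)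
 have rr: "X:PD r1" "X:PD r2" if "X:PD r" for X :: "complex^('n+'n)"
 using that PD_mono[of r r1] PD_mono[of r r2] by (auto simp: r_def)
 have Fd: "cdiff F X" and Gd: "cdiff G X" and FC: "norm (F X) <= C" and GC: "norm (G X) <= C" if "X:PD r" for X
 using r1(3,4)[OF rr(1)[OF that]] r2(3,4)[OF rr(2)[OF that]] by (auto simp: C_def)
 have evr: "NEAR X. X:(PD r :: (complex^('n+'n)) set)" unfolding eventually_nhds_PD using r by blast
 \<comment> \<open>On real points F - T_d G equals (b - T_d) G, which is of order d + 1, so the two
   have the same homogeneous parts up to degree d.\<close>
 have fl1: "hk k F X = hk k (%X. T d X * G X) X" if "k <= d" for k d X
 proof -
 have "hk k (%X. F X - T d X * G X) X = 0"
 proof (rule hk_flat[OF ger_diff[OF F ger_mult[OF gT G]] _ that])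
 show "NEAR x. norm (F (rl x) - T d (rl x) * G (rl x)) <= (K d * C) * norm x ^ Suc d"
 using K[rule_format, of d] bG ev_rl[OF evr]
 proof eventually_elim
 case (elim x)
 have "F (rl x) - T d (rl x) * G (rl x) = (b x - T d (rl x)) * G (rl x)" using elim(2) by (simp add: algebra_simps)
 moreover have "norm (b x - T d (rl x)) * norm (G (rl x)) <= (K d * norm x ^ Suc d) * C"
 by (rule mult_mono[OF elim(1) GC[OF elim(3)]]) (use elim(1) norm_ge_zero order_trans in "blast, simp")
 ultimately show ?case by (simp add: norm_mult mult_ac)
 qed
 qed
 thus ?thesis using hk_diff[OF F ger_mult[OF gT G]] by simp
 qed
 have fl2: "hk k (T d) X = hk k (T d') X" if "k <= d" "d <= d'" for k d d' X
 proof -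
 have "hk k (%X. T d X - T d' X) X = 0"
 proof (rule hk_flat[OF ger_diff[OF gT gT] _ that(1)])
 have "\<forall>\<^sub>F x in nhds (0::complex^'n). norm x < 1" unfolding eventually_nhds_metric by (intro exI[of _ 1]) simp
 thus "NEAR x. norm (T d (rl x) - T d' (rl x)) <= (\<bar>K d\<bar>+\<bar>K d'\<bar>) * norm x ^ Suc d"
 using K[rule_format, of d] K[rule_format, of d']
 proof eventually_elim
 case (elim x)
 have 0: "norm x ^ Suc d' <= norm x ^ Suc d" using elim(1) that(2) by (intro power_decreasing) auto
 have 1: "K d * norm x ^ Suc d <= \<bar>K d\<bar> * norm x ^ Suc d" by (intro mult_right_mono) auto
 have "K d' * norm x ^ Suc d' <= \<bar>K d'\<bar> * norm x ^ Suc d'" by (intro mult_right_mono) auto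
 also have "\<dots> \<le> \<bar>K d'\<bar> * norm x ^ Suc d" using 0 by (intro mult_left_mono) auto
 finally have 2: "K d' * norm x ^ Suc d' <= \<bar>K d'\<bar> * norm x ^ Suc d" .
 have "norm (T d (rl x) - T d' (rl x)) <= norm (b x - T d (rl x))+norm (b x - T d' (rl x))"
 using norm_triangle_ineq4[of "b x - T d' (rl x)" "b x - T d (rl x)"] by simp
 thus ?case using elim(2,3) 1 2 by (simp add: distrib_right)
 qed
 qed
 thus ?thesis using hk_diff[OF gT gT] by simp
 qed
 \<comment> \<open>The formal Taylor series of b on the doubled space; by \<open>fl2\<close> every
   approximation of order at least k gives the same part of degree k.\<close>
 define Bk where "Bk k = hk k (T k)" for k
 have Bkd: "cdiff (Bk k) X" for k X unfolding Bk_def by (rule hk_cdiff[OF gT])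
 have Bks: "Bk k (c *s X) = c ^ k * Bk k X" for k c X unfolding Bk_def by (rule hk_scale[OF gT])
 have conv: "hk k F X = (\<Sum>i\<le>k. Bk i X * hk (k - i) G X)" for k X
 proof -
 have "hk k F X = (\<Sum>i\<le>k. hk i (T k) X * hk (k - i) G X)" using fl1[of k k] hk_mult[OF gT G] by simp
 also have "\<dots> = (\<Sum>i\<le>k. Bk i X * hk (k - i) G X)"
 by (rule sum.cong) (use fl2 in "auto simp: Bk_def")
 finally show ?thesis .
 qed
 have "EX k X. hk k G X ~= 0"
 proof (rule ccontr)
 assume "\<not> (EX k X. hk k G X ~= 0)"
 hence "G X = 0" if "X:PD (r/2)" for X
 using hk_sums[OF Gd r that] sums_unique2[OF _ sums_zero] by simp
 hence "NEAR X. G X = 0" unfolding eventually_nhds_PD using r by (intro exI[of _ "r/2"]) auto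
 thus False using nz by simp
 qed
 then obtain k0 X0 where "hk k0 G X0 ~= 0" by blast
 \<comment> \<open>The order of G at 0. Division of power series divides by the part of degree m, so
   a point is sought at which this part is bounded away from 0.\<close>
 define m where "m = (LEAST k. EX X. hk k G X ~= 0)"
 have "EX X. hk m G X ~= 0" unfolding m_def by (rule LeastI[of _ k0]) (use `hk k0 G X0 ~= 0` in blast)
 then obtain e0 where e0: "hk m G e0 ~= 0" by blast
 have low: "hk j G X = 0" if "j < m" for j X using not_less_Least[OF that[unfolded m_def]] by blast
 \<comment> \<open>Moves \<open>e0\<close> into the polydisc of radius r/4; by homogeneity the
   leading part of G stays nonzero there.\<close>
 define c1 where "c1 = complex_of_real (r / (4 * (norm e0+1)))"
 have n1: "norm e0+1 > 0" by (simp add: add_nonneg_pos)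
 have c1: "c1 ~= 0" unfolding c1_def using r n1 by (simp only: of_real_eq_0_iff) simp
 have c1n: "norm c1 * (norm e0+1) = r/4"
 proof -
 have "(r / (4 * n)) * n = r/4" if "n > 0" for n :: real using that by simp
 moreover have "norm c1 = r / (4 * (norm e0+1))" unfolding c1_def norm_of_real using r n1 by simp
 ultimately show ?thesis using n1 by metis
 qed
 define e where "e = c1 *s e0"
 have eP: "e:PD (r/4)" unfolding e_def by (rule smult_PD0[OF in_PD_norm]) (use c1n r in auto)
 have eG: "hk m G e ~= 0" unfolding e_def hk_scale[OF G] using e0 c1 by simp
 define c0 where "c0 = norm (hk m G e) / 2"
 have c0: "c0 > 0" using eG by (simp add: c0_def)
 have "\<forall>\<^sub>F y in nhds e. c0 < norm (hk m G y)"
 proof -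
 have "isCont (hk m G) e" by (rule cdiff_iscont[OF hk_cdiff[OF G]])
 hence "(hk m G \<longlongrightarrow> hk m G e) (nhds e)" unfolding isCont_def tendsto_at_iff_tendsto_nhds .
 hence "((%y. norm (hk m G y)) \<longlongrightarrow> norm (hk m G e)) (nhds e)" by (rule tendsto_norm)
 thus ?thesis by (rule order_tendstoD) (use eG in "simp add: c0_def")
 qed
 hence "NEAR y. c0 < norm (hk m G (e+y))" unfolding ev_shift[of _ e] .
 then obtain qx0 where d0: "qx0 > 0" "!!y. y:PD qx0 ==> c0 < norm (hk m G (e+y))" unfolding eventually_nhds_PD by blast
 \<comment> \<open>The bound r/4 keeps l e + y in the polydisc of radius r/2 for all l in the unit
   disc, where \<open>hk_bound\<close> is available.\<close>
 define qx where "qx = min qx0 (r/4)"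
 have d: "qx > 0" using d0 r by (simp add: qx_def)
 have dG: "c0 < norm (hk m G (e+y))" if "y:PD qx" for y
 by (rule d0(2)) (use that PD_mono[of qx qx0] in "auto simp: qx_def")
 have Om: "l *s e+y:PD (r/2)" if "norm l <= 1" "y:PD qx" for l and y :: "complex^('n+'n)"
 proof -
 have "norm ((l *s e+y)$j) < r/2" for j
 proof -
 have "norm (l * e$j) <= norm (e$j)" using that(1) mult_right_mono[of "norm l" 1 "norm (e$j)"] by (simp add: norm_mult)
 moreover have "norm (e$j) < r/4" "norm (y$j) < r/4" using eP that(2) by (auto simp: PD_def qx_def)
 ultimately show ?thesis using norm_triangle_ineq[of "l * e$j" "y$j"] by simp
 qed
 thus ?thesis by (simp add: PD_def)
 qed
 \<comment> \<open>With R = 1 + A, the sum of A R^i over i < k is R^k - 1. The recursion for the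
   part of degree k then gives at most C + C (R^k - 1) = C R^k before division by c0, which is below
   A R^k after it.\<close>
 define A where "A = 2 * C / c0"
 define R where "R = 1+A"
 have A: "A > 0" using C c0 by (simp add: A_def)
 have R: "R > 1" using A by (simp add: R_def)
 \<comment> \<open>The leading part of G is bounded below only near the circle of points l e with l
   of modulus 1. The recursion is solved there, and the maximum principle in l extends the bound to
   the disc. At l = 0 it becomes a bound on a full polydisc around 0.\<close>
 have bound: "ALL l. ALL y::complex^('n+'n). norm l <= 1 --> y:PD qx --> norm (Bk k (l *s e+y)) <= A * R ^ k" for k
 proof (induction k rule: less_induct)
 case (less k)
 have Gam: "norm (Bk k (l *s e+y)) <= A * R ^ k" if l: "norm l = 1" and y: "y:PD qx" for l and y :: "complex^('n+'n)"
 proof -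
 let ?X = "l *s e+y"
 have l0: "l ~= 0" using l by auto
 have Xr: "?X:PD (r/2)" by (rule Om) (use l y in auto)
 have "inverse l *s y:PD qx" by (rule smult_PD0[OF y _ d]) (simp add: norm_inverse l)
 from dG[OF this] have "c0 < norm (hk m G (e+inverse l *s y))" .
 moreover have eqX: "?X = l *s (e+inverse l *s y)" using l0 by (simp add: vector_add_ldistrib)
 have "norm (hk m G ?X) = norm (hk m G (e+inverse l *s y))"
 by (simp only: eqX hk_scale[OF G] norm_mult norm_power l power_one mult_1_left)
 ultimately have big: "c0 < norm (hk m G ?X)" by simp
 have "hk (k+m) F ?X = (\<Sum>i\<le>k+m. Bk i ?X * hk (k+m - i) G ?X)" by (rule conv)
 also have "\<dots> = (\<Sum>i\<le>k. Bk i ?X * hk (k+m - i) G ?X)"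
 by (rule sum.mono_neutral_right) (auto simp: low)
 also have "\<dots> = (\<Sum>i<k. Bk i ?X * hk (k+m - i) G ?X)+Bk k ?X * hk m G ?X"
 by (simp flip: lessThan_Suc_atMost)
 finally have eq: "Bk k ?X * hk m G ?X = hk (k+m) F ?X - (\<Sum>i<k. Bk i ?X * hk (k+m - i) G ?X)" by simp
 have "norm (Bk k ?X) * c0 <= norm (Bk k ?X * hk m G ?X)" unfolding norm_mult by (intro mult_left_mono) (use big in auto)
 also have "\<dots> \<le> norm (hk (k+m) F ?X)+norm (\<Sum>i<k. Bk i ?X * hk (k+m - i) G ?X)" unfolding eq by (rule norm_triangle_ineq4)
 also have "norm (hk (k+m) F ?X) <= C" by (rule hk_bound[OF Fd FC r Xr])
 also have "norm (\<Sum>i<k. Bk i ?X * hk (k+m - i) G ?X) <= (\<Sum>i<k. A * R ^ i * C)"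
 proof (rule sum_norm_le)
 fix i assume "i:{..<k}"
 hence i: "i < k" by simp
 have 1: "norm (Bk i ?X) <= A * R ^ i" using less.IH[OF i] l y by simp
 have 2: "norm (hk (k+m - i) G ?X) <= C" by (rule hk_bound[OF Gd GC r Xr])
 show "norm (Bk i ?X * hk (k+m - i) G ?X) <= A * R ^ i * C"
 unfolding norm_mult by (rule mult_mono[OF 1 2]) (use A R in auto)
 qed
 also have "(\<Sum>i<k. A * R ^ i * C) = C * ((R - 1) * (\<Sum>i<k. R ^ i))" by (simp add: R_def sum_distrib_left sum_distrib_right mult_ac)
 also have "(R - 1) * (\<Sum>i<k. R ^ i) = R ^ k - 1" using power_diff_1_eq[of R k] by simp
 finally have "norm (Bk k ?X) * c0 <= C * R ^ k" by (simp add: algebra_simps)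
 also have "\<dots> \<le> (2 * C) * R ^ k" using C R by simp
 finally show ?thesis using c0 by (simp add: A_def pos_le_divide_eq mult.commute mult.left_commute)
 qed
 show ?case
 proof (intro allI impI)
 fix l and y :: "complex^('n+'n)" assume l: "norm (l::complex) <= 1" and y: "y:PD qx"
 let ?f = "%z. Bk k (y+z *s e)"
 have hol: "?f holomorphic_on UNIV" by (rule line_holomorphic) (rule Bkd)
 have "norm (?f l) <= A * R ^ k"
 proof (rule maximum_modulus_frontier[of ?f "cball 0 1"])
 show "?f holomorphic_on interior (cball 0 1)" by (rule holomorphic_on_subset[OF hol]) auto
 show "con (closure (cball 0 1)) ?f"
 using holomorphic_on_imp_continuous_on[OF hol] continuous_on_subset by blast
 show "norm (?f z) <= A * R ^ k" if "z:frontier (cball 0 1)" for z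
 using Gam[OF _ y, of z] that by (simp add: add.commute)
 qed (use l in auto)
 thus "norm (Bk k (l *s e+y)) <= A * R ^ k" by (simp add: add.commute)
 qed
 qed
 \<comment> \<open>Scaling by 2R turns the bound A R^k into A / 2^k, so the series converges on this
   polydisc.\<close>
 define s where "s = qx / (2 * R)"
 have s: "s > 0" using d R by (simp add: s_def)
 have Bs: "norm (Bk k X) <= A * (1/2) ^ k" if X: "X:PD s" for k X
 proof -
 let ?c = "complex_of_real (2 * R)"
 have R2: "norm ?c * s <= qx" unfolding norm_of_real using R by (simp add: s_def)
 have "?c *s X:PD qx" by (rule smult_PD0[OF X R2 d])
 from bound[rule_format, of 0, OF _ this] have "norm (?c ^ k * Bk k X) <= A * R ^ k" by (simp add: Bks)
 hence "(2 * R) ^ k * norm (Bk k X) <= A * R ^ k" unfolding norm_mult norm_power norm_of_real using R by simp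
 hence "R ^ k * (2 ^ k * norm (Bk k X)) <= R ^ k * A" by (simp add: power_mult_distrib mult_ac)
 hence "2 ^ k * norm (Bk k X) <= A" using R by simp
 thus ?thesis by (simp add: power_one_over field_simps)
 qed
 define B where "B X = (\<Sum>\<^sub>\<infinity>k\<in>UNIV. Bk k X)" for X
 have sg: "summable (%k. A * (1/2) ^ k)" by (intro summable_mult summable_geometric) simp
 have Bd: "cdiff B X" if "X:PD s" for X unfolding B_def
 proof (rule hol_infsum[OF open_PD _ Bs _ that])
 show "(%k. A * (1/2) ^ k) summable_on UNIV" by (rule summable_nonneg_imp_summable_on[OF sg]) (use A in simp)
 qed (rule Bkd)
 have BG: "B X * G X = F X" if X: "X:PD (min s (r/2))" for X
 proof -
 have Xs: "X:PD s" and Xr: "X:PD (r/2)" using X by (simp_all add: PD_def)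
 have sB: "summable (%k. norm (Bk k X))" by (rule summable_comparison_test'[OF sg]) (use Bs[OF Xs] in simp)
 have hs: "(%k. hk k G X) sums G X" by (rule hk_sums[OF Gd r Xr])
 have "B X = (\<Sum>k. Bk k X)" unfolding B_def
 by (rule infsumI[OF norm_summable_imp_has_sum[OF sB summable_sums[OF summable_norm_cancel[OF sB]]]])
 moreover have sG: "summable (%k. norm (hk k G X))"
 proof -
 have hol: "(%t. G (t *s X)) holomorphic_on ball 0 2" by (rule line_hol0[OF Gd Xr]) (use r in auto)
 have "summable (%n. (deriv ^^ n) (%t. G (t *s X)) 0 / fact n * (3/2) ^ n)"
 using holomorphic_power_series[OF hol, of "3/2"] by (auto simp: sums_iff)
 from powser_insidea[OF this, of 1] show ?thesis by (simp add: hk_def)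
 qed
 ultimately have "(%k. \<Sum>i\<le>k. Bk i X * hk (k - i) G X) sums (B X * G X)"
 using Cauchy_product_sums[OF sB sG] hs by (simp add: sums_iff)
 hence "(%k. hk k F X) sums (B X * G X)" unfolding conv .
 moreover have "(%k. hk k F X) sums F X" by (rule hk_sums[OF Fd r Xr])
 ultimately show ?thesis by (rule sums_unique2)
 qed
 have gB: "ger B" unfolding ger_def eventually_nhds_PD using Bd s by blast
 define q where "q = min s (r/2)"
 have q: "q > 0" using s r by (simp add: q_def)
 have evq: "NEAR X. X:(PD q :: (complex^('n+'n)) set)" unfolding eventually_nhds_PD using q by blast
 have "NEAR x. rl x:PD q & x:S & b x * G (rl x) = F (rl x)"
 by (intro eventually_conj bG evo[OF S(1,2)] ev_rl[OF evq])
 then obtain U where U: "open U" "0:U" "!!x. x:U ==> rl x:PD q" "!!x. x:U ==> x:S" "!!x. x:U ==> b x * G (rl x) = F (rl x)"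
 unfolding eventually_nhds by blast
 \<comment> \<open>Both b and B solve the equation with divisor G. If they differed at x, then by
   continuity G would vanish at all real points near x, and therefore identically.\<close>
 have eqU: "b x = B (rl x)" if x: "x:U" for x
 proof (rule ccontr)
 assume ne: "b x ~= B (rl x)"
 have "isCont b x" using S(3)[of 0] S(1) U(4)[OF x] by (simp add: continuous_on_eq_continuous_at)
 moreover have "isCont (%x. B (rl x)) x"
 proof (rule isCont_o2[where g=B and f=rl, OF isCont_rl cdiff_iscont[OF Bd]])
 show "rl x:PD s" using U(3)[OF x] PD_mono[of q s] by (auto simp: q_def)
 qed
 ultimately have "isCont (%x. b x - B (rl x)) x" by (rule continuous_diff)
 hence "((%x. b x - B (rl x)) \<longlongrightarrow> b x - B (rl x)) (nhds x)"
 unfolding isCont_def using tendsto_at_iff_tendsto_nhds[of "%x. b x - B (rl x)" x] by simp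
 hence "\<forall>\<^sub>F y in nhds x. b y - B (rl y) ~= 0" by (rule tendsto_imp_eventually_ne) (use ne in simp)
 moreover have "\<forall>\<^sub>F y in nhds x. y:U" by (intro evo U(1) x)
 ultimately have "\<forall>\<^sub>F y in nhds x. G (rl y) = 0"
 proof eventually_elim
 case (elim y)
 have "B (rl y) * G (rl y) = F (rl y)" by (rule BG) (use U(3)[OF elim(2)] in "simp add: q_def")
 hence "(b y - B (rl y)) * G (rl y) = 0" using U(5)[OF elim(2)] by (simp add: algebra_simps)
 thus ?case using elim(1) by simp
 qed
 note spread = this
 have "G Y = 0" if "Y:PD r" for Y
 proof (rule germ_zero_spread[OF Gd _ spread that])
 have "q <= r" using r by (simp add: q_def)
 thus "rl x:PD r" using U(3)[OF x] PD_mono[of q r] by blast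
 qed
 hence "NEAR X. G X = 0" unfolding eventually_nhds_PD using r by blast
 thus False using nz by simp
 qed
 show ?thesis
 proof (intro exI[of _ B] conjI gB)
 show "NEAR x. b x = B (rl x)" unfolding eventually_nhds using U(1,2) eqU by blast
 qed
qed

section \<open>The complexified submanifold in normal form\<close>

locale nf =
 fixes a b :: "'n::finite" and W T :: "'n => complex^('n+'n) => complex"
 assumes ab: "a ~= b"
 and gW: "!!k. k:{a, b} ==> ger (W k)" and W0: "!!k. k:{a, b} ==> W k 0 = 0"
 and dW0: "!!k V. k:{a, b} ==> dd (W k) 0 V = V$Inl k"
 and gT: "!!k. k:{a, b} ==> ger (T k)"
 and dT0: "!!k V. k:{a, b} ==> dd (T k) 0 V = V$Inl k"
 and WQ: "!!k X. k:{a, b} ==> W k (cpl (lc X) (\<chi> i. if i:{a,b} then X$Inl i else X$Inr i)) = W k X"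
 and TQ: "!!k X. k:{a, b} ==> T k (cpl (lc X) (\<chi> i. if i:{a,b} then X$Inl i else X$Inr i)) = T k X"
 and Tdef: "!!k X. k:{a, b} ==> X = cpl (lc X) (\<chi> i. if i:{a,b} then X$Inl i else X$Inr i) ==> T k X = cnj (W k (cj X))"
 and nr: "!!k. k:{a, b} ==> NEAR X. (ALL i. i ~: {a,b} --> X$Inr i = 0) --> W k X = T k X"
 and nl: "!!k. k:{a, b} ==> NEAR X. (ALL i. i ~: {a,b} --> X$Inl i = 0) --> W k X = T k X"
begin

text \<open>Projection to the complexified submanifold, on which z_i = X$Inl i and zeta_i = X$Inr i
  for i outside {a,b}, and s_k = X$Inl k for k in {a,b}; the entries X$Inr a and X$Inr b repeat s.
  In these terms \<open>nr\<close> and \<open>nl\<close> are the two halves of normality: W = T on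
  zeta = 0 and on z = 0.\<close>

definition Qp :: "complex^('n+'n) => complex^('n+'n)" where
 "Qp X = cpl (lc X) (\<chi> i. if i:{a,b} then X$Inl i else X$Inr i)"
definition Pm :: "complex^('n+'n) => complex^('n+'n)" where
 "Pm X = cpl (\<chi> i. if i:{a,b} then (X$Inl i+X$Inr i)/2 else X$Inl i)
 (\<chi> i. if i:{a,b} then (X$Inl i+X$Inr i)/2 else X$Inr i)"
definition dr :: "complex^'n => complex^'n" where
 "dr y = (\<chi> i. if i:{a,b} then of_real (Re (y$i)) else y$i)"
definition pk :: "complex^'n => complex^'n" where
 "pk y = (\<chi> i. if i:{a,b} then y$i else 0)"
text \<open>In the locale \<open>nfM\<close> below, y |-> \<open>zW (R y)\<close> parametrizes M in
  normal coordinates; at the real points \<open>R y\<close> the map \<open>zT\<close> is its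
  conjugate.\<close>

definition zW :: "complex^('n+'n) => complex^'n" where
 "zW X = (\<chi> i. if i:{a,b} then W i X else X$Inl i)"
definition zT :: "complex^('n+'n) => complex^'n" where
 "zT X = (\<chi> i. if i:{a,b} then T i X else X$Inr i)"
definition kap :: "complex^('n+'n) => complex^('n+'n)" where
 "kap X = cpl (zW X) (rc X)"
definition kas :: "complex^('n+'n) => complex^('n+'n)" where
 "kas X = cpl (\<chi> i. if i:{a,b} then T i X else X$Inl i) (rc X)"
text \<open>The real points of the complexified submanifold: zeta is the conjugate of z, and s is
  real.\<close>

definition R :: "complex^'n => complex^('n+'n)" where "R y = rl (dr y)"

lemma Qp_nth[simp]: "Qp X$Inl i = X$Inl i" "Qp X$Inr i = (if i:{a,b} then X$Inl i else X$Inr i)"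
 by (simp_all add: Qp_def)
lemma Pm_nth[simp]: "Pm X$Inl i = (if i:{a,b} then (X$Inl i+X$Inr i)/2 else X$Inl i)"
 "Pm X$Inr i = (if i:{a,b} then (X$Inl i+X$Inr i)/2 else X$Inr i)"
 by (simp_all add: Pm_def)
lemma dr_nth[simp]: "dr y$i = (if i:{a,b} then of_real (Re (y$i)) else y$i)" by (simp add: dr_def)
lemma pk_nth[simp]: "pk y$i = (if i:{a,b} then y$i else 0)" by (simp add: pk_def)
lemma zW_nth: "zW X$i = (if i:{a,b} then W i X else X$Inl i)" by (simp add: zW_def)
lemma zT_nth: "zT X$i = (if i:{a,b} then T i X else X$Inr i)" by (simp add: zT_def)
lemma kap_nth: "kap X$Inl i = (if i:{a,b} then W i X else X$Inl i)" "kap X$Inr i = X$Inr i"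
 by (simp_all add: kap_def zW_def)
lemma kas_nth: "kas X$Inl i = (if i:{a,b} then T i X else X$Inl i)" "kas X$Inr i = X$Inr i"
 by (simp_all add: kas_def)

lemma Qp_Qp[simp]: "Qp (Qp X) = Qp X" by (simp add: veq2)
lemma Pm_Qp[simp]: "Pm (Qp X) = Qp X" by (simp add: veq2)
lemma Qp_Pm[simp]: "Qp (Pm X) = Pm X" by (simp add: veq2)
lemma Qp_R[simp]: "Qp (R y) = R y" by (simp add: veq2 R_def)
lemma Pm_R[simp]: "Pm (R y) = R y" by (simp add: veq2 R_def)
lemma Pm_rl: "Pm (rl y) = R y" by (simp add: veq2 R_def ceq)
lemma cj_R[simp]: "cj (R y) = R y" by (simp add: R_def)
lemma dr_dr[simp]: "dr (dr y) = dr y" by (simp add: veq)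
lemma R_dr[simp]: "R (dr y) = R y" by (simp add: R_def)
lemma pk_pk[simp]: "pk (pk y) = pk y" by (simp add: veq)
lemma Qp0[simp]: "Qp 0 = 0" and Pm0[simp]: "Pm 0 = 0" by (simp_all add: veq2)
lemma dr0[simp]: "dr 0 = 0" and pk0[simp]: "pk 0 = 0" by (simp_all add: veq)
lemma R0[simp]: "R 0 = 0" by (simp add: R_def)
lemma cj_Qp: "cj (Qp X) = Qp (cj (Qp X))" by (simp add: veq2)

lemma WQp[simp]: "k:{a,b} ==> W k (Qp X) = W k X" using WQ by (simp add: Qp_def)
lemma TQp[simp]: "k:{a,b} ==> T k (Qp X) = T k X" using TQ by (simp add: Qp_def)
lemma T_cj: "k:{a,b} ==> T k (Qp X) = cnj (W k (cj (Qp X)))"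
 by (rule Tdef) (simp_all add: veq2)
lemma T0: "k:{a,b} ==> T k 0 = 0" using T_cj[of k 0] W0[of k] by simp

lemma bl_Qp: "blin Qp" unfolding lcb[symmetric]
 by (rule linearI) (simp_all add: veq2)
lemma bl_Pm: "blin Pm" unfolding lcb[symmetric]
 by (rule linearI) (simp_all add: veq2 ceq field_simps)
lemma bl_dr: "blin dr" unfolding lcb[symmetric]
 by (rule linearI) (simp_all add: veq ceq)
lemma bl_R: "blin R" unfolding lcb[symmetric]
 by (rule linearI) (simp_all add: veq2 R_def ceq)

lemma vger_linear:
 assumes "blin F" "!!c v. F (c *s v) = c *s F v" shows "vger F" "dd F X = F" "vdiff F X"
proof -
 have 1: "(F HD F) (at X)" for X by (rule blhd[OF assms(1)])
 have 2: "vdiff F X" for X unfolding vdiff_alt using 1 assms(2) by blast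
 show "vger F" by (simp add: vger_def 2)
 show "vdiff F X" by (rule 2)
 show "dd F X = F" using frechet_derivative_at[OF 1] by simp
qed

lemma Qp_smult: "Qp (c *s X) = c *s Qp X" by (simp add: veq2)
lemma Pm_smult: "Pm (c *s X) = c *s Pm X" by (simp add: veq2 algebra_simps)

lemmas vger_Qp = vger_linear[OF bl_Qp Qp_smult]
lemmas vger_Pm = vger_linear[OF bl_Pm Pm_smult]

lemma ev_R: "NEAR X. P X ==> NEAR y. P (R y)"
 by (rule ev_nhds_compose[where F=R and b=0, rotated 2]) (simp_all add: lincont[OF bl_R])
lemma ev_Qp: "NEAR X. P X ==> NEAR X. P (Qp X)"
 by (rule ev_compose[OF vger_Qp(1) Qp0])

text \<open>\<open>Pm\<close> averages the two entries for a and for b, so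
  \<open>Pm (rl y) = R y\<close> and the identity theorem of the doubled space applies to the
  composite of F with \<open>Pm\<close>.\<close>

lemma identity_M:
 assumes "ger F" "NEAR y. F (R y) = 0" shows "NEAR X. F (Qp X) = 0"
proof -
 have "NEAR X. F (Pm X) = 0"
 by (rule germ_identity[OF ger_compose[OF vger_Pm(1) Pm0 assms(1)]]) (simp add: Pm_rl assms(2))
 from ev_Qp[OF this] show ?thesis by simp
qed

lemma vger_zW: "vger zW" unfolding vger_iff zW_def by (auto intro!: ger_if gW)
lemma vger_zT: "vger zT" unfolding vger_iff zT_def by (auto intro!: ger_if gT)
lemma vger_kap: "vger kap" unfolding vger_iff
proof
 fix k show "ger (%X. kap X$k)" by (cases k) (auto simp: kap_nth intro!: ger_if gW)
qed
lemma vger_kas: "vger kas" unfolding vger_iff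
proof
 fix k show "ger (%X. kas X$k)" by (cases k) (auto simp: kas_nth intro!: ger_if gT)
qed
lemma zW0[simp]: "zW 0 = 0" by (simp add: veq zW_nth W0)
lemma zT0[simp]: "zT 0 = 0" by (simp add: veq zT_nth T0)
lemma kap0[simp]: "kap 0 = 0" by (simp add: veq2 kap_nth W0)
lemma kas0[simp]: "kas 0 = 0" by (simp add: veq2 kas_nth T0)

lemma dd_if: "dd (%x. if P then f x else g x) x v = (if P then dd f x v else dd g x v)" by simp

lemma dd_nth: "dd (%x. x$i) x v = v$i" for v :: "complex^'m" by (rule dd_eqI[OF nth_has_derivative])

lemma dd_kap0: "dd kap 0 V = V"
 unfolding veq2 vdiffD(2)[OF vgerD0[OF vger_kap]] kap_nth
 using dW0 by (auto simp: dd_nth dd_if)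
lemma dd_kas0: "dd kas 0 V = V"
 unfolding veq2 vdiffD(2)[OF vgerD0[OF vger_kas]] kas_nth
 using dT0 by (auto simp: dd_nth dd_if)

lemma inj_kap: "inj (dd kap 0)" by (rule injI) (simp add: dd_kap0)
lemma inj_kas: "inj (dd kas 0)" by (rule injI) (simp add: dd_kas0)

text \<open>Inverse germs are fixed by choice, so that the vector fields built from them are
  constants of the locale.\<close>

definition kai where "kai = (SOME G. vger G & G 0 = 0 & (NEAR x. G (kap x) = x) & (NEAR y. kap (G y) = y))"
definition ksi where "ksi = (SOME G. vger G & G 0 = 0 & (NEAR x. G (kas x) = x) & (NEAR y. kas (G y) = y))"

lemma kai: "vger kai" "kai 0 = 0" "NEAR x. kai (kap x) = x" "NEAR y. kap (kai y) = y"
proof -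
 have "EX G. vger G & G 0 = 0 & (NEAR x. G (kap x) = x) & (NEAR y. kap (G y) = y)"
 by (rule germ_inverse[OF vger_kap kap0 inj_kap]) blast
 from someI_ex[OF this] show "vger kai" "kai 0 = 0" "NEAR x. kai (kap x) = x" "NEAR y. kap (kai y) = y"
 unfolding kai_def by blast+
qed

lemma ksi: "vger ksi" "ksi 0 = 0" "NEAR x. ksi (kas x) = x" "NEAR y. kas (ksi y) = y"
proof -
 have "EX G. vger G & G 0 = 0 & (NEAR x. G (kas x) = x) & (NEAR y. kas (G y) = y)"
 by (rule germ_inverse[OF vger_kas kas0 inj_kas]) blast
 from someI_ex[OF this] show "vger ksi" "ksi 0 = 0" "NEAR x. ksi (kas x) = x" "NEAR y. kas (ksi y) = y"
 unfolding ksi_def by blast+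
qed

text \<open>The (0,1) fields of M, extended to the complexification: d/dzeta_i in the coordinates
  \<open>kap\<close>, which keep \<open>zW\<close> constant, made tangent by
  \<open>Qp\<close>.\<close>

definition eb :: "'n => complex^('n+'n) => complex^('n+'n)" where
 "eb i X = Qp (dd kai (kap X) (ax (Inr i)))"
text \<open>The (1,0) fields: d/dz_j in the coordinates \<open>kas\<close>, in which the values of T
  and zeta stay constant.\<close>

definition el :: "'n => complex^('n+'n) => complex^('n+'n)" where
 "el j X = Qp (dd ksi (kas X) (ax (Inl j)))"

lemma vger_dd:
 assumes "vger F" shows "vger (%x. dd F x v)"
 unfolding vger_iff
proof
 fix i
 have "ger (%x. dd (%x. F x$i) x v)" by (rule ger_dd[OF vger_nth[OF assms]])
 moreover have "NEAR x. dd (%x. F x$i) x v = dd F x v$i"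
 using assms unfolding vger_def by eventually_elim (simp add: vdiffD(2))
 ultimately show "ger (%x. dd F x v$i)" by (rule ger_cong)
qed

lemma vger_eb: "vger (eb i)"
 unfolding eb_def
 by (rule vger_iff[THEN iffD2], rule allI, rule vger_nth)
 (rule vger_iff[THEN iffD2], rule allI, rename_tac k l, case_tac l,
 auto intro!: ger_if vger_nth[OF vger_compose[OF vger_kap kap0 vger_dd[OF kai(1)]]])
lemma vger_el: "vger (el i)"
 unfolding el_def
 by (rule vger_iff[THEN iffD2], rule allI, rule vger_nth)
 (rule vger_iff[THEN iffD2], rule allI, rename_tac k l, case_tac l,
 auto intro!: ger_if vger_nth[OF vger_compose[OF vger_kas kas0 vger_dd[OF ksi(1)]]])

lemma Qp_eb[simp]: "Qp (eb i X) = eb i X" by (simp add: eb_def)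
lemma Qp_el[simp]: "Qp (el i X) = el i X" by (simp add: el_def)

lemma ev_kai: "NEAR X. P X ==> NEAR Y. P (kai Y)" by (rule ev_compose[OF kai(1,2)])
lemma ev_ksi: "NEAR X. P X ==> NEAR Y. P (ksi Y)" by (rule ev_compose[OF ksi(1,2)])
lemma ev_kap: "NEAR X. P X ==> NEAR Y. P (kap Y)" by (rule ev_compose[OF vger_kap kap0])
lemma ev_kas: "NEAR X. P X ==> NEAR Y. P (kas Y)" by (rule ev_compose[OF vger_kas kas0])

text \<open>Functions on the complexification of \<open>M\<close> are germs \<open>F\<close> with \<open>F (Qp X) = F X\<close>; in the coordinates
 \<open>kap\<close> (resp. \<open>kas\<close>) those annihilated by all \<open>eb i\<close> (resp. \<open>el j\<close>) are functions of \<open>zW\<close> (resp. \<open>zT\<close>).\<close>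

lemma ddF_Qp:
 assumes "ger F" "!!X. F (Qp X) = F X"
 shows "NEAR X. ALL V. dd F X (Qp V) = dd F X V"
 using assms(1)[unfolded ger_def] ev_Qp[OF assms(1)[unfolded ger_def]]
proof eventually_elim
 case (elim X)
 have "dd F X V = dd F (Qp X) (Qp V)" for V
 proof -
 have "dd (%X. F (Qp X)) X V = dd F (Qp X) (dd Qp X V)"
 by (rule cdiff_compose(2)[OF vger_Qp(3) elim(2)])
 thus ?thesis using assms(2) vger_Qp(2) by simp
 qed
 from this[of "Qp V" for V] this show ?case by simp
qed

lemma dd_Inr_ab:
 assumes "ger F" "!!X. F (Qp X) = F X" "k:{a,b}"
 shows "NEAR X. dd F X (ax (Inr k)) = 0"
 using ddF_Qp[OF assms(1,2)] assms(1)[unfolded ger_def]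
proof eventually_elim
 case (elim X)
 have "Qp (ax (Inr k)) = 0" using assms(3) by (auto simp: veq2 axis_def)
 thus ?case using elim(1)[rule_format, of "ax (Inr k)"] dd_zero_vec[OF elim(2)] by simp
qed

lemma kills_Lb:
 assumes F: "ger F" "!!X. F (Qp X) = F X"
 and L: "!!i. i ~: {a,b} ==> NEAR X. dd F X (eb i X) = 0"
 defines "F1 \<equiv> %y. F (kai (cpl y 0))"
 shows "ger F1" "NEAR X. F X = F1 (zW X)"
proof -
 have vc: "vger (%y. cpl y (0::complex^'n))" unfolding vger_iff
 proof
 fix k show "ger (%y. cpl y (0::complex^'n)$k)" by (cases k) simp_all
 qed
 have gk: "ger (%Y. F (kai Y))" by (rule ger_compose[OF kai(1,2) F(1)])
 show "ger F1" unfolding F1_def by (rule ger_compose[OF vc _ gk]) simp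
 have "NEAR Y. dd (%Y. F (kai Y)) Y (ax k) = 0" if k: "k:range Inr" for k
 proof -
 obtain i where i: "k = Inr i" using k by blast
 have t: "NEAR Y. dd (%Y. F (kai Y)) Y (ax k) = dd F (kai Y) (dd kai Y (ax k))"
 using dd_compose_germ[OF kai(1,2) F(1)] by eventually_elim simp
 show ?thesis
 proof (cases "i:{a,b}")
 case False
 from t ev_kai[OF L[OF False]] ev_kai[OF ddF_Qp[OF F]] kai(4) show ?thesis
 by eventually_elim (simp add: eb_def i)
 next
 case True
 \<comment> \<open>shifting the dummy coordinate \<open>Inr i\<close> is compatible with \<open>kap\<close>, hence with its inverse\<close>
 have dk: "NEAR X. dd kap X (ax k) = ax k"
 proof -
 have "NEAR X. dd (W a) X (ax (Inr i)) = 0" "NEAR X. dd (W b) X (ax (Inr i)) = 0"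
 using dd_Inr_ab[OF gW _ True] by simp_all
 thus ?thesis using vger_kap[unfolded vger_def]
 proof eventually_elim
 case (elim X)
 show ?case unfolding veq2 vdiffD(2)[OF elim(3)] kap_nth
 using elim(1,2) by (auto simp: dd_nth dd_if i axis_def)
 qed
 qed
 have "NEAR X. ALL V. dd (%X. F (kai (kap X))) X V = dd F X V"
 by (rule dd_cong_germ) (use kai(3) in eventually_elim, simp)
 hence "NEAR X. dd (%Y. F (kai Y)) (kap X) (ax k) = 0"
 using dd_compose_germ[OF vger_kap kap0 gk] dk dd_Inr_ab[OF F True]
 by eventually_elim (metis i)
 from ev_kai[OF this] kai(4) show ?thesis by eventually_elim simp
 qed
 qed
 from indep_germ[OF gk this]
 have "NEAR Y. F (kai Y) = F (kai (\<chi> i. if i:range Inr then 0 else Y$i))" .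
 from ev_kap[OF this] kai(3) show "NEAR X. F X = F1 (zW X)"
 proof eventually_elim
 case (elim X)
 have "(\<chi> i. if i:range Inr then 0 else kap X$i) = cpl (zW X) 0" by (auto simp: veq2 kap_nth zW_nth)
 thus ?case using elim by (simp add: F1_def)
 qed
qed

lemma kills_L:
 assumes F: "ger F" "!!X. F (Qp X) = F X"
 and L: "!!j. j ~: {a,b} ==> NEAR X. dd F X (el j X) = 0"
 defines "F2 \<equiv> %y. F (ksi (cpl (pk y) (y - pk y)))"
 shows "ger F2" "NEAR X. F X = F2 (zT X)"
proof -
 have vc: "vger (%y. cpl (pk y) (y - pk y))" unfolding vger_iff
 proof
 fix k show "ger (%y. cpl (pk y) (y - pk y)$k)" by (cases k) (auto intro!: ger_if ger_diff)
 qed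
 have gk: "ger (%Y. F (ksi Y))" by (rule ger_compose[OF ksi(1,2) F(1)])
 show "ger F2" unfolding F2_def by (rule ger_compose[OF vc _ gk]) simp
 let ?A = "{Inl j |j. j ~: {a,b}} \<union> {Inr k |k. k:{a,b}} :: ('n+'n) set"
 have "NEAR Y. dd (%Y. F (ksi Y)) Y (ax k) = 0" if k: "k:?A" for k
 proof -
 have t: "NEAR Y. dd (%Y. F (ksi Y)) Y (ax k) = dd F (ksi Y) (dd ksi Y (ax k))"
 using dd_compose_germ[OF ksi(1,2) F(1)] by eventually_elim simp
 show ?thesis
 proof (cases "EX j. j ~: {a,b} & k = Inl j")
 case True
 then obtain j where j: "j ~: {a,b}" "k = Inl j" by blast
 from t ev_ksi[OF L[OF j(1)]] ev_ksi[OF ddF_Qp[OF F]] ksi(4) show ?thesis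
 by eventually_elim (simp add: el_def j)
 next
 case False
 then obtain i where i: "i:{a,b}" "k = Inr i" using k by blast
 have dk: "NEAR X. dd kas X (ax k) = ax k"
 proof -
 have "NEAR X. dd (T a) X (ax (Inr i)) = 0" "NEAR X. dd (T b) X (ax (Inr i)) = 0"
 using dd_Inr_ab[OF gT _ i(1)] by simp_all
 thus ?thesis using vger_kas[unfolded vger_def]
 proof eventually_elim
 case (elim X)
 show ?case unfolding veq2 vdiffD(2)[OF elim(3)] kas_nth
 using elim(1,2) by (auto simp: dd_nth dd_if i axis_def)
 qed
 qed
 have "NEAR X. ALL V. dd (%X. F (ksi (kas X))) X V = dd F X V"
 by (rule dd_cong_germ) (use ksi(3) in eventually_elim, simp)
 hence "NEAR X. dd (%Y. F (ksi Y)) (kas X) (ax k) = 0"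
 using dd_compose_germ[OF vger_kas kas0 gk] dk dd_Inr_ab[OF F i(1)]
 by eventually_elim (metis i(2))
 from ev_ksi[OF this] ksi(4) show ?thesis by eventually_elim simp
 qed
 qed
 from indep_germ[OF gk this]
 have "NEAR Y. F (ksi Y) = F (ksi (\<chi> i. if i:?A then 0 else Y$i))" .
 from ev_kas[OF this] ksi(3) show "NEAR X. F X = F2 (zT X)"
 proof eventually_elim
 case (elim X)
 have "(\<chi> i. if i:?A then 0 else kas X$i) = cpl (pk (zT X)) (zT X - pk (zT X))" by (auto simp: veq2 kas_nth zT_nth)
 thus ?case using elim by (simp add: F2_def)
 qed
qed

lemma vger_pk: "vger pk" unfolding vger_iff pk_def by (auto intro!: ger_if)

lemma ev_pk: "NEAR X. P X ==> NEAR Y. P (pk Y)" by (rule ev_compose[OF vger_pk pk0])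

text \<open>The point with zeta = 0 over a given value y of \<open>zW\<close>. Normality gives T = W
  there, so \<open>zT\<close> has the same w-entries as y and vanishing remaining entries.\<close>

lemma zeta_zero:
 "NEAR y. zW (kai (cpl y 0)) = y & zT (kai (cpl y 0)) = pk y"
proof -
 have vc: "vger (%y. cpl y (0::complex^'n))" unfolding vger_iff
 proof
 fix k show "ger (%y. cpl y (0::complex^'n)$k)" by (cases k) simp_all
 qed
 have n: "NEAR X. ALL k:{a,b}. (ALL i. i ~: {a,b} --> X$Inr i = 0) --> W k X = T k X"
 using nr by (intro eventually_ball_finite) auto
 have "NEAR y. kap (kai (cpl y (0::complex^'n))) = cpl y 0"
 by (rule ev_compose[OF vc _ kai(4)]) simp
 moreover have "NEAR y. ALL k:{a,b}. (ALL i. i ~: {a,b} --> kai (cpl y (0::complex^'n))$Inr i = 0) --> W k (kai (cpl y 0)) = T k (kai (cpl y 0))"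
 by (rule ev_compose[OF vc _ ev_kai[OF n]]) simp
 ultimately show ?thesis
 proof eventually_elim
 case (elim y)
 let ?X = "kai (cpl y (0::complex^'n))"
 have r: "?X$Inr i = 0" for i using arg_cong[OF elim(1), of "%X. X$Inr i"] by (simp add: kap_nth)
 have l: "zW ?X$i = y$i" for i using arg_cong[OF elim(1), of "%X. X$Inl i"] by (simp add: kap_nth zW_nth)
 have "zT ?X$i = pk y$i" for i
 using elim(2) r l[of i] by (auto simp: zT_nth zW_nth)
 thus ?case using l by (simp add: veq)
 qed
qed

lemma z_zero:
 "NEAR y. zT (ksi (cpl (pk y) (y - pk y))) = y & zW (ksi (cpl (pk y) (y - pk y))) = pk y"
proof -
 have vc: "vger (%y. cpl (pk y) (y - pk y))" unfolding vger_iff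
 proof
 fix k show "ger (%y. cpl (pk y) (y - pk y)$k)" by (cases k) (auto intro!: ger_if ger_diff)
 qed
 have n: "NEAR X. ALL k:{a,b}. (ALL i. i ~: {a,b} --> X$Inl i = 0) --> W k X = T k X"
 using nl by (intro eventually_ball_finite) auto
 have "NEAR y. kas (ksi (cpl (pk y) (y - pk y))) = cpl (pk y) (y - pk y)"
 by (rule ev_compose[OF vc _ ksi(4)]) simp
 moreover have "NEAR y. ALL k:{a,b}. (ALL i. i ~: {a,b} --> ksi (cpl (pk y) (y - pk y))$Inl i = 0) --> W k (ksi (cpl (pk y) (y - pk y))) = T k (ksi (cpl (pk y) (y - pk y)))"
 by (rule ev_compose[OF vc _ ev_ksi[OF n]]) simp
 ultimately show ?thesis
 proof eventually_elim
 case (elim y)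
 let ?X = "ksi (cpl (pk y) (y - pk y))"
 have r: "?X$Inr i = y$i - pk y$i" for i using arg_cong[OF elim(1), of "%X. X$Inr i"] by (simp add: kas_nth)
 have l: "(if i:{a,b} then T i ?X else ?X$Inl i) = pk y$i" for i using arg_cong[OF elim(1), of "%X. X$Inl i"] by (simp add: kas_nth)
 have z: "ALL i. i ~: {a,b} --> ?X$Inl i = 0" using l by (metis pk_nth)
 have 1: "zT ?X$i = y$i" for i using r[of i] l[of i] by (auto simp: zT_nth)
 have 2: "zW ?X$i = pk y$i" for i
 using elim(2) z l[of i] by (auto simp: zW_nth)
 show ?case using 1 2 by (simp add: veq)
 qed
qed

text \<open>The object through which all implications to (iii) pass: a germ in w alone with nonzero
  differential. At real points T is the conjugate of W, so the equation says that g takes the same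
  value at w and at its conjugate on M; \<open>real_good_g\<close> later makes g real on M.\<close>

definition good_g :: "(complex^'n => complex) => bool" where
 "good_g g <-> ger g & (ALL y. g (pk y) = g y) & (NEAR X. g (zW X) = g (zT X)) &
 (dd g 0 (ax a) ~= 0 | dd g 0 (ax b) ~= 0)"

lemma dd_zW0: "dd zW 0 V = lc V"
 unfolding veq vdiffD(2)[OF vgerD0[OF vger_zW]] zW_nth
 using dW0 by (auto simp: dd_nth dd_if)

text \<open>F is a function F1 of \<open>zW\<close> and also a function F2 of \<open>zT\<close>.
  Restricting F1(zW) = F2(zT) to zeta = 0 and to z = 0 shows that both depend on the w-entries alone
  and coincide.\<close>

lemma CR_real:
 assumes F: "ger F" "!!X. F (Qp X) = F X"
 and Lb: "!!i. i ~: {a,b} ==> NEAR X. dd F X (eb i X) = 0"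
 and L: "!!j. j ~: {a,b} ==> NEAR X. dd F X (el j X) = 0"
 and nz: "dd F 0 V ~= 0"
 shows "EX g. good_g g"
proof -
 define F1 where "F1 = (%y. F (kai (cpl y 0)))"
 define F2 where "F2 = (%y. F (ksi (cpl (pk y) (y - pk y))))"
 have f11: "ger F1" unfolding F1_def by (rule kills_Lb(1)[OF F Lb])
 have f12: "NEAR X. F X = F1 (zW X)" unfolding F1_def by (rule kills_Lb(2)[OF F Lb])
 have f22: "NEAR X. F X = F2 (zT X)" unfolding F2_def by (rule kills_L(2)[OF F L])
 have vc: "vger (%y. cpl y (0::complex^'n))" unfolding vger_iff
 proof
 fix k show "ger (%y. cpl y (0::complex^'n)$k)" by (cases k) simp_all
 qed
 have vd: "vger (%y. cpl (pk y) (y - pk y))" unfolding vger_iff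
 proof
 fix k show "ger (%y. cpl (pk y) (y - pk y)$k)" by (cases k) (auto intro!: ger_if ger_diff)
 qed
 have "NEAR X. F1 (zW X) = F2 (zT X)" using f12 f22 by eventually_elim simp
 note e12 = this
 have "NEAR y. F1 (zW (kai (cpl y 0))) = F2 (zT (kai (cpl y 0)))"
 by (rule ev_compose[OF vc _ ev_kai[OF e12]]) simp
 hence a1: "NEAR y. F1 y = F2 (pk y)" using zeta_zero by eventually_elim simp
 have "NEAR y. F1 (zW (ksi (cpl (pk y) (y - pk y)))) = F2 (zT (ksi (cpl (pk y) (y - pk y))))"
 by (rule ev_compose[OF vd _ ev_ksi[OF e12]]) simp
 hence a2: "NEAR y. F1 (pk y) = F2 y" using z_zero by eventually_elim simp
 define g where "g y = F1 (pk y)" for y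
 have gg: "ger g" unfolding g_def by (rule ger_compose[OF vger_pk pk0 f11])
 have b1: "NEAR y. F1 y = g y" using a1 ev_pk[OF a1] by eventually_elim (simp add: g_def)
 have b2: "NEAR y. F2 y = g y" using a2 by eventually_elim (simp add: g_def)
 have w: "NEAR X. F X = g (zW X)" using f12 ev_compose[OF vger_zW zW0 b1] by eventually_elim simp
 have t: "NEAR X. F X = g (zT X)" using f22 ev_compose[OF vger_zT zT0 b2] by eventually_elim simp
 have "NEAR X. ALL V. dd F X V = dd (%X. g (zW X)) X V" by (rule dd_cong_germ[OF w])
 from ev_x[OF this] have "dd (%X. g (zW X)) 0 V ~= 0" using nz by simp
 moreover have "dd (%X. g (zW X)) 0 V = dd g (zW 0) (dd zW 0 V)"
 by (rule cdiff_compose(2)[OF vgerD0[OF vger_zW]]) (simp add: gerD0[OF gg])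
 ultimately have d: "dd g 0 (lc V) ~= 0" by (simp add: dd_zW0)
 have dj: "dd g 0 (ax j) = 0" if "j ~: {a,b}" for j
 proof -
 have "dd (%y. g (pk y)) 0 (ax j) = dd g (pk 0) (dd pk 0 (ax j))"
 by (rule cdiff_compose(2)[OF vgerD0[OF vger_pk]]) (simp add: gerD0[OF gg])
 moreover have "dd pk 0 (ax j) = 0"
 unfolding veq vdiffD(2)[OF vgerD0[OF vger_pk]] pk_nth using that
 by (auto simp: dd_nth dd_if axis_def dd_eqI[OF has_derivative_const])
 moreover have "(%y. g (pk y)) = g" by (simp add: g_def fun_eq_iff)
 ultimately show ?thesis by (simp add: dd_zero_vec[OF gerD0[OF gg]])
 qed
 have "dd g 0 (ax a) ~= 0 | dd g 0 (ax b) ~= 0"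
 proof (rule ccontr)
 assume "\<not> (dd g 0 (ax a) ~= 0 | dd g 0 (ax b) ~= 0)"
 hence "dd g 0 (ax j) = 0" for j using dj[of j] by auto
 thus False using d dd_expand[OF gerD0[OF gg], of "lc V"] by simp
 qed
 moreover have "NEAR X. g (zW X) = g (zT X)" using w t by eventually_elim simp
 ultimately show ?thesis using gg unfolding good_g_def by (intro exI[of _ g]) (simp add: g_def)
qed

end

section \<open>CR functions on the real points and the quotient argument\<close>

lemma cmult_real_iff: "Im (u * cnj v) = 0 <-> u * cnj v = v * cnj u"
 by (auto simp: ceq)

context nf
begin

lemma R_has_derivative:
 assumes "ger F"
 shows "NEAR y. ((%y. F (R y)) HD (%u. dd F (R y) (R u))) (at y)"
 using ev_R[OF assms[unfolded ger_def]]
proof eventually_elim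
 case (elim y)
 show ?case
 by (rule hdc[OF blhd[OF bl_R] cdiffD[OF elim]])
qed

text \<open>The real derivative of f, extended complex linearly to the vector e. The two arguments
  are the real and the imaginary part of e with respect to \<open>cj\<close>, which for
  \<open>Qp e = e\<close> are of the form \<open>R u\<close>.\<close>

definition CRd :: "(complex^'n => complex) => complex^'n => complex^('n+'n) => complex" where
 "CRd f y e = dd f y (lc ((1/2) *s (e+cj e)))+\<i> * dd f y (lc ((1/(2*\<i>)) *s (e - cj e)))"

lemma R_lc: assumes "Qp e = e"
 shows "R (lc ((1/2) *s (e+cj e))) = (1/2) *s (e+cj e)" "R (lc ((1/(2*\<i>)) *s (e - cj e))) = (1/(2*\<i>)) *s (e - cj e)"
proof -
 have e: "e$Inr k = e$Inl k" if "k:{a,b}" for k using arg_cong[OF assms, of "%X. X$Inr k"] that by auto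
 show "R (lc ((1/2) *s (e+cj e))) = (1/2) *s (e+cj e)" "R (lc ((1/(2*\<i>)) *s (e - cj e))) = (1/(2*\<i>)) *s (e - cj e)"
 using e by (auto simp: veq2 R_def ceq)
qed

lemma CRd_hol:
 assumes "ger F" shows "NEAR y. ALL e. Qp e = e --> CRd (%y. F (R y)) y e = dd F (R y) e"
 using R_has_derivative[OF assms] ev_R[OF assms[unfolded ger_def]]
proof eventually_elim
 case (elim y)
 show ?case
 proof (intro allI impI)
 fix e assume e: "Qp e = e"
 have "CRd (%y. F (R y)) y e = dd F (R y) ((1/2) *s (e+cj e))+\<i> * dd F (R y) ((1/(2*\<i>)) *s (e - cj e))"
 unfolding CRd_def dd_eqI[OF elim(1)] R_lc[OF e] ..
 also have "\<dots> = dd F (R y) ((1/2) *s (e+cj e)+\<i> *s ((1/(2*\<i>)) *s (e - cj e)))"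
 by (simp only: dd_add_vec[OF elim(2)] cdiff_scale[OF elim(2)])
 also have "(1/2) *s (e+cj e)+\<i> *s ((1/(2*\<i>)) *s (e - cj e)) = e"
 by (simp add: veq field_simps)
 finally show "CRd (%y. F (R y)) y e = dd F (R y) e" .
 qed
qed

lemma CRd_cong:
 assumes "NEAR y. f y = g y" shows "NEAR y. ALL e. CRd f y e = CRd g y e"
 using dd_cong_germ[OF assms]
proof eventually_elim
 case (elim y)
 thus ?case by (simp only: CRd_def) simp
qed

lemma R_nth: "R y$Inl i = dr y$i" "R y$Inr i = cnj (dr y$i)" by (simp_all add: R_def)

lemma ddF_QpQp:
 assumes "ger F" "!!X. F (Qp X) = F X"
 shows "NEAR X. ALL V. dd F X V = dd F (Qp X) (Qp V)"
 using ev_Qp[OF assms(1)[unfolded ger_def]]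
proof eventually_elim
 case (elim X)
 have "dd (%X. F (Qp X)) X V = dd F (Qp X) (dd Qp X V)" for V
 by (rule cdiff_compose(2)[OF vger_Qp(3) elim])
 thus ?case using assms(2) vger_Qp(2) by simp
qed

lemma kap_inv_dd:
 "NEAR X. ALL V. dd kai (kap X) (dd kap X V) = V"
 "NEAR X. ALL V. dd kap X (dd kai (kap X) V) = V"
proof -
 have 1: "NEAR X. ALL V. dd (%X. kai (kap X)) X V = dd (%X. X) X V"
 by (rule dd_cong_germ) (use kai(3) in eventually_elim, simp)
 show "NEAR X. ALL V. dd kai (kap X) (dd kap X V) = V"
 using 1 vger_kap[unfolded vger_def] ev_kap[OF kai(1)[unfolded vger_def]]
 proof eventually_elim
 case (elim X)
 have "dd (%X. X) X V = V" for V :: "complex^('n+'n)" by (rule dd_eqI[OF has_derivative_ident])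
 thus ?case using elim(1) vdiff_compose(2)[OF elim(2,3)] by simp
 qed
 have 2: "NEAR Y. ALL V. dd (%Y. kap (kai Y)) Y V = dd (%X. X) Y V"
 by (rule dd_cong_germ) (use kai(4) in eventually_elim, simp)
 have "NEAR Y. ALL V. dd kap (kai Y) (dd kai Y V) = V"
 using 2 kai(1)[unfolded vger_def] ev_kai[OF vger_kap[unfolded vger_def]]
 proof eventually_elim
 case (elim Y)
 have "dd (%X. X) Y V = V" for V :: "complex^('n+'n)" by (rule dd_eqI[OF has_derivative_ident])
 thus ?case using elim(1) vdiff_compose(2)[OF elim(2,3)] by simp
 qed
 from ev_kap[OF this] kai(3) show "NEAR X. ALL V. dd kap X (dd kai (kap X) V) = V"
 by eventually_elim simp
qed

lemma kas_inv_dd: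
 "NEAR X. ALL V. dd ksi (kas X) (dd kas X V) = V"
 "NEAR X. ALL V. dd kas X (dd ksi (kas X) V) = V"
proof -
 have 1: "NEAR X. ALL V. dd (%X. ksi (kas X)) X V = dd (%X. X) X V"
 by (rule dd_cong_germ) (use ksi(3) in eventually_elim, simp)
 show "NEAR X. ALL V. dd ksi (kas X) (dd kas X V) = V"
 using 1 vger_kas[unfolded vger_def] ev_kas[OF ksi(1)[unfolded vger_def]]
 proof eventually_elim
 case (elim X)
 have "dd (%X. X) X V = V" for V :: "complex^('n+'n)" by (rule dd_eqI[OF has_derivative_ident])
 thus ?case using elim(1) vdiff_compose(2)[OF elim(2,3)] by simp
 qed
 have 2: "NEAR Y. ALL V. dd (%Y. kas (ksi Y)) Y V = dd (%X. X) Y V"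
 by (rule dd_cong_germ) (use ksi(4) in eventually_elim, simp)
 have "NEAR Y. ALL V. dd kas (ksi Y) (dd ksi Y V) = V"
 using 2 ksi(1)[unfolded vger_def] ev_ksi[OF vger_kas[unfolded vger_def]]
 proof eventually_elim
 case (elim Y)
 have "dd (%X. X) Y V = V" for V :: "complex^('n+'n)" by (rule dd_eqI[OF has_derivative_ident])
 thus ?case using elim(1) vdiff_compose(2)[OF elim(2,3)] by simp
 qed
 from ev_kas[OF this] ksi(3) show "NEAR X. ALL V. dd kas X (dd ksi (kas X) V) = V"
 by eventually_elim simp
qed

lemma kap_dd_nth: assumes "vdiff kap X"
 shows "dd kap X V$Inl i = (if i:{a,b} then dd (W i) X V else V$Inl i)" "dd kap X V$Inr i = V$Inr i"
 unfolding vdiffD(2)[OF assms] kap_nth dd_if dd_nth by simp_all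

lemma kas_dd_nth: assumes "vdiff kas X"
 shows "dd kas X V$Inl i = (if i:{a,b} then dd (T i) X V else V$Inl i)" "dd kas X V$Inr i = V$Inr i"
 unfolding vdiffD(2)[OF assms] kas_nth dd_if dd_nth by simp_all

lemma ev_W: "NEAR X. ALL k:{a,b}. cdiff (W k) X & (ALL V. dd (W k) X V = dd (W k) (Qp X) (Qp V))"
proof (rule eventually_ball_finite)
 show "ALL k:{a,b}. NEAR X. cdiff (W k) X & (ALL V. dd (W k) X V = dd (W k) (Qp X) (Qp V))"
 using gW[unfolded ger_def] ddF_QpQp[OF gW] by (intro ballI eventually_conj) auto
qed simp

lemma ev_T: "NEAR X. ALL k:{a,b}. cdiff (T k) X & (ALL V. dd (T k) X V = dd (T k) (Qp X) (Qp V))"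
proof (rule eventually_ball_finite)
 show "ALL k:{a,b}. NEAR X. cdiff (T k) X & (ALL V. dd (T k) X V = dd (T k) (Qp X) (Qp V))"
 using gT[unfolded ger_def] ddF_QpQp[OF gT] by (intro ballI eventually_conj) auto
qed simp

text \<open>For independence of the repeated entries, the preimages v1 and v2 of one axis vector,
  taken at X and at \<open>Qp X\<close>, are compared: the derivative of \<open>kap\<close> at X
  sends their difference to 0, and it is injective. The other claims are read off from the
  components of \<open>kap\<close>.\<close>

lemma eb_props:
 assumes "i ~: {a,b}"
 shows "NEAR X. (ALL k:{a,b}. dd (W k) X (eb i X) = 0) & (ALL j. j ~: {a,b} --> eb i X$Inl j = 0) & eb i (Qp X) = eb i X"
 using kap_inv_dd(1) kap_inv_dd(2) ev_Qp[OF kap_inv_dd(2)] vger_kap[unfolded vger_def] ev_Qp[OF vger_kap[unfolded vger_def]] ev_W ev_Qp[OF ev_W]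
proof eventually_elim
 case (elim X)
 define v1 where "v1 = dd kai (kap X) (ax (Inr i))"
 define v2 where "v2 = dd kai (kap (Qp X)) (ax (Inr i))"
 have k1: "dd kap X v1 = ax (Inr i)" using elim(2) by (simp add: v1_def)
 have k2: "dd kap (Qp X) v2 = ax (Inr i)" using elim(3) by (simp add: v2_def)
 have w1: "dd (W k) X v1 = 0" if "k:{a,b}" for k
 using arg_cong[OF k1, of "%v. v$Inl k"] that unfolding kap_dd_nth[OF elim(4)] by (simp add: axis_def)
 have w2: "dd (W k) (Qp X) v2 = 0" if "k:{a,b}" for k
 using arg_cong[OF k2, of "%v. v$Inl k"] that unfolding kap_dd_nth[OF elim(5)] by (simp add: axis_def)
 have w2': "dd (W k) X v2 = 0" if k: "k:{a,b}" for k
 proof -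
 have "dd (W k) X v2 = dd (W k) (Qp X) (Qp v2)" using elim(6) k by blast
 moreover have "dd (W k) (Qp X) v2 = dd (W k) (Qp (Qp X)) (Qp v2)" using elim(7) k by blast
 ultimately show ?thesis using w2[OF k] by (simp only: Qp_Qp)
 qed
 have l1: "v1$Inl j = 0" if "j ~: {a,b}" for j
 using arg_cong[OF k1, of "%v. v$Inl j"] that unfolding kap_dd_nth[OF elim(4)] by (simp add: axis_def)
 have l2: "v2$Inl j = 0" if "j ~: {a,b}" for j
 using arg_cong[OF k2, of "%v. v$Inl j"] that unfolding kap_dd_nth[OF elim(5)] by (simp add: axis_def)
 have r1: "v1$Inr j = (ax (Inr i) :: complex^('n+'n))$Inr j" for j
 using arg_cong[OF k1, of "%v. v$Inr j"] unfolding kap_dd_nth[OF elim(4)] .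
 have r2: "v2$Inr j = (ax (Inr i) :: complex^('n+'n))$Inr j" for j
 using arg_cong[OF k2, of "%v. v$Inr j"] unfolding kap_dd_nth[OF elim(5)] .
 have cd: "cdiff (W k) X" if "k:{a,b}" for k using elim(6) that by blast
 have lin: "dd (W k) X (v1 - v2) = dd (W k) X v1 - dd (W k) X v2" if "k:{a,b}" for k
 by (rule linear_diff[OF bllin[OF cdiff_linear[OF cd[OF that]]]])
 have "dd kap X (v1 - v2) = 0"
 unfolding veq2 kap_dd_nth[OF elim(4)] using lin w1 w2' l1 l2 r1 r2 by auto
 hence "v1 - v2 = dd kai (kap X) 0" using elim(1)[rule_format, of "v1 - v2"] by simp
 moreover have "dd kai (kap X) 0 = 0"
 proof -
 have "dd kap X 0 = 0"
 unfolding veq2 kap_dd_nth[OF elim(4)] using dd_zero_vec[OF cd] by auto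
 thus ?thesis using elim(1)[rule_format, of 0] by simp
 qed
 ultimately have v12: "v1 = v2" by simp
 have "dd (W k) X (eb i X) = 0" if k: "k:{a,b}" for k
 proof -
 have "dd (W k) X (Qp v1) = dd (W k) (Qp X) (Qp (Qp v1))" using elim(6) k by blast
 also have "\<dots> = dd (W k) (Qp X) (Qp v1)" by simp
 also have "\<dots> = dd (W k) X v1" using elim(6) k by metis
 finally show ?thesis using w1[OF k] by (simp add: eb_def v1_def)
 qed
 thus ?case using l1 v12 by (simp add: eb_def v1_def v2_def)
qed

lemma el_props:
 assumes "i ~: {a,b}"
 shows "NEAR X. (ALL k:{a,b}. dd (T k) X (el i X) = 0) & (ALL j. j ~: {a,b} --> el i X$Inr j = 0) & el i (Qp X) = el i X"
 using kas_inv_dd(1) kas_inv_dd(2) ev_Qp[OF kas_inv_dd(2)] vger_kas[unfolded vger_def] ev_Qp[OF vger_kas[unfolded vger_def]] ev_T ev_Qp[OF ev_T]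
proof eventually_elim
 case (elim X)
 define v1 where "v1 = dd ksi (kas X) (ax (Inl i))"
 define v2 where "v2 = dd ksi (kas (Qp X)) (ax (Inl i))"
 have k1: "dd kas X v1 = ax (Inl i)" using elim(2) by (simp add: v1_def)
 have k2: "dd kas (Qp X) v2 = ax (Inl i)" using elim(3) by (simp add: v2_def)
 have w1: "dd (T k) X v1 = 0" if "k:{a,b}" for k
 using arg_cong[OF k1, of "%v. v$Inl k"] that assms unfolding kas_dd_nth[OF elim(4)] by (auto simp: axis_def)
 have w2: "dd (T k) (Qp X) v2 = 0" if "k:{a,b}" for k
 using arg_cong[OF k2, of "%v. v$Inl k"] that assms unfolding kas_dd_nth[OF elim(5)] by (auto simp: axis_def)
 have w2': "dd (T k) X v2 = 0" if k: "k:{a,b}" for k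
 proof -
 have "dd (T k) X v2 = dd (T k) (Qp X) (Qp v2)" using elim(6) k by blast
 moreover have "dd (T k) (Qp X) v2 = dd (T k) (Qp (Qp X)) (Qp v2)" using elim(7) k by blast
 ultimately show ?thesis using w2[OF k] by (simp only: Qp_Qp)
 qed
 have l1: "v1$Inl j = (ax (Inl i) :: complex^('n+'n))$Inl j" if "j ~: {a,b}" for j
 using arg_cong[OF k1, of "%v. v$Inl j"] that unfolding kas_dd_nth[OF elim(4)] by simp
 have l2: "v2$Inl j = (ax (Inl i) :: complex^('n+'n))$Inl j" if "j ~: {a,b}" for j
 using arg_cong[OF k2, of "%v. v$Inl j"] that unfolding kas_dd_nth[OF elim(5)] by simp
 have r1: "v1$Inr j = 0" for j
 using arg_cong[OF k1, of "%v. v$Inr j"] unfolding kas_dd_nth[OF elim(4)] by (simp add: axis_def)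
 have r2: "v2$Inr j = 0" for j
 using arg_cong[OF k2, of "%v. v$Inr j"] unfolding kas_dd_nth[OF elim(5)] by (simp add: axis_def)
 have cd: "cdiff (T k) X" if "k:{a,b}" for k using elim(6) that by blast
 have lin: "dd (T k) X (v1 - v2) = dd (T k) X v1 - dd (T k) X v2" if "k:{a,b}" for k
 by (rule linear_diff[OF bllin[OF cdiff_linear[OF cd[OF that]]]])
 have "dd kas X (v1 - v2) = 0"
 unfolding veq2 kas_dd_nth[OF elim(4)] using lin w1 w2' l1 l2 r1 r2 by auto
 hence "v1 - v2 = dd ksi (kas X) 0" using elim(1)[rule_format, of "v1 - v2"] by simp
 moreover have "dd ksi (kas X) 0 = 0"
 proof -
 have "dd kas X 0 = 0"
 unfolding veq2 kas_dd_nth[OF elim(4)] using dd_zero_vec[OF cd] by auto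
 thus ?thesis using elim(1)[rule_format, of 0] by simp
 qed
 ultimately have v12: "v1 = v2" by simp
 have "dd (T k) X (el i X) = 0" if k: "k:{a,b}" for k
 proof -
 have "dd (T k) X (Qp v1) = dd (T k) (Qp X) (Qp (Qp v1))" using elim(6) k by blast
 also have "\<dots> = dd (T k) (Qp X) (Qp v1)" by simp
 also have "\<dots> = dd (T k) X v1" using elim(6) k by metis
 finally show ?thesis using w1[OF k] by (simp add: el_def v1_def)
 qed
 thus ?case using r1 v12 by (simp add: el_def v1_def v2_def)
qed

lemma ger_Qp: "ger F ==> ger (%X. F (Qp X))" by (rule ger_compose[OF vger_Qp(1) Qp0])

lemma kill_from_real:
 assumes F: "ger F" "!!X. F (Qp X) = F X" and i: "i ~: {a,b}"
 and z: "NEAR y. dd F (R y) (eb i (R y)) = 0"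
 shows "NEAR X. dd F X (eb i X) = 0"
 using identity_M[OF ger_dd_vec[OF F(1) vger_eb[of i]] z] eb_props[OF i] ddF_QpQp[OF F]
 by eventually_elim simp

lemma zeta_deriv:
 assumes k: "k:{a,b}"
 shows "NEAR X. (ALL i. i ~: {a,b} --> X$Inr i = 0) --> (ALL V. (ALL i. i ~: {a,b} --> V$Inr i = 0) --> dd (W k) X V = dd (T k) X V)"
 using ev_nhds_nested[OF nr[OF k]] ev_W ev_T
proof eventually_elim
 case (elim X)
 show ?case
 proof (intro allI impI)
 fix V :: "complex^('n+'n)" assume X0: "ALL i. i ~: {a,b} --> X$Inr i = 0" and V0: "ALL i. i ~: {a,b} --> V$Inr i = 0"
 have c: "cdiff (W k) (X+0 *s V)" "cdiff (T k) (X+0 *s V)" using elim(2,3) k by auto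
 have "isCont (%z. X+z *s V) 0"
 by (intro continuous_intros lincont[OF bounded_linear_vsmult])
 from ev_nhds_compose[OF this _ elim(1)]
 have "NEAR z. (ALL i. i ~: {a,b} --> (X+z *s V)$Inr i = 0) --> W k (X+z *s V) = T k (X+z *s V)" by simp
 hence "NEAR z. W k (X+z *s V) = T k (X+z *s V)"
 by eventually_elim (use X0 V0 in simp)
 hence "deriv (%z. W k (X+z *s V)) 0 = deriv (%z. T k (X+z *s V)) 0" by (rule deriv_cong_ev) simp
 thus "dd (W k) X V = dd (T k) X V"
 using DERIV_imp_deriv[OF cdiff_line[OF c(1)]] DERIV_imp_deriv[OF cdiff_line[OF c(2)]] by simp
 qed
qed

text \<open>The w_k-component of the (1,0) field \<open>el j\<close>. Since \<open>eb i\<close>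
  annihilates \<open>W k\<close>, the derivative of this component along \<open>eb i\<close> is the
  commutator of the two fields applied to \<open>W k\<close>, that is, a Levi form
  coefficient.\<close>

definition ell' :: "'n => 'n => complex^('n+'n) => complex" where
 "ell' j k X = dd (W k) (Qp X) (el j (Qp X))"

lemma ger_ell: "k:{a,b} ==> ger (ell' j k)"
 unfolding ell'_def by (rule ger_Qp[OF ger_dd_vec[OF gW vger_el]])

lemma ell_Qp[simp]: "ell' j k (Qp X) = ell' j k X" by (simp add: ell'_def)
lemma ell_ev: assumes "k:{a,b}" "j ~: {a,b}" shows "NEAR X. dd (W k) X (el j X) = ell' j k X"
 using ev_W el_props[OF assms(2)]
proof eventually_elim
 case (elim X)
 have "dd (W k) X (el j X) = dd (W k) (Qp X) (Qp (el j X))" using elim(1) assms(1) by blast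
 thus ?case using elim(2) by (simp add: ell'_def)
qed

text \<open>On zeta = 0 the field \<open>el j\<close> is tangent to that set, where W and T agree;
  so it acts on W as on T, which it annihilates.\<close>

lemma ell_zeta:
 assumes "k:{a,b}" "j ~: {a,b}"
 shows "NEAR X. (ALL i. i ~: {a,b} --> X$Inr i = 0) --> ell' j k X = 0"
 using ev_Qp[OF zeta_deriv[OF assms(1)]] ev_Qp[OF el_props[OF assms(2)]]
proof eventually_elim
 case (elim X)
 show ?case
 proof
 assume z: "ALL i. i ~: {a,b} --> X$Inr i = 0"
 have 1: "ALL i. i ~: {a,b} --> Qp X$Inr i = 0" using z by simp
 have 2: "ALL i. i ~: {a,b} --> el j (Qp X)$Inr i = 0" using elim(2) by blast
 have "dd (W k) (Qp X) (el j (Qp X)) = dd (T k) (Qp X) (el j (Qp X))" using elim(1) 1 2 by blast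
 also have "\<dots> = 0" using elim(2) assms(1) by blast
 finally show "ell' j k X = 0" by (simp add: ell'_def)
 qed
qed

lemma vger_cpl0: "vger (%y. cpl y (0::complex^'n))" unfolding vger_iff
proof
 fix k show "ger (%y. cpl y (0::complex^'n)$k)" by (cases k) simp_all
qed

lemma ev_kai0: assumes "NEAR X. (ALL i. i ~: {a,b} --> X$Inr i = 0) --> P X"
 shows "NEAR y. P (kai (cpl y 0))"
proof -
 have "NEAR y. kap (kai (cpl y (0::complex^'n))) = cpl y 0"
 by (rule ev_compose[OF vger_cpl0 _ kai(4)]) simp
 moreover have "NEAR y. (ALL i. i ~: {a,b} --> kai (cpl y (0::complex^'n))$Inr i = 0) --> P (kai (cpl y 0))"
 by (rule ev_compose[OF vger_cpl0 _ ev_kai[OF assms]]) simp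
 ultimately show ?thesis
 proof eventually_elim
 case (elim y)
 have "kai (cpl y (0::complex^'n))$Inr i = 0" for i using arg_cong[OF elim(1), of "%X. X$Inr i"] by (simp add: kap_nth)
 thus ?case using elim(2) by simp
 qed
qed

text \<open>F is a function of \<open>zW\<close>, and near 0 every value of \<open>zW\<close> is
  attained on zeta = 0.\<close>

lemma kill_zeta_zero:
 assumes F: "ger F" "!!X. F (Qp X) = F X"
 and L: "!!i. i ~: {a,b} ==> NEAR X. dd F X (eb i X) = 0"
 and z: "NEAR X. (ALL i. i ~: {a,b} --> X$Inr i = 0) --> F X = 0"
 shows "NEAR X. F X = 0"
proof -
 have "NEAR X. F X = F (kai (cpl (zW X) 0))" by (rule kills_Lb(2)[OF F L])
 thus ?thesis using ev_compose[OF vger_zW zW0 ev_kai0[OF z]] by eventually_elim simp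
qed

lemma dd_T_conj:
 assumes k: "k:{a,b}"
 shows "NEAR y. ALL u. dd (T k) (R y) (R u) = cnj (dd (W k) (R y) (R u))"
 using R_has_derivative[OF gW[OF k]] R_has_derivative[OF gT[OF k]]
proof eventually_elim
 case (elim y)
 have "(%y. T k (R y)) = (%y. cnj (W k (R y)))" using T_cj[OF k, of "R _"] by (simp add: fun_eq_iff)
 hence "((%y. T k (R y)) HD (%u. cnj (dd (W k) (R y) (R u)))) (at y)"
 using hdc[OF elim(1) blhd[OF bounded_linear_cnj]] by simp
 from has_derivative_unique[OF elim(2) this] show ?case by (simp add: fun_eq_iff)
qed

text \<open>K and C j stand for the components of a conormal of the hypersurface, divided by minus
  the component b. \<open>E3\<close> says that the conormal annihilates the (1,0) fields of M;
  \<open>E4\<close> says that, where all C j vanish, its values on the two real directions s_a and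
  s_b lie on one real line.\<close>

theorem smooth_CR_quotient:
 fixes K :: "complex^'n => complex" and C :: "'n => complex^'n => complex"
 assumes S: "open S" "0:S" "!!k. Ck_on k K S" and Kdr: "!!y. K (dr y) = K y"
 and CK: "!!i. i ~: {a,b} ==> NEAR y. CRd K y (eb i (R y)) = 0"
 and CC: "!!i j. i ~: {a,b} ==> j ~: {a,b} ==> NEAR y. CRd (C j) y (eb i (R y)) = 0"
 and E3: "!!j. j ~: {a,b} ==> NEAR y. C j y = ell' j b (R y) - K y * ell' j a (R y)"
 and E4: "NEAR y. (ALL j. j ~: {a,b} --> C j y = 0) -->
 Im ((dd (W b) (R y) (R (ax a)) - K y * dd (W a) (R y) (R (ax a))) *
 cnj (dd (W b) (R y) (R (ax b)) - K y * dd (W a) (R y) (R (ax b)))) = 0"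
 shows "EX g. good_g g"
proof -
 have Kd: "NEAR y. (K HD dd K y) (at y)"
 using evo[OF S(1,2)] by eventually_elim (rule Ck_has_derivative[OF S(3)[of "Suc 0"]])
 have abI: "a:{a,b}" "b:{a,b}" by auto
 \<comment> \<open>The Levi form of M, component w_k.\<close>
 define mm where "mm i j k X = dd (ell' j k) X (eb i X)" for i j k X
 have gm: "ger (mm i j k)" if "k:{a,b}" for i j k unfolding mm_def by (rule ger_dd_vec[OF ger_ell[OF that] vger_eb])
 \<comment> \<open>\<open>eb i\<close> is applied to \<open>E3\<close>. Both C j and K are
   annihilated, so only the derivatives of the two coefficients \<open>ell'\<close> remain.\<close>
 have S2: "NEAR y. K y * mm i j a (R y) = mm i j b (R y)" if i: "i ~: {a,b}" and j: "j ~: {a,b}" for i j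
 using CRd_cong[OF E3[OF j]] CC[OF i j] CK[OF i] Kd R_has_derivative[OF ger_ell[OF abI(1), of j]]
 R_has_derivative[OF ger_ell[OF abI(2), of j]] CRd_hol[OF ger_ell[OF abI(1), of j]] CRd_hol[OF ger_ell[OF abI(2), of j]]
 proof eventually_elim
 case (elim y)
 let ?e = "eb i (R y)"
 have dv: "dd (%y. ell' j b (R y) - K y * ell' j a (R y)) y u
 = dd (%y. ell' j b (R y)) y u - (K y * dd (%y. ell' j a (R y)) y u+dd K y u * ell' j a (R y))" for u
 unfolding dd_eqI[OF elim(5)] dd_eqI[OF elim(6)]
 by (rule dd_eqI[OF has_derivative_diff[OF elim(6) has_derivative_mult[OF elim(4) elim(5)]]])
 have "CRd (%y. ell' j b (R y) - K y * ell' j a (R y)) y ?e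
 = CRd (%y. ell' j b (R y)) y ?e - K y * CRd (%y. ell' j a (R y)) y ?e - CRd K y ?e * ell' j a (R y)"
 unfolding CRd_def dv by (simp add: algebra_simps)
 moreover have "CRd (%y. ell' j b (R y) - K y * ell' j a (R y)) y ?e = 0" using elim(1,2) by metis
 moreover have "CRd (%y. ell' j b (R y)) y ?e = mm i j b (R y)" "CRd (%y. ell' j a (R y)) y ?e = mm i j a (R y)"
 using elim(7,8) by (simp_all add: mm_def)
 ultimately show ?case using elim(3) by simp
 qed
 show ?thesis
 proof (cases "ALL i j. i ~: {a,b} --> j ~: {a,b} --> (NEAR X. mm i j a X = 0)")
 \<comment> \<open>By \<open>S2\<close> the whole Levi form vanishes. Then \<open>ell' j b\<close>
   is CR and vanishes on zeta = 0, hence vanishes identically, and \<open>W b\<close> is annihilated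
   by both kinds of fields.\<close>
 case True
 have mb: "NEAR X. dd (ell' j b) X (eb i X) = 0" if i: "i ~: {a,b}" and j: "j ~: {a,b}" for i j
 proof (rule kill_from_real[OF ger_ell[OF abI(2)] ell_Qp i])
 have "NEAR X. mm i j a X = 0" using True i j by blast
 from S2[OF i j] ev_R[OF this] show "NEAR y. dd (ell' j b) (R y) (eb i (R y)) = 0"
 by eventually_elim (simp add: mm_def)
 qed
 have lz: "NEAR X. ell' j b X = 0" if j: "j ~: {a,b}" for j
 by (rule kill_zeta_zero[OF ger_ell[OF abI(2)] ell_Qp mb[OF _ j] ell_zeta[OF abI(2) j]])
 show ?thesis
 proof (rule CR_real[OF gW[OF abI(2)] WQp[OF abI(2)], of "ax (Inl b)"])
 fix i assume "i ~: {a,b}" from eb_props[OF this] show "NEAR X. dd (W b) X (eb i X) = 0" by eventually_elim simp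
 next
 fix j assume j: "j ~: {a,b}"
 from ell_ev[OF abI(2) j] lz[OF j] show "NEAR X. dd (W b) X (el j X) = 0" by eventually_elim simp
 next
 show "dd (W b) 0 (ax (Inl b)) ~= 0" by (simp add: dW0 axis_def)
 qed
 next
 case False
 then obtain i0 j0 where i0: "i0 ~: {a,b}" and j0: "j0 ~: {a,b}" and nz: "\<not> (NEAR X. mm i0 j0 a X = 0)" by blast
 have "EX B. ger B & (NEAR x. K x = B (rl x))"
 proof (rule analytic_quotient[OF S, of "%X. mm i0 j0 b (Pm X)" "%X. mm i0 j0 a (Pm X)"])
 show "ger (%X. mm i0 j0 b (Pm X))" "ger (%X. mm i0 j0 a (Pm X))"
 using ger_compose[OF vger_Pm(1) Pm0 gm] by auto
 show "NEAR x. K x * mm i0 j0 a (Pm (rl x)) = mm i0 j0 b (Pm (rl x))"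
 using S2[OF i0 j0] by (simp add: Pm_rl)
 show "\<not> (NEAR X. mm i0 j0 a (Pm X) = 0)"
 proof
 assume "NEAR X. mm i0 j0 a (Pm X) = 0"
 from ev_Qp[OF this] eb_props[OF i0] ddF_QpQp[OF ger_ell[OF abI(1)] ell_Qp, of j0]
 have "NEAR X. mm i0 j0 a X = 0" by eventually_elim (simp add: mm_def)
 thus False using nz by simp
 qed
 qed
 then obtain B where B: "ger B" "NEAR x. K x = B (rl x)" by blast
 define Kh where "Kh X = B (Qp X)" for X
 have gK: "ger Kh" unfolding Kh_def by (rule ger_Qp[OF B(1)])
 have KQ: "Kh (Qp X) = Kh X" for X by (simp add: Kh_def)
 have KR: "NEAR y. Kh (R y) = K y"
 proof -
 have "NEAR y. K (dr y) = B (rl (dr y))"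
 by (rule ev_nhds_compose[where F=dr and b=0, rotated 2, OF B(2)]) (simp_all add: lincont[OF bl_dr])
 thus ?thesis by eventually_elim (simp add: Kh_def Kdr R_def[symmetric])
 qed
 have kK: "NEAR X. dd Kh X (eb i X) = 0" if i: "i ~: {a,b}" for i
 proof (rule kill_from_real[OF gK KQ i])
 show "NEAR y. dd Kh (R y) (eb i (R y)) = 0"
 using CRd_hol[OF gK] CRd_cong[OF KR] CK[OF i] by eventually_elim (metis Qp_eb)
 qed
 define Ch where "Ch j X = ell' j b X - Kh X * ell' j a X" for j X
 have gC: "ger (Ch j)" for j unfolding Ch_def by (intro ger_diff ger_mult ger_ell gK abI)
 have CQ: "Ch j (Qp X) = Ch j X" for j X by (simp add: Ch_def KQ)
 have CR: "NEAR y. Ch j (R y) = C j y" if j: "j ~: {a,b}" for j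
 using KR E3[OF j] by eventually_elim (simp add: Ch_def)
 have kC: "NEAR X. dd (Ch j) X (eb i X) = 0" if i: "i ~: {a,b}" and j: "j ~: {a,b}" for i j
 proof (rule kill_from_real[OF gC CQ i])
 show "NEAR y. dd (Ch j) (R y) (eb i (R y)) = 0"
 using CRd_hol[OF gC[of j]] CRd_cong[OF CR[OF j]] CC[OF i j] by eventually_elim (metis Qp_eb)
 qed
 \<comment> \<open>The extended C j is CR and vanishes on zeta = 0, since both coefficients
   \<open>ell'\<close> do. Consequently the w_b-component of each (1,0) field is K times its
   w_a-component.\<close>
 have C0: "NEAR X. Ch j X = 0" if j: "j ~: {a,b}" for j
 proof (rule kill_zeta_zero[OF gC CQ kC[OF _ j]])
 show "NEAR X. (ALL i. i ~: {a,b} --> X$Inr i = 0) --> Ch j X = 0"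
 using ell_zeta[OF abI(1) j] ell_zeta[OF abI(2) j] by eventually_elim (simp add: Ch_def)
 qed
 define k1 where "k1 = (%y. Kh (kai (cpl y 0)))"
 have gk1: "ger k1" unfolding k1_def by (rule kills_Lb(1)[OF gK KQ kK])
 have Kk1: "NEAR X. Kh X = k1 (zW X)" unfolding k1_def by (rule kills_Lb(2)[OF gK KQ kK])
 define k1c where "k1c y = cnj (k1 (cnj_vec y))" for y
 have gk1c: "ger k1c"
 proof -
 have bl: "blin (cnj_vec :: complex^'n => _)" unfolding lcb[symmetric]
 by (rule linearI) (simp_all add: veq)
 have "NEAR y. cdiff k1 (cnj_vec y)"
 by (rule ev_nhds_compose[where F=cnj_vec and b=0, rotated 2, OF gk1[unfolded ger_def]]) (simp_all add: lincont[OF bl])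
 thus ?thesis unfolding ger_def
 proof eventually_elim
 case (elim y)
 have "((%y. k1 (cnj_vec y)) HD (%v. dd k1 (cnj_vec y) (cnj_vec v))) (at y)"
 by (rule hdc[OF blhd[OF bl] cdiffD[OF elim]])
 from hdc[OF this blhd[OF bounded_linear_cnj]]
 have 1: "(k1c HD (%v. cnj (dd k1 (cnj_vec y) (cnj_vec v)))) (at y)"
 by (simp add: k1c_def[abs_def])
 show ?case
 proof (rule cdiffI[OF 1])
 fix c :: complex and v :: "complex^'n"
 have "cnj_vec (c *s v) = cnj c *s cnj_vec v" by (simp add: veq)
 thus "cnj (dd k1 (cnj_vec y) (cnj_vec (c *s v))) = c * cnj (dd k1 (cnj_vec y) (cnj_vec v))"
 by (simp add: cdiff_scale[OF elim])
 qed
 qed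
 qed
 \<comment> \<open>At real points \<open>zT\<close> is the conjugate of \<open>zW\<close>, so this
   extends the conjugate of K to the complexification.\<close>
 define Kc where "Kc X = k1c (zT X)" for X
 have gKc: "ger Kc" unfolding Kc_def by (rule ger_compose[OF vger_zT zT0 gk1c])
 have KcR: "NEAR y. Kc (R y) = cnj (Kh (R y))"
 using ev_R[OF Kk1]
 proof eventually_elim
 case (elim y)
 have "cnj_vec (zT (R y)) = zW (R y)"
 using T_cj[of a "R y"] T_cj[of b "R y"] by (auto simp: veq zT_nth zW_nth R_nth)
 thus ?case by (simp add: Kc_def k1c_def elim)
 qed
 define D where "D k l X = dd (W k) (Qp X) (R (ax l))" for k l X
 define Dt where "Dt k l X = dd (T k) (Qp X) (R (ax l))" for k l X
 have gD: "ger (D k l)" if "k:{a,b}" for k l unfolding D_def by (rule ger_Qp[OF ger_dd[OF gW[OF that]]])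
 have gDt: "ger (Dt k l)" if "k:{a,b}" for k l unfolding Dt_def by (rule ger_Qp[OF ger_dd[OF gT[OF that]]])
 \<comment> \<open>The complexified form of \<open>E4\<close>, whose premise holds because all C j
   vanish. Conjugated factors are replaced by derivatives of T and by \<open>Kc\<close>.\<close>
 define P where "P X = (D b a X - Kh X * D a a X) * (Dt b b X - Kc X * Dt a b X)
 - (D b b X - Kh X * D a b X) * (Dt b a X - Kc X * Dt a a X)" for X
 have gP: "ger P" unfolding P_def by (intro ger_diff ger_mult gD gDt gK gKc abI)
 have evC: "NEAR y. ALL j. j ~: {a,b} --> C j y = 0"
 proof (rule eventually_all_finite)
 fix j show "NEAR y. j ~: {a,b} --> C j y = 0"
 proof (cases "j ~: {a,b}")
 case True
 from CR[OF True] ev_R[OF C0[OF True]] show ?thesis by eventually_elim simp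
 qed simp
 qed
 have "NEAR y. P (R y) = 0"
 using E4 evC KR KcR dd_T_conj[OF abI(1)] dd_T_conj[OF abI(2)]
 proof eventually_elim
 case (elim y)
 have "Im ((D b a (R y) - K y * D a a (R y)) * cnj (D b b (R y) - K y * D a b (R y))) = 0"
 using elim(1,2) by (simp add: D_def)
 hence "(D b a (R y) - K y * D a a (R y)) * cnj (D b b (R y) - K y * D a b (R y))
 = (D b b (R y) - K y * D a b (R y)) * cnj (D b a (R y) - K y * D a a (R y))"
 unfolding cmult_real_iff .
 moreover have "cnj (D k l (R y)) = Dt k l (R y)" if "k:{a,b}" for k l
 using elim(5,6) that by (auto simp: D_def Dt_def)
 ultimately show ?case using elim(3,4) by (simp add: P_def)
 qed
 from identity_M[OF gP this] have PQ: "NEAR X. P (Qp X) = 0" .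
 have det: "NEAR X. D a a X * D b b X - D a b X * D b a X ~= 0"
 proof (rule ger_nz)
 show "ger (%X. D a a X * D b b X - D a b X * D b a X)" by (intro ger_diff ger_mult gD abI)
 show "D a a 0 * D b b 0 - D a b 0 * D b a 0 ~= 0" using ab by (simp add: D_def dW0 R_def axis_def)
 qed
 \<comment> \<open>On zeta = 0 the derivatives of W and T in the directions s_a, s_b agree, and P =
   0 collapses to (Kc - Kh) times the Jacobian determinant of W in s, which is nonzero.\<close>
 have KKc: "NEAR X. (ALL i. i ~: {a,b} --> X$Inr i = 0) --> Kh X = Kc X"
 using PQ ev_Qp[OF det] ev_Qp[OF zeta_deriv[OF abI(1)]] ev_Qp[OF zeta_deriv[OF abI(2)]]
 proof eventually_elim
 case (elim X)
 show ?case
 proof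
 assume z: "ALL i. i ~: {a,b} --> X$Inr i = 0"
 have zq: "ALL i. i ~: {a,b} --> Qp X$Inr i = 0" using z by simp
 have zR: "ALL i. i ~: {a,b} --> R (ax l)$Inr i = 0" if "l:{a,b}" for l using that by (auto simp: R_def axis_def)
 have DD: "D k l (Qp X) = Dt k l (Qp X)" if "k:{a,b}" "l:{a,b}" for k l
 using elim(3,4) zq zR[OF that(2)] that(1) by (auto simp: D_def Dt_def)
 have DQ: "D k l (Qp X) = D k l X" "Dt k l (Qp X) = Dt k l X" for k l by (simp_all add: D_def Dt_def)
 have KcQ: "Kc (Qp X) = Kc X"
 proof -
 have "zT (Qp X) = zT X" by (simp add: veq zT_nth)
 thus ?thesis by (simp add: Kc_def)
 qed
 have "(D b a X - Kh X * D a a X) * (D b b X - Kc X * D a b X)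
 = (D b b X - Kh X * D a b X) * (D b a X - Kc X * D a a X)"
 using elim(1) DD unfolding P_def DQ KQ KcQ by simp
 hence "(Kc X - Kh X) * (D a a X * D b b X - D a b X * D b a X) = 0" by (simp add: algebra_simps)
 thus "Kh X = Kc X" using elim(2) unfolding DQ by simp
 qed
 qed
 \<comment> \<open>The previous equation read at the points of zeta = 0. The right-hand side
   involves only the w-entries, so K is a function of w alone.\<close>
 have k1pk: "NEAR y. k1 y = k1c (pk y)"
 using ev_kai0[OF KKc] zeta_zero by eventually_elim (simp add: k1_def Kc_def)
 have k1k: "NEAR y. k1 (pk y) = k1 y" using k1pk ev_pk[OF k1pk] by eventually_elim simp
 obtain g0 where g0: "ger g0" "g0 0 = 0" "NEAR x. dd g0 x (ax a)+k1 x * dd g0 x (ax b) = 0" "dd g0 0 (ax b) ~= 0"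
 using first_integral[OF gk1 ab] .
 \<comment> \<open>\<open>first_integral\<close> treats z as a parameter, so \<open>g0\<close> may
   depend on it; projecting to z = 0 removes this dependence, and K is unaffected by
   \<open>k1k\<close>.\<close>
 define pz where "pz X = pk (zW X)" for X
 have pz0: "pz 0 = 0" by (simp add: pz_def)
 have vpz: "vger pz" unfolding pz_def by (rule vger_compose[OF vger_zW zW0 vger_pk])
 define F where "F X = g0 (pz X)" for X
 have gF: "ger F" unfolding F_def by (rule ger_compose[OF vpz pz0 g0(1)])
 have FQ: "F (Qp X) = F X" for X
 proof -
 have "pz (Qp X) = pz X" by (simp add: veq pz_def zW_nth)
 thus ?thesis by (simp add: F_def)
 qed
 have dF: "NEAR X. ALL V. dd F X V = dd (W a) X V * dd g0 (pz X) (ax a)+dd (W b) X V * dd g0 (pz X) (ax b)"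
 using dd_compose_germ[OF vpz pz0 g0(1)] ev_compose[OF vpz pz0 g0(1)[unfolded ger_def]] vpz[unfolded vger_def]
 proof eventually_elim
 case (elim X)
 show ?case
 proof
 fix V
 have "dd pz X V = dd (W a) X V *s ax a+dd (W b) X V *s ax b"
 unfolding veq vdiffD(2)[OF elim(3)] using ab
 by (auto simp: pz_def zW_nth dd_if axis_def dd_eqI[OF has_derivative_const])
 thus "dd F X V = dd (W a) X V * dd g0 (pz X) (ax a)+dd (W b) X V * dd g0 (pz X) (ax b)"
 using elim(1) by (simp add: F_def[abs_def] dd_add_vec[OF elim(2)] cdiff_scale[OF elim(2)])
 qed
 qed
 show ?thesis
 proof (rule CR_real[OF gF FQ, of "ax (Inl b)"])
 fix i assume "i ~: {a,b}"
 from dF eb_props[OF this] show "NEAR X. dd F X (eb i X) = 0" by eventually_elim simp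
 next
 fix j assume j: "j ~: {a,b}"
 show "NEAR X. dd F X (el j X) = 0"
 using dF ell_ev[OF abI(1) j] ell_ev[OF abI(2) j] C0[OF j] Kk1 ev_compose[OF vger_zW zW0 k1k] ev_compose[OF vpz pz0 g0(3)]
 proof eventually_elim
 case (elim X)
 have "Kh X = k1 (pz X)" using elim(5,6) by (simp add: pz_def)
 hence "dd F X (el j X) = ell' j a X * (dd g0 (pz X) (ax a)+k1 (pz X) * dd g0 (pz X) (ax b))"
 using elim(1,2,3,4) by (simp add: Ch_def algebra_simps)
 thus ?case using elim(7) by simp
 qed
 next
 show "dd F 0 (ax (Inl b)) ~= 0"
 using ev_x[OF dF] g0(4) ab by (simp add: pz0 dW0 axis_def)
 qed
 qed
qed

end

section \<open>Construction of normal coordinates\<close>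

lemma symmetric_complexification:
 fixes f :: "complex^'n::finite => complex"
 assumes "cpx f 0" "NEAR x. Im (f x) = 0"
 obtains F where "ger F" "ALL X. cnj (F (cj X)) = F X" "NEAR x. f x = F (rl x)" "F 0 = f 0"
proof -
 obtain G where G: "ger G" "NEAR x. f (0+x) = G (rl x)" "G 0 = f 0" using cpxE[OF assms(1)] .
 define F where "F X = (G X+cnj (G (cj X))) * (1/2)" for X
 have 1: "ger F" unfolding F_def by (rule ger_mult[OF ger_add[OF G(1) ger_cj[OF G(1)]]]) simp
 have 2: "cnj (F (cj X)) = F X" for X by (simp add: F_def add.commute)
 have 3: "NEAR x. f x = F (rl x)"
 using G(2) assms(2) by eventually_elim (simp add: F_def ceq)
 have 4: "F 0 = f 0" using ev_x[OF assms(2)] G(3) by (simp add: F_def ceq)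
 show thesis by (rule that[OF 1 allI[OF 2] 3 4])
qed

text \<open>Ties the normal form to M: \<open>qp\<close> is the holomorphic change to normal
  coordinates with inverse \<open>jx\<close>, M is parametrized by y |->
  \<open>jx (zW (R y))\<close>, and \<open>h\<close> recovers the parameter.\<close>

locale nfM = nf a b W T for a b :: "'n::finite" and W T +
 fixes M :: "(complex^'n) set" and qp jx h :: "complex^'n => complex^'n"
 assumes vTh: "vger qp" and vXi: "vger jx" and Th0: "qp 0 = 0" and Xi0: "jx 0 = 0"
 and XiTh: "NEAR x. jx (qp x) = x" and ThXi: "NEAR y. qp (jx y) = y"
 and h0: "h 0 = 0" and hcpx: "NEAR x. ALL i. cpx (%x. h x$i) x"
 and inM: "NEAR y. jx (zW (R y)):M & h (jx (zW (R y))) = dr y"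
 and onM: "NEAR x. x:M --> qp x = zW (R (h x)) & Im (h x$a) = 0 & Im (h x$b) = 0"

text \<open>New w-coordinates come from Segre varieties. Over a point x take the point of the
  complexified M with left component x and zeta = 0, keep its right component, and find the point on
  the transversal z = zeta = 0 with the same right component; its parameter is the new w of x. The
  conjugation maps this transversal to itself, and therefore W and T agree on zeta = 0.\<close>

lemma normalization:
 fixes a b :: "'n::finite" and P :: "'n => complex^('n+'n) => complex" and M :: "(complex^'n) set"
 assumes ab: "a ~= b"
 and P: "!!k. k:{a,b} ==> ger (P k)" "!!k X. k:{a,b} ==> cnj (P k (cj X)) = P k X" "!!k. k:{a,b} ==> P k 0 = 0"
 and det: "dd (P a) 0 (ax (Inl a)) * dd (P b) 0 (ax (Inl b)) - dd (P a) 0 (ax (Inl b)) * dd (P b) 0 (ax (Inl a)) ~= 0"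
 and M: "NEAR x. x:M <-> P a (rl x) = 0 & P b (rl x) = 0"
 and C: "!!k. k:{a,b} ==> NEAR x. cpx (%x. P k (rl x)) x"
 shows "EX W T qp jx h. nfM a b W T M qp jx h"
proof -
 define D where "D k = dd (P k) 0" for k
 have cP: "cdiff (P k) 0" if "k:{a,b}" for k by (rule gerD0[OF P(1)[OF that]])
 have Dlin: "blin (D k)" "D k (c *s V) = c * D k V" "D k (V+V') = D k V+D k V'" "D k 0 = 0" if "k:{a,b}" for k c V V'
 using cdiff_linear[OF cP[OF that]] cdiff_scale[OF cP[OF that]] dd_add_vec[OF cP[OF that]] dd_zero_vec[OF cP[OF that]] by (auto simp: D_def)
 have Dcj: "cnj (D k (cj V)) = D k V" if k: "k:{a,b}" for k V
 proof -
 have "((%X. P k (cj X)) HD (%V. D k (cj V))) (at 0)"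
 by (rule hdc[OF blhd[OF bounded_linear_cj]])
 (use cdiffD[OF cP[OF k]] in "simp add: D_def")
 from hdc[OF this blhd[OF bounded_linear_cnj]]
 have "(P k HD (%V. cnj (D k (cj V)))) (at 0)" using P(2)[OF k] by simp
 note d = dd_eqI[OF this, of V]
 show ?thesis using d unfolding D_def by (rule sym)
 qed
 \<comment> \<open>For i in {a,b} the difference of the two entries is 2 i P, and half their sum is
   the skew form i D(lc, -rc), real at real points. So the complexified M is where the two entries
   agree, and the skew choice makes the derivative at 0 respect the splitting into left and right
   components.\<close>
 define H where "H X = cpl (\<chi> i. if i:{a,b} then \<i> * D i (cpl (lc X) (- rc X))+\<i> * P i X else X$Inl i)
 (\<chi> i. if i:{a,b} then \<i> * D i (cpl (lc X) (- rc X)) - \<i> * P i X else X$Inr i)" for X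
 have Hn: "H X$Inl i = (if i:{a,b} then \<i> * D i (cpl (lc X) (- rc X))+\<i> * P i X else X$Inl i)"
 "H X$Inr i = (if i:{a,b} then \<i> * D i (cpl (lc X) (- rc X)) - \<i> * P i X else X$Inr i)" for X i
 by (simp_all add: H_def)
 have gD: "ger (%X. D i (cpl (lc X) (- rc X)))" if i: "i:{a,b}" for i
 proof -
 have e: "D i (cpl (lc X) (- rc X)) = (SUM j:UNIV. cpl (lc X) (- rc X)$j * D i (ax j))" for X
 unfolding D_def by (rule dd_expand[OF cP[OF i]])
 have "ger (%X. cpl (lc X) (- rc X)$j * c)" for j :: "'n+'n" and c
 by (cases j) (auto intro!: ger_mult ger_minus)
 thus ?thesis unfolding e by (intro ger_sum) auto
 qed
 have vH: "vger H" unfolding vger_iff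
 proof
 fix k show "ger (%X. H X$k)"
 by (cases k) (auto simp: Hn intro!: ger_if ger_add ger_diff ger_mult gD P(1))
 qed
 have H0: "H 0 = 0" by (simp add: veq2 Hn P(3) Dlin(4))
 have Hcj: "H (cj X) = cj (H X)" for X
 proof -
 have 1: "cnj (D k (cpl (lc X) (- rc X))) = - D k (cpl (cnj_vec (rc X)) (- cnj_vec (lc X)))" if k: "k:{a,b}" for k
 proof -
 have "cnj (D k (cpl (lc X) (- rc X))) = D k (cj (cpl (lc X) (- rc X)))" using Dcj[OF k, of "cj (cpl (lc X) (- rc X))"] by simp
 also have "cj (cpl (lc X) (- rc X)) = (-1) *s cpl (cnj_vec (rc X)) (- cnj_vec (lc X))" by (simp add: veq2)
 finally show ?thesis using Dlin(2)[OF k, of "-1" "cpl (cnj_vec (rc X)) (- cnj_vec (lc X))"] by simp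
 qed
 have 2: "cnj (P k X) = P k (cj X)" if k: "k:{a,b}" for k using P(2)[OF k, of "cj X"] by simp
 have 3: "lc (cj X) = cnj_vec (rc X)" "rc (cj X) = cnj_vec (lc X)" by (simp_all add: veq)
 show ?thesis using 1 2 by (auto simp: veq2 Hn 3)
 qed
 have DH: "dd H 0 V$Inl i = (if i:{a,b} then 2 * \<i> * D i (cpl (lc V) 0) else V$Inl i)"
 "dd H 0 V$Inr i = (if i:{a,b} then - 2 * \<i> * D i (cpl 0 (rc V)) else V$Inr i)" for V i
 proof -
 have bl: "blin (%X. cpl (lc X) (- rc X))" unfolding lcb[symmetric]
 by (rule linearI) (simp_all add: veq2)
 have d: "((%X. D i (cpl (lc X) (- rc X))) HD (%V. D i (cpl (lc V) (- rc V)))) (at 0)" "(P i HD D i) (at 0)" if i: "i:{a,b}"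
 using blhd[OF bounded_linear_compose[OF Dlin(1)[OF i] bl]] cdiffD[OF cP[OF i]] by (simp_all add: D_def)
 have s: "D i (cpl (lc V) (- rc V))+D i V = 2 * D i (cpl (lc V) 0)" "D i (cpl (lc V) (- rc V)) - D i V = - 2 * D i (cpl 0 (rc V))" if i: "i:{a,b}"
 proof -
 have "cpl (lc V) (- rc V)+V = 2 *s cpl (lc V) 0" by (simp add: veq2)
 thus "D i (cpl (lc V) (- rc V))+D i V = 2 * D i (cpl (lc V) 0)" using Dlin(2,3)[OF i] by metis
 have "cpl (lc V) (- rc V)+(-1) *s V = (-2) *s cpl 0 (rc V)" by (simp add: veq2)
 hence "D i (cpl (lc V) (- rc V))+(-1) * D i V = (-2) * D i (cpl 0 (rc V))" using Dlin(2,3)[OF i] by metis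
 thus "D i (cpl (lc V) (- rc V)) - D i V = - 2 * D i (cpl 0 (rc V))" by simp
 qed
 note v = vdiffD(2)[OF vgerD0[OF vH]]
 show "dd H 0 V$Inl i = (if i:{a,b} then 2 * \<i> * D i (cpl (lc V) 0) else V$Inl i)"
 proof (cases "i:{a,b}")
 case True
 have d1: "((%X. \<i> * D i (cpl (lc X) (- rc X))+\<i> * P i X) HD (%V. \<i> * D i (cpl (lc V) (- rc V))+\<i> * D i V)) (at 0)"
 using d[OF True] by (intro has_derivative_add has_derivative_mult_right)
 have "\<i> * D i (cpl (lc V) (- rc V))+\<i> * D i V = 2 * \<i> * D i (cpl (lc V) 0)"
 using s(1)[OF True] by (simp add: distrib_left[symmetric])
 thus ?thesis unfolding v Hn using True dd_eqI[OF d1, of V] by auto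
 next
 case False thus ?thesis unfolding v Hn by (simp add: dd_eqI[OF nth_has_derivative])
 qed
 show "dd H 0 V$Inr i = (if i:{a,b} then - 2 * \<i> * D i (cpl 0 (rc V)) else V$Inr i)"
 proof (cases "i:{a,b}")
 case True
 have d1: "((%X. \<i> * D i (cpl (lc X) (- rc X)) - \<i> * P i X) HD (%V. \<i> * D i (cpl (lc V) (- rc V)) - \<i> * D i V)) (at 0)"
 using d[OF True] by (intro has_derivative_diff has_derivative_mult_right)
 have "\<i> * D i (cpl (lc V) (- rc V)) - \<i> * D i V = - 2 * \<i> * D i (cpl 0 (rc V))"
 using s(2)[OF True] by (simp add: right_diff_distrib[symmetric])
 thus ?thesis unfolding v Hn using True dd_eqI[OF d1, of V] by auto
 next
 case False thus ?thesis unfolding v Hn by (simp add: dd_eqI[OF nth_has_derivative])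
 qed
 qed
 have vlin: "vdiff F x ==> dd F x (u - w) = dd F x u - dd F x w" for F :: "complex^'p::finite => complex^'q::finite" and x u w
 using linear_diff[OF bllin[OF hdbl[OF vdiffD(1)]]] .
 have injI0: "inj (dd F 0)" if "vger F" "!!V. dd F 0 V = 0 ==> V = 0" for F :: "complex^'p::finite => complex^'q::finite"
 proof (rule injI)
 fix u w assume "dd F 0 u = dd F 0 w"
 hence "dd F 0 (u - w) = 0" using vlin[OF vgerD0[OF that(1)]] by simp
 from that(2)[OF this] show "u = w" by simp
 qed
 have cramer: "x = 0 & y = 0" if "x * p+y * q = 0" "x * r+y * s = 0" "p * s - q * r ~= 0" for x y p q r s :: complex
 proof -
 have "x * (p * s - q * r) = (x * p+y * q) * s - (x * r+y * s) * q" "y * (p * s - q * r) = (x * r+y * s) * p - (x * p+y * q) * r"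
 by (simp_all add: algebra_simps)
 thus ?thesis using that by simp
 qed
 have injA: "v = 0" if z: "!!i. i ~: {a,b} ==> v$i = 0" and k: "!!k. k:{a,b} ==> D k (cpl v 0) = 0" for v :: "complex^'n"
 proof -
 have e: "cpl v 0 = v$a *s ax (Inl a)+v$b *s ax (Inl b)" using z ab by (auto simp: veq2 axis_def)
 have "v$a * D k (ax (Inl a))+v$b * D k (ax (Inl b)) = 0" if "k:{a,b}" for k
 using k[OF that] unfolding e by (simp add: Dlin(2,3)[OF that])
 from cramer[OF this[of a] this[of b]] have "v$a = 0 & v$b = 0" using det by (simp add: D_def)
 hence "v$i = 0" for i using z[of i] by (cases "i:{a,b}") auto
 thus ?thesis by (simp add: veq)
 qed
 have injB: "w = 0" if z: "!!i. i ~: {a,b} ==> w$i = 0" and k: "!!k. k:{a,b} ==> D k (cpl 0 w) = 0" for w :: "complex^'n"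
 proof -
 have "D k (cpl (cnj_vec w) 0) = 0" if kk: "k:{a,b}" for k
 proof -
 have "cj (cpl 0 w) = cpl (cnj_vec w) 0" by (simp add: veq2)
 thus ?thesis using Dcj[OF kk, of "cpl 0 w"] k[OF kk] by simp
 qed
 with injA[of "cnj_vec w"] z have "cnj_vec w = 0" by simp
 thus ?thesis by (simp add: veq)
 qed
 have injH: "inj (dd H 0)"
 proof (rule injI0[OF vH])
 fix V assume "dd H 0 V = 0"
 hence c: "dd H 0 V$j = 0" for j by simp
 have "lc V = 0"
 proof (rule injA)
 fix i assume "i ~: {a,b}" thus "lc V$i = 0" using c[of "Inl i"] by (simp add: DH)
 next
 fix k assume "k:{a,b}" thus "D k (cpl (lc V) 0) = 0" using c[of "Inl k"] by (simp add: DH)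
 qed
 moreover have "rc V = 0"
 proof (rule injB)
 fix i assume "i ~: {a,b}" thus "rc V$i = 0" using c[of "Inr i"] by (simp add: DH)
 next
 fix k assume "k:{a,b}" thus "D k (cpl 0 (rc V)) = 0" using c[of "Inr k"] by (simp add: DH)
 qed
 ultimately show "V = 0" by (metis cpl_lc_rc cpl_0)
 qed
 obtain N where N: "vger N" "N 0 = 0" "NEAR x. N (H x) = x" "NEAR y. H (N y) = y"
 by (rule germ_inverse[OF vH H0 injH])
 have Ncj: "NEAR Y. N (cj Y) = cj (N Y)"
 using ev_compose[OF N(1,2) ev_cj[OF N(3)]] N(4) by eventually_elim (simp add: Hcj)
 have inv_dd: "dd F 0 (dd G 0 V) = V" if "vger F" "F 0 = 0" "vger G" "G 0 = 0" "NEAR x. F (G x) = x" for F G :: "complex^'p::finite => complex^'p" and V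
 proof -
 have "dd (%x. F (G x)) 0 V = dd F (G 0) (dd G 0 V)" by (rule vdiff_compose(2)[OF vgerD0[OF that(3)]]) (simp add: that vgerD0)
 moreover have "dd (%x. F (G x)) 0 V = dd (%x. x) 0 V" by (rule dd_cong_ev[OF that(5)])
 ultimately show ?thesis using that(4) by (simp add: dd_eqI[OF has_derivative_ident])
 qed
 have HN': "dd H 0 (dd N 0 V) = V" for V by (rule inv_dd[OF vH H0 N(1,2,4)])
 have NI: "NEAR Y. ALL i. i ~: {a,b} --> N Y$Inl i = Y$Inl i & N Y$Inr i = Y$Inr i"
 using N(4) by eventually_elim (metis Hn)
 define pk where "pk y = (\<chi> i. if i:{a,b} then y$i else 0)" for y :: "complex^'n"
 have pkn[simp]: "pk y$i = (if i:{a,b} then y$i else 0)" for y i by (simp add: pk_def)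
 define Q where "Q X = cpl (lc X) (\<chi> i. if i:{a,b} then X$Inl i else X$Inr i)" for X :: "complex^('n+'n)"
 have Qn[simp]: "Q X$Inl i = X$Inl i" "Q X$Inr i = (if i:{a,b} then X$Inl i else X$Inr i)" for X i
 by (simp_all add: Q_def)
 have QQ: "Q (Q X) = Q X" "Q (cj (Q X)) = cj (Q X)" for X by (simp_all add: veq2)
 have blQ: "blin Q" unfolding lcb[symmetric] by (rule linearI) (simp_all add: veq2)
 have vQ: "vger Q" unfolding vger_iff
 proof
 fix k show "ger (%X. Q X$k)" by (cases k) (auto intro!: ger_if)
 qed
 have Q0: "Q 0 = 0" by (simp add: veq2)
 \<comment> \<open>In the coordinates \<open>H\<close>, \<open>q y\<close> is the point of the
   complexified M with left part y and zeta = 0; \<open>p y\<close> below also has z = 0.\<close>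
 define q where "q y = cpl y (pk y)" for y :: "complex^'n"
 have vq: "vger q" unfolding vger_iff
 proof
 fix k show "ger (%X. q X$k)" unfolding q_def by (cases k) (auto intro!: ger_if)
 qed
 have q0: "q 0 = 0" by (simp add: veq2 q_def)
 define p where "p y = cpl (pk y) (pk y)" for y :: "complex^'n"
 have vp: "vger p" unfolding vger_iff
 proof
 fix k show "ger (%X. p X$k)" unfolding p_def by (cases k) (auto intro!: ger_if)
 qed
 have p0: "p 0 = 0" by (simp add: veq2 p_def)
 have vlindd: "dd F 0 V = F V" if "blin F" for F :: "complex^'p::finite => complex^'q::finite" and V
 by (rule dd_eqI[OF blhd[OF that]])
 have blq: "blin q" unfolding lcb[symmetric] by (rule linearI) (simp_all add: veq2 q_def)
 have blp: "blin p" unfolding lcb[symmetric] by (rule linearI) (simp_all add: veq2 p_def)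
 \<comment> \<open>\<open>al\<close> is the left component over zeta = 0. \<open>be\<close> and
   \<open>ga\<close> record the entries a, b of the right component over zeta = 0 and over the
   transversal; their remaining entries carry z along, so that all three maps are
   invertible.\<close>
 define al where "al y = lc (N (q y))" for y
 define be where "be y = (\<chi> i. if i:{a,b} then N (q y)$Inr i else y$i)" for y
 define ga where "ga y = (\<chi> i. if i:{a,b} then N (p y)$Inr i else y$i)" for y
 have vNq: "vger (%y. N (q y))" by (rule vger_compose[OF vq q0 N(1)])
 have vNp: "vger (%y. N (p y))" by (rule vger_compose[OF vp p0 N(1)])
 have dNq: "dd (%y. N (q y)) 0 V = dd N 0 (q V)" for V
 using vdiff_compose(2)[OF vgerD0[OF vq], of N] vgerD0[OF N(1)] by (simp add: q0 vlindd[OF blq])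
 have dNp: "dd (%y. N (p y)) 0 V = dd N 0 (p V)" for V
 using vdiff_compose(2)[OF vgerD0[OF vp], of N] vgerD0[OF N(1)] by (simp add: p0 vlindd[OF blp])
 have val: "vger al" unfolding vger_iff al_def using vger_nth[OF vNq] by simp
 have vbe: "vger be" unfolding vger_iff be_def using vger_nth[OF vNq] by (auto intro!: ger_if)
 have vga: "vger ga" unfolding vger_iff ga_def using vger_nth[OF vNp] by (auto intro!: ger_if)
 have abg0: "al 0 = 0" "be 0 = 0" "ga 0 = 0" by (simp_all add: veq al_def be_def ga_def q0 p0 N(2))
 have dal: "dd al 0 V = lc (dd N 0 (q V))" for V
 unfolding veq vdiffD(2)[OF vgerD0[OF val]] using vdiffD(2)[OF vgerD0[OF vNq]] dNq by (simp add: al_def)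
 have dbe: "dd be 0 V$i = (if i:{a,b} then dd N 0 (q V)$Inr i else V$i)" for V i
 unfolding vdiffD(2)[OF vgerD0[OF vbe]] using vdiffD(2)[OF vgerD0[OF vNq], of V "Inr i"] dNq[of V] by (simp add: be_def dd_eqI[OF nth_has_derivative])
 have dga: "dd ga 0 V$i = (if i:{a,b} then dd N 0 (p V)$Inr i else V$i)" for V i
 unfolding vdiffD(2)[OF vgerD0[OF vga]] using vdiffD(2)[OF vgerD0[OF vNp], of V "Inr i"] dNp[of V] by (simp add: ga_def dd_eqI[OF nth_has_derivative])
 \<comment> \<open>the linear part of \<open>H\<close> maps the two summands of the complexification to themselves, hence so does that of \<open>N\<close>\<close>
 have lcN: "lc X = 0" if "lc (dd N 0 X) = 0" for X
 proof -
 have z: "dd N 0 X$Inl i = 0" for i using that by (metis lc_nth zero_index)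
 have "X$Inl i = 0" for i using z[of i] DH(1)[of "dd N 0 X" i] arg_cong[OF that, of "%v. v$i"] HN'[of X] that by (auto simp: Dlin(4) split: if_splits)
 thus ?thesis by (simp add: veq)
 qed
 have rcN: "rc X = 0" if "rc (dd N 0 X) = 0" for X
 proof -
 have z: "dd N 0 X$Inr i = 0" for i using that by (metis rc_nth zero_index)
 have "X$Inr i = 0" for i using z[of i] DH(2)[of "dd N 0 X" i] arg_cong[OF that, of "%v. v$i"] HN'[of X] that by (auto simp: Dlin(4) split: if_splits)
 thus ?thesis by (simp add: veq)
 qed
 have rcNI: "dd N 0 X$Inr i = X$Inr i" "dd N 0 X$Inl i = X$Inl i" if "i ~: {a,b}" for X i
 using DH(2)[of "dd N 0 X" i] DH(1)[of "dd N 0 X" i] HN'[of X] that by auto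
 have N0lin: "dd N 0 (X - Y) = dd N 0 X - dd N 0 Y" for X Y by (rule vlin[OF vgerD0[OF N(1)]])
 have dN00: "dd N 0 0 = 0" using N0lin[of 0 0] by simp
 have rceq: "dd N 0 X$Inr i = dd N 0 Y$Inr i" if "rc X = rc Y" for X Y i
 proof -
 have "rc (dd N 0 (X - Y)) = 0"
 proof (rule injB)
 fix j assume j: "j ~: {a,b}" show "rc (dd N 0 (X - Y))$j = 0" using rcNI(1)[OF j, of "X - Y"] arg_cong[OF that, of "%v. v$j"] by simp
 next
 fix k assume k: "k:{a,b}"
 show "D k (cpl 0 (rc (dd N 0 (X - Y)))) = 0"
 using DH(2)[of "dd N 0 (X - Y)" k] HN'[of "X - Y"] k arg_cong[OF that, of "%v. v$k"] by auto
 qed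
 hence "dd N 0 (X - Y)$Inr i = 0" by (metis rc_nth zero_index)
 thus ?thesis using N0lin[of X Y] by simp
 qed
 have inja: "inj (dd al 0)"
 proof (rule injI0[OF val])
 fix V assume "dd al 0 V = 0"
 hence "lc (q V) = 0" using lcN dal by metis
 thus "V = 0" by (simp add: q_def)
 qed
 have dbg: "dd be 0 V = dd ga 0 V" for V
 unfolding veq dbe dga using rceq[of "q V" "p V"] by (simp add: q_def p_def)
 have injg: "inj (dd ga 0)"
 proof (rule injI0[OF vga])
 fix V assume "dd ga 0 V = 0"
 hence c: "dd ga 0 V$i = 0" for i by simp
 have VI: "V$i = 0" if "i ~: {a,b}" for i using c[of i] that by (simp add: dga)
 have "dd N 0 (p V)$Inr i = 0" for i
 using c[of i] rcNI(1)[of i "p V"] by (cases "i:{a,b}") (auto simp: dga p_def)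
 hence "rc (dd N 0 (p V)) = 0" by (simp add: veq)
 from rcN[OF this] have "pk V = 0" by (simp add: p_def)
 hence "V$i = 0" if "i:{a,b}" for i using that by (metis pkn zero_index)
 thus "V = 0" using VI by (auto simp: veq)
 qed
 obtain ai where ai: "vger ai" "ai 0 = 0" "NEAR x. ai (al x) = x" "NEAR y. al (ai y) = y"
 by (rule germ_inverse[OF val abg0(1) inja])
 obtain gi where gi: "vger gi" "gi 0 = 0" "NEAR x. gi (ga x) = x" "NEAR y. ga (gi y) = y"
 by (rule germ_inverse[OF vga abg0(3) injg])
 have vgb: "vger (%y. gi (be y))" by (rule vger_compose[OF vbe abg0(2) gi(1)])
 \<comment> \<open>Read from inside: the parameter of the point over x with zeta = 0, its right
   component, and the parameter on the transversal with that right component.\<close>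
 define qp where "qp x = gi (be (ai x))" for x
 have vTh: "vger qp" unfolding qp_def using vger_compose[OF ai(1,2) vgb] .
 have Th0: "qp 0 = 0" by (simp add: qp_def ai gi abg0)
 have dTh: "dd qp 0 V = dd ai 0 V" for V
 proof -
 have 1: "dd qp 0 V = dd (%y. gi (be y)) (ai 0) (dd ai 0 V)" unfolding qp_def
 by (rule vdiff_compose(2)[OF vgerD0[OF ai(1)]]) (simp add: ai vgerD0[OF vgb])
 have 2: "dd (%y. gi (be y)) 0 U = dd gi (be 0) (dd be 0 U)" for U
 by (rule vdiff_compose(2)[OF vgerD0[OF vbe]]) (simp add: abg0 vgerD0[OF gi(1)])
 show ?thesis using inv_dd[OF gi(1,2) vga abg0(3) gi(3)] by (simp add: 1 2 ai abg0 dbg)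
 qed
 have dThal: "dd qp 0 (lc (dd N 0 (q V))) = V" for V
 unfolding dTh dal[symmetric] by (rule inv_dd[OF ai(1,2) val abg0(1) ai(3)])
 have lceq: "lc (dd N 0 X) = lc (dd N 0 Y)" if "lc X = lc Y" for X Y
 proof -
 have "lc (dd N 0 (X - Y)) = 0"
 proof (rule injA)
 fix j assume j: "j ~: {a,b}" show "lc (dd N 0 (X - Y))$j = 0" using rcNI(2)[OF j, of "X - Y"] arg_cong[OF that, of "%v. v$j"] by simp
 next
 fix k assume k: "k:{a,b}"
 show "D k (cpl (lc (dd N 0 (X - Y))) 0) = 0"
 using DH(1)[of "dd N 0 (X - Y)" k] HN'[of "X - Y"] k arg_cong[OF that, of "%v. v$k"] by auto
 qed
 thus ?thesis using N0lin[of X Y] by (simp add: veq)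
 qed
 have dThN: "dd qp 0 (lc (dd N 0 X)) = lc X" for X
 using dThal[of "lc X"] lceq[of X "q (lc X)"] by (simp add: q_def)
 have injTh: "inj (dd qp 0)"
 proof (rule injI0[OF vTh])
 fix V assume z: "dd qp 0 V = 0"
 have "V = dd al 0 (dd ai 0 V)" using inv_dd[OF val abg0(1) ai(1,2,4)] by simp
 also have "dd ai 0 V = 0" using z dTh by simp
 also have "dd al 0 0 = 0" using vlin[OF vgerD0[OF val], of 0 0] by simp
 finally show "V = 0" .
 qed
 obtain jx where Xi: "vger jx" "jx 0 = 0" "NEAR x. jx (qp x) = x" "NEAR y. qp (jx y) = y"
 by (rule germ_inverse[OF vTh Th0 injTh])
 define m where "m X = qp (lc (N X))" for X
 have vlcN: "vger (%X. lc (N X))" unfolding vger_iff using vger_nth[OF N(1)] by simp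
 have lcN0: "lc (N 0) = 0" by (simp add: N)
 have vm: "vger m" unfolding m_def by (rule vger_compose[OF vlcN lcN0 vTh])
 have m0: "m 0 = 0" by (simp add: m_def N Th0)
 have dm: "dd m 0 X = lc X" for X
 proof -
 have "dd m 0 X = dd qp (lc (N 0)) (dd (%X. lc (N X)) 0 X)" unfolding m_def
 by (rule vdiff_compose(2)[OF vgerD0[OF vlcN]]) (simp only: lcN0 vgerD0[OF vTh])
 moreover have "dd (%X. lc (N X)) 0 X = lc (dd N 0 X)"
 unfolding veq vdiffD(2)[OF vgerD0[OF vlcN]] using vdiffD(2)[OF vgerD0[OF N(1)]] by simp
 ultimately show ?thesis unfolding lcN0 using dThN by simp
 qed
 define W where "W k X = m (Q X)$k" for k X
 define T where "T k X = cnj (W k (cj (Q X)))" for k X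
 have gmk: "ger (%X. m X$k)" for k by (rule vger_nth[OF vm])
 have gW: "ger (W k)" for k unfolding W_def by (rule ger_compose[OF vQ Q0 gmk])
 have gT: "ger (T k)" for k unfolding T_def by (rule ger_compose[OF vQ Q0 ger_cj[OF gW]])
 have dW: "dd (W k) 0 V = V$Inl k" for k V
 proof -
 have "dd (W k) 0 V = dd (%X. m X$k) (Q 0) (dd Q 0 V)" unfolding W_def
 by (rule cdiff_compose(2)[OF vgerD0[OF vQ]]) (simp only: Q0 gerD0[OF gmk])
 thus ?thesis using vdiffD(2)[OF vgerD0[OF vm], of "Q V" k] dm by (simp add: Q0 vlindd[OF blQ])
 qed
 have dT: "dd (T k) 0 V = V$Inl k" if k: "k:{a,b}" for k V
 proof -
 have bl: "blin (%X. cj (Q X))" by (rule bounded_linear_compose[OF bounded_linear_cj blQ])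
 have "((%X. W k (cj (Q X))) HD (%V. dd (W k) 0 (cj (Q V)))) (at 0)"
 by (rule hdc[OF blhd[OF bl]])
 (use cdiffD[OF gerD0[OF gW[of k]]] in "simp add: Q0")
 from hdc[OF this blhd[OF bounded_linear_cnj]]
 have "(T k HD (%V. cnj (dd (W k) 0 (cj (Q V))))) (at 0)" by (simp add: T_def[abs_def])
 from dd_eqI[OF this] show ?thesis using k by (simp add: dW)
 qed
 have WQ: "W k (Q X) = W k X" "T k (Q X) = T k X" for k X by (simp_all add: W_def T_def QQ)
 have nr: "NEAR X. (ALL i. i ~: {a,b} --> X$Inr i = 0) --> W k X = T k X" if k: "k:{a,b}" for k
 proof -
 have vb: "vger (%X. lc X)" unfolding vger_iff by simp
 have blcv: "isCont (%y. cnj_vec (pk (gi (be y)))) 0"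
 proof -
 have bl: "blin (%y. cnj_vec (pk y))" unfolding lcb[symmetric] by (rule linearI) (simp_all add: veq)
 show ?thesis by (rule isCont_o2[OF vger_isCont[OF vgb] lincont[OF bl]])
 qed
 define u where "u y = cnj_vec (pk (gi (be y)))" for y
 have u0: "u 0 = 0" by (simp add: u_def abg0 gi veq)
 have uc: "isCont u 0" using blcv by (simp add: u_def[abs_def])
 have E: "NEAR y. ai (al y) = y & ga (gi (be y)) = be y & ai (al (u y)) = u y & gi (ga (u y)) = u y
 & N (cj (q y)) = cj (N (q y)) & N (cj (p (gi (be y)))) = cj (N (p (gi (be y))))
 & (ALL i. i ~: {a,b} --> N (q y)$Inl i = q y$Inl i & N (q y)$Inr i = q y$Inr i)
 & (ALL i. i ~: {a,b} --> N (p (gi (be y)))$Inl i = p (gi (be y))$Inl i & N (p (gi (be y)))$Inr i = p (gi (be y))$Inr i)"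
 by (intro eventually_conj ai(3) ev_compose[OF vbe abg0(2) gi(4)] ev_nhds_compose[OF uc u0 ai(3)] ev_nhds_compose[OF uc u0 gi(3)]
 ev_compose[OF vq q0 Ncj] ev_compose[OF vgb _ ev_compose[OF vp p0 Ncj]] ev_compose[OF vq q0 NI] ev_compose[OF vgb _ ev_compose[OF vp p0 NI]])
 (simp_all add: abg0 gi)
 have "NEAR X. lc X = lc X & ai (al (lc X)) = lc X & ga (gi (be (lc X))) = be (lc X) & ai (al (u (lc X))) = u (lc X) & gi (ga (u (lc X))) = u (lc X)
 & N (cj (q (lc X))) = cj (N (q (lc X))) & N (cj (p (gi (be (lc X))))) = cj (N (p (gi (be (lc X)))))
 & (ALL i. i ~: {a,b} --> N (q (lc X))$Inl i = q (lc X)$Inl i & N (q (lc X))$Inr i = q (lc X)$Inr i)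
 & (ALL i. i ~: {a,b} --> N (p (gi (be (lc X))))$Inl i = p (gi (be (lc X)))$Inl i & N (p (gi (be (lc X))))$Inr i = p (gi (be (lc X)))$Inr i)"
 using ev_compose[OF vb _ E] by simp
 thus ?thesis
 proof eventually_elim
 case (elim X)
 show ?case
 proof
 assume z: "ALL i. i ~: {a,b} --> X$Inr i = 0"
 define y where "y = lc X"
 define y' where "y' = gi (be y)"
 note e = elim[folded y_def, folded y'_def]
 have e1: "ai (al y) = y" and e2: "ga y' = be y" and e3: "ai (al (u y)) = u y" and e4: "gi (ga (u y)) = u y"
 and e5: "N (cj (q y)) = cj (N (q y))" and e6: "N (cj (p y')) = cj (N (p y'))"
 and e7: "!!i. i ~: {a,b} ==> N (q y)$Inr i = q y$Inr i"
 and e8: "!!i. i ~: {a,b} ==> N (p y')$Inr i = p y'$Inr i" using e by blast+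
 have QX: "Q X = q y" using z by (auto simp: veq2 q_def y_def)
 have uu: "u y = cnj_vec (pk y')" by (simp add: u_def y'_def)
 have W1: "W k X = y'$k" using e1 by (simp add: W_def QX m_def qp_def y'_def al_def)
 have be: "N (p y')$Inr l = N (q y)$Inr l" if "l:{a,b}" for l
 using arg_cong[OF e2, of "%v. v$l"] that by (simp add: ga_def be_def)
 have cjp: "cj (p y') = p (u y)" "q (u y) = p (u y)" by (auto simp: veq2 p_def q_def uu)
 \<comment> \<open>Conjugation exchanges left and right components. The right component at
   \<open>q y\<close> equals the one at \<open>p y'\<close>, and the conjugate of a transversal
   point is again on the transversal, with parameter \<open>u y\<close>.\<close>
 have "lc (N (cj (q y))) = al (u y)"
 proof -
 have "lc (cj (N (q y)))$l = lc (cj (N (p y')))$l" for l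
 using be[of l] e7[of l] e8[of l] by (cases "l:{a,b}") (auto simp: q_def p_def)
 hence "lc (cj (N (q y))) = lc (cj (N (p y')))" by (simp add: veq)
 thus ?thesis by (simp add: e5 al_def cjp e6[symmetric])
 qed
 moreover have "be (u y) = ga (u y)" by (simp only: be_def ga_def cjp)
 ultimately have "m (cj (q y)) = u y" using e3 e4 by (simp add: m_def qp_def)
 hence "T k X = cnj (u y$k)" using QQ(2)[of X] by (simp add: T_def W_def QX)
 thus "W k X = T k X" using k W1 by (simp add: uu)
 qed
 qed
 qed
 have Tdef: "T k X = cnj (W k (cj X))" if "X = Q X" for k X using that by (simp add: T_def)
 \<comment> \<open>The involution \<open>cj\<close> exchanges z = 0 with zeta = 0 and W with T, so
   this half of normality follows from \<open>nr\<close>.\<close>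
 have nl: "NEAR X. (ALL i. i ~: {a,b} --> X$Inl i = 0) --> W k X = T k X" if k: "k:{a,b}" for k
 using ev_compose[OF vQ Q0 ev_cj[OF nr[OF k]]]
 proof eventually_elim
 case (elim X)
 show ?case
 proof
 assume "ALL i. i ~: {a,b} --> X$Inl i = 0"
 hence "W k (cj (Q X)) = T k (cj (Q X))" using elim by simp
 also have "\<dots> = cnj (W k X)" using Tdef[of "cj (Q X)" k] QQ(2)[of X] WQ(1) by simp
 finally show "W k X = T k X" by (simp add: T_def)
 qed
 qed
 have W00: "W k 0 = 0" for k by (simp add: W_def Q0 m0)
 have "nf a b W T" unfolding nf_def Q_def[symmetric]
 by (intro conjI allI impI ab gW W00 gT dW dT WQ Tdef nr nl) assumption+
 then interpret nf a b W T .
 define h where "h x = lc (H (rl x))" for x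
 have QpQ: "Qp X = Q X" for X by (simp add: veq2)
 have HR: "H (rl x) = rl (h x)" for x
 proof -
 have "cj (H (rl x)) = H (rl x)" by (simp add: Hcj[symmetric])
 hence "H (rl x)$Inr i = cnj (H (rl x)$Inl i)" for i by (metis cj_nth(2))
 thus ?thesis by (simp add: veq2 h_def)
 qed
 have hk: "h x$i = (if i:{a,b} then \<i> * D i (cpl x (- cnj_vec x))+\<i> * P i (rl x) else x$i)" for x i
 by (simp add: h_def Hn)
 have rP: "Im (P k (rl x)) = 0" if "k:{a,b}" for k x using P(2)[OF that, of "rl x"] by (simp add: ceq)
 have rD: "Re (D k (cpl x (- cnj_vec x))) = 0" if k: "k:{a,b}" for k x
 proof -
 have "cj (cpl x (- cnj_vec x)) = (-1) *s cpl x (- cnj_vec x)" by (simp add: veq2)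
 thus ?thesis using Dcj[OF k, of "cpl x (- cnj_vec x)"] Dlin(2)[OF k, of "-1" "cpl x (- cnj_vec x)"] by (simp add: ceq)
 qed
 have Imh: "Im (h x$k) = Re (P k (rl x))" if "k:{a,b}" for k x using that rD[OF that, of x] by (simp add: hk)
 have Mh: "NEAR x. x:M <-> Im (h x$a) = 0 & Im (h x$b) = 0"
 using M by eventually_elim (use rP in "auto simp: Imh ceq")
 have Rh: "R (h x) = rl (h x)" if "Im (h x$a) = 0" "Im (h x$b) = 0" for x
 using that by (auto simp: veq2 R_nth ceq)
 have zWm: "NEAR X. zW X = m (Q X)"
 proof -
 have "NEAR y. ALL i. i ~: {a,b} --> qp y$i = y$i"
 proof -
 have "NEAR y. ALL i. i ~: {a,b} --> ai y$i = y$i"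
 using ai(4) ev_compose[OF ai(1,2) ev_compose[OF vq q0 NI]]
 proof eventually_elim
 case (elim y)
 thus ?case by (metis al_def lc_nth q_def cpl_nth(1))
 qed
 thus ?thesis using ev_compose[OF ai(1,2) ev_compose[OF vbe abg0(2) gi(4)]]
 proof eventually_elim
 case (elim y)
 show ?case
 proof (intro allI impI)
 fix i assume i: "i ~: {a,b}"
 have "ga (qp y)$i = be (ai y)$i" using elim(2) by (simp add: qp_def)
 thus "qp y$i = y$i" using i elim(1) by (simp add: ga_def be_def)
 qed
 qed
 qed
 from ev_compose[OF vQ Q0 ev_compose[OF vlcN lcN0 this]] ev_compose[OF vQ Q0 NI] show ?thesis
 proof eventually_elim
 case (elim X)
 show ?case unfolding veq
 proof
 fix i show "zW X$i = m (Q X)$i"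
 proof (cases "i:{a,b}")
 case True thus ?thesis by (simp add: zW_nth W_def)
 next
 case False
 hence "m (Q X)$i = X$Inl i" using elim by (simp add: m_def)
 thus ?thesis using False by (simp add: zW_nth)
 qed
 qed
 qed
 qed
 have hD: "blin (%x. D k (cpl x (- cnj_vec x)))" if "k:{a,b}" for k
 proof -
 have bl: "blin (%x::complex^'n. cpl x (- cnj_vec x))" unfolding lcb[symmetric]
 by (rule linearI) (simp_all add: veq2)
 show ?thesis by (rule bounded_linear_compose[OF Dlin(1)[OF that] bl])
 qed
 have hDcpx: "cpx (%x. D k (cpl x (- cnj_vec x))) p" if k: "k:{a,b}" for k p
 proof -
 have e: "D k (cpl x (- cnj_vec x)) = (SUM i:UNIV. x$i * D k (ax (Inl i)) - cnj (x$i) * D k (ax (Inr i)))" for x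
 proof -
 have "D k (cpl x (- cnj_vec x)) = (SUM j:UNIV. cpl x (- cnj_vec x)$j * D k (ax j))"
 unfolding D_def by (rule dd_expand[OF cP[OF k]])
 also have "\<dots> = (SUM i:UNIV. cpl x (- cnj_vec x)$Inl i * D k (ax (Inl i)))+(SUM i:UNIV. cpl x (- cnj_vec x)$Inr i * D k (ax (Inr i)))"
 unfolding UNIV_Plus_UNIV[symmetric] by (rule trans[OF sum.Plus]) (simp_all only: finite_class.finite_UNIV o_def)
 finally show ?thesis by (simp add: sum_subtractf sum_negf)
 qed
 have "cpx (%x. SUM i:I. x$i * D k (ax (Inl i)) - cnj (x$i) * D k (ax (Inr i))) p" if "finite I" for I
 using that
 proof (induction I)
 case empty show ?case by simp
 next
 case (insert j I)
 have "cpx (%x. (x$j * D k (ax (Inl j)) - cnj (x$j) * D k (ax (Inr j)))+(SUM i:I. x$i * D k (ax (Inl i)) - cnj (x$i) * D k (ax (Inr i)))) p"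
 by (rule cpx_add[OF cpx_diff[OF cpx_mult[OF cpx_nth cpx_const] cpx_mult[OF cpx_cnj[OF cpx_nth] cpx_const]] insert(3)])
 thus ?case using insert by simp
 qed
 thus ?thesis unfolding e by simp
 qed
 have hcpx: "NEAR x. ALL i. cpx (%x. h x$i) x"
 proof (rule eventually_all_finite)
 fix i
 show "NEAR x. cpx (%x. h x$i) x"
 proof (cases "i:{a,b}")
 case True
 from C[OF True] show ?thesis unfolding hk if_P[OF True]
 by eventually_elim (rule cpx_add[OF cpx_mult[OF cpx_const hDcpx[OF True]] cpx_mult[OF cpx_const]])
 qed (simp add: hk)
 qed
 have h0: "h 0 = 0" by (simp add: h_def H0)
 have hcont: "isCont h 0"
 proof -
 have "isCont H 0" by (rule vger_isCont[OF vH])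
 hence "isCont (%x. H (rl x)) 0" using isCont_o2[where f=rl and g=H and a=0, OF isCont_rl] by simp
 thus ?thesis unfolding h_def[abs_def] by (rule isCont_o2[where f="%x. H (rl x)" and g=lc and a=0, OF _ isCont_lc])
 qed
 have onM: "NEAR x. x:M --> qp x = zW (R (h x)) & Im (h x$a) = 0 & Im (h x$b) = 0"
 using Mh ev_nhds_compose[OF hcont h0 ev_rl[OF zWm]] ev_rl[OF N(3)]
 proof eventually_elim
 case (elim x)
 show ?case
 proof
 assume "x:M"
 hence r: "Im (h x$a) = 0" "Im (h x$b) = 0" using elim(1) by auto
 have "Q (rl (h x)) = rl (h x)" using Qp_R[of "h x"] Rh[OF r] QpQ by simp
 hence "zW (R (h x)) = qp (lc (N (rl (h x))))" using elim(2) Rh[OF r] by (simp add: m_def)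
 also have "\<dots> = qp x" using elim(3) by (simp add: HR)
 finally show "qp x = zW (R (h x)) & Im (h x$a) = 0 & Im (h x$b) = 0" using r by simp
 qed
 qed
 have vlN: "isCont (%y. lc (N (R y))) 0"
 proof (rule isCont_o2[where f="%y. N (R y)" and g=lc and a=0, OF _ isCont_lc])
 show "isCont (%y. N (R y)) 0"
 by (rule isCont_o2[where f=R and g=N and a=0, OF lincont[OF bl_R]]) (simp add: vger_isCont[OF N(1)])
 qed
 have lN0: "lc (N (R 0)) = 0" by (simp add: N)
 have inM: "NEAR y. jx (zW (R y)):M & h (jx (zW (R y))) = dr y"
 using ev_nhds_compose[OF vlN lN0 Mh] ev_nhds_compose[OF vlN lN0 Xi(3)] ev_R[OF Ncj] ev_R[OF N(4)] ev_R[OF zWm]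
 proof eventually_elim
 case (elim y)
 define x where "x = lc (N (R y))"
 have "cj (N (R y)) = N (R y)" using elim(3) by simp
 hence "N (R y)$Inr i = cnj (N (R y)$Inl i)" for i by (metis cj_nth(2))
 hence Nx: "N (R y) = rl x" by (simp add: veq2 x_def)
 hence "rl (h x) = R y" using elim(4) HR by simp
 hence hx: "h x = dr y" by (metis lc_cpl R_def)
 have "x:M" using elim(1) hx by (simp add: x_def)
 moreover have "jx (zW (R y)) = x"
 using elim(2,5) QpQ[of "R y"] by (simp add: m_def x_def)
 ultimately show ?case using hx by simp
 qed
 have "nfM a b W T M qp jx h"
 by unfold_locales (fact vTh Xi Th0 h0 hcpx inM onM)+
 thus ?thesis by blast
qed

section \<open>Slice charts, tangent spaces and existence of the normal form\<close>

lemma real_analytic_Ck: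
 fixes f :: "complex^'n::finite => complex^'k::finite"
 assumes "open S" "real_analytic_on f S" shows "Ck_on k f S"
proof (rule Ck_on_vec[OF assms(1)])
 fix i
 have "blin (%x::complex^'k. x$i)" by (rule bounded_linear_vec_nth)
 from real_analytic_linear[OF assms(2) this] show "Ck_on k (%x. f x$i) S"
 by (intro cpx_Ck_on real_analytic_cpx)
qed

lemma of_class_Ck:
 fixes f :: "complex^'n::finite => complex^'k::finite"
 assumes "open S" "of_class r f S" "r = C_infinity | r = C_omega" shows "Ck_on k f S"
 using assms real_analytic_Ck by auto

lemma diffeo_deriv:
 fixes f :: "complex^'n::finite => complex^'n"
 assumes d: "diffeo r U V f" and r: "r = C_infinity | r = C_omega" and x: "x:U"
 obtains A B where "(f HD A) (at x)" "(inv_into U f HD B) (at (f x))"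
 "ALL w. A (B w) = w" "ALL v. B (A v) = v" "blin A" "blin B"
proof -
 have o: "open U" "open V" and bij: "bij_betw f U V" and c: "of_class r f U" "of_class r (inv_into U f) V"
 using d by (auto simp: diffeo_def)
 have fx: "f x:V" using bij x by (auto simp: bij_betw_def)
 have 1: "(f HD dd f x) (at x)" by (rule Ck_has_derivative[OF of_class_Ck[OF o(1) c(1) r, of "Suc 0"] x])
 have 2: "(inv_into U f HD dd (inv_into U f) (f x)) (at (f x))"
 by (rule Ck_has_derivative[OF of_class_Ck[OF o(2) c(2) r, of "Suc 0"] fx])
 have gf: "inv_into U f (f y) = y" if "y:U" for y using bij that by (simp add: bij_betw_def)
 have fg: "f (inv_into U f y) = y" if "y:V" for y using bij that by (simp add: bij_betw_def f_inv_into_f)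
 have 3: "((%y. inv_into U f (f y)) HD (%v. dd (inv_into U f) (f x) (dd f x v))) (at x)"
 by (rule hdc[OF 1 2])
 have "((%y. y) HD (%v. dd (inv_into U f) (f x) (dd f x v))) (at x)"
 by (rule has_derivative_transform_within_open[OF 3 o(1) x gf])
 from has_derivative_unique[OF this has_derivative_ident] have 4: "dd (inv_into U f) (f x) (dd f x v) = v" for v by metis
 have 5: "((%y. f (inv_into U f y)) HD (%v. dd f x (dd (inv_into U f) (f x) v))) (at (f x))"
 by (rule hdc[OF 2]) (simp add: gf[OF x] 1)
 have "((%y. y) HD (%v. dd f x (dd (inv_into U f) (f x) v))) (at (f x))"
 by (rule has_derivative_transform_within_open[OF 5 o(2) fx fg])
 from has_derivative_unique[OF this has_derivative_ident] have 6: "dd f x (dd (inv_into U f) (f x) v) = v" for v by metis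
 show thesis by (rule that[OF 1 2 allI[OF 6] allI[OF 4] hdbl[OF 1] hdbl[OF 2]])
qed

lemma slice_chartD:
 assumes "slice_chart r M B V f"
 shows "diffeo r V (f ` V) f" "B <= Basis" "x:V ==> x:M <-> (ALL b:B. f x ~~ b = 0)"
 "x:V ==> inv_into V f (f x) = x" "y:f ` V ==> f (inv_into V f y) = y" "y:f ` V ==> inv_into V f y:V" "open V" "open (f ` V)"
proof -
 have e: "f ` (M Int V) = {y:f ` V. ALL b:B. y ~~ b = 0}" and d: "diffeo r V (f ` V) f" and B: "B <= Basis"
 using assms by (auto simp: slice_chart_def)
 show "diffeo r V (f ` V) f" "B <= Basis" by fact+
 have inj: "inj_on f V" using d by (auto simp: diffeo_def bij_betw_def)
 show "x:M <-> (ALL b:B. f x ~~ b = 0)" if x: "x:V"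
 proof
 assume "x:M" hence "f x:f ` (M Int V)" using x by auto
 thus "ALL b:B. f x ~~ b = 0" unfolding e by auto
 next
 assume "ALL b:B. f x ~~ b = 0"
 hence "f x:f ` (M Int V)" unfolding e using x by auto
 then obtain y where "y:M" "y:V" "f y = f x" by auto
 thus "x:M" using inj_onD[OF inj] x by metis
 qed
 show "x:V ==> inv_into V f (f x) = x" using inj by simp
 show "y:f ` V ==> f (inv_into V f y) = y" by (rule f_inv_into_f)
 show "y:f ` V ==> inv_into V f y:V" by (rule inv_into_into)
 show "open V" "open (f ` V)" using d by (auto simp: diffeo_def)
qed

lemma tangent_kills:
 fixes f :: "'a::real_normed_vector => 'b::real_normed_vector"
 assumes v: "v:tsp M p" and d: "(f HD A) (at p)" and V: "open V" "p:V"
 and c: "!!x. x:M ==> x:V ==> f x = f p"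
 shows "A v = 0"
proof -
 obtain g e where e: "e > 0" and g: "g 0 = p" "!!t::real. \<bar>t\<bar> < e ==> g t:M" "(g has_vector_derivative v) (at 0)"
 using v unfolding tangent_space_def by blast
 have gd: "(g HD (%t. t *R v)) (at 0)" using g(3) by (simp add: has_vector_derivative_def)
 have 1: "((%t. f (g t)) HD (%t. A (t *R v))) (at 0)"
 by (rule hdc[OF gd]) (simp add: g d)
 have "isCont g 0" using gd has_derivative_continuous by blast
 hence "NEAR t. g t:V"
 by (rule ev_nhds_compose) (use g(1) evo[OF V] in auto)
 moreover have "\<forall>\<^sub>F t in nhds (0::real). \<bar>t\<bar> < e"
 using evo[of "ball 0 e" "0::real"] e by (simp add: dist_norm)
 ultimately have "NEAR t. f (g t) = f p" by eventually_elim (use g(2) c in auto)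
 from dd_cong_ev[OF this, of 1] have "A (1 *R v) = 0" unfolding dd_eqI[OF 1] by simp
 thus ?thesis by simp
qed

lemma slice_chart_curve:
 fixes f :: "complex^'n::finite => complex^'n"
 assumes s: "slice_chart r M B V f" and r: "r = C_infinity | r = C_omega" and p: "p:M" "p:V" and A: "(f HD A) (at p)"
 and v: "ALL b:B. A v ~~ b = 0"
 shows "EX g qv. qv > 0 & g 0 = p & (ALL t::real. \<bar>t\<bar> < qv --> g t:M & g t:V & f (g t) = f p+t *R A v) &
 (g has_vector_derivative v) (at 0) & con {-qv<..<qv} g"
proof -
 note S = slice_chartD[OF s]
 obtain A' C where AC: "(f HD A') (at p)" "(inv_into V f HD C) (at (f p))" "ALL w. A' (C w) = w" "ALL v. C (A' v) = v" "blin A'" "blin C"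
 by (rule diffeo_deriv[OF S(1) r p(2)])
 have AA: "A' = A" by (rule has_derivative_unique[OF AC(1) A])
 define g where "g t = inv_into V f (f p+t *R A v)" for t :: real
 have l: "((%t::real. f p+t *R A v) HD (%t. t *R A v)) (at 0)"
 by (auto intro!: derivative_eq_intros)
 have "(g HD (%t. C (t *R A v))) (at 0)"
 unfolding g_def by (rule hdc[OF l]) (simp add: AC(2))
 moreover have "C (t *R A v) = t *R v" for t
 using linear_cmul[OF bllin[OF hdbl[OF AC(2)]]] AC(4)[rule_format, of v] AA by simp
 ultimately have gv: "(g has_vector_derivative v) (at 0)" by (simp add: has_vector_derivative_def)
 have fp: "f p:f ` V" using p by auto
 have "isCont (%t::real. f p+t *R A v) 0" by (intro continuous_intros)
 hence "\<forall>\<^sub>F t in nhds (0::real). f p+t *R A v:f ` V"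
 by (rule ev_nhds_compose) (use evo[OF S(8) fp] in auto)
 then obtain e where e: "e > 0" "!!t::real. dist t 0 < e ==> f p+t *R A v:f ` V"
 unfolding eventually_nhds_metric by blast
 have "g t:M & g t:V & f (g t) = f p+t *R A v" if "\<bar>t\<bar> < e" for t
 proof -
 have "f p+t *R A v:f ` V" using e(2)[of t] that by simp
 from S(5,6)[OF this] have 1: "f (g t) = f p+t *R A v" "g t:V" by (auto simp: g_def)
 have "f (g t) ~~ b = 0" if "b:B" for b using S(3)[OF p(2)] p(1) v that unfolding 1 by (simp add: inner_add_left)
 thus ?thesis using S(3)[OF 1(2)] 1 by blast
 qed
 moreover have "g 0 = p" using S(4)[OF p(2)] by (simp add: g_def)
 moreover have "con {-e<..<e} g"
 proof -
 have "of_class r (inv_into V f) (f ` V)" using S(1) by (simp add: diffeo_def)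
 from of_class_Ck[OF S(8) this r, of 0] have c: "con (f ` V) (inv_into V f)" by simp
 show ?thesis unfolding g_def
 by (rule continuous_on_compose2[OF c]) (auto intro!: continuous_intros e(2))
 qed
 ultimately show ?thesis using e(1) gv by (intro exI[of _ g] exI[of _ e]) simp
qed

lemma slice_chart_tangent:
 fixes f :: "complex^'n::finite => complex^'n"
 assumes s: "slice_chart r M B V f" and r: "r = C_infinity | r = C_omega" and p: "p:M" "p:V" and A: "(f HD A) (at p)"
 shows "tsp M p = {v. ALL b:B. A v ~~ b = 0}"
proof
 note S = slice_chartD[OF s]
 show "tsp M p <= {v. ALL b:B. A v ~~ b = 0}"
 proof (intro subsetI CollectI ballI)
 fix v b assume v: "v:tsp M p" and b: "b:B"
 have d: "((%x. f x ~~ b) HD (%v. A v ~~ b)) (at p)" by (intro has_derivative_inner_left A)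
 show "A v ~~ b = 0" by (rule tangent_kills[OF v d S(7) p(2)]) (use S(3) b p in auto)
 qed
 show "{v. ALL b:B. A v ~~ b = 0} <= tsp M p"
 proof
 fix v assume "v:{v. ALL b:B. A v ~~ b = 0}"
 hence z: "ALL b:B. A v ~~ b = 0" by simp
 obtain g e where "e > 0" "g 0 = p" "ALL t::real. \<bar>t\<bar> < e --> g t:M & g t:V & f (g t) = f p+t *R A v"
 "(g has_vector_derivative v) (at 0)" "con {-e<..<e} g" using slice_chart_curve[OF s r p A, of v, OF z] by (elim exE conjE)
 thus "v:tsp M p" unfolding tangent_space_def by (intro CollectI exI[of _ g] exI[of _ e]) simp
 qed
qed

lemma dim_coordinate_kernel:
 fixes A C :: "'a::euclidean_space => 'a"
 assumes "linear A" "linear C" "!!w. A (C w) = w" "!!v. C (A v) = v" "B <= Basis"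
 shows "dim {v. ALL b:B. A v ~~ b = 0} = DIM('a) - card B"
proof -
 have "{v. ALL b:B. A v ~~ b = 0} = C ` {w. ALL b:B. w ~~ b = 0}"
 proof
 show "C ` {w. ALL b:B. w ~~ b = 0} <= {v. ALL b:B. A v ~~ b = 0}" using assms(3) by auto
 show "{v. ALL b:B. A v ~~ b = 0} <= C ` {w. ALL b:B. w ~~ b = 0}"
 proof
 fix v assume "v:{v. ALL b:B. A v ~~ b = 0}"
 hence "A v:{w. ALL b:B. w ~~ b = 0}" by simp
 from imageI[OF this, of C] show "v:C ` {w. ALL b:B. w ~~ b = 0}" by (simp add: assms(4))
 qed
 qed
 moreover have "inj C" by (rule inj_on_inverseI[of _ A]) (simp add: assms)
 ultimately have "dim {v. ALL b:B. A v ~~ b = 0} = dim {w::'a. ALL b:B. w ~~ b = 0}"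
 by (simp add: dim_image_eq[OF assms(2) inj_on_subset])
 also have "{w::'a. ALL b:B. w ~~ b = 0} = {w. ALL i:Basis. i ~: Basis - B --> w ~~ i = 0}" using assms(5) by auto
 also have "dim \<dots> = card (Basis - B)" by (rule dim_substandard) auto
 also have "\<dots> = DIM('a) - card B" by (rule card_Diff_subset[OF finite_subset[OF assms(5) finite_Basis] assms(5)])
 finally show ?thesis .
qed

text \<open>Genericity makes the holomorphic differentials of the two defining functions linearly
  independent, so some 2 x 2 minor of coordinate derivatives is nonzero; a and b are its
  columns.\<close>

theorem nfM_exists:
 fixes M :: "(complex^'n::finite) set"
 assumes sub: "submanifold C_omega 2 M" and gen: "generic M" and M0: "0:M"
 shows "EX a b W T qp jx h. nfM a b W T M qp jx h"
proof -
 obtain V f B where V: "0:V" and cB: "card B = 2" and s: "slice_chart C_omega M B V f"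
 using sub M0 unfolding submanifold_def by blast
 note S = slice_chartD[OF s]
 obtain b1 b2 where B: "B = {b1,b2}" "b1 ~= b2" using cB by (meson card_2_iff)
 have bB: "b1:Basis" "b2:Basis" using S(2) B by auto
 define qj where "qj b x = complex_of_real (f x ~~ b)" for b x
 have rac: "real_analytic_on f V" using S(1) by (simp add: diffeo_def)
 have cp: "cpx (qj b) x" if "x:V" for b x
 proof -
 have "blin (%y. complex_of_real (y ~~ b))"
 by (rule bounded_linear_compose[OF bounded_linear_of_real bounded_linear_inner_left])
 from real_analytic_cpx[OF real_analytic_linear[OF rac this] that] show ?thesis by (simp add: qj_def[abs_def])
 qed
 have rho0: "qj b 0 = 0" if "b:B" for b using S(3)[OF V] M0 that by (simp add: qj_def)
 have im: "NEAR x. Im (qj b x) = 0" for b by (simp add: qj_def)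
 obtain F1 where F1: "ger F1" "ALL X. cnj (F1 (cj X)) = F1 X" "NEAR x. qj b1 x = F1 (rl x)" "F1 0 = qj b1 0"
 by (rule symmetric_complexification[OF cp[OF V, of b1] im])
 obtain F2 where F2: "ger F2" "ALL X. cnj (F2 (cj X)) = F2 X" "NEAR x. qj b2 x = F2 (rl x)" "F2 0 = qj b2 0"
 by (rule symmetric_complexification[OF cp[OF V, of b2] im])
 have rg: "C_omega = C_infinity | C_omega = C_omega" by simp
 obtain A C where AC: "(f HD A) (at 0)" "(inv_into V f HD C) (at (f 0))" "ALL w. A (C w) = w" "ALL v. C (A v) = v" "blin A" "blin C"
 by (rule diffeo_deriv[OF S(1) rg V])
 have T: "tsp M 0 = {v. ALL b:B. A v ~~ b = 0}" by (rule slice_chart_tangent[OF s _ M0 V AC(1)]) simp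
 define D1 where "D1 = dd F1 0"
 define D2 where "D2 = dd F2 0"
 have DA: "dd F 0 (rl v) = of_real (A v ~~ b)" if "ger F" "NEAR x. qj b x = F (rl x)" for F b v
 proof -
 have "(qj b HD (%v. dd F (rl 0) (rl v))) (at (0+0))"
 using ev_x[OF cpx_has_derivative[OF that(1), of "qj b" 0]] that(2) by simp
 moreover have "(qj b HD (%v. of_real (A v ~~ b))) (at 0)"
 unfolding qj_def by (intro has_derivative_of_real has_derivative_inner_left AC)
 ultimately have "(%v. dd F (rl 0) (rl v)) = (%v. of_real (A v ~~ b))" by (intro has_derivative_unique) simp_all
 from fun_cong[OF this, of v] show ?thesis by simp
 qed
 have c1: "cdiff F1 0" and c2: "cdiff F2 0" using F1(1) F2(1) gerD0 by auto
 \<comment> \<open>Since T + J T is everything, some tangent vector w has prescribed differentials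
   s1, s2 on J w, while those on w vanish. As \<open>cpl w 0\<close> is half of \<open>rl w\<close>
   plus 1/(2i) times \<open>rl (J w)\<close>, the values become s1/(2i) and s2/(2i).\<close>
 have key: "EX w. D1 (cpl w 0) = of_real s1 / (2*\<i>) & D2 (cpl w 0) = of_real s2 / (2*\<i>)" for s1 s2
 proof -
 have "C (s1 *R b1+s2 *R b2):{u+v |u v. u:tsp M 0 & v:J ` tsp M 0}"
 using gen M0 unfolding generic_def by blast
 then obtain u w where uw: "C (s1 *R b1+s2 *R b2) = u+J w" "u:tsp M 0" "w:tsp M 0" by blast
 have bl: "blin A" by (rule hdbl[OF AC(1)])
 have "A u+A (J w) = s1 *R b1+s2 *R b2" using AC(3)[rule_format, of "s1 *R b1+s2 *R b2"] uw(1) linear_add[OF bllin[OF bl]] by metis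
 hence "A (J w) = s1 *R b1+s2 *R b2 - A u" by (metis add_diff_cancel_left')
 hence e: "A (J w) ~~ b = s1 * (b1 ~~ b)+s2 * (b2 ~~ b) - A u ~~ b" for b
 by (simp add: inner_add_left inner_diff_left)
 have Au: "A u ~~ b1 = 0" "A u ~~ b2 = 0" "A w ~~ b1 = 0" "A w ~~ b2 = 0" using uw T B by auto
 have i: "b1 ~~ b1 = 1" "b2 ~~ b2 = 1" "b1 ~~ b2 = 0" "b2 ~~ b1 = 0" using bB B(2) by (auto simp: inner_Basis)
 have AJ: "A (J w) ~~ b1 = s1" "A (J w) ~~ b2 = s2" using e[of b1] e[of b2] by (simp_all add: Au i)
 have r: "cpl w 0 = (1/2) *s rl w+(1/(2*\<i>)) *s rl (J w)" by (simp add: veq2 J_def)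
 have "dd F 0 (cpl w 0) = (1/2) * dd F 0 (rl w)+(1/(2*\<i>)) * dd F 0 (rl (J w))" if "cdiff F 0" for F
 unfolding r by (simp only: dd_add_vec[OF that] cdiff_scale[OF that])
 hence "D1 (cpl w 0) = of_real s1 / (2*\<i>)" "D2 (cpl w 0) = of_real s2 / (2*\<i>)"
 using c1 c2 DA[OF F1(1,3)] DA[OF F2(1,3)] Au AJ by (simp_all add: D1_def D2_def)
 thus ?thesis by blast
 qed
 have "EX a b. D1 (ax (Inl a)) * D2 (ax (Inl b)) - D1 (ax (Inl b)) * D2 (ax (Inl a)) ~= 0"
 proof (rule ccontr)
 assume n: "\<not> ?thesis"
 obtain w1 where w1: "D1 (cpl w1 0) = 1 / (2*\<i>)" "D2 (cpl w1 0) = 0" using key[of 1 0] by auto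
 obtain w2 where w2: "D1 (cpl w2 0) = 0" "D2 (cpl w2 0) = 1 / (2*\<i>)" using key[of 0 1] by auto
 let ?u = "cpl w1 0" and ?v = "cpl w2 0"
 \<comment> \<open>Expansion of a minor by coordinate minors: if all of those in holomorphic
   directions vanished, so would this one, since the vectors have no right components.\<close>
 have "D1 ?u * D2 ?v - D1 ?v * D2 ?u = (SUM i:UNIV. SUM l:UNIV. ?u$i * ?v$l * (D1 (ax i) * D2 (ax l) - D1 (ax l) * D2 (ax i)))"
 proof -
 have x: "D1 Z = (SUM i:UNIV. Z$i * D1 (ax i))" "D2 Z = (SUM i:UNIV. Z$i * D2 (ax i))" for Z
 unfolding D1_def D2_def by (rule dd_expand[OF c1], rule dd_expand[OF c2])
 have "D1 ?u * D2 ?v = (SUM i:UNIV. SUM l:UNIV. (?u$i * D1 (ax i)) * (?v$l * D2 (ax l)))"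
 by (subst x(1), subst x(2), rule sum_product)
 moreover have "D2 ?u * D1 ?v = (SUM i:UNIV. SUM l:UNIV. (?u$i * D2 (ax i)) * (?v$l * D1 (ax l)))"
 by (subst x(1), subst x(2), rule sum_product)
 ultimately show ?thesis by (simp add: sum_subtractf[symmetric] algebra_simps)
 qed
 also have "\<dots> = 0"
 proof (intro sum.neutral ballI)
 fix i l :: "'n+'n"
 show "?u$i * ?v$l * (D1 (ax i) * D2 (ax l) - D1 (ax l) * D2 (ax i)) = 0"
 using n by (cases i; cases l) auto
 qed
 finally show False by (simp add: w1 w2)
 qed
 then obtain a b where det: "D1 (ax (Inl a)) * D2 (ax (Inl b)) - D1 (ax (Inl b)) * D2 (ax (Inl a)) ~= 0" by blast
 hence ab: "a ~= b" by auto
 define P where "P k = (if k = a then F1 else F2)" for k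
 have evV: "NEAR x. x:V" by (rule evo[OF S(7) V])
 have "EX W T qp jx h. nfM a b W T M qp jx h"
 proof (rule normalization[OF ab, of P])
 show "ger (P k)" "cnj (P k (cj X)) = P k X" "P k 0 = 0" for k X
 using F1 F2 rho0 B by (auto simp: P_def)
 show "dd (P a) 0 (ax (Inl a)) * dd (P b) 0 (ax (Inl b)) - dd (P a) 0 (ax (Inl b)) * dd (P b) 0 (ax (Inl a)) ~= 0"
 using det ab by (simp add: P_def D1_def D2_def)
 show "NEAR x. x:M <-> P a (rl x) = 0 & P b (rl x) = 0"
 using evV F1(3) F2(3)
 proof eventually_elim
 case (elim x)
 have "x:M <-> qj b1 x = 0 & qj b2 x = 0" using S(3)[OF elim(1)] B(1) by (simp add: qj_def)
 thus ?case using elim(2,3) ab by (simp add: P_def)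
 qed
 show "NEAR x. cpx (%x. P k (rl x)) x" for k
 using evV ev_nhds_nested[OF F1(3)] ev_nhds_nested[OF F2(3)]
 proof eventually_elim
 case (elim x)
 show ?case
 using cpx_cong[OF cp[OF elim(1), of b1] elim(2)] cpx_cong[OF cp[OF elim(1), of b2] elim(3)] by (simp add: P_def)
 qed
 qed
 thus ?thesis by blast
qed

section \<open>Conormals of Levi-flat hypersurfaces\<close>

definition pr :: "(complex^'n => real) => complex^'n => complex^'n => complex" where
 "pr r x v = of_real (dd r x v) - \<i> * of_real (dd r x (\<i> *s v))"

text \<open>\<open>pr r x\<close> is twice the (1,0) part of dr; on a hypersurface whose tangent
  spaces are the kernels of dr, its kernel is the complex tangent space. \<open>lam\<close> is the
  multiple that takes the value 1 on e, which makes it independent of the choice of r.\<close>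

definition lam :: "(complex^'n => real) => complex^'n => complex^'n => complex^'n => complex" where
 "lam r e x v = pr r x v * inverse (pr r x e)"

lemma pr_linear:
 assumes "r differentiable (at x)"
 shows "pr r x (u+v) = pr r x u+pr r x v" "pr r x (c *s v) = c * pr r x v"
proof -
 have bl: "blin (dd r x)" using assms fdw hdbl by blast
 note lin = linear_add[OF bllin[OF bl]] linear_cmul[OF bllin[OF bl]]
 show add: "pr r x (u+v) = pr r x u+pr r x v" for u v
 by (simp add: pr_def lin vector_add_ldistrib algebra_simps)
 have r: "pr r x (a *R v) = a * pr r x v" for a v
 proof -
 have "\<i> *s (a *R v) = a *R (\<i> *s v)" by (simp add: veq)
 thus ?thesis by (simp add: pr_def lin algebra_simps)
 qed
 have i: "pr r x (\<i> *s v) = \<i> * pr r x v" for v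
 proof -
 have "\<i> *s (\<i> *s v) = (-1) *R v" by (simp add: veq)
 hence "dd r x (\<i> *s (\<i> *s v)) = - dd r x v" using lin(2)[of "-1" v] by simp
 thus ?thesis by (simp add: pr_def algebra_simps)
 qed
 have "c *s v = Re c *R v+Im c *R (\<i> *s v)" by (simp add: veq ceq)
 thus "pr r x (c *s v) = c * pr r x v"
 by (simp add: add r i) (simp add: ceq algebra_simps)
qed

lemma pr_zero_iff: "pr r x v = 0 <-> dd r x v = 0 & dd r x (\<i> *s v) = 0"
 by (auto simp: pr_def ceq)

lemma complex_tangent_pr:
 assumes T: "tsp A x = {v. dd r x v = 0}" and d: "r differentiable (at x)"
 shows "v:cts A x <-> pr r x v = 0"
proof
 assume "v:cts A x"
 then obtain u where u: "v = \<i> *s u" "dd r x u = 0" "dd r x v = 0" using T by (auto simp: cts_def J_def)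
 hence "pr r x u = 0" by (simp add: pr_zero_iff)
 thus "pr r x v = 0" using pr_linear(2)[OF d] u(1) by simp
next
 assume z: "pr r x v = 0"
 hence "pr r x ((-\<i>) *s v) = 0" unfolding pr_linear(2)[OF d] by simp
 hence "dd r x ((-\<i>) *s v) = 0" by (simp only: pr_zero_iff)
 moreover have "v = J ((-\<i>) *s v)" by (simp add: J_def veq)
 moreover have "dd r x v = 0" using z by (simp add: pr_zero_iff)
 ultimately show "v:cts A x" unfolding cts_def T by blast
qed

lemma Ck_on_pr:
 assumes "open S" "!!k. Ck_on k r S" shows "Ck_on k (%x. pr r x v) S"
proof -
 have 1: "Ck_on k (%x. dd r x v) S" for v using assms(2)[of "Suc k"] by simp
 have 2: "Ck_on k (%x. complex_of_real (dd r x v)) S" for v by (rule Ck_on_linear[OF assms(1) bounded_linear_of_real 1])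
 have 3: "blin (%z. - \<i> * z)" by (rule bounded_linear_mult_right)
 have "Ck_on k (%x. of_real (dd r x v)+- \<i> * of_real (dd r x (\<i> *s v))) S"
 by (rule Ck_on_add[OF assms(1) 2 Ck_on_linear[OF assms(1) 3 2]])
 thus ?thesis by (simp add: pr_def)
qed

context
 fixes r :: "complex^'n::finite => real" and e :: "complex^'n" and S :: "(complex^'n) set"
 assumes S: "open S" and rC: "!!k. Ck_on k r S" and e: "!!x. x:S ==> pr r x e ~= 0"
begin

lemma r_diff: "x:S ==> r differentiable (at x)"
 using rC[of "Suc 0"] by simp

lemma Ck_on_lam: "Ck_on k (%x. lam r e x v) S"
 unfolding lam_def
 by (rule Ck_on_mult[OF S Ck_on_pr[OF S rC] Ck_on_inverse[OF S Ck_on_pr[OF S rC] e]])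

lemma lam_deriv: "x:S ==> ((%x. lam r e x v) HD dd (%x. lam r e x v) x) (at x)"
 by (rule Ck_has_derivative[OF Ck_on_lam[of "Suc 0"]])

lemma lam_linear:
 assumes "x:S"
 shows "lam r e x (u+v) = lam r e x u+lam r e x v" "lam r e x (c *s v) = c * lam r e x v" "lam r e x e = 1"
 using e[OF assms] by (simp_all add: lam_def pr_linear[OF r_diff[OF assms]] algebra_simps)

lemma dd_lam_add:
 assumes x: "x:S" shows "dd (%x. lam r e x (u+c *s v)) x w = dd (%x. lam r e x u) x w+c * dd (%x. lam r e x v) x w"
proof -
 have "dd (%x. lam r e x (u+c *s v)) x w = dd (%x. lam r e x u+c * lam r e x v) x w"
 by (rule dd_cong_ev[OF evm[OF evo[OF S x]]]) (simp add: lam_linear)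
 also have "\<dots> = dd (%x. lam r e x u) x w+c * dd (%x. lam r e x v) x w"
 by (rule dd_eqI[OF has_derivative_add[OF lam_deriv[OF x] has_derivative_mult_right[OF lam_deriv[OF x]]]])
 finally show ?thesis .
qed

lemma dd_lam_e: assumes x: "x:S" shows "dd (%x. lam r e x e) x w = 0"
proof -
 have "dd (%x. lam r e x e) x w = dd (%x. 1) x w"
 by (rule dd_cong_ev[OF evm[OF evo[OF S x]]]) (simp add: lam_linear)
 thus ?thesis by (simp add: dd_eqI[OF has_derivative_const])
qed

text \<open>Involutivity is applied to the fields \<open>X - \<lambda>(X) e\<close> with \<open>X\<close> constant, which annihilate \<open>\<lambda>\<close>.\<close>

lemma levi_flat_symmetric:
 assumes LF: "Levi_flat A" and T: "!!x. x:A ==> x:S ==> tsp A x = {v. dd r x v = 0}"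
 and x: "x:A" "x:S" and X: "lam r e x X = 0" and Y: "lam r e x Y = 0"
 shows "dd (%x. lam r e x Y) x X = dd (%x. lam r e x X) x Y"
proof -
 have inE: "v:cts A q <-> lam r e q v = 0" if "q:A" "q:S" for q v
 using complex_tangent_pr[OF T[OF that] r_diff[OF that(2)], of v] e[OF that(2)] by (simp add: lam_def)
 define F where "F X q = X - lam r e q X *s e" for X q
 have Fd: "(F X HD (%u. - (dd (%x. lam r e x X) q u *s e))) (at q)" if "q:S" for X q
 proof -
 have "((%q. lam r e q X *s e) HD (%u. dd (%x. lam r e x X) q u *s e)) (at q)"
 by (rule bounded_linear.has_derivative[OF bounded_linear_vsmult lam_deriv[OF that]])
 from has_derivative_diff[OF has_derivative_const[of X] this] show ?thesis by (simp add: F_def[abs_def])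
 qed
 have FC: "Ck_on 1 (F X) S" for X
 proof -
 have bl: "blin (%c. - (c *s e))" by (rule bounded_linear_minus[OF bounded_linear_vsmult])
 have "Ck_on (Suc 0) (%q. X+- (lam r e q X *s e)) S"
 by (rule Ck_on_add[OF S Ck_on_const Ck_on_linear[OF S bl Ck_on_lam]])
 thus ?thesis by (simp add: F_def[abs_def])
 qed
 have F0: "lam r e q (F X q) = 0" if "q:S" for q X
 proof -
 have "F X q = X+(- lam r e q X) *s e" by (simp add: F_def veq)
 thus ?thesis by (simp only: lam_linear[OF that]) simp
 qed
 have "dd (F Y) x (F X x) - dd (F X) x (F Y x):cts A x"
 using LF[unfolded Levi_flat_def involutive_def, rule_format, of S "F X" "F Y" x] S FC F0 inE x by auto
 hence L: "lam r e x (dd (F Y) x (F X x) - dd (F X) x (F Y x)) = 0" using inE x by blast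
 have FX: "F X x = X" "F Y x = Y" using X Y by (simp_all add: F_def)
 have eq: "dd (F Y) x (F X x) - dd (F X) x (F Y x) = (dd (%x. lam r e x X) x Y - dd (%x. lam r e x Y) x X) *s e"
 unfolding FX dd_eqI[OF Fd[OF x(2)]] by (simp add: veq algebra_simps)
 from L show ?thesis unfolding eq lam_linear(2,3)[OF x(2)] by simp
qed

text \<open>On A the symmetry is used twice: the derivative of lam(v) along iX is that of lam(iX)
  along v, which is i times that of lam(X) along v, hence i times that of lam(v) along X. A boundary
  point is only in the closure of A, so the identity is carried over as the vanishing of a
  continuous function.\<close>

lemma levi_flat_CR:
 assumes LF: "Levi_flat A" and T: "!!x. x:A ==> x:S ==> tsp A x = {v. dd r x v = 0}"
 and x: "x:closure A" "x:S" and X: "lam r e x X = 0"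
 shows "dd (%x. lam r e x v) x (\<i> *s X) = \<i> * dd (%x. lam r e x v) x X"
proof -
 have onA: "dd (%x. lam r e x v) x (\<i> *s X) = \<i> * dd (%x. lam r e x v) x X" if x: "x:A" "x:S" and X: "lam r e x X = 0" for x X
 proof -
 \<comment> \<open>The symmetry requires vectors in the kernel of lam. Subtracting a multiple of e
   achieves this and leaves the derivatives unchanged, because lam(e) is constant.\<close>
 define v' where "v' = v+(- lam r e x v) *s e"
 have v': "lam r e x v' = 0" unfolding v'_def by (simp only: lam_linear[OF x(2)]) simp
 have iX: "lam r e x (\<i> *s X) = 0" using X by (simp add: lam_linear[OF x(2)])
 have vv: "dd (%x. lam r e x v') x w = dd (%x. lam r e x v) x w" for w
 unfolding v'_def dd_lam_add[OF x(2)] dd_lam_e[OF x(2)] by simp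
 have i: "dd (%x. lam r e x (\<i> *s X)) x w = \<i> * dd (%x. lam r e x X) x w" for w
 proof -
 have "dd (%x. lam r e x (0+\<i> *s X)) x w = dd (%x. lam r e x 0) x w+\<i> * dd (%x. lam r e x X) x w"
 by (rule dd_lam_add[OF x(2)])
 moreover have "dd (%x. lam r e x (0+(-1) *s 0)) x w = dd (%x. lam r e x 0) x w+(-1) * dd (%x. lam r e x 0) x w"
 by (rule dd_lam_add[OF x(2)])
 ultimately show ?thesis by simp
 qed
 show ?thesis
 using levi_flat_symmetric[OF LF T x v' iX] levi_flat_symmetric[OF LF T x v' X] i vv by metis
 qed
 \<comment> \<open>X lies in the kernel of lam at x only; at a nearby q it is replaced by X - lam(X)
   e. The result is expanded in the fixed directions e and i e, so that continuity in q is
   visible.\<close>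
 define G where "G q = dd (%x. lam r e x v) q (\<i> *s X) - of_real (Re (\<i> * lam r e q X)) * dd (%x. lam r e x v) q e
 - of_real (Im (\<i> * lam r e q X)) * dd (%x. lam r e x v) q (\<i> *s e)
 - \<i> * (dd (%x. lam r e x v) q X - of_real (Re (lam r e q X)) * dd (%x. lam r e x v) q e
 - of_real (Im (lam r e q X)) * dd (%x. lam r e x v) q (\<i> *s e))" for q
 have cl: "con S (%q. lam r e q X)" using Ck_on_lam[of 0] by simp
 have cd: "con S (%q. dd (%x. lam r e x v) q u)" for u using Ck_on_lam[of "Suc 0" v] by simp
 have cG: "con S G" unfolding G_def by (intro continuous_intros cl cd)
 have G: "G q = dd (%x. lam r e x v) q (\<i> *s (X - lam r e q X *s e)) - \<i> * dd (%x. lam r e x v) q (X - lam r e q X *s e)" if q: "q:S" for q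
 proof -
 have bl: "blin (dd (%x. lam r e x v) q)" by (rule hdbl[OF lam_deriv[OF q]])
 have L: "dd (%x. lam r e x v) q (Y - c *s e) = dd (%x. lam r e x v) q Y - of_real (Re c) * dd (%x. lam r e x v) q e - of_real (Im c) * dd (%x. lam r e x v) q (\<i> *s e)" for Y c
 proof -
 have c: "Y - c *s e = Y - (Re c *R e+Im c *R (\<i> *s e))" by (simp add: veq ceq)
 show ?thesis unfolding c
 using linear_diff[OF bllin[OF bl]] linear_add[OF bllin[OF bl]] linear_cmul[OF bllin[OF bl]]
 by (simp add: scaleR_conv_of_real)
 qed
 have "\<i> *s (X - lam r e q X *s e) = \<i> *s X - (\<i> * lam r e q X) *s e" by (simp add: veq algebra_simps)
 thus ?thesis unfolding G_def by (simp only: L)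
 qed
 have GA: "G q = 0" if "q:A" "q:S" for q
 proof -
 have "X - lam r e q X *s e = X+(- lam r e q X) *s e" by (simp add: veq)
 hence "lam r e q (X - lam r e q X *s e) = 0" by (simp only: lam_linear[OF that(2)]) simp
 from onA[OF that this] show ?thesis unfolding G[OF that(2)] by simp
 qed
 have "G x = 0"
 proof (rule ccontr)
 assume ne: "G x ~= 0"
 have "open (S Int G -` (- {0}))" by (rule continuous_open_preimage[OF cG S]) auto
 moreover have "x:S Int G -` (- {0})" using ne x(2) by simp
 ultimately obtain q where "q:A" "q:S Int G -` (- {0})"
 using x(1) unfolding closure_iff_nhds_not_empty by blast
 thus False using GA by auto
 qed
 thus ?thesis unfolding G[OF x(2)] X by simp
qed

end

section \<open>The conormal as a CR function in normal coordinates\<close>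

context nf
begin

definition CR0 :: "(complex^'n => complex) => complex^'n => complex^('n+'n) => bool" where
 "CR0 f y e <-> f differentiable (at y) & CRd f y e = 0"

lemma CR0_const: "CR0 (%y. c) y e"
 by (simp add: CR0_def CRd_def dd_eqI[OF has_derivative_const])

lemma CR0_mult: assumes "CR0 f y e" "CR0 g y e" shows "CR0 (%y. f y * g y) y e"
proof -
 have d: "(f HD dd f y) (at y)" "(g HD dd g y) (at y)"
 using assms by (auto simp: CR0_def fdw[symmetric])
 note m = has_derivative_mult[OF d]
 have "CRd (%y. f y * g y) y e = f y * CRd g y e+CRd f y e * g y"
 unfolding CRd_def dd_eqI[OF m] by (simp add: algebra_simps)
 thus ?thesis using assms m unfolding CR0_def differentiable_def by auto
qed

lemma CR0_add: assumes "CR0 f y e" "CR0 g y e" shows "CR0 (%y. f y+g y) y e"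
proof -
 have d: "(f HD dd f y) (at y)" "(g HD dd g y) (at y)"
 using assms by (auto simp: CR0_def fdw[symmetric])
 note m = has_derivative_add[OF d]
 have "CRd (%y. f y+g y) y e = CRd g y e+CRd f y e"
 unfolding CRd_def dd_eqI[OF m] by (simp add: algebra_simps)
 thus ?thesis using assms m unfolding CR0_def differentiable_def by auto
qed

lemma CR0_sum: "finite I ==> (!!i. i:I ==> CR0 (f i) y e) ==> CR0 (%y. SUM i:I. f i y) y e"
 by (induction I rule: finite_induct) (simp_all add: CR0_const CR0_add)

lemma CR0_inverse: assumes "CR0 f y e" "f y ~= 0" shows "CR0 (%y. inverse (f y)) y e"
proof -
 have d: "(f HD dd f y) (at y)"
 using assms by (auto simp: CR0_def fdw[symmetric])
 note m = Deriv.has_derivative_inverse[OF assms(2) d]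
 have "CRd (%y. inverse (f y)) y e = - (inverse (f y) * CRd f y e * inverse (f y))"
 unfolding CRd_def dd_eqI[OF m] by (simp add: algebra_simps)
 thus ?thesis using assms m unfolding CR0_def differentiable_def by auto
qed

lemma cpx_R: assumes "ger F" shows "NEAR p. cpx (%y. F (R y)) p"
proof -
 have R: "cpx (%y. R y$k) p" for k p
 proof -
 have e: "complex_of_real (Re z) = (z+cnj z) * (1/2)" for z by (simp add: ceq)
 have h: "cpx (%y. complex_of_real (Re (y$i))) p" for i
 unfolding e by (rule cpx_mult[OF cpx_add[OF cpx_nth cpx_cnj[OF cpx_nth]] cpx_const])
 show ?thesis
 proof (cases k)
 case (Inl i) thus ?thesis by (cases "i:{a,b}") (auto simp: R_nth h)
 next
 case (Inr i) thus ?thesis by (cases "i:{a,b}") (auto simp: R_nth h cpx_cnj)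
 qed
 qed
 show ?thesis using ev_R[OF ger_nested[OF assms]]
 proof eventually_elim
 case (elim p)
 show ?case by (rule cpx_compose[where f=R, OF R cpx_hol[OF elim]])
 qed
qed

lemma el_Inl: "i ~: {a,b} ==> NEAR X. el j X$Inl i = (if i = j then 1 else 0)"
 using kas_inv_dd(2) vger_kas[unfolded vger_def]
proof eventually_elim
 case (elim X)
 have "dd kas X (dd ksi (kas X) (ax (Inl j)))$Inl i = (ax (Inl j) :: complex^('n+'n))$Inl i" using elim(2) by simp
 thus ?case using elim(1) unfolding kas_dd_nth[OF elim(3)] by (auto simp: el_def axis_def)
qed

lemma zW_dd_nth: "vdiff zW X ==> dd zW X V$i = (if i:{a,b} then dd (W i) X V else V$Inl i)"
 unfolding vdiffD(2) zW_nth dd_if dd_nth by simp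
lemma zT_dd_nth: "vdiff zT X ==> dd zT X V$i = (if i:{a,b} then dd (T i) X V else V$Inr i)"
 unfolding vdiffD(2) zT_nth dd_if dd_nth by simp

end

context nf
begin

lemma real_parts:
 assumes "Qp V = V"
 obtains u1 u2 where "V = R u1+\<i> *s R u2" "ALL f y. CRd f y V = dd f y u1+\<i> * dd f y u2"
proof
 show "V = R (lc ((1/2) *s (V+cj V)))+\<i> *s R (lc ((1/(2*\<i>)) *s (V - cj V)))"
 unfolding R_lc[OF assms] by (simp add: veq field_simps)
 show "ALL f y. CRd f y V = dd f y (lc ((1/2) *s (V+cj V)))+\<i> * dd f y (lc ((1/(2*\<i>)) *s (V - cj V)))"
 by (intro allI) (rule CRd_def)
qed

text \<open>The conormal ratio needs a nonzero denominator at 0. If its b-component vanishes there,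
  the argument is repeated with a and b exchanged.\<close>

lemma nf_swap: "nf b a W T"
proof -
 have ins: "{b,a} = {a,b}" by auto
 show ?thesis
 by (rule nf.intro, unfold ins) (rule ab[symmetric] | erule gW W0 dW0 gT dT0 WQ TQ nr nl | erule (1) Tdef)+
qed

lemma swap_defs: "nf.zW b a W = zW" "nf.zT b a T = zT" "nf.R b a = R" "nf.dr b a = dr" "nf.pk b a = pk"
proof -
 interpret s: nf b a W T by (rule nf_swap)
 have ins: "{b,a} = {a,b}" by auto
 show "nf.zW b a W = zW" unfolding s.zW_def zW_def ins ..
 show "nf.zT b a T = zT" unfolding s.zT_def zT_def ins ..
 show "nf.dr b a = dr" unfolding s.dr_def dr_def ins ..
 thus "nf.R b a = R" by (simp add: fun_eq_iff s.R_def R_def)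
 show "nf.pk b a = pk" unfolding s.pk_def pk_def ins ..
qed

lemma swap_good: "nf.good_g b a W T g ==> good_g g"
proof -
 interpret s: nf b a W T by (rule nf_swap)
 show "s.good_g g ==> good_g g" unfolding s.good_g_def good_g_def swap_defs by blast
qed

end

context nfM
begin

text \<open>The parametrization of M by its complexified parameters, back in the original
  coordinates.\<close>

definition mh :: "complex^('n+'n) => complex^'n" where "mh X = jx (zW X)"

lemma vmh: "vger mh" unfolding mh_def[abs_def] by (rule vger_compose[OF vger_zW zW0 vXi])
lemma mh0[simp]: "mh 0 = 0" by (simp add: mh_def Xi0)

lemma ev_zW: "NEAR X. P X ==> NEAR X. P (zW X)" by (rule ev_compose[OF vger_zW zW0])

lemma dd_mh: "NEAR X. ALL V. dd mh X V = dd jx (zW X) (dd zW X V)"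
 using vger_zW[unfolded vger_def] ev_zW[OF vXi[unfolded vger_def]]
 by eventually_elim (simp add: mh_def[abs_def] vdiff_compose(2))

lemma isCont_mhR: "isCont (%y. mh (R y)) 0"
proof (rule isCont_o2[where f=R and g=mh])
 show "isCont R 0" by (rule lincont[OF bl_R])
 show "isCont mh (R 0)" using vger_isCont[OF vmh] by simp
qed

lemma ev_mhR: "NEAR x. P x ==> NEAR y. P (mh (R y))"
 by (rule ev_nhds_compose[OF isCont_mhR]) simp_all

lemma mh_inM: "NEAR y. mh (R y):M"
 using inM by eventually_elim (simp add: mh_def)

lemma mhR_deriv: "NEAR y. ((%y. mh (R y)) HD (%u. dd mh (R y) (R u))) (at y)"
 using ev_R[OF vmh[unfolded vger_def]]
 by eventually_elim (rule hdc[OF blhd[OF bl_R] vdiffD(1)])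

lemma tangent_mh:
 fixes f :: "complex^'n => real"
 assumes "NEAR x. f differentiable (at x)" "NEAR x. x:M --> f x = 0"
 shows "NEAR y. ALL u. dd f (mh (R y)) (dd mh (R y) (R u)) = 0"
proof -
 have "NEAR y. f (mh (R y)) = 0" using ev_mhR[OF assms(2)] mh_inM by eventually_elim simp
 from dd_cong_germ[OF this] mhR_deriv ev_mhR[OF assms(1)] show ?thesis
 proof eventually_elim
 case (elim y)
 have "((%y. f (mh (R y))) HD (%u. dd f (mh (R y)) (dd mh (R y) (R u)))) (at y)"
 by (rule hdc[OF elim(2)]) (use elim(3) in "simp add: fdw")
 from dd_eqI[OF this] elim(1) show ?case by (simp add: dd_eqI[OF has_derivative_const])
 qed
qed

lemma vlinear:
 assumes "vdiff F x" shows "dd F x (u+v) = dd F x u+dd F x v" "dd F x (c *s v) = c *s dd F x v"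
 using linear_add[OF bllin[OF hdbl[OF vdiffD(1)[OF assms]]]] vdiffD(3)[OF assms] by auto

lemma dzW_eb: assumes "i ~: {a,b}" shows "NEAR X. dd zW X (eb i X) = 0"
 using eb_props[OF assms] vger_zW[unfolded vger_def]
proof eventually_elim
 case (elim X)
 have "dd zW X (eb i X)$k = 0" for k
 unfolding zW_dd_nth[OF elim(2)] by (cases "k:{a,b}") (use elim(1) in auto)
 thus ?case by (simp add: veq)
qed

lemma dzT_el: assumes "j ~: {a,b}" shows "NEAR X. dd zT X (el j X) = 0"
 using el_props[OF assms] vger_zT[unfolded vger_def]
proof eventually_elim
 case (elim X)
 have "dd zT X (el j X)$k = 0" for k
 unfolding zT_dd_nth[OF elim(2)] by (cases "k:{a,b}") (use elim(1) in auto)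
 thus ?case by (simp add: veq)
qed

lemma dzW_el: assumes j: "j ~: {a,b}"
 shows "NEAR X. dd zW X (el j X) = ax j+ell' j a X *s ax a+ell' j b X *s ax b"
proof -
 have "NEAR X. ALL i. i ~: {a,b} --> el j X$Inl i = (if i = j then 1 else 0)"
 proof (rule eventually_all_finite)
 fix i show "NEAR X. i ~: {a,b} --> el j X$Inl i = (if i = j then 1 else 0)"
 using el_Inl[of i j] by (cases "i:{a,b}") (auto elim: evm)
 qed
 moreover have "NEAR X. dd (W k) X (el j X) = ell' j k X" if "k:{a,b}" for k by (rule ell_ev[OF that j])
 from this[of a] this[of b] have "NEAR X. dd (W a) X (el j X) = ell' j a X & dd (W b) X (el j X) = ell' j b X"
 by (intro eventually_conj) auto
 ultimately show ?thesis using vger_zW[unfolded vger_def]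
 proof eventually_elim
 case (elim X)
 have "dd zW X (el j X)$i = (ax j+ell' j a X *s ax a+ell' j b X *s ax b)$i" for i
 using elim(1,2) j ab unfolding zW_dd_nth[OF elim(3)] by (auto simp: axis_def)
 thus ?case by (simp add: veq)
 qed
qed

lemma dzT_R: "NEAR y. ALL u. dd zT (R y) (R u) = cnj_vec (dd zW (R y) (R u))"
 using ev_R[OF vger_zW[unfolded vger_def]] ev_R[OF vger_zT[unfolded vger_def]] dd_T_conj[of a, simplified] dd_T_conj[of b, simplified]
proof eventually_elim
 case (elim y)
 show ?case
 proof (intro allI)
 fix u
 have "dd zT (R y) (R u)$i = cnj_vec (dd zW (R y) (R u))$i" for i
 using elim(3,4) unfolding cnj_vec_nth zW_dd_nth[OF elim(1)] zT_dd_nth[OF elim(2)] by (auto simp: R_nth)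
 thus "dd zT (R y) (R u) = cnj_vec (dd zW (R y) (R u))" by (simp add: veq)
 qed
qed

text \<open>A (0,1) field annihilates \<open>zW\<close>, hence the holomorphic map
  \<open>mh\<close>. Split into real and imaginary part, this is the Cauchy-Riemann equation along
  M.\<close>

lemma dmh_eb: assumes i: "i ~: {a,b}"
 shows "NEAR y. ALL u1 u2. eb i (R y) = R u1+\<i> *s R u2 --> dd mh (R y) (R u2) = \<i> *s dd mh (R y) (R u1)"
 using ev_R[OF vmh[unfolded vger_def]] ev_R[OF dzW_eb[OF i]] ev_R[OF dd_mh] ev_R[OF ev_zW[OF vXi[unfolded vger_def]]]
proof eventually_elim
 case (elim y)
 show ?case
 proof (intro allI impI)
 fix u1 u2 assume e: "eb i (R y) = R u1+\<i> *s R u2"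
 have "dd jx (zW (R y)) 0 = 0" using vlinear(2)[OF elim(4), of 0 0] by simp
 hence "dd mh (R y) (eb i (R y)) = 0" using elim(2,3) by simp
 hence "dd mh (R y) (R u1)+\<i> *s dd mh (R y) (R u2) = 0" unfolding e vlinear[OF elim(1)] .
 hence "\<i> *s (dd mh (R y) (R u1)+\<i> *s dd mh (R y) (R u2)) = 0" by simp
 thus "dd mh (R y) (R u2) = \<i> *s dd mh (R y) (R u1)" by (simp add: veq algebra_simps)
 qed
qed

text \<open>\<open>el j\<close> annihilates \<open>zT\<close>, whose derivative in real directions
  is the conjugate of that of \<open>zW\<close>; conjugating gives the equation with the opposite
  orientation.\<close>

lemma dmh_el: assumes j: "j ~: {a,b}"
 shows "NEAR y. ALL u1 u2. el j (R y) = R u1+\<i> *s R u2 --> dd mh (R y) (R u1) = \<i> *s dd mh (R y) (R u2)"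
 using ev_R[OF vger_zT[unfolded vger_def]] ev_R[OF dzT_el[OF j]] ev_R[OF dd_mh] ev_R[OF ev_zW[OF vXi[unfolded vger_def]]] dzT_R
proof eventually_elim
 case (elim y)
 show ?case
 proof (intro allI impI)
 fix u1 u2 assume e: "el j (R y) = R u1+\<i> *s R u2"
 let ?z = "%u. dd zW (R y) (R u)"
 have "cnj_vec (?z u1)+\<i> *s cnj_vec (?z u2) = 0"
 using elim(2,5) unfolding e vlinear[OF elim(1)] by simp
 hence "cnj_vec (cnj_vec (?z u1)+\<i> *s cnj_vec (?z u2)) = 0" by simp
 hence "?z u1 = \<i> *s ?z u2" by (simp add: veq)
 thus "dd mh (R y) (R u1) = \<i> *s dd mh (R y) (R u2)" using elim(3) vlinear(2)[OF elim(4)] by simp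
 qed
qed

lemma nfM_swap: "nfM b a W T M qp jx h"
proof -
 have on': "NEAR x. x:M --> qp x = zW (R (h x)) & Im (h x$b) = 0 & Im (h x$a) = 0"
 using onM by eventually_elim blast
 show ?thesis
 by (intro nfM.intro nfM_axioms.intro nf_swap; (unfold swap_defs)?) (fact vTh vXi Th0 Xi0 XiTh ThXi h0 hcpx inM on')+
qed

end

text \<open>A is the Levi-flat hypersurface without boundary. M is merely required to lie in its
  closure, which covers both a hypersurface through M and one ending at M.\<close>

locale lf = nfM a b W T M qp jx h for a b :: "'n::finite" and W T M qp jx h +
 fixes r :: "complex^'n => real" and e :: "complex^'n" and S A :: "(complex^'n) set"
 assumes S: "open S" "0:S" and rC: "!!k. Ck_on k r S" and e: "!!x. x:S ==> pr r x e ~= 0"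
 and rM: "NEAR x. x:M --> r x = 0"
 and LF: "Levi_flat A" and TA: "!!x. x:A ==> x:S ==> tsp A x = {v. dd r x v = 0}"
 and cl: "NEAR x. x:M --> x:closure A"
begin

text \<open>The components of the normalized conormal in normal coordinates, as functions of the
  parameters of M.\<close>

definition eta :: "'n => complex^'n => complex" where
 "eta i y = (SUM l:UNIV. lam r e (mh (R y)) (ax l) * dd jx (zW (R y)) (ax i)$l)"

lemma lam_sum: assumes x: "x:S" shows "lam r e x v = (SUM l:UNIV. lam r e x (ax l) * v$l)"
proof -
 note L = lam_linear[OF S(1) rC e x]
 have z: "lam r e x 0 = 0" using L(2)[of 0 0] by simp
 have "lam r e x (SUM l:I. v$l *s ax l) = (SUM l:I. lam r e x (ax l) * v$l)" if "finite I" for I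
 using that by (induction I) (simp_all add: z L(1,2) mult.commute)
 from this[of UNIV] show ?thesis using vec_basis_expansion[of v] by simp
qed

lemma eta_lam: "mh (R y):S ==> eta i y = lam r e (mh (R y)) (dd jx (zW (R y)) (ax i))"
 by (simp add: eta_def lam_sum)

lemma ev_S: "NEAR y. mh (R y):S" by (rule ev_mhR[OF evo[OF S]])
lemma ev_cl: "NEAR y. mh (R y):closure A" using ev_mhR[OF cl] mh_inM by eventually_elim simp

lemma dr_mh: "NEAR y. ALL u. dd r (mh (R y)) (dd mh (R y) (R u)) = 0"
 by (rule tangent_mh[OF evm[OF evo[OF S] r_diff[OF S(1) rC e]] rM])

text \<open>The real and imaginary parts of \<open>el j\<close> are pushed forward to vectors of M
  that are multiples of each other by i. As r vanishes on M, both are annihilated by dr, hence by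
  \<open>lam\<close>; the relation is this fact in coordinates.\<close>

lemma eta_rel: assumes j: "j ~: {a,b}"
 shows "NEAR y. eta j y+ell' j a (R y) * eta a y+ell' j b (R y) * eta b y = 0"
 using ev_S dmh_el[OF j] dr_mh ev_R[OF dd_mh] ev_R[OF dzW_el[OF j]] ev_R[OF ev_zW[OF vXi[unfolded vger_def]]] ev_R[OF vmh[unfolded vger_def]]
proof eventually_elim
 case (elim y)
 note L = lam_linear[OF S(1) rC e elim(1)]
 obtain u1 u2 where u: "el j (R y) = R u1+\<i> *s R u2" "ALL f y'. CRd f y' (el j (R y)) = dd f y' u1+\<i> * dd f y' u2"
 by (rule real_parts[OF Qp_el[of j "R y"]])
 let ?d = "dd mh (R y)"
 have 1: "?d (R u1) = \<i> *s ?d (R u2)" using elim(2) u(1) by blast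
 have "pr r (mh (R y)) (?d (R u2)) = 0" unfolding pr_zero_iff using elim(3) 1 by metis
 hence 0: "lam r e (mh (R y)) (?d (R u2)) = 0" by (simp add: lam_def)
 have "?d (el j (R y)) = \<i> *s ?d (R u2)+\<i> *s ?d (R u2)" unfolding u(1) vlinear[OF elim(7)] 1 ..
 moreover have "lam r e (mh (R y)) (\<i> *s ?d (R u2)+\<i> *s ?d (R u2)) = \<i> * lam r e (mh (R y)) (?d (R u2))+\<i> * lam r e (mh (R y)) (?d (R u2))"
 by (simp only: L(1,2))
 ultimately have "lam r e (mh (R y)) (?d (el j (R y))) = 0" using 0 by simp
 also have "?d (el j (R y)) = dd jx (zW (R y)) (ax j+ell' j a (R y) *s ax a+ell' j b (R y) *s ax b)" using elim(4,5) by simp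
 finally show ?case by (simp add: vlinear[OF elim(6)] L(1,2) eta_lam[OF elim(1)])
qed

text \<open>If both components vanished at 0, \<open>eta_rel\<close> would make all the others
  vanish too, against lam(e) = 1.\<close>

lemma eta_nz: "eta a 0 ~= 0 | eta b 0 ~= 0"
proof (rule ccontr)
 assume "\<not> ?thesis"
 hence "eta j 0 = 0" for j using ev_x[OF eta_rel[of j]] by (cases "j:{a,b}") auto
 hence z: "lam r e 0 (dd jx 0 (ax j)) = 0" for j using eta_lam[of 0 j] S(2) by simp
 have x0: "vdiff jx 0" "vdiff qp 0" by (rule vgerD0[OF vXi], rule vgerD0[OF vTh])
 note L = lam_linear[OF S(1) rC e S(2)]
 have l0: "lam r e 0 0 = 0" using L(2)[of 0 0] by simp
 have d0: "dd jx 0 0 = 0" using vlinear(2)[OF x0(1), of 0 0] by simp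
 have "lam r e 0 (dd jx 0 (SUM l:I. v$l *s ax l)) = 0" if "finite I" for I v
 using that by (induction I) (simp_all add: vlinear[OF x0(1)] L(1,2) z l0 d0)
 from this[of UNIV "dd qp 0 e"] have "lam r e 0 (dd jx 0 (dd qp 0 e)) = 0" using vec_basis_expansion[of "dd qp 0 e"] by simp
 moreover have "dd (%x. jx (qp x)) 0 e = dd jx 0 (dd qp 0 e)" using vdiff_compose(2)[OF x0(2), of jx] x0(1) Th0 by simp
 moreover have "dd (%x. jx (qp x)) 0 e = dd (%x. x) 0 e" by (rule dd_cong_ev[OF XiTh])
 ultimately show False using L(3) by (simp add: dd_eqI[OF has_derivative_ident])
qed

text \<open>Each summand is a product of \<open>lam\<close>, which is CR by
  \<open>levi_flat_CR\<close> even at points of the closure, and of a derivative of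
  \<open>jx\<close>, which is a holomorphic function of \<open>zW\<close>.\<close>

lemma eta_CR: assumes i: "i ~: {a,b}" shows "NEAR y. ALL j. CR0 (eta j) y (eb i (R y))"
proof -
 have 1: "NEAR y. CR0 (%y. lam r e (mh (R y)) v) y (eb i (R y))" for v
 using ev_S ev_cl dmh_eb[OF i] dr_mh mhR_deriv
 proof eventually_elim
 case (elim y)
 obtain u1 u2 where u: "eb i (R y) = R u1+\<i> *s R u2" "ALL f y'. CRd f y' (eb i (R y)) = dd f y' u1+\<i> * dd f y' u2" by (rule real_parts[OF Qp_eb[of i "R y"]])
 let ?d = "dd mh (R y)"
 have 2: "?d (R u2) = \<i> *s ?d (R u1)" using elim(3) u(1) by blast
 have "pr r (mh (R y)) (?d (R u1)) = 0" unfolding pr_zero_iff using elim(4) 2 by metis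
 hence 0: "lam r e (mh (R y)) (?d (R u1)) = 0" by (simp add: lam_def)
 have D: "((%y. lam r e (mh (R y)) v) HD (%u. dd (%x. lam r e x v) (mh (R y)) (?d (R u)))) (at y)"
 by (rule hdc[OF elim(5) lam_deriv[OF S(1) rC e elim(1)]])
 have 3: "dd (%x. lam r e x v) (mh (R y)) (\<i> *s ?d (R u1)) = \<i> * dd (%x. lam r e x v) (mh (R y)) (?d (R u1))"
 by (rule levi_flat_CR[OF S(1) rC e LF TA elim(2,1) 0])
 have "CRd (%y. lam r e (mh (R y)) v) y (eb i (R y)) = 0"
 unfolding u(2)[rule_format] dd_eqI[OF D] 2 3 by simp
 thus ?case using D unfolding CR0_def differentiable_def by blast
 qed
 have 2: "NEAR y. CR0 (%y. dd jx (zW (R y)) (ax j)$l) y (eb i (R y))" for j l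
 proof -
 have g0: "ger (%Z. dd jx Z (ax j)$l)" by (rule vger_nth[OF vger_dd[OF vXi]])
 have g: "ger (%X. dd jx (zW X) (ax j)$l)" by (rule ger_compose[OF vger_zW zW0 g0])
 show ?thesis using R_has_derivative[OF g] CRd_hol[OF g] ev_R[OF dd_compose_germ[OF vger_zW zW0 g0]] ev_R[OF dzW_eb[OF i]] ev_R[OF ev_zW[OF g0[unfolded ger_def]]]
 proof eventually_elim
 case (elim y)
 have "CRd (%y. dd jx (zW (R y)) (ax j)$l) y (eb i (R y)) = 0"
 using elim(2,3,4) dd_zero_vec[OF elim(5)] by simp
 thus ?case using elim(1) unfolding CR0_def differentiable_def by blast
 qed
 qed
 have "NEAR y. ALL j l. CR0 (%y. lam r e (mh (R y)) (ax l) * dd jx (zW (R y)) (ax j)$l) y (eb i (R y))"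
 proof (intro eventually_all_finite)
 fix j l show "NEAR y. CR0 (%y. lam r e (mh (R y)) (ax l) * dd jx (zW (R y)) (ax j)$l) y (eb i (R y))"
 using 1[of "ax l"] 2[of j l] by eventually_elim (rule CR0_mult)
 qed
 thus ?thesis unfolding eta_def[abs_def]
 by eventually_elim (intro allI CR0_sum, auto)
qed

lemma eta_Ck: "EX U. open U & 0:U & (ALL y:U. mh (R y):S) & (ALL k j. Ck_on k (eta j) U)"
proof -
 have "NEAR y. ALL l. cpx (%y. mh (R y)$l) y"
 by (intro eventually_all_finite cpx_R vger_nth[OF vmh])
 moreover have "NEAR y. ALL j l. cpx (%y. dd jx (zW (R y)) (ax j)$l) y"
 by (intro eventually_all_finite cpx_R ger_compose[OF vger_zW zW0 vger_nth[OF vger_dd[OF vXi]]])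
 ultimately have "NEAR y. (ALL l. cpx (%y. mh (R y)$l) y) & (ALL j l. cpx (%y. dd jx (zW (R y)) (ax j)$l) y) & mh (R y):S"
 using ev_S by eventually_elim blast
 then obtain U where U: "open U" "0:U" "!!y l. y:U ==> cpx (%y. mh (R y)$l) y"
 "!!y j l. y:U ==> cpx (%y. dd jx (zW (R y)) (ax j)$l) y" "!!y. y:U ==> mh (R y):S"
 unfolding eventually_nhds by blast
 have m: "Ck_on k (%y. mh (R y)) U" for k by (rule Ck_on_vec[OF U(1) cpx_Ck_on[OF U(3)]])
 have "Ck_on k (eta j) U" for k j unfolding eta_def[abs_def]
 by (rule Ck_on_sum[OF U(1)], simp)
 (rule Ck_on_mult[OF U(1) Ck_on_compose[OF U(1) S(1) Ck_on_lam[OF S(1) rC e] m U(5)] cpx_Ck_on[OF U(4)]])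
 thus ?thesis using U(1,2,5) by (intro exI[of _ U]) simp
qed

lemma good_of_eta_b: assumes nb: "eta b 0 ~= 0" shows "EX g. good_g g"
proof -
 obtain U0 where U0: "open U0" "0:U0" "!!y. y:U0 ==> mh (R y):S" "!!k j. Ck_on k (eta j) U0" using eta_Ck by blast
 have cb: "con U0 (eta b)" using U0(4)[of 0 b] by simp
 define U where "U = U0 Int eta b -` (- {0})"
 have U: "open U" "0:U" unfolding U_def using continuous_open_preimage[OF cb U0(1)] nb U0(2) by auto
 have nzU: "eta b y ~= 0" if "y:U" for y using that by (simp add: U_def)
 have UC: "Ck_on k (eta j) U" for k j by (rule Ck_on_mono[OF U0(4)]) (auto simp: U_def)
 have evU: "NEAR y. y:U" by (rule evo[OF U])
 \<comment> \<open>The sign is the one for which \<open>eta_rel\<close>, divided by the component b,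
   becomes assumption \<open>E3\<close> of \<open>smooth_CR_quotient\<close>.\<close>
 define K where "K j y = (-1) * (eta j y * inverse (eta b y))" for j y
 have KC: "Ck_on k (K j) U" for k j unfolding K_def
 by (intro Ck_on_mult Ck_on_const Ck_on_inverse UC U nzU)
 have CRK: "NEAR y. CRd (K j) y (eb i (R y)) = 0" if i: "i ~: {a,b}" for i j
 using eta_CR[OF i] evU
 proof eventually_elim
 case (elim y)
 have "CR0 (K j) y (eb i (R y))" unfolding K_def[abs_def]
 by (intro CR0_mult CR0_const CR0_inverse nzU elim(2) elim(1)[rule_format])
 thus ?case by (simp add: CR0_def)
 qed
 show ?thesis
 proof (rule smooth_CR_quotient[OF U KC[of _ a], of K])
 show "K a (dr y) = K a y" for y by (simp add: K_def eta_def)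
 show "NEAR y. CRd (K a) y (eb i (R y)) = 0" if "i ~: {a,b}" for i by (rule CRK[OF that])
 show "NEAR y. CRd (K j) y (eb i (R y)) = 0" if "i ~: {a,b}" "j ~: {a,b}" for i j by (rule CRK[OF that(1)])
 show "NEAR y. K j y = ell' j b (R y) - K a y * ell' j a (R y)" if j: "j ~: {a,b}" for j
 using eta_rel[OF j] evU
 proof eventually_elim
 case (elim y)
 have h: "eta j y = - (ell' j a (R y) * eta a y) - ell' j b (R y) * eta b y" using elim(1) by (simp add: algebra_simps eq_neg_iff_add_eq_0)
 show ?case unfolding K_def h using nzU[OF elim(2)] by (simp add: field_simps)
 qed
 show "NEAR y. (ALL j. j ~: {a,b} --> K j y = 0) -->
 Im ((dd (W b) (R y) (R (ax a)) - K a y * dd (W a) (R y) (R (ax a))) *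
 cnj (dd (W b) (R y) (R (ax b)) - K a y * dd (W a) (R y) (R (ax b)))) = 0"
 using evU dr_mh ev_R[OF dd_mh] ev_R[OF vger_zW[unfolded vger_def]] ev_R[OF ev_zW[OF vXi[unfolded vger_def]]]
 proof eventually_elim
 case (elim y)
 have yS: "mh (R y):S" using U0(3) elim(1) by (auto simp: U_def)
 note L = lam_linear[OF S(1) rC e yS]
 define c where "c = - \<i> * (inverse (pr r (mh (R y)) e) * inverse (eta b y))"
 \<comment> \<open>\<open>R (ax l)\<close> is pushed forward to a real tangent vector v of M, on
   which dr vanishes. So lam(v) is -i dr(i v) divided by \<open>pr r\<close> of e: a real multiple
   of one complex number, the same for both l.\<close>
 have z: "EX t. dd (W b) (R y) (R (ax l)) - K a y * dd (W a) (R y) (R (ax l)) = of_real t * c" if l: "l:{a,b}" for l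
 proof -
 let ?v = "dd mh (R y) (R (ax l))"
 have "dd zW (R y) (R (ax l))$i = (dd (W a) (R y) (R (ax l)) *s ax a+dd (W b) (R y) (R (ax l)) *s ax b)$i" for i
 using l ab unfolding zW_dd_nth[OF elim(4)] by (auto simp: R_nth axis_def)
 hence "dd zW (R y) (R (ax l)) = dd (W a) (R y) (R (ax l)) *s ax a+dd (W b) (R y) (R (ax l)) *s ax b" by (simp add: veq)
 hence "lam r e (mh (R y)) ?v = dd (W a) (R y) (R (ax l)) * eta a y+dd (W b) (R y) (R (ax l)) * eta b y"
 using elim(3) by (simp add: vlinear[OF elim(5)] L(1,2) eta_lam[OF yS])
 also have "\<dots> = eta b y * (dd (W b) (R y) (R (ax l)) - K a y * dd (W a) (R y) (R (ax l)))"
 using nzU[OF elim(1)] by (simp add: K_def field_simps)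
 finally have 1: "dd (W b) (R y) (R (ax l)) - K a y * dd (W a) (R y) (R (ax l)) = lam r e (mh (R y)) ?v * inverse (eta b y)"
 using nzU[OF elim(1)] by (simp add: field_simps)
 have 2: "lam r e (mh (R y)) ?v = - \<i> * of_real (dd r (mh (R y)) (\<i> *s ?v)) * inverse (pr r (mh (R y)) e)"
 using elim(2) by (simp add: lam_def pr_def)
 show ?thesis unfolding 1 2 c_def by (rule exI[of _ "dd r (mh (R y)) (\<i> *s ?v)"]) simp
 qed
 obtain t1 where t1: "dd (W b) (R y) (R (ax a)) - K a y * dd (W a) (R y) (R (ax a)) = of_real t1 * c" using z[of a] by auto
 obtain t2 where t2: "dd (W b) (R y) (R (ax b)) - K a y * dd (W a) (R y) (R (ax b)) = of_real t2 * c" using z[of b] by auto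
 show ?case unfolding t1 t2 by simp
 qed
 qed
qed

lemma lf_swap: "lf b a W T M qp jx h r e S A"
 by (intro lf.intro nfM_swap conjunct2[OF lf_axioms[unfolded lf_def]])

theorem levi_flat_good: "EX g. good_g g"
proof (cases "eta b 0 = 0")
 case False thus ?thesis by (rule good_of_eta_b)
next
 case True
 interpret s: lf b a W T M qp jx h r e S A by (rule lf_swap)
 have "s.mh X = mh X" for X by (simp add: s.mh_def mh_def swap_defs)
 hence "s.eta a 0 = eta a 0" by (simp add: s.eta_def eta_def swap_defs)
 hence "s.eta a 0 ~= 0" using True eta_nz by simp
 from s.good_of_eta_b[OF this] show ?thesis using swap_good by blast
qed

end

section \<open>From conditions (ii), (i) and (iv) to the germ g\<close>

context nfM
begin

lemma levi_to_good:
 fixes r :: "complex^'n => real"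
 assumes S: "open S" "0:S" and rC: "!!k. Ck_on k r S" and d: "dd r 0 v ~= 0"
 and rM: "NEAR x. x:M --> r x = 0"
 and LF: "Levi_flat A" and TA: "!!x. x:A ==> x:S ==> tsp A x = {v. dd r x v = 0}"
 and cl: "NEAR x. x:M --> x:closure A"
 shows "EX g. good_g g"
proof -
 define S' where "S' = S Int (%x. pr r x v) -` (- {0})"
 have "con S (%x. pr r x v)" using Ck_on_pr[OF S(1) rC, of 0 v] by simp
 hence 1: "open S'" unfolding S'_def by (rule continuous_open_preimage[OF _ S(1)]) auto
 have 2: "0:S'" using S(2) d by (auto simp: S'_def pr_zero_iff)
 interpret lf a b W T M qp jx h r v S' A
 proof unfold_locales
 show "Ck_on k r S'" for k by (rule Ck_on_mono[OF rC]) (auto simp: S'_def)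
 show "x:S' ==> pr r x v ~= 0" for x by (auto simp: S'_def)
 show "x:A ==> x:S' ==> tsp A x = {v. dd r x v = 0}" for x using TA by (auto simp: S'_def)
 qed (fact 1 2 rM LF cl)+
 show ?thesis by (rule levi_flat_good)
qed

lemma Ck_component:
 fixes f :: "complex^'n => complex^'n"
 assumes "open V" "of_class r f V" "r = C_infinity | r = C_omega"
 shows "Ck_on k (%x. f x ~~ c) V"
 by (rule Ck_on_linear[OF assms(1) bounded_linear_inner_left of_class_Ck[OF assms]])

lemma ii_good:
 assumes "open U" "0:U" "hypersurface C_omega H" "Levi_flat H" "M Int U <= H" "0:M"
 shows "EX g. good_g g"
proof -
 have H0: "0:H" using assms by auto
 obtain V f B where V: "0:V" and cB: "card B = 1" and s: "slice_chart C_omega H B V f"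
 using assms(3) H0 unfolding hypersurface_def submanifold_def by blast
 obtain b' where B: "B = {b'}" using cB by (meson card_1_singletonE)
 note C = slice_chartD[OF s]
 have rg: "C_omega = C_infinity | C_omega = C_omega" by simp
 have oc: "of_class C_omega f V" using C(1) by (simp add: diffeo_def)
 have dr: "((%x. f x ~~ b') HD (%v. A v ~~ b')) (at x)" if "(f HD A) (at x)" for A x
 by (intro has_derivative_inner_left that)
 obtain A D where AD: "(f HD A) (at 0)" "(inv_into V f HD D) (at (f 0))" "ALL w. A (D w) = w" "ALL v. D (A v) = v" "blin A" "blin D"
 by (rule diffeo_deriv[OF C(1) rg V])
 show ?thesis
 proof (rule levi_to_good[OF C(7) V Ck_component[OF C(7) oc rg], of b' "D b'" H])
 show "dd (%x. f x ~~ b') 0 (D b') ~= 0" using AD(3) C(2) B by (simp add: dd_eqI[OF dr[OF AD(1)]] inner_Basis)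
 show "NEAR x. x:M --> f x ~~ b' = 0"
 using evo[OF C(7) V] evo[OF assms(1,2)]
 by eventually_elim (use C(3) B assms(5) in auto)
 show "Levi_flat H" by fact
 show "tsp H x = {v. dd (%x. f x ~~ b') x v = 0}" if x: "x:H" "x:V" for x
 proof -
 obtain A D where AD: "(f HD A) (at x)" "(inv_into V f HD D) (at (f x))" "ALL w. A (D w) = w" "ALL v. D (A v) = v" "blin A" "blin D"
 by (rule diffeo_deriv[OF C(1) rg x(2)])
 show ?thesis using slice_chart_tangent[OF s rg x AD(1)] B by (simp add: dd_eqI[OF dr[OF AD(1)]])
 qed
 show "NEAR x. x:M --> x:closure H"
 using evo[OF assms(1,2)] by eventually_elim (use assms(5) closure_subset in auto)
 qed
qed

lemma dim_two_coordinates: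
 fixes B :: "'a::euclidean_space set"
 assumes "B <= Basis" shows "dim {v. ALL b:B. v ~~ b = 0} = DIM('a) - card B"
 using dim_coordinate_kernel[of "%x. x" "%x. x" B] assms by (simp add: linear_iff)

text \<open>The inclusion of the boundary in M has to be reversed near 0. Both have real codimension
  2, so invariance of domain makes the boundary open in M, and M near 0 lies in the closure of the
  interior of H.\<close>

lemma i_good:
 assumes sub: "submanifold C_omega 2 M" and H: "hypersurface_with_boundary C_infinity H bd" "Levi_flat (H - bd)" and bd: "0:bd" "bd <= M"
 shows "EX g. good_g g"
proof -
 have "ALL p:bd. EX U wx. EX b1:Basis. EX b2:Basis. b1 ~= b2 & p:U & diffeo C_infinity U (UNIV :: (complex^'n) set) wx &
 wx ` (H Int U) = {x. x ~~ b1 >= 0 & x ~~ b2 = 0} & wx ` (bd Int U) = {x. x ~~ b1 = 0 & x ~~ b2 = 0}"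
 using H(1) unfolding hypersurface_with_boundary_def by (elim conjE)
 from bspec[OF this bd(1)] obtain U f b1 b2 where b: "b1:Basis" "b2:Basis" "b1 ~= b2" and U0: "0:U" and df: "diffeo C_infinity U (UNIV :: (complex^'n) set) f"
 and fH: "f ` (H Int U) = {x. x ~~ b1 >= 0 & x ~~ b2 = 0}" and fbd: "f ` (bd Int U) = {x. x ~~ b1 = 0 & x ~~ b2 = 0}"
 by (elim exE bexE conjE)
 have bH: "bd <= H" using H(1) by (simp add: hypersurface_with_boundary_def)
 have oU: "open U" and bij: "bij_betw f U UNIV" and oc: "of_class C_infinity f U" "of_class C_infinity (inv_into U f) UNIV"
 using df by (auto simp: diffeo_def)
 have rg: "C_infinity = C_infinity | C_infinity = C_omega" by simp
 define g where "g = inv_into U f"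
 have gf: "g (f x) = x" if "x:U" for x using bij that by (simp add: bij_betw_def g_def)
 have fg: "f (g y) = y" for y using bij by (simp add: bij_betw_def g_def f_inv_into_f)
 have gU: "g y:U" for y using bij by (simp add: bij_betw_def g_def inv_into_into)
 have inH: "x:H <-> f x ~~ b1 >= 0 & f x ~~ b2 = 0" if x: "x:U" for x
 proof -
 have "x:H <-> f x:f ` (H Int U)" using x gf by (metis IntI imageE imageI Int_iff)
 thus ?thesis unfolding fH by simp
 qed
 have inbd: "x:bd <-> f x ~~ b1 = 0 & f x ~~ b2 = 0" if x: "x:U" for x
 proof -
 have "x:bd <-> f x:f ` (bd Int U)" using x gf by (metis IntI imageE imageI Int_iff)
 thus ?thesis unfolding fbd by simp
 qed
 have cf: "con U f" using of_class_Ck[OF oU oc(1) rg, of 0] by simp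
 have cg: "con UNIV g" using of_class_Ck[OF open_UNIV oc(2) rg, of 0] by (simp add: g_def)
 have bdM: "NEAR x. x:M --> x:bd"
 proof -
 have M0: "0:M" using bd by auto
 obtain V F B where V: "0:V" and cB: "card B = 2" and s: "slice_chart C_omega M B V F"
 using sub M0 unfolding submanifold_def by blast
 note C = slice_chartD[OF s]
 have cF: "con V F" using of_class_Ck[OF C(7), of C_omega F 0] C(1) by (simp add: diffeo_def)
 define L1 where "L1 = {y::complex^'n. ALL b:{b1,b2}. y ~~ b = 0}"
 define L2 where "L2 = {y::complex^'n. ALL b:B. y ~~ b = 0}"
 define D where "D = L1 Int g -` V"
 have dims: "dim L2 <= dim L1" unfolding L1_def L2_def using b cB dim_two_coordinates[OF C(2)] dim_two_coordinates[of "{b1,b2}"] by simp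
 have sub12: "subspace L1" "subspace L2" unfolding L1_def L2_def by (auto simp: subspace_def inner_add_left)
 have oD: "openin (top_of_set L1) D"
 proof -
 have "open (g -` V)" using continuous_open_vimage[OF C(7)] cg continuous_on_eq_continuous_at[OF open_UNIV] by blast
 thus ?thesis unfolding D_def by auto
 qed
 have cD: "con D (%y. F (g y))"
 by (rule continuous_on_compose2[OF cF continuous_on_subset[OF cg]]) (auto simp: D_def)
 have gM: "g y:bd" if "y:L1" for y using inbd[OF gU, of y] that by (simp add: fg L1_def)
 have imD: "(%y. F (g y)):D \<rightarrow> L2"
 proof
 fix y assume y: "y:D"
 hence "g y:M" "g y:V" using gM bd(2) by (auto simp: D_def)
 thus "F (g y):L2" using C(3)[of "g y"] by (simp add: L2_def)
 qed
 have injF: "x = y" if "F x = F y" "x:V" "y:V" for x y using C(4)[OF that(2)] C(4)[OF that(3)] that(1) by metis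
 have injD: "inj_on (%y. F (g y)) D"
 proof (rule inj_onI)
 fix x y assume xy: "x:D" "y:D" "F (g x) = F (g y)"
 hence "g x = g y" using injF by (auto simp: D_def)
 thus "x = y" using fg by metis
 qed
 \<comment> \<open>In the two charts the inclusion is a continuous injection from an open part of
   one coordinate subspace into another of the same dimension.\<close>
 have "openin (top_of_set L2) ((%y. F (g y)) ` D)"
 by (rule invariance_of_domain_subspaces[OF oD sub12 dims cD imD injD])
 then obtain Q where Q: "open Q" "(%y. F (g y)) ` D = L2 Int Q" unfolding openin_open by blast
 have "f 0:D" using inbd[OF U0] bd(1) V gf[OF U0] by (simp add: D_def L1_def)
 hence "F (g (f 0)):L2 Int Q" using Q(2) by blast
 hence FQ: "F 0:Q" using gf[OF U0] by simp
 have "isCont F 0" using cF V C(7) by (simp add: continuous_on_eq_continuous_at)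
 hence "NEAR x. F x:Q" by (rule ev_nhds_compose) (auto intro: evo Q FQ)
 thus ?thesis using evo[OF C(7) V]
 proof eventually_elim
 case (elim x)
 show ?case
 proof
 assume "x:M"
 hence "F x:L2 Int Q" using C(3)[OF elim(2)] elim(1) by (simp add: L2_def)
 then obtain y where y: "y:D" "F x = F (g y)" using Q(2) by (metis imageE)
 hence "x = g y" using injF elim(2) by (auto simp: D_def)
 thus "x:bd" using gM y(1) by (simp add: D_def)
 qed
 qed
 qed
 have dr: "((%x. f x ~~ b2) HD (%v. A v ~~ b2)) (at x)" if "(f HD A) (at x)" for A x
 by (intro has_derivative_inner_left that)
 obtain A D where AD: "(f HD A) (at 0)" "(inv_into U f HD D) (at (f 0))" "ALL w. A (D w) = w" "ALL v. D (A v) = v" "blin A" "blin D"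
 by (rule diffeo_deriv[OF df rg U0])
 show ?thesis
 proof (rule levi_to_good[OF oU U0 Ck_component[OF oU oc(1) rg], of b2 "D b2" "H - bd"])
 show "dd (%x. f x ~~ b2) 0 (D b2) ~= 0" using AD(3) b by (simp add: dd_eqI[OF dr[OF AD(1)]] inner_Basis)
 show "NEAR x. x:M --> f x ~~ b2 = 0"
 using bdM evo[OF oU U0] by eventually_elim (use inbd in auto)
 show "Levi_flat (H - bd)" by fact
 show "NEAR x. x:M --> x:closure (H - bd)"
 using bdM evo[OF oU U0]
 proof eventually_elim
 case (elim x)
 show ?case
 proof
 assume "x:M"
 hence fx: "f x ~~ b1 = 0" "f x ~~ b2 = 0" using elim inbd by auto
 \<comment> \<open>Moving from a boundary point in the direction \<open>b1\<close> of the chart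
   leads into the interior of H.\<close>
 have "((%t. g (f x+t *R b1)) \<longlongrightarrow> g (f x+0 *R b1)) (at_right (0::real))"
 proof (rule isCont_tendsto_compose[where g=g])
 show "isCont g (f x+0 *R b1)" using cg by (simp add: continuous_on_eq_continuous_at)
 show "((%t. f x+t *R b1) \<longlongrightarrow> f x+0 *R b1) (at_right 0)" by (intro tendsto_intros)
 qed
 hence lim: "((%t. g (f x+t *R b1)) \<longlongrightarrow> x) (at_right (0::real))" using gf[OF elim(2)] by simp
 have evc: "\<forall>\<^sub>F t in at_right (0::real). g (f x+t *R b1):closure (H - bd)"
 proof (rule evm[OF eventually_at_right_less])
 fix t :: real assume "t > 0"
 hence "g (f x+t *R b1):H - bd"
 using inH[OF gU] inbd[OF gU] fx b by (auto simp: fg inner_add_left inner_Basis)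
 thus "g (f x+t *R b1):closure (H - bd)" by (rule subsetD[OF closure_subset])
 qed
 show "x:closure (H - bd)"
 by (rule Lim_in_closed_set[OF closed_closure evc trivial_limit_at_right_real lim])
 qed
 qed
 show "tsp (H - bd) x = {v. dd (%x. f x ~~ b2) x v = 0}" if x: "x:H - bd" "x:U" for x
 proof -
 \<comment> \<open>On the open half where the coordinate \<open>b1\<close> is positive, the boundary
   chart is an ordinary slice chart of the interior, with \<open>b2\<close> as vanishing
   coordinate.\<close>
 define V where "V = U Int (%x. f x ~~ b1) -` {0<..}"
 have oV: "open V" unfolding V_def
 by (rule continuous_open_preimage[OF _ oU]) (auto intro!: continuous_intros cf)
 have fV: "f ` V = {y. y ~~ b1 > 0}"
 proof (intro set_eqI iffI)
 fix y assume "y:{y. y ~~ b1 > 0}"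
 hence "g y:V" using fg gU by (simp add: V_def)
 from imageI[OF this, of f] show "y:f ` V" unfolding fg .
 qed (auto simp: V_def)
 have iV: "inv_into V f y = g y" if "y:f ` V" for y
 proof (rule inv_into_f_eq)
 show "inj_on f V" using bij by (auto simp: bij_betw_def V_def intro: inj_on_subset)
 show "g y:V" using that gU fg by (auto simp: V_def fV)
 qed (rule fg)
 have ofV: "open (f ` V)" unfolding fV by (rule open_Collect_less) (auto intro!: continuous_intros)
 have s: "slice_chart C_infinity (H - bd) {b2} V f" unfolding slice_chart_def diffeo_def
 proof (intro conjI oV ofV)
 show "bij_betw f V (f ` V)" using bij by (auto simp: bij_betw_def V_def intro: inj_on_subset)
 show "of_class C_infinity f V" using oc(1) by (auto simp: V_def intro: Ck_on_mono)
 have "Ck_on k (inv_into V f) (f ` V)" for k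
 by (rule Ck_on_cong[OF ofV Ck_on_mono[of _ g UNIV]]) (use oc(2) iV in "auto simp: g_def")
 thus "of_class C_infinity (inv_into V f) (f ` V)" by simp
 show "{b2} <= Basis" using b by simp
 have "x:H - bd <-> f x ~~ b2 = 0" if "x:V" for x using that inH inbd by (auto simp: V_def)
 thus "f ` ((H - bd) Int V) = {y:f ` V. ALL b:{b2}. y ~~ b = 0}" by (auto simp: image_iff)
 qed
 have xV: "x:V" using x inH inbd by (auto simp: V_def)
 obtain A D where AD: "(f HD A) (at x)" "(inv_into U f HD D) (at (f x))" "ALL w. A (D w) = w" "ALL v. D (A v) = v" "blin A" "blin D"
 by (rule diffeo_deriv[OF df rg x(2)])
 show ?thesis using slice_chart_tangent[OF s rg x(1) xV AD(1)] by (simp add: dd_eqI[OF dr[OF AD(1)]])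
 qed
 qed
qed

lemma tangent_mhR: "NEAR y. ALL u. dd mh (R y) (R u):tsp M (mh (R y))"
 using mhR_deriv ev_nhds_nested[OF mh_inM]
proof eventually_elim
 case (elim y)
 show ?case
 proof
 fix u
 have l: "((%t::real. y+t *R u) HD (%t. t *R u)) (at 0)" by (auto intro!: derivative_eq_intros)
 have "((%t::real. mh (R (y+t *R u))) HD (%t. dd mh (R y) (R (t *R u)))) (at 0)"
 by (rule hdc[OF l]) (simp add: elim(1))
 moreover have "dd mh (R y) (R (t *R u)) = t *R dd mh (R y) (R u)" for t
 using linear_cmul[OF bllin[OF hdbl[OF elim(1)]]] .
 ultimately have d: "((%t. mh (R (y+t *R u))) has_vector_derivative dd mh (R y) (R u)) (at 0)"
 by (simp add: has_vector_derivative_def)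
 have "isCont (%t::real. y+t *R u) 0" by (intro continuous_intros)
 hence "\<forall>\<^sub>F t in nhds (0::real). mh (R (y+t *R u)):M" by (rule ev_nhds_compose) (use elim(2) in auto)
 then obtain e where "e > 0" "!!t::real. dist t 0 < e ==> mh (R (y+t *R u)):M" unfolding eventually_nhds_metric by blast
 thus "dd mh (R y) (R u):tsp M (mh (R y))" unfolding tangent_space_def
 using d by (intro CollectI exI[of _ "%t. mh (R (y+t *R u))"] exI[of _ e]) simp
 qed
qed

text \<open>The function f on M is extended to the complexification. It is constant in complex
  tangent directions, which contain the real and imaginary parts of all fields \<open>eb i\<close>
  and \<open>el j\<close>, so the extension satisfies the premises of \<open>CR_real\<close>. The
  curve in \<open>nz\<close>, along which f grows with speed 1, shows that its differential at 0 is
  not zero.\<close>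

lemma leaf_good:
 fixes f :: "complex^'n => real"
 assumes cf: "cpx (%x. of_real (f x)) 0"
 and fd: "NEAR x. f differentiable (at x)"
 and k: "NEAR x. x:M --> (ALL v:cts M x. dd f x v = 0)"
 and nz: "EX g e. e > 0 & g 0 = 0 & (ALL t::real. \<bar>t\<bar> < e --> g t:M & f (g t) = f 0+t) & (EX v. (g has_vector_derivative v) (at 0))"
 shows "EX g. good_g g"
proof -
 obtain Fh where Fh: "ger Fh" "NEAR x. of_real (f (0+x)) = Fh (rl x)" "Fh 0 = of_real (f 0)" using cpxE[OF cf] .
 define mm where "mm X = cpl (mh X) (cnj_vec (mh (cj X)))" for X
 have vm: "vger mm" unfolding vger_iff
 proof
 fix j show "ger (%X. mm X$j)"
 by (cases j) (auto simp: mm_def intro: vger_nth[OF vmh] ger_cj[OF vger_nth[OF vmh]])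
 qed
 have mm0: "mm 0 = 0" by (simp add: mm_def)
 define F where "F X = Fh (mm (Qp X))" for X
 have gF: "ger F" unfolding F_def by (rule ger_Qp[OF ger_compose[OF vm mm0 Fh(1)]])
 have FQ: "F (Qp X) = F X" for X by (simp add: F_def)
 have FR: "NEAR y. F (R y) = of_real (f (mh (R y)))"
 using ev_mhR[OF Fh(2)] by eventually_elim (simp add: F_def mm_def)
 \<comment> \<open>One statement for both kinds of fields: s is i for \<open>eb\<close> and -i for
   \<open>el\<close>, and in either case the two pushed-forward parts form a pair invariant under J
   up to sign.\<close>
 have key: "NEAR y. ALL e. Qp e = e --> (EX u1 u2 s. s * s = -1 & (ALL f. CRd f y e = dd f y u1+\<i> * dd f y u2) & dd mh (R y) (R u2) = s *s dd mh (R y) (R u1) & (s = \<i> | s = - \<i>)) --> dd F (R y) e = 0"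
 using CRd_hol[OF gF] CRd_cong[OF FR] tangent_mhR ev_mhR[OF k] mh_inM mhR_deriv ev_mhR[OF fd]
 proof eventually_elim
 case (elim y)
 show ?case
 proof (intro allI impI, elim exE conjE)
 fix e u1 u2 s assume e: "Qp e = e" and c: "ALL f. CRd f y e = dd f y u1+\<i> * dd f y u2"
 and p: "dd mh (R y) (R u2) = s *s dd mh (R y) (R u1)" and s: "s = \<i> | s = - \<i>"
 let ?T = "tsp M (mh (R y))"
 have bl: "blin (%u. dd mh (R y) (R u))" by (rule hdbl[OF elim(6)])
 have neg: "dd mh (R y) (R (- u)) = - dd mh (R y) (R u)" for u by (rule linear_neg[OF bllin[OF bl]])
 have t: "dd mh (R y) (R u1):?T" "dd mh (R y) (R u2):?T" "- dd mh (R y) (R u1):?T" "- dd mh (R y) (R u2):?T"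
 using elim(3) neg by metis+
 have J1: "dd mh (R y) (R u1) = J (- dd mh (R y) (R u2)) | dd mh (R y) (R u1) = J (dd mh (R y) (R u2))"
 using s unfolding p J_def by (auto simp: veq)
 have J2: "dd mh (R y) (R u2) = J (dd mh (R y) (R u1)) | dd mh (R y) (R u2) = J (- dd mh (R y) (R u1))"
 using s unfolding p J_def by (auto simp: veq)
 have "dd mh (R y) (R u1):cts M (mh (R y))" "dd mh (R y) (R u2):cts M (mh (R y))"
 unfolding cts_def using t J1 J2 by blast+
 hence z: "dd f (mh (R y)) (dd mh (R y) (R u1)) = 0" "dd f (mh (R y)) (dd mh (R y) (R u2)) = 0" using elim(4,5) by auto
 have "((%y. f (mh (R y))) HD (%u. dd f (mh (R y)) (dd mh (R y) (R u)))) (at y)"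
 by (rule hdc[OF elim(6)]) (use elim(7) in "simp add: fdw")
 from has_derivative_of_real[OF this]
 have d: "((%y. complex_of_real (f (mh (R y)))) HD (%u. of_real (dd f (mh (R y)) (dd mh (R y) (R u))))) (at y)" .
 have "dd F (R y) e = CRd (%y. of_real (f (mh (R y)))) y e" using elim(1,2) e by metis
 also have "\<dots> = 0" unfolding c[rule_format] dd_eqI[OF d] by (simp add: z)
 finally show "dd F (R y) e = 0" .
 qed
 qed
 have ii: "\<i> * \<i> = -1" by simp
 have Lb: "NEAR X. dd F X (eb i X) = 0" if i: "i ~: {a,b}" for i
 proof (rule kill_from_real[OF gF FQ i])
 show "NEAR y. dd F (R y) (eb i (R y)) = 0" using key dmh_eb[OF i]
 proof eventually_elim
 case (elim y)
 obtain u1 u2 where u: "eb i (R y) = R u1+\<i> *s R u2" "ALL f y'. CRd f y' (eb i (R y)) = dd f y' u1+\<i> * dd f y' u2" by (rule real_parts[OF Qp_eb[of i "R y"]])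
 have "dd mh (R y) (R u2) = \<i> *s dd mh (R y) (R u1)" using elim(2) u(1) by blast
 thus ?case using u(2)
 by (intro elim(1)[rule_format, OF Qp_eb] exI[of _ u1] exI[of _ u2] exI[of _ \<i>]) simp
 qed
 qed
 have L: "NEAR X. dd F X (el j X) = 0" if j: "j ~: {a,b}" for j
 proof -
 have "NEAR y. dd F (R y) (el j (R y)) = 0" using key dmh_el[OF j]
 proof eventually_elim
 case (elim y)
 obtain u1 u2 where u: "el j (R y) = R u1+\<i> *s R u2" "ALL f y'. CRd f y' (el j (R y)) = dd f y' u1+\<i> * dd f y' u2" by (rule real_parts[OF Qp_el[of j "R y"]])
 have "dd mh (R y) (R u1) = \<i> *s dd mh (R y) (R u2)" using elim(2) u(1) by blast
 hence "dd mh (R y) (R u2) = (-\<i>) *s dd mh (R y) (R u1)" by (simp add: veq)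
 thus ?case using u(2)
 by (intro elim(1)[rule_format, OF Qp_el] exI[of _ u1] exI[of _ u2] exI[of _ "-\<i>"]) simp
 qed
 from identity_M[OF ger_dd_vec[OF gF vger_el[of j]] this] el_props[OF j] ddF_QpQp[OF gF FQ]
 show ?thesis by eventually_elim simp
 qed
 have "EX V. dd F 0 V ~= 0"
 proof (rule ccontr)
 assume n: "\<not> ?thesis"
 obtain g e v where g: "e > 0" "g 0 = 0" "!!t::real. \<bar>t\<bar> < e ==> g t:M" "!!t. \<bar>t\<bar> < e ==> f (g t) = f 0+t" "(g has_vector_derivative v) (at 0)"
 using nz by blast
 have gd: "(g HD (%t. t *R v)) (at 0)" using g(5) by (simp add: has_vector_derivative_def)
 have "((%x. h x$i) HD dd (%x. h x$i) 0) (at 0)" for i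
 using cpx_differentiable(1)[of "%x. h x$i" 0] ev_x[OF hcpx] by (simp add: fdw)
 hence hd: "(h HD (%v. \<chi> i. dd (%x. h x$i) 0 v)) (at 0)" unfolding has_derivative_vec_iff by simp
 have gc: "isCont g 0" using gd has_derivative_continuous by blast
 have hc: "isCont h 0" using hd has_derivative_continuous by blast
 have FF: "NEAR x. x:M --> F (R (h x)) = of_real (f x)"
 using onM XiTh ev_nhds_compose[OF hc h0 FR]
 by eventually_elim (auto simp: mh_def)
 have "\<forall>\<^sub>F t in nhds (0::real). \<bar>t\<bar> < e" using evo[of "ball 0 e" "0::real"] g(1) by (simp add: dist_norm)
 moreover have "NEAR t. g t:M --> F (R (h (g t))) = of_real (f (g t))" by (rule ev_nhds_compose[OF gc g(2) FF])
 ultimately have E: "NEAR t. F (R (h (g t))) = of_real (f 0+t)"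
 by eventually_elim (use g(3,4) in auto)
 have 1: "((%t. R (h (g t))) HD (%t. R (\<chi> i. dd (%x. h x$i) 0 (t *R v)))) (at 0)"
 by (rule hdc[OF hdc[OF gd] blhd[OF bl_R]]) (simp add: g(2) hd)
 have 2: "((%t. F (R (h (g t)))) HD (%t. dd F 0 (R (\<chi> i. dd (%x. h x$i) 0 (t *R v))))) (at 0)"
 by (rule hdc[OF 1]) (simp add: g(2) h0 cdiffD[OF gerD0[OF gF]])
 have 3: "((%t. complex_of_real (f 0+t)) HD (%t. of_real t)) (at 0)"
 by (auto intro!: derivative_eq_intros)
 from dd_cong_ev[OF E, of 1] show False unfolding dd_eqI[OF 2] dd_eqI[OF 3] using n by simp
 qed
 then obtain V where "dd F 0 V ~= 0" by blast
 from CR_real[OF gF FQ Lb L this] show ?thesis .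
qed

text \<open>The transversal coordinate of the foliation chart is f. A complex tangent vector of M at
  x is tangent to the orbit representative through x contained in the leaf; a short curve in it
  stays in one component of the leaf in the chart, where f is constant.\<close>

lemma iv_good:
 assumes U: "open U" "0:U" "0:M" and fol: "foliation C_omega 1 (M Int U) \<L>"
 and orb: "ALL L:\<L>. \<exists>\<S>. L = \<Union>\<S> & (ALL S:\<S>. EX p:M. represents_local_CR_orbit M p S)"
 shows "EX g. good_g g"
proof -
 have part: "partition_on (M Int U) \<L>" using fol by (simp add: foliation_def)
 have "ALL p:M Int U. EX V wx B B'. p:V & slice_chart C_omega (M Int U) B V wx & B' <= Basis - B & card B' = 1 &
 (ALL L:\<L>. ALL C:components (L Int V). \<exists>c :: complex^'n => real. C = {x:(M Int U) Int V. ALL b:B'. wx x ~~ b = c b})"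
 using fol unfolding foliation_def by (elim conjE)
 moreover have "0:M Int U" using U by auto
 ultimately have "EX V wx B B'. 0:V & slice_chart C_omega (M Int U) B V wx & B' <= Basis - B & card B' = 1 &
 (ALL L:\<L>. ALL C:components (L Int V). \<exists>c :: complex^'n => real. C = {x:(M Int U) Int V. ALL b:B'. wx x ~~ b = c b})"
 by (rule bspec)
 then obtain V wx B B' where V: "0:V" and s: "slice_chart C_omega (M Int U) B V wx" and B': "B' <= Basis - B" "card B' = 1"
 and leaf: "ALL L:\<L>. ALL C:components (L Int V). \<exists>c :: complex^'n => real. C = {x:(M Int U) Int V. ALL b:B'. wx x ~~ b = c b}"
 by (elim exE conjE)
 obtain b' where b': "B' = {b'}" using B'(2) by (meson card_1_singletonE)
 note C = slice_chartD[OF s]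
 have rg: "C_omega = C_infinity | C_omega = C_omega" by simp
 have oc: "of_class C_omega wx V" using C(1) by (simp add: diffeo_def)
 define f where "f x = wx x ~~ b'" for x
 have fC: "Ck_on k f V" for k unfolding f_def by (rule Ck_component[OF C(7) oc rg])
 have fd: "f differentiable (at x)" if "x:V" for x using fC[of "Suc 0"] that by simp
 have bl: "blin (%y. complex_of_real (y ~~ b'))"
 by (rule bounded_linear_compose[OF bounded_linear_of_real bounded_linear_inner_left])
 have cf: "cpx (%x. of_real (f x)) 0" unfolding f_def
 by (rule real_analytic_cpx[OF real_analytic_linear[OF _ bl] V]) (use oc in simp)
 have k: "dd f x v = 0" if x: "x:M Int U" "x:V" and v: "v:cts M x" for x v
 proof -
 obtain L where L: "L:\<L>" "x:L" using part x(1) unfolding partition_on_def by blast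
 obtain Q where "L = \<Union>Q" "ALL S:Q. EX p:M. represents_local_CR_orbit M p S" using orb L(1) by blast
 then obtain Z p where Z: "x:Z" "Z <= L" "represents_local_CR_orbit M p Z" using L(2) by blast
 then obtain d where d: "CR_orbit_candidate M p d Z" unfolding represents_local_CR_orbit_def by blast
 have vZ: "v:tsp Z x" using d v Z(1) unfolding CR_orbit_candidate_def cts_def by blast
 obtain V1 wz B1 where V1: "x:V1" and s1: "slice_chart C_infinity Z B1 V1 wz" using d Z(1) unfolding CR_orbit_candidate_def submanifold_def by blast
 have rg1: "C_infinity = C_infinity | C_infinity = C_omega" by simp
 obtain A D where AD: "(wz HD A) (at x)" "(inv_into V1 wz HD D) (at (wz x))" "ALL w. A (D w) = w" "ALL v. D (A v) = v" "blin A" "blin D"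
 by (rule diffeo_deriv[OF slice_chartD(1)[OF s1] rg1 V1])
 have "ALL b:B1. A v ~~ b = 0" using vZ unfolding slice_chart_tangent[OF s1 rg1 Z(1) V1 AD(1)] by blast
 from slice_chart_curve[OF s1 rg1 Z(1) V1 AD(1), of v, OF this] obtain g e where g: "e > 0" "g 0 = x" "ALL t::real. \<bar>t\<bar> < e --> g t:Z & g t:V1 & wz (g t) = wz x+t *R A v"
 "(g has_vector_derivative v) (at 0)" "con {-e<..<e} g" by (elim exE conjE)
 have gd: "(g HD (%t. t *R v)) (at 0)" using g(4) by (simp add: has_vector_derivative_def)
 have gc: "isCont g 0" using gd has_derivative_continuous by blast
 have "NEAR t. g t:V" by (rule ev_nhds_compose[OF gc g(2) evo[OF C(7) x(2)]])
 then obtain e' where e': "e' > 0" "!!t::real. dist t 0 < e' ==> g t:V" unfolding eventually_nhds_metric by blast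
 define I where "I = {- min e e' <..< min e e'}"
 have I0: "0:I" using g(1) e'(1) by (simp add: I_def)
 have gI: "g ` I <= L Int V"
 proof (rule image_subsetI)
 fix t assume "t:I"
 hence "\<bar>t\<bar> < e" "dist t 0 < e'" by (auto simp: I_def)
 thus "g t:L Int V" using g(3) e'(2) Z(2) by blast
 qed
 have "connected (g ` I)"
 proof (rule connected_continuous_image)
 show "con I g" by (rule continuous_on_subset[OF g(5)]) (auto simp: I_def)
 show "connected I" by (simp add: I_def)
 qed
 moreover have "g ` I Int (L Int V) ~= {}" using gI I0 by blast
 ultimately obtain K where K: "K:components (L Int V)" "g ` I <= K"
 using exists_component_superset[of "g ` I" "L Int V"] gI I0 by blast
 then obtain c :: "complex^'n => real" where "K = {x:(M Int U) Int V. ALL b:B'. wx x ~~ b = c b}" using leaf L(1) by blast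
 hence fI: "f (g t) = c b'" if "t:I" for t using K(2) that b' by (auto simp: f_def)
 have oI: "open I" by (simp add: I_def)
 have "NEAR t. f (g t) = c b'" by (rule evm[OF evo[OF oI I0] fI])
 from dd_cong_ev[OF this, of 1] have "dd (%t. f (g t)) 0 1 = 0" by (simp add: dd_eqI[OF has_derivative_const])
 moreover have "((%t. f (g t)) HD (%t. dd f x (t *R v))) (at 0)"
 by (rule hdc[OF gd]) (use fd[OF x(2)] in "simp add: g(2) fdw")
 ultimately show ?thesis using dd_eqI[of "%t. f (g t)" _ 0 1] by fastforce
 qed
 have evU: "NEAR x. x:U" and evV: "NEAR x. x:V"
 by (rule evo[OF U(1,2)], rule evo[OF C(7) V])
 show ?thesis
 proof (rule leaf_good[OF cf evm[OF evV fd]])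
 show "NEAR x. x:M --> (ALL v:cts M x. dd f x v = 0)"
 using evU evV by eventually_elim (use k in auto)
 obtain A D where AD: "(wx HD A) (at 0)" "(inv_into V wx HD D) (at (wx 0))" "ALL w. A (D w) = w" "ALL v. D (A v) = v" "blin A" "blin D"
 by (rule diffeo_deriv[OF C(1) rg V])
 have bb: "b':Basis" "b' ~: B" using B' b' by auto
 have "ALL b:B. A (D b') ~~ b = 0" using AD(3) bb C(2) by (auto simp: inner_Basis)
 from slice_chart_curve[OF s rg `0:M Int U` V AD(1), of "D b'", OF this]
 obtain g e where g: "e > 0" "g 0 = 0" "ALL t::real. \<bar>t\<bar> < e --> g t:M Int U & g t:V & wx (g t) = wx 0+t *R A (D b')" "(g has_vector_derivative D b') (at 0)"
 "con {-e<..<e} g" by (elim exE conjE)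
 have "f (g t) = f 0+t" if "\<bar>t\<bar> < e" for t using g(3) that AD(3) bb by (simp add: f_def inner_add_left inner_Basis)
 thus "EX g e. e > 0 & g 0 = 0 & (ALL t::real. \<bar>t\<bar> < e --> g t:M & f (g t) = f 0+t) & (EX v. (g has_vector_derivative v) (at 0))"
 using g(1-4) by (intro exI[of _ g] exI[of _ e]) auto
 qed
qed

end

section \<open>From the germ g to normal equations\<close>

lemma multi_indicesD: "qw:mis I ==> i ~: I ==> qw i = 0"
 by (simp add: multi_indices_def)

text \<open>A multi-index on the doubled space supported on \<open>Q\<close> splits uniquely into
  exponents of z, of zeta and of the two real parameters, which are stored at \<open>Inl i1\<close>
  and \<open>Inl i2\<close>.\<close>

lemma series_reindex:
 fixes F :: "complex^('n::finite+'n) => complex" and i1 i2 :: 'n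
 assumes i: "i1 ~= i2" and Q: "Q = range Inl \<union> Inr ` (- {i1,i2})"
 and F: "((%wk. c0 wk * (PROD j:Q. X$j ^ wk j)) has_sum F X) (mis Q)"
 and X: "!!i. i ~: {i1,i2} ==> X$Inl i = z$i" "!!i. i ~: {i1,i2} ==> X$Inr i = wq$i" "X$Inl i1 = of_real (fst s)" "X$Inl i2 = of_real (snd s)"
 defines "e \<equiv> %qw qk k l. case_sum (%i. if i = i1 then k else if i = i2 then l else qw i) qk"
 shows "(series_term (- {i1,i2}) (%qw qk k l. c0 (e qw qk k l)) z wq s has_sum F X)
 (mis (- {i1,i2}) \<times> mis (- {i1,i2}) \<times> UNIV \<times> UNIV)"
proof -
 let ?I = "- {i1,i2} :: 'n set"
 let ?D = "mis ?I \<times> mis ?I \<times> (UNIV :: nat set) \<times> (UNIV :: nat set)"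
 define E where "E = (%(qw, qk, k, l). e qw qk k l)"
 have bij: "bij_betw E ?D (mis Q)"
 proof (rule bij_betw_byWitness[where f' = "%wk. (%i. if i:?I then wk (Inl i) else 0, %i. wk (Inr i), wk (Inl i1), wk (Inl i2))"])
 show "ALL p:?D. (%i. if i:?I then E p (Inl i) else 0, %i. E p (Inr i), E p (Inl i1), E p (Inl i2)) = p"
 proof
 fix p assume "p:?D"
 then obtain qw qk k l where p: "p = (qw, qk, k, l)" "qw:mis ?I" by (cases p) auto
 have "(%i. if i:?I then E p (Inl i) else 0) = qw"
 using p(2) by (intro ext) (auto simp: p(1) E_def e_def multi_indices_def)
 thus "(%i. if i:?I then E p (Inl i) else 0, %i. E p (Inr i), E p (Inl i1), E p (Inl i2)) = p"
 using i by (simp add: p(1)) (simp add: E_def e_def)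
 qed
 show "ALL wk:mis Q. E (%i. if i:?I then wk (Inl i) else 0, %i. wk (Inr i), wk (Inl i1), wk (Inl i2)) = wk"
 proof (intro ballI ext)
 fix wk :: "'n+'n => nat" and j
 show "E (%i. if i:?I then wk (Inl i) else 0, %i. wk (Inr i), wk (Inl i1), wk (Inl i2)) j = wk j"
 by (cases j) (simp_all add: E_def e_def)
 qed
 show "E ` ?D <= mis Q"
 proof (rule image_subsetI)
 fix p assume "p:?D"
 then obtain qw qk k l where p: "p = (qw, qk, k, l)" "qk:mis ?I" by (cases p) auto
 have "E p j = 0" if "j ~: Q" for j
 proof (cases j)
 case (Inl i) thus ?thesis using that by (simp add: Q)
 next
 case (Inr i)
 hence "i ~: ?I" using that by (auto simp: Q)
 hence "qk i = 0" by (rule multi_indicesD[OF p(2)])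
 thus ?thesis using Inr by (simp add: p(1) E_def e_def)
 qed
 thus "E p:mis Q" by (simp add: multi_indices_def)
 qed
 show "(%wk. (%i. if i:?I then wk (Inl i) else 0, %i. wk (Inr i), wk (Inl i1), wk (Inl i2))) ` mis Q <= ?D"
 proof (rule image_subsetI)
 fix wk :: "'n+'n => nat" assume g: "wk:mis Q"
 have "wk (Inr j) = 0" if "j ~: ?I" for j
 proof -
 have "Inr j ~: Q" using that by (auto simp: Q)
 thus ?thesis by (rule multi_indicesD[OF g])
 qed
 thus "(%i. if i:?I then wk (Inl i) else 0, %i. wk (Inr i), wk (Inl i1), wk (Inl i2)):?D"
 by (simp add: multi_indices_def)
 qed
 qed
 have hs: "((%p. c0 (E p) * (PROD j:Q. X$j ^ E p j)) has_sum F X) ?D"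
 using F has_sum_reindex_bij_betw[OF bij, of "%wk. c0 wk * (PROD j:Q. X$j ^ wk j)" "F X"] by simp
 have eq: "c0 (E p) * (PROD j:Q. X$j ^ E p j) = series_term ?I (%qw qk k l. c0 (e qw qk k l)) z wq s p" for p
 proof -
 obtain qw qk k l where p: "p = (qw, qk, k, l)" by (cases p)
 have Ep: "E p (Inl i1) = k" "E p (Inl i2) = l" "E p (Inr j) = qk j" "j:?I ==> E p (Inl j) = qw j" for j
 using i by (auto simp: p E_def e_def)
 have "(PROD j:Q. X$j ^ E p j) = (PROD j:range Inl. X$j ^ E p j) * (PROD j:Inr ` ?I. X$j ^ E p j)"
 unfolding Q by (rule prod.union_disjoint) auto
 also have "(PROD j:Inr ` ?I. X$j ^ E p j) = (PROD i:?I. wq$i ^ qk i)"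
 by (subst prod.reindex) (auto simp: Ep X(2) intro!: prod.cong)
 also have "(PROD j:range Inl. X$j ^ E p j) = (PROD i:UNIV. X$Inl i ^ E p (Inl i))"
 by (subst prod.reindex) auto
 also have "(UNIV :: 'n set) = insert i1 (insert i2 ?I)" by auto
 also have "(PROD i:insert i1 (insert i2 ?I). X$Inl i ^ E p (Inl i)) = of_real (fst s ^ k) * (of_real (snd s ^ l) * (PROD i:?I. X$Inl i ^ E p (Inl i)))"
 using i by (subst prod.insert, simp, simp, subst prod.insert) (simp_all add: X Ep)
 also have "(PROD i:?I. X$Inl i ^ E p (Inl i)) = (PROD i:?I. z$i ^ qw i)"
 by (rule prod.cong) (simp_all add: X Ep)
 finally show ?thesis by (simp add: p series_term_def E_def)
 qed
 show ?thesis using hs unfolding eq .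
qed

context nfM
begin

text \<open>A multiple of g - g 0 is added to its conjugate. The factor c makes both derivatives
  along \<open>ax k\<close> equal to 1, so they cannot cancel.\<close>

lemma real_good_g:
 assumes g: "good_g g"
 obtains G k where "ger G" "G 0 = 0" "ALL y. G (pk y) = G y" "ALL y. G (cnj_vec y) = cnj (G y)"
 "NEAR X. G (zW X) = G (zT X)" "k:{a,b}" "dd G 0 (ax k) ~= 0"
proof -
 have gg: "ger g" and gp: "!!y. g (pk y) = g y" and gWT: "NEAR X. g (zW X) = g (zT X)" using g by (auto simp: good_g_def)
 obtain k where k: "k:{a,b}" "dd g 0 (ax k) ~= 0" using g by (auto simp: good_g_def)
 define c where "c = inverse (dd g 0 (ax k))"
 define G where "G y = c * (g y - g 0)+cnj (c * (g (cnj_vec y) - g 0))" for y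
 have cp: "cnj_vec (pk y) = pk (cnj_vec y)" for y by (simp add: veq)
 have bl: "blin (cnj_vec :: complex^'n => _)" unfolding lcb[symmetric]
 by (rule linearI) (simp_all add: veq)
 have evc: "NEAR y. P (cnj_vec y)" if "NEAR y. P y" for P :: "complex^'n => bool"
 by (rule ev_nhds_compose[OF _ _ that]) (simp_all add: lincont[OF bl])
 have gd: "((%y. cnj (g (cnj_vec y))) HD (%v. cnj (dd g (cnj_vec y) (cnj_vec v)))) (at y)" if "cdiff g (cnj_vec y)" for y
 by (rule hdc[OF hdc[OF blhd[OF bl] cdiffD[OF that]] blhd[OF bounded_linear_cnj]])
 have gcn: "ger (%y. cnj (g (cnj_vec y)))" unfolding ger_def
 using evc[OF gg[unfolded ger_def]]
 proof eventually_elim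
 case (elim y)
 show ?case
 proof (rule cdiffI[OF gd[OF elim]])
 fix s :: complex and v :: "complex^'n"
 have "cnj_vec (s *s v) = cnj s *s cnj_vec v" by (simp add: veq)
 thus "cnj (dd g (cnj_vec y) (cnj_vec (s *s v))) = s * cnj (dd g (cnj_vec y) (cnj_vec v))"
 by (simp add: cdiff_scale[OF elim])
 qed
 qed
 have Ge: "G = (%y. c * (g y - g 0)+cnj c * (cnj (g (cnj_vec y)) - cnj (g 0)))" by (simp add: G_def fun_eq_iff)
 have 1: "ger G" unfolding Ge by (intro ger_add ger_mult ger_diff ger_const gg gcn)
 have 2: "G 0 = 0" by (simp add: G_def)
 have 3: "G (pk y) = G y" for y by (simp add: G_def gp cp)
 have 4: "G (cnj_vec y) = cnj (G y)" for y by (simp add: G_def add.commute)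
 have c1: "g (cnj_vec (zW X)) = g (zT (cj (Qp X)))" for X
 proof -
 have "T i (cj (Qp X)) = cnj (W i X)" if "i:{a,b}" for i
 using T_cj[OF that, of "cj (Qp X)"] cj_Qp[of X] that by simp
 hence "pk (cnj_vec (zW X)) = pk (zT (cj (Qp X)))" by (auto simp: veq zW_nth zT_nth)
 thus ?thesis using gp by metis
 qed
 have c2: "g (cnj_vec (zT X)) = g (zW (cj (Qp X)))" for X
 proof -
 have "cnj (T i X) = W i (cj (Qp X))" if "i:{a,b}" for i
 using T_cj[OF that, of X] that by simp
 hence "pk (cnj_vec (zT X)) = pk (zW (cj (Qp X)))" by (auto simp: veq zW_nth zT_nth)
 thus ?thesis using gp by metis
 qed
 have 5: "NEAR X. G (zW X) = G (zT X)"
 using gWT ev_Qp[OF ev_cj[OF gWT]] by eventually_elim (simp add: G_def c1 c2)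
 have "dd G 0 (ax k) = c * dd g 0 (ax k)+cnj c * cnj (dd g 0 (cnj_vec (ax k)))"
 proof -
 have h1: "((%y. c * (g y - g 0)) HD (%v. c * (dd g 0 v - 0))) (at 0)"
 by (intro has_derivative_mult_right has_derivative_diff cdiffD gerD0 gg has_derivative_const)
 have h2: "((%y. cnj (g (cnj_vec y))) HD (%v. cnj (dd g 0 (cnj_vec v)))) (at 0)"
 using gd[of 0] gerD0[OF gg] by simp
 have h3: "((%y. cnj c * (cnj (g (cnj_vec y)) - cnj (g 0))) HD (%v. cnj c * (cnj (dd g 0 (cnj_vec v)) - 0))) (at 0)"
 by (intro has_derivative_mult_right has_derivative_diff h2 has_derivative_const)
 show ?thesis unfolding Ge dd_eqI[OF has_derivative_add[OF h1 h3]] by simp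
 qed
 moreover have "cnj_vec (ax k) = (ax k :: complex^'n)" by (simp add: veq axis_def)
 ultimately have "dd G 0 (ax k) = c * dd g 0 (ax k)+cnj (c * dd g 0 (ax k))" by simp
 hence 6: "dd G 0 (ax k) ~= 0" using k(2) by (simp add: c_def)
 show thesis by (rule that[OF 1 2 allI[OF 3] allI[OF 4] 5 k(1) 6])
qed

text \<open>G replaces w_b as the coordinate w_2 and is real on M. The parameters s of M are
  exchanged for Re w_a and G, and Im w_a as a function of z, zeta and these is the defining
  function. Since it is a multiple of W a - T a, it vanishes on z = 0 and on zeta = 0.\<close>

lemma good_iii_b:
 assumes G: "ger G" "G 0 = 0" "ALL y. G (pk y) = G y" "ALL y. G (cnj_vec y) = cnj (G y)"
 "NEAR X. G (zW X) = G (zT X)" and dG: "dd G 0 (ax b) ~= 0"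
 shows "EX U V qz i1 i2. 0:U & biholomorphic U V qz & qz 0 = 0 & i1 ~= i2 & in_normal_coordinates M U qz i1 i2"
proof -
 have abI: "a:{a,b}" by simp
 define wz where "wz y = (\<chi> i. if i = b then G y else y$i)" for y
 define qz where "qz x = wz (qp x)" for x
 have vwz: "vger wz" unfolding wz_def by (intro vger_lambda ger_if G(1) ger_nth)
 have wz0: "wz 0 = 0" by (simp add: wz_def veq G(2))
 have dwz: "dd wz 0 V$i = (if i = b then dd G 0 V else V$i)" for V i
 unfolding vdiffD(2)[OF vgerD0[OF vwz]] by (simp add: wz_def dd_nth)
 have lin0: "V = 0" if F: "vger F" "inj (dd F 0)" "dd F 0 V = 0" for F :: "complex^'p::finite => complex^'q::finite" and V
 proof -
 have "dd F 0 0 = 0" using vlinear(2)[OF vgerD0[OF F(1)], of 0 0] by simp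
 thus ?thesis using injD[OF F(2), of V 0] F(3) by simp
 qed
 have injI0: "inj (dd F 0)" if "vger F" "!!V. dd F 0 V = 0 ==> V = 0" for F :: "complex^'p::finite => complex^'q::finite"
 proof (rule injI)
 fix u w assume "dd F 0 u = dd F 0 w"
 moreover have "dd F 0 (u+(-1) *s w) = dd F 0 u+(-1) *s dd F 0 w" by (simp only: vlinear[OF vgerD0[OF that(1)]])
 ultimately have "dd F 0 (u+(-1) *s w) = 0" by (simp add: veq)
 from that(2)[OF this] show "u = w" by (simp add: veq)
 qed
 have dG_single: "dd G 0 V = V$b * dd G 0 (ax b)" if "!!i. i ~= b ==> V$i = 0" for V
 proof -
 have "V = V$b *s ax b" using that by (auto simp: veq axis_def)
 hence "dd G 0 V = dd G 0 (V$b *s ax b)" by simp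
 thus ?thesis using cdiff_scale[OF gerD0[OF G(1)]] by simp
 qed
 have injwz: "inj (dd wz 0)"
 proof (rule injI0[OF vwz])
 fix V assume "dd wz 0 V = 0"
 hence z: "dd wz 0 V$i = 0" for i by simp
 have o: "V$i = 0" if "i ~= b" for i using z[of i] that by (simp add: dwz)
 have "V$b = 0" using z[of b] dG_single[OF o] dG by (simp add: dwz)
 hence "V$i = 0" for i using o by (cases "i = b") auto
 thus "V = 0" by (simp add: veq)
 qed
 have vqz: "vger qz" unfolding qz_def by (rule vger_compose[OF vTh Th0 vwz])
 have qz0: "qz 0 = 0" by (simp add: qz_def Th0 wz0)
 have dqz: "dd qz 0 V = dd wz 0 (dd qp 0 V)" for V
 using vdiff_compose(2)[OF vgerD0[OF vTh], of wz] vgerD0[OF vwz] by (simp add: qz_def[abs_def] Th0)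
 have injqz: "inj (dd qz 0)"
 proof (rule injI0[OF vqz])
 fix V assume "dd qz 0 V = 0"
 hence z: "dd qp 0 V = 0" using lin0[OF vwz injwz] dqz by simp
 have "dd (%x. jx (qp x)) 0 V = dd jx 0 (dd qp 0 V)" using vdiff_compose(2)[OF vgerD0[OF vTh], of jx] vgerD0[OF vXi] Th0 by simp
 moreover have "dd (%x. jx (qp x)) 0 V = dd (%x. x) 0 V" by (rule dd_cong_ev[OF XiTh])
 moreover have "dd jx 0 0 = 0" using vlinear(2)[OF vgerD0[OF vXi], of 0 0] by simp
 ultimately show "V = 0" by (simp add: dd_eqI[OF has_derivative_ident] z)
 qed
 \<comment> \<open>The change of parameters on the complexification: s_a becomes (W a + T a)/2, the
   extension of Re w_a, and s_b becomes G. The repeated entries are replaced by differences, so the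
   complexified M is where these vanish.\<close>
 define K where "K X = cpl (\<chi> i. if i = b then G (zW X) else if i = a then (W a X+T a X) * (1/2) else X$Inl i)
 (\<chi> i. if i:{a,b} then X$Inr i - X$Inl i else X$Inr i)" for X
 have Kn: "K X$Inl i = (if i = b then G (zW X) else if i = a then (W a X+T a X) * (1/2) else X$Inl i)"
 "K X$Inr i = (if i:{a,b} then X$Inr i - X$Inl i else X$Inr i)" for X i by (simp_all add: K_def)
 have gGW: "ger (%X. G (zW X))" by (rule ger_compose[OF vger_zW zW0 G(1)])
 have vK: "vger K" unfolding vger_iff
 proof
 fix j show "ger (%X. K X$j)"
 by (cases j) (auto simp: Kn intro!: ger_if ger_mult ger_add ger_diff gGW gW gT abI)
 qed
 have K0: "K 0 = 0" using W0[OF abI] T0[OF abI] by (simp add: veq2 Kn G(2))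
 have dGW: "dd (%X. G (zW X)) 0 V = dd G 0 (lc V)" for V
 using cdiff_compose(2)[OF vgerD0[OF vger_zW], of G] gerD0[OF G(1)] by (simp add: dd_zW0)
 have dWT: "dd (%X. (W a X+T a X) * (1/2)) 0 V = V$Inl a" for V
 proof -
 have "((%X. (W a X+T a X) * (1/2)) HD (%V. (dd (W a) 0 V+dd (T a) 0 V) * (1/2))) (at 0)"
 by (intro has_derivative_mult_left has_derivative_add cdiffD gerD0 gW gT abI)
 from dd_eqI[OF this] show ?thesis by (simp add: dW0[OF abI] dT0[OF abI])
 qed
 have dK: "dd K 0 V$Inl i = (if i = b then dd G 0 (lc V) else V$Inl i)"
 "dd K 0 V$Inr i = (if i:{a,b} then V$Inr i - V$Inl i else V$Inr i)" for V i
 proof -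
 note v = vdiffD(2)[OF vgerD0[OF vK]]
 show "dd K 0 V$Inl i = (if i = b then dd G 0 (lc V) else V$Inl i)"
 unfolding v Kn using dWT dGW by (cases "i = b"; cases "i = a") (simp_all add: dd_nth)
 have "dd (%X. X$Inr i - X$Inl i) 0 V = V$Inr i - V$Inl i" for V :: "complex^('n+'n)"
 by (rule dd_eqI[OF has_derivative_diff[OF nth_has_derivative nth_has_derivative]])
 thus "dd K 0 V$Inr i = (if i:{a,b} then V$Inr i - V$Inl i else V$Inr i)"
 unfolding v Kn by (auto simp: dd_nth)
 qed
 have injK: "inj (dd K 0)"
 proof (rule injI0[OF vK])
 fix V assume "dd K 0 V = 0"
 hence z: "dd K 0 V$j = 0" for j by simp
 have o: "V$Inl i = 0" if "i ~= b" for i using z[of "Inl i"] that by (simp add: dK)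
 have "V$Inl b = 0" using z[of "Inl b"] dG_single[of "lc V"] o dG by (simp add: dK)
 hence l: "V$Inl i = 0" for i using o by (cases "i = b") auto
 have "V$Inr i = 0" for i using z[of "Inr i"] l[of i] by (simp add: dK split: if_splits)
 thus "V = 0" using l by (simp add: veq2)
 qed
 obtain L where L: "vger L" "L 0 = 0" "NEAR x. L (K x) = x" "NEAR y. K (L y) = y"
 by (rule germ_inverse[OF vK K0 injK])
 obtain jz where jz: "vger jz" "jz 0 = 0" "NEAR x. jz (qz x) = x" "NEAR y. qz (jz y) = y"
 by (rule germ_inverse[OF vqz qz0 injqz])
 \<comment> \<open>The extension of Im w_a in the new parameters.\<close>
 define F where "F Y = (W a (L Y) - T a (L Y)) * (1/(2*\<i>))" for Y
 have gF: "ger F" unfolding F_def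
 by (rule ger_mult[OF ger_diff[OF ger_compose[OF L(1,2) gW[OF abI]] ger_compose[OF L(1,2) gT[OF abI]]] ger_const])
 define Q :: "('n+'n) set" where "Q = range Inl \<union> Inr ` (- {a,b})"
 obtain qj1 c0 where ps: "qj1 > 0" "ALL x:PD qj1. (ALL i. i ~: Q --> x$i = 0) --> ((%qw. c0 qw * (PROD j:Q. x$j ^ qw j)) has_sum F x) (mis Q)"
 by (rule germ_power_seriesE[OF gF])
 define pt where "pt z wq s = cpl (\<chi> i. if i = a then of_real (fst s) else if i = b then of_real (snd s) else z$i) (\<chi> i. if i:{a,b} then 0 else wq$i)"
 for z wq :: "complex^'n" and s :: "real \<times> real"
 have ptn: "pt z wq s$Inl i = (if i = a then of_real (fst s) else if i = b then of_real (snd s) else z$i)"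
 "pt z wq s$Inr i = (if i:{a,b} then 0 else wq$i)" for z wq s i by (simp_all add: pt_def)
 \<comment> \<open>Conjugation adapted to the new parameters: z and zeta are exchanged, whereas the
   entries for a and b are conjugated in place, because after \<open>K\<close> their second entries
   no longer repeat s. It commutes with \<open>K\<close> and hence with \<open>L\<close>.\<close>
 define wp where "wp X = cpl (\<chi> i. if i:{a,b} then cnj (X$Inl i) else cnj (X$Inr i)) (\<chi> i. if i:{a,b} then cnj (X$Inr i) else cnj (X$Inl i))"
 for X :: "complex^('n+'n)"
 have sn: "wp X$Inl i = (if i:{a,b} then cnj (X$Inl i) else cnj (X$Inr i))"
 "wp X$Inr i = (if i:{a,b} then cnj (X$Inr i) else cnj (X$Inl i))" for X i by (simp_all add: wp_def)
 have bls: "blin wp" unfolding lcb[symmetric]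
 by (rule linearI) (simp_all add: veq2 sn)
 have s0: "wp 0 = 0" by (simp add: veq2 sn)
 have evs: "NEAR X. P (wp X)" if "NEAR X. P X" for P
 by (rule ev_nhds_compose[OF lincont[OF bls] s0 that])
 have Qs: "Qp (wp X) = cj (Qp X)" for X by (auto simp: veq2 sn)
 have Ws: "W k (wp X) = cnj (T k X)" if k: "k:{a,b}" for k X
 using T_cj[OF k, of X] WQp[OF k, of "wp X"] TQp[OF k, of X] by (simp add: Qs)
 have Ts: "T k (wp X) = cnj (W k X)" if k: "k:{a,b}" for k X
 using T_cj[OF k, of "wp X"] TQp[OF k, of "wp X"] WQp[OF k, of X] by (simp add: Qs)
 have Gs: "G (zW (wp X)) = cnj (G (zT X))" for X
 proof -
 have "pk (zW (wp X)) = pk (cnj_vec (zT X))" using Ws by (auto simp: veq zW_nth zT_nth)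
 thus ?thesis using G(3,4) by metis
 qed
 have Ks: "NEAR X. K (wp X) = wp (K X)"
 using G(5)
 proof eventually_elim
 case (elim X)
 have "K (wp X)$Inl i = wp (K X)$Inl i" for i
 using elim Ws[OF abI, of X] Ts[OF abI, of X] Gs[of X] ab by (cases "i:{a,b}") (auto simp: Kn sn)
 moreover have "K (wp X)$Inr i = wp (K X)$Inr i" for i
 using ab by (cases "i:{a,b}") (auto simp: Kn sn)
 ultimately show ?case by (simp add: veq2)
 qed
 have Ls: "NEAR Y. L (wp Y) = wp (L Y)"
 using ev_compose[OF L(1,2) Ks] ev_compose[OF L(1,2) evs[OF L(3)]] L(4) by eventually_elim metis
 have mh_inM': "NEAR y. mh (R y):M" by (rule mh_inM)
 have vlc: "isCont (%Y. lc (L Y)) 0" by (rule isCont_o2[where f=L and g=lc, OF vger_isCont[OF L(1)] isCont_lc])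
 have lc0: "lc (L 0) = 0" by (simp add: L(2))
 have psi_mh: "NEAR X. qz (mh X) = wz (zW X)"
 using ev_zW[OF ThXi] by eventually_elim (simp add: qz_def mh_def)
 have "NEAR Y. K (L Y) = Y & L (wp Y) = wp (L Y)
 & ((ALL i. i ~: {a,b} --> L Y$Inr i = 0) --> W a (L Y) = T a (L Y))
 & ((ALL i. i ~: {a,b} --> L Y$Inl i = 0) --> W a (L Y) = T a (L Y))
 & mh (R (lc (L Y))):M & qz (mh (L Y)) = wz (zW (L Y)) & jz (qz (mh (L Y))) = mh (L Y) & G (zW (L Y)) = G (zT (L Y))"
 by (intro eventually_conj L(4) Ls ev_compose[OF L(1,2) nr[OF abI]] ev_compose[OF L(1,2) nl[OF abI]]
 ev_nhds_compose[OF vlc lc0 mh_inM'] ev_compose[OF L(1,2) psi_mh] ev_compose[OF L(1,2) ev_compose[OF vmh mh0 jz(3)]] ev_compose[OF L(1,2) G(5)])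
 then obtain qj2 where r2: "qj2 > 0" and E: "!!Y. Y:PD qj2 ==> K (L Y) = Y & L (wp Y) = wp (L Y)
 & ((ALL i. i ~: {a,b} --> L Y$Inr i = 0) --> W a (L Y) = T a (L Y))
 & ((ALL i. i ~: {a,b} --> L Y$Inl i = 0) --> W a (L Y) = T a (L Y))
 & mh (R (lc (L Y))):M & qz (mh (L Y)) = wz (zW (L Y)) & jz (qz (mh (L Y))) = mh (L Y) & G (zW (L Y)) = G (zT (L Y))"
 unfolding eventually_nhds_PD by blast
 define qj where "qj = min qj1 qj2"
 have r: "qj > 0" "qj <= qj1" "qj <= qj2" using ps(1) r2 by (auto simp: qj_def)
 have ptPD: "pt z wq s:PD qj" if "ALL i:- {a,b}. norm (z$i) < qj & norm (wq$i) < qj" "\<bar>fst s\<bar> < qj" "\<bar>snd s\<bar> < qj" for z wq s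
 unfolding PD_def mem_Collect_eq
 proof
 fix j show "norm (pt z wq s$j) < qj" using that r(1) by (cases j) (auto simp: ptn)
 qed
 have PD12: "Y:PD qj1" "Y:PD qj2" if "Y:PD qj" for Y using that r PD_mono by blast+
 define wj where "wj z wq s = F (pt z wq s)" for z wq s
 define wx where "wx z s = Re (wj z (cnj_vec z) s)" for z s
 have ser: "has_series (- {a,b}) (%qw qk k l. c0 (case_sum (%i. if i = a then k else if i = b then l else qw i) qk)) qj wj"
 unfolding has_series_def
 proof (intro allI impI, elim conjE)
 fix z wq :: "complex^'n" and s :: "real \<times> real"
 assume h: "ALL i:- {a,b}. norm (z$i) < qj & norm (wq$i) < qj" "\<bar>fst s\<bar> < qj" "\<bar>snd s\<bar> < qj"
 have "ALL j. j ~: Q --> pt z wq s$j = 0"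
 proof (intro allI impI)
 fix j assume "j ~: Q" thus "pt z wq s$j = 0" by (cases j) (auto simp: Q_def ptn)
 qed
 with ps(2) PD12(1)[OF ptPD[OF h]] have f: "((%qw. c0 qw * (PROD j:Q. pt z wq s$j ^ qw j)) has_sum F (pt z wq s)) (mis Q)" by blast
 show "(series_term (- {a,b}) (%qw qk k l. c0 (case_sum (%i. if i = a then k else if i = b then l else qw i) qk)) z wq s has_sum wj z wq s)
 (mis (- {a,b}) \<times> mis (- {a,b}) \<times> UNIV \<times> UNIV)"
 unfolding wj_def by (rule series_reindex[where F=F and X="pt z wq s" and ?c0.0=c0, OF ab Q_def f]) (use ab in "auto simp: ptn")
 qed
 have Lcomp: "L Y$Inl i = Y$Inl i" "L Y$Inr i = Y$Inr i" if "Y:PD qj2" "i ~: {a,b}" for Y i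
 proof -
 have "K (L Y) = Y" using E[OF that(1)] by blast
 thus "L Y$Inl i = Y$Inl i" "L Y$Inr i = Y$Inr i" using that(2) Kn[of "L Y" i] by auto
 qed
 have real: "wp (L Y) = L Y" "cnj (F Y) = F Y" if Y: "Y:PD qj2" "wp Y = Y" for Y
 proof -
 show 1: "wp (L Y) = L Y" using E[OF Y(1)] Y(2) by metis
 have "cnj (W a (L Y)) = T a (L Y)" using Ts[OF abI, of "L Y"] 1 by simp
 hence "cnj (T a (L Y)) = W a (L Y)" by (metis complex_cnj_cnj)
 thus "cnj (F Y) = F Y" using `cnj (W a (L Y)) = T a (L Y)` by (simp add: F_def field_simps)
 qed
 have ptr: "wp (pt z (cnj_vec z) s) = pt z (cnj_vec z) s" for z s by (auto simp: veq2 sn ptn)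
 have norm3: "wj z (cnj_vec z) s = of_real (wx z s) & wj 0 (cnj_vec z) s = 0 & wj z 0 s = 0"
 if h: "ALL i:- {a,b}. norm (z$i) < qj" "\<bar>fst s\<bar> < qj" "\<bar>snd s\<bar> < qj" for z s
 proof (intro conjI)
 have p1: "pt z (cnj_vec z) s:PD qj2" by (rule PD12(2)[OF ptPD]) (use h in auto)
 have p2: "pt 0 (cnj_vec z) s:PD qj2" by (rule PD12(2)[OF ptPD]) (use h r in auto)
 have p3: "pt z 0 s:PD qj2" by (rule PD12(2)[OF ptPD]) (use h r in auto)
 show "wj z (cnj_vec z) s = of_real (wx z s)" using real(2)[OF p1 ptr] by (simp add: wx_def wj_def ceq)
 have "L (pt 0 (cnj_vec z) s)$Inl i = 0" if "i ~: {a,b}" for i using Lcomp(1)[OF p2 that] that by (auto simp: ptn)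
 thus "wj 0 (cnj_vec z) s = 0" using E[OF p2] by (simp add: wj_def F_def)
 have "L (pt z 0 s)$Inr i = 0" if "i ~: {a,b}" for i using Lcomp(2)[OF p3 that] that by (auto simp: ptn)
 thus "wj z 0 s = 0" using E[OF p3] by (simp add: wj_def F_def)
 qed
 define Yw where "Yw w = pt w (cnj_vec w) (Re (w$a), Re (w$b))" for w
 have FM: "NEAR y. L (K (R y)) = R y & G (zW (R y)) = G (zT (R y))"
 using ev_R[OF L(3)] ev_R[OF G(5)] by eventually_elim simp
 have hc: "isCont h 0"
 proof -
 have "((%x. h x$i) HD dd (%x. h x$i) 0) (at 0)" for i
 using cpx_differentiable(1)[of "%x. h x$i" 0] ev_x[OF hcpx] by (simp add: fdw)
 hence "(h HD (%v. \<chi> i. dd (%x. h x$i) 0 v)) (at 0)" unfolding has_derivative_vec_iff by simp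
 thus ?thesis using has_derivative_continuous by blast
 qed
 have "\<forall>\<^sub>F w in nhds (0::complex^'n). w:PD qj" unfolding eventually_nhds_PD using r(1) by blast
 from ev_compose[OF vqz qz0 this]
 have "NEAR x. vdiff qz x & qz x:PD qj & jz (qz x) = x & (x:M --> qp x = zW (R (h x)) & Im (h x$a) = 0 & Im (h x$b) = 0)
 & L (K (R (h x))) = R (h x) & G (zW (R (h x))) = G (zT (R (h x)))"
 using vqz[unfolded vger_def] jz(3) onM ev_nhds_compose[OF hc h0 FM] by eventually_elim blast
 then obtain O' where O: "open O'" "0:O'" and EO: "!!x. x:O' ==> vdiff qz x & qz x:PD qj & jz (qz x) = x & (x:M --> qp x = zW (R (h x)) & Im (h x$a) = 0 & Im (h x$b) = 0)
 & L (K (R (h x))) = R (h x) & G (zW (R (h x))) = G (zT (R (h x)))" unfolding eventually_nhds by blast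
 have vO: "vdiff qz x" if "x:O'" for x using EO[OF that] by blast
 obtain U V jq where UV: "open U" "0:U" "U <= O'" "open V" "qz 0:V" "homeomorphism U V qz jq" and vjq: "!!y. y:V ==> vdiff jq y"
 by (rule local_inverse[OF O vO injqz]) blast+
 have bij: "bij_betw qz U V" using UV(6) by (auto simp: homeomorphism_def bij_betw_def intro: inj_on_inverseI)
 have iG: "inv_into U qz y = jq y" if "y:V" for y
 by (rule inv_into_f_eq[OF bij_betw_imp_inj_on[OF bij]]) (use UV(6) that in "auto simp: homeomorphism_def")
 have bh: "biholomorphic U V qz" unfolding biholomorphic_def holomorphic_map_on_def
 proof (intro conjI UV(1,4) bij ballI)
 fix x assume "x:U" hence "vdiff qz x" using UV(3) vO by blast
 thus "EX f'. (qz HD f') (at x) & (ALL c v. f' (c *s v) = c *s f' v)" unfolding vdiff_alt .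
 next
 fix y assume y: "y:V"
 obtain f' where f': "(jq HD f') (at y)" "ALL c v. f' (c *s v) = c *s f' v" using vjq[OF y] unfolding vdiff_alt by blast
 have "(inv_into U qz HD f') (at y)" by (rule has_derivative_transform_within_open[OF f'(1) UV(4) y]) (simp add: iG)
 thus "EX f'. (inv_into U qz HD f') (at y) & (ALL c v. f' (c *s v) = c *s f' v)" using f'(2) by blast
 qed
 have qzn: "qz x$i = (if i = b then G (qp x) else qp x$i)" for x i by (simp add: qz_def wz_def)
 have Greal: "Im (G (zW (R y))) = 0" if "G (zW (R y)) = G (zT (R y))" for y
 proof -
 have "cnj_vec (zT (R y)) = zW (R y)"
 using T_cj[of a "R y"] T_cj[of b "R y"] by (auto simp: veq zT_nth zW_nth R_nth)
 hence "G (zW (R y)) = cnj (G (zW (R y)))" using G(4) that by metis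
 thus ?thesis by (simp add: ceq)
 qed
 have TR: "T a (R y) = cnj (W a (R y))" for y using T_cj[OF abI, of "R y"] by simp
 have main: "x:M <-> Im (qz x$a) = wx (qz x) (Re (qz x$a), Re (qz x$b)) & Im (qz x$b) = 0" if xU: "x:U" for x
 proof -
 have e: "qz x:PD qj" "jz (qz x) = x" "x:M ==> qp x = zW (R (h x)) & Im (h x$a) = 0 & Im (h x$b) = 0"
 "L (K (R (h x))) = R (h x)" "G (zW (R (h x))) = G (zT (R (h x)))" using EO[of x] xU UV(3) by blast+
 have nPD: "norm (qz x$i) < qj" for i using e(1) by (simp add: PD_def)
 have rePD: "\<bar>Re (qz x$i)\<bar> < qj" for i using nPD[of i] abs_Re_le_cmod[of "qz x$i"] by linarith
 have Y2: "Yw (qz x):PD qj2" unfolding Yw_def by (rule PD12(2)[OF ptPD]) (use nPD rePD in auto)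
 have phiF: "wx (qz x) (Re (qz x$a), Re (qz x$b)) = Re (F (Yw (qz x)))" by (simp add: wx_def wj_def Yw_def)
 have sY: "wp (Yw (qz x)) = Yw (qz x)" unfolding Yw_def by (rule ptr)
 show ?thesis
 proof
 assume xM: "x:M"
 let ?X = "R (h x)"
 have Th: "qp x = zW ?X" using e(3)[OF xM] by blast
 have P2: "qz x$b = G (zW ?X)" by (simp add: qzn Th)
 have im2: "Im (qz x$b) = 0" unfolding P2 by (rule Greal[OF e(5)])
 have P1: "qz x$a = W a ?X" using ab by (simp add: qzn Th zW_nth)
 have Pi: "qz x$i = h x$i" if "i ~: {a,b}" for i using that by (simp add: qzn Th zW_nth R_nth)
 have "K ?X$Inl i = Yw (qz x)$Inl i" for i
 using P1 P2 im2 Pi[of i] TR[of "h x"] ab by (auto simp: Kn Yw_def ptn R_nth ceq)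
 moreover have "K ?X$Inr i = Yw (qz x)$Inr i" for i
 using Pi[of i] by (auto simp: Kn Yw_def ptn R_nth)
 ultimately have KY: "K ?X = Yw (qz x)" by (simp add: veq2)
 have "F (Yw (qz x)) = (W a ?X - cnj (W a ?X)) * (1/(2*\<i>))" unfolding F_def KY[symmetric] e(4) TR ..
 hence "Re (F (Yw (qz x))) = Im (qz x$a)" by (simp add: P1 ceq complex_diff_cnj)
 thus "Im (qz x$a) = wx (qz x) (Re (qz x$a), Re (qz x$b)) & Im (qz x$b) = 0" using im2 phiF by simp
 next
 \<comment> \<open>A solution of the equations determines the parameter
   \<open>L (Yw (qz x))\<close>, which is fixed by the conjugation and therefore real. The point of
   M it parametrizes has the same image under \<open>qz\<close> as x, so it is x.\<close>
 assume A: "Im (qz x$a) = wx (qz x) (Re (qz x$a), Re (qz x$b)) & Im (qz x$b) = 0"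
 let ?Y = "Yw (qz x)"
 let ?X = "L ?Y"
 note E = E[OF Y2]
 have KX: "K ?X = ?Y" using E by blast
 have sX: "wp ?X = ?X" by (rule real(1)[OF Y2 sY])
 have r1: "?X$Inr i = ?X$Inl i" if "i:{a,b}" for i
 using arg_cong[OF KX, of "%v. v$Inr i"] that by (simp add: Kn Yw_def ptn)
 have r2: "cnj (?X$Inl i) = ?X$Inl i" if "i:{a,b}" for i
 using arg_cong[OF sX, of "%v. v$Inl i"] that by (simp add: sn)
 have r3: "?X$Inr i = cnj (?X$Inl i)" if "i ~: {a,b}" for i
 using arg_cong[OF sX, of "%v. v$Inr i"] that by (simp add: sn)
 have RX: "R (lc ?X) = ?X"
 proof -
 have "R (lc ?X)$Inl i = ?X$Inl i" for i using r2[of i] by (auto simp: R_nth ceq)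
 moreover have "R (lc ?X)$Inr i = ?X$Inr i" for i
 using r1[of i] r2[of i] r3[of i] by (cases "i:{a,b}") (auto simp: R_nth ceq)
 ultimately show ?thesis by (simp add: veq2)
 qed
 have inM': "mh ?X:M" using E RX by simp
 have "Im (F ?Y) = 0" using real(2)[OF Y2 sY] by (simp add: ceq)
 hence FY: "F ?Y = of_real (Im (qz x$a))" using A phiF by (simp add: ceq)
 have W1: "W a ?X = qz x$a"
 proof -
 have "(W a ?X+T a ?X) * (1/2) = of_real (Re (qz x$a))"
 using arg_cong[OF KX, of "%v. v$Inl a"] ab by (simp add: Kn Yw_def ptn)
 moreover have "W a ?X - T a ?X = 2 * \<i> * of_real (Im (qz x$a))" using FY by (simp add: F_def field_simps)
 moreover have "W a ?X = (W a ?X+T a ?X) * (1/2)+(W a ?X - T a ?X) * (1/2)" by (simp add: field_simps)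
 ultimately have "W a ?X = of_real (Re (qz x$a))+\<i> * of_real (Im (qz x$a))" by simp
 thus ?thesis using complex_eq[of "qz x$a"] by simp
 qed
 have G2: "G (zW ?X) = qz x$b"
 using arg_cong[OF KX, of "%v. v$Inl b"] A ab by (simp add: Kn Yw_def ptn ceq)
 have "wz (zW ?X)$i = qz x$i" for i
 proof (cases "i:{a,b}")
 case True
 then consider "i = b" | "i = a" using True by blast
 thus ?thesis using W1 G2 ab by cases (auto simp: wz_def zW_nth)
 next
 case False
 hence "?X$Inl i = qz x$i" using Lcomp(1)[OF Y2 False] by (auto simp: Yw_def ptn)
 thus ?thesis using False by (auto simp: wz_def zW_nth)
 qed
 hence "wz (zW ?X) = qz x" by (simp add: veq)
 hence "mh ?X = x" using E e(2) by metis
 thus "x:M" using inM' by simp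
 qed
 qed
 have "in_normal_coordinates M U qz a b" unfolding in_normal_coordinates_def
 proof (intro exI conjI ballI allI impI)
 show "0 < qj" by (rule r)
 show "has_series (- {a,b}) (%qw qk k l. c0 (case_sum (%i. if i = a then k else if i = b then l else qw i) qk)) qj wj" by (rule ser)
 show "M Int U = {x:U. Im (qz x$a) = wx (qz x) (Re (qz x$a), Re (qz x$b)) & Im (qz x$b) = 0}" using main by blast
 next
 fix z :: "complex^'n" and s :: "real \<times> real" assume "(ALL i:- {a,b}. norm (z$i) < qj) & \<bar>fst s\<bar> < qj & \<bar>snd s\<bar> < qj"
 hence h: "ALL i:- {a,b}. norm (z$i) < qj" "\<bar>fst s\<bar> < qj" "\<bar>snd s\<bar> < qj" by auto
 note n = norm3[OF h]
 show "wj z (cnj_vec z) s = of_real (wx z s)" "wj 0 (cnj_vec z) s = 0" "wj z 0 s = 0" using n by blast+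
 next
 fix x assume "x:U"
 hence "qz x:PD qj" using EO UV(3) by blast
 hence n: "norm (qz x$i) < qj" for i by (simp add: PD_def)
 hence m: "\<bar>Re (qz x$i)\<bar> < qj" for i using abs_Re_le_cmod[of "qz x$i"] by (meson le_less_trans)
 show "norm (qz x$i) < qj" for i by (rule n)
 show "\<bar>Re (qz x$a)\<bar> < qj" "\<bar>Re (qz x$b)\<bar> < qj" by (rule m)+
 qed
 thus ?thesis using UV(2) bh qz0 ab by blast
qed

theorem good_iii:
 assumes "good_g g"
 shows "EX U V qz i1 i2. 0:U & biholomorphic U V qz & qz 0 = 0 & i1 ~= i2 & in_normal_coordinates M U qz i1 i2"
proof -
 obtain G k where G: "ger G" "G 0 = 0" "ALL y. G (pk y) = G y" "ALL y. G (cnj_vec y) = cnj (G y)"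
 "NEAR X. G (zW X) = G (zT X)" and k: "k:{a,b}" "dd G 0 (ax k) ~= 0" by (rule real_good_g[OF assms])
 show ?thesis
 proof (cases "k = b")
 case True thus ?thesis using good_iii_b[OF G] k(2) by blast
 next
 case False
 hence "k = a" using k(1) by simp
 interpret s: nfM b a W T M qp jx h by (rule nfM_swap)
 show ?thesis by (rule s.good_iii_b[unfolded swap_defs, OF G]) (use k(2) `k = a` in simp)
 qed
qed

end

section \<open>Levi-flat level sets and the flattening shear\<close>

lemma dd_symmetric:
 fixes f :: "complex^'m::finite => complex"
 assumes S: "open S" and hol: "!!x. x:S ==> cdiff f x" and x: "x:S"
 shows "dd (%x. dd f x v) x u = dd (%x. dd f x u) x v"
proof -
 obtain R0 where R0: "R0 > 0" "ball x R0 <= S" using S x openE by blast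
 define r where "r = R0 / (4 * (1+norm u+norm v))"
 have p: "1+norm u+norm v > 0" by (simp add: add_pos_nonneg)
 have r: "r > 0" using R0 p by (simp add: r_def)
 have inS: "x+z *s u+w *s v:S" if "norm z < 2 * r" "norm w < 2 * r" for z w
 proof -
 have "norm (z *s u+w *s v) <= norm z * norm u+norm w * norm v"
 using norm_triangle_ineq[of "z *s u" "w *s v"] by (simp add: norm_vector_scalar_mult)
 also have "\<dots> \<le> 2 * r * norm u+2 * r * norm v" using that by (intro add_mono mult_right_mono) auto
 also have "\<dots> < 2 * r * (1+norm u+norm v)" using r by (simp add: algebra_simps)
 also have "\<dots> = R0 / 2" using p by (simp add: r_def field_simps)
 also have "\<dots> < R0" using R0 by simp
 finally have n: "norm (z *s u+w *s v) < R0" .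
 have "dist (x+(z *s u+w *s v)) x = norm (z *s u+w *s v)" by (simp add: dist_norm)
 hence "x+(z *s u+w *s v):ball x R0" using n by (simp add: dist_commute)
 thus ?thesis using R0(2) by (auto simp: add.assoc)
 qed
 \<comment> \<open>The mixed derivative is a double circle integral; symmetry is then the exchange
   of the order of integration.\<close>
 have main: "dd (%x. dd f x v') x u' = integral {0..1} (%s. integral {0..1} (%t. f (x+circ r s *s u'+circ r t *s v') / (circ r s * circ r t)))"
 if inS: "!!z w. norm z < 2 * r ==> norm w < 2 * r ==> x+z *s u'+w *s v':S" for u' v'
 proof -
 have 1: "((%s. dd f (x+circ r s *s u') v' / circ r s) has_integral dd (%x. dd f x v') x u') {0..1}"
 proof (rule dd_circle[of "2 * r"])
 fix z :: complex assume "z:ball 0 (2 * r)"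
 hence "x+z *s u':S" using inS[of z 0] r by simp
 show "cdiff (%x. dd f x v') (x+z *s u')" by (rule hol_dd[OF S hol `x+z *s u':S`])
 qed (use r in auto)
 have 2: "integral {0..1} (%t. f (x+circ r s *s u'+circ r t *s v') / (circ r s * circ r t)) = dd f (x+circ r s *s u') v' / circ r s" for s
 proof -
 have "((%t. f (x+circ r s *s u'+circ r t *s v') / circ r t) has_integral dd f (x+circ r s *s u') v') {0..1}"
 proof (rule dd_circle[of "2 * r"])
 fix z :: complex assume "z:ball 0 (2 * r)"
 thus "cdiff f (x+circ r s *s u'+z *s v')" using r by (intro hol inS) auto
 qed (use r in auto)
 from has_integral_divide[OF this, of "circ r s"] show ?thesis
 by (intro integral_unique) (simp add: mult.commute)
 qed
 show ?thesis unfolding 2 by (rule integral_unique[OF 1, symmetric])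
 qed
 have c: "con (cbox (0::real,0::real) (1,1)) (%(s,t). f (x+circ r s *s u+circ r t *s v) / (circ r s * circ r t))"
 proof -
 have "con (cbox (0::real,0::real) (1,1)) (%p. f (x+circ r (fst p) *s u+circ r (snd p) *s v) / (circ r (fst p) * circ r (snd p)))"
 proof (intro continuous_on_divide continuous_on_mult)
 show "con (cbox (0,0) (1,1)) (%p. f (x+circ r (fst p) *s u+circ r (snd p) *s v))"
 by (rule continuous_on_compose2[OF hol_continuous[of S f]]) (use hol r in "auto intro!: continuous_intros inS")
 qed (use r in "auto intro!: continuous_intros")
 thus ?thesis by (simp add: case_prod_unfold)
 qed
 have "dd (%x. dd f x v) x u = integral (cbox 0 1) (%s. integral (cbox 0 1) (%t. f (x+circ r s *s u+circ r t *s v) / (circ r s * circ r t)))"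
 using main[of u v] inS by simp
 also have "\<dots> = integral (cbox 0 1) (%t. integral (cbox 0 1) (%s. f (x+circ r s *s u+circ r t *s v) / (circ r s * circ r t)))"
 by (rule integral_swap_continuous[OF c])
 also have "\<dots> = dd (%x. dd f x u) x v"
 proof -
 have "x+z *s v+w *s u:S" if "norm z < 2 * r" "norm w < 2 * r" for z w using inS[OF that(2,1)] by (simp add: add_ac)
 from main[of v u, OF this] show ?thesis by (simp add: add_ac mult.commute)
 qed
 finally show ?thesis .
qed

text \<open>The complex tangent space is the kernel of df. Differentiating df(Y) = 0 along X gives
  the second derivative of f in X and Y plus df of the derivative of Y along X; the second
  derivative is symmetric, so the difference for X and Y shows that df annihilates the
  bracket.\<close>

lemma levi_flat_holomorphic:
 fixes f :: "complex^'n::finite => complex"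
 assumes O: "open O'" "A <= O'" and hol: "!!x. x:O' ==> cdiff f x"
 and T: "!!q. q:A ==> tsp A q = {v. Im (dd f q v) = 0}"
 shows "Levi_flat A"
proof -
 have cT: "w:cts A q <-> dd f q w = 0" if q: "q:A" for q w
 proof
 have c: "cdiff f q" using hol O q by blast
 show "dd f q w = 0" if "w:cts A q"
 proof -
 have "w:J ` {v. Im (dd f q v) = 0}" "Im (dd f q w) = 0" using that unfolding cts_def T[OF q] by blast+
 then obtain u where u: "w = J u" "Im (dd f q u) = 0" "Im (dd f q w) = 0" by blast
 thus ?thesis using cdiff_scale[OF c, of \<i> u] by (simp add: ceq J_def)
 qed
 assume z: "dd f q w = 0"
 have "w = J ((-\<i>) *s w)" by (simp add: J_def veq)
 moreover have "dd f q ((-\<i>) *s w) = 0" using cdiff_scale[OF c, of "-\<i>" w] unfolding z by simp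
 ultimately show "w:cts A q" unfolding cts_def T[OF q] using z by (intro IntI image_eqI[of w J]) auto
 qed
 have key: "dd (%x. dd f x (X q)) q (Y q)+dd f q (dd Y q (X q)) = 0"
 if U: "open U" and Y: "Ck_on 1 Y U" and E: "!!q. q:A Int U ==> dd f q (X q) = 0 & dd f q (Y q) = 0" and q: "q:A Int U" for U X Y q
 proof -
 have qO: "q:O'" using q O by auto
 note c = hol[OF qO]
 have Yd: "(Y HD dd Y q) (at q)" using Ck_has_derivative[of 0 Y U q] Y q by simp
 have Yi: "((%x. Y x$i) HD (%v. dd Y q v$i)) (at q)" for i using Yd unfolding has_derivative_vec_iff by blast
 have fi: "((%x. dd f x (ax i)) HD dd (%x. dd f x (ax i)) q) (at q)" for i by (rule cdiffD[OF hol_dd[OF O(1) hol qO]])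
 have D: "((%x. SUM i:UNIV. Y x$i * dd f x (ax i)) HD (%v. SUM i:UNIV. Y q$i * dd (%x. dd f x (ax i)) q v+dd Y q v$i * dd f q (ax i))) (at q)"
 by (intro has_derivative_sum has_derivative_mult Yi fi)
 have z: "(SUM i:UNIV. Y x$i * dd f x (ax i)) = 0" if "x:A" "x:U" for x
 proof -
 have "cdiff f x" using hol O that by blast
 from dd_expand[OF this, of "Y x"] E[of x] that show ?thesis by simp
 qed
 have "Im (dd f q (X q)) = 0" using E[OF q] by simp
 hence "X q:tsp A q" using T[of q] q by simp
 from tangent_kills[OF this D U] z q
 have "(SUM i:UNIV. Y q$i * dd (%x. dd f x (ax i)) q (X q)+dd Y q (X q)$i * dd f q (ax i)) = 0" by auto
 moreover have "(SUM i:UNIV. dd Y q (X q)$i * dd f q (ax i)) = dd f q (dd Y q (X q))" by (rule dd_expand[OF c, symmetric])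
 moreover have "(SUM i:UNIV. Y q$i * dd (%x. dd f x (ax i)) q (X q)) = dd (%x. dd f x (X q)) q (Y q)"
 proof -
 have h: "cdiff (%x. dd f x (X q)) q" by (rule hol_dd[OF O(1) hol qO])
 have sy: "dd (%x. dd f x (ax i)) q (X q) = dd (%x. dd f x (X q)) q (ax i)" for i by (rule dd_symmetric[OF O(1) hol qO])
 show ?thesis unfolding dd_expand[OF h, of "Y q"] sy ..
 qed
 ultimately show ?thesis by (simp add: sum.distrib)
 qed
 show ?thesis unfolding Levi_flat_def involutive_def
 proof (intro allI impI ballI, elim conjE)
 fix U X Y q assume U: "open U" and XY: "Ck_on 1 X U" "Ck_on 1 Y U" and E: "ALL q:A Int U. X q:cts A q & Y q:cts A q" and q: "q:A Int U"
 have E': "dd f q (X q) = 0 & dd f q (Y q) = 0" if "q:A Int U" for q using E that cT[of q] by auto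
 have E'': "dd f q (Y q) = 0 & dd f q (X q) = 0" if "q:A Int U" for q using E'[OF that] by simp
 have qO: "q:O'" using q O by auto
 have "dd f q (dd Y q (X q) - dd X q (Y q)) = dd f q (dd Y q (X q)) - dd f q (dd X q (Y q))"
 by (rule linear_diff[OF bllin[OF cdiff_linear[OF hol[OF qO]]]])
 also have "\<dots> = 0"
 proof -
 have "dd (%x. dd f x (X q)) q (Y q) = dd (%x. dd f x (Y q)) q (X q)" by (rule dd_symmetric[OF O(1) hol qO])
 moreover have "dd (%x. dd f x (X q)) q (Y q)+dd f q (dd Y q (X q)) = 0" by (rule key[OF U XY(2) E' q])
 moreover have "dd (%x. dd f x (Y q)) q (X q)+dd f q (dd X q (Y q)) = 0" by (rule key[OF U XY(1) E'' q])
 ultimately show ?thesis by (metis add_left_cancel right_minus_eq)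
 qed
 finally show "dd Y q (X q) - dd X q (Y q):cts A q" using cT q by blast
 qed
qed

text \<open>Absolute convergence at one common radius q, strictly between the moduli of the
  coordinates of Y and the given radius, is a majorant near Y. So the series continues
  holomorphically to complex values of s.\<close>

lemma series_complexification:
 fixes c :: "'n::finite series_coeffs"
 assumes i: "i1 ~= i2" and r: "qj > 0" and ser: "has_series (- {i1, i2}) c qj wj"
 defines "pt \<equiv> %z wq s. cpl (\<chi> i. if i = i1 then of_real (fst s) else if i = i2 then of_real (snd s) else z$i) (\<chi> i. if i:{i1,i2} then 0 else wq$i)"
 shows "EX F. (ALL Y:PD qj. cdiff F Y) & (\<forall>z wq s. (ALL i:- {i1, i2}. norm (z$i) < qj & norm (wq$i) < qj) & \<bar>fst s\<bar> < qj & \<bar>snd s\<bar> < qj --> wj z wq s = F (pt z wq s))"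
proof -
 let ?I = "- {i1, i2} :: 'n set"
 let ?D = "mis ?I \<times> mis ?I \<times> (UNIV :: nat set) \<times> (UNIV :: nat set)"
 define t where "t = (%(qw, qk, k, l) (Y :: complex^('n+'n)). c qw qk k l * (PROD i:?I. (Y$Inl i) ^ qw i) * (PROD i:?I. (Y$Inr i) ^ qk i) * (Y$Inl i1 ^ k * Y$Inl i2 ^ l))"
 define F where "F Y = (\<Sum>\<^sub>\<infinity>p\<in>?D. t p Y)" for Y
 have tc: "cdiff (t p) Y" for p Y
 by (cases p) (auto simp: t_def intro!: cdiff_mult cdiff_prod cdiff_power)
 have "cdiff F Y" if Y: "Y:PD qj" for Y
 proof -
 define m where "m = Max (range (%j. norm (Y$j)))"
 have m: "norm (Y$j) <= m" for j unfolding m_def by (intro Max_ge) auto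
 have "m:range (%j. norm (Y$j))" unfolding m_def by (intro Max_in) auto
 hence "m < qj" "m >= 0" using Y by (auto simp: PD_def)
 define q where "q = (m+qj) / 2"
 have q: "q > 0" "q < qj" "m < q" using `m < qj` `m >= 0` r by (auto simp: q_def)
 have Yq: "Y:PD q" using m q(3) by (auto simp: PD_def intro: le_less_trans)
 define M where "M p = norm (series_term ?I c (\<chi> i. of_real q) (\<chi> i. of_real q) (q, q) p)" for p
 have "series_term ?I c (\<chi> i. of_real q) (\<chi> i. of_real q) (q, q) summable_on ?D"
 using ser[unfolded has_series_def, rule_format, of "\<chi> i. of_real q" "\<chi> i. of_real q" "(q,q)"] q by (auto simp: summable_on_def)
 hence Ms: "M summable_on ?D" unfolding M_def using summable_on_iff_abs_summable_on_complex by blast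
 have le: "norm (t p X) <= M p" if "X:PD q" for p X
 proof -
 obtain qw qk k l where p: "p = (qw, qk, k, l)" by (cases p)
 have X: "norm (X$j) <= q" for j using that by (auto simp: PD_def less_imp_le)
 have "norm (t p X) = norm (c qw qk k l) * (PROD i:?I. norm (X$Inl i) ^ qw i) * (PROD i:?I. norm (X$Inr i) ^ qk i) * (norm (X$Inl i1) ^ k * norm (X$Inl i2) ^ l)"
 by (simp add: p t_def norm_mult norm_power prod_norm[symmetric])
 also have "\<dots> \<le> norm (c qw qk k l) * (PROD i:?I. q ^ qw i) * (PROD i:?I. q ^ qk i) * (q ^ k * q ^ l)"
 using q(1) by (intro mult_mono prod_mono conjI power_mono X mult_nonneg_nonneg prod_nonneg ballI zero_le_power norm_ge_zero order.refl) auto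
 also have "\<dots> = M p" using q(1) by (simp add: M_def p series_term_def norm_mult norm_power prod_norm[symmetric])
 finally show ?thesis .
 qed
 show ?thesis unfolding F_def by (rule hol_infsum[OF open_PD tc le Ms Yq])
 qed
 moreover have "wj z wq s = F (pt z wq s)" if h: "(ALL i:?I. norm (z$i) < qj & norm (wq$i) < qj) & \<bar>fst s\<bar> < qj & \<bar>snd s\<bar> < qj" for z wq s
 proof -
 have "series_term ?I c z wq s = (%p. t p (pt z wq s))"
 proof
 fix p show "series_term ?I c z wq s p = t p (pt z wq s)"
 proof (cases p)
 case (fields qw qk k l)
 have "(PROD j:?I. (pt z wq s$Inl j) ^ qw j) = (PROD j:?I. (z$j) ^ qw j)" "(PROD j:?I. (pt z wq s$Inr j) ^ qk j) = (PROD j:?I. (wq$j) ^ qk j)"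
 by (intro prod.cong refl, simp add: pt_def)+
 moreover have "pt z wq s$Inl i1 = of_real (fst s)" "pt z wq s$Inl i2 = of_real (snd s)" using i by (simp_all add: pt_def)
 ultimately show ?thesis by (simp add: fields t_def series_term_def)
 qed
 qed
 thus ?thesis using ser[unfolded has_series_def, rule_format, OF h] unfolding F_def by (simp add: infsumI)
 qed
 ultimately show ?thesis by blast
qed

text \<open>A real analytic chart onto a ball in which M is flat. Only the coordinate
  \<open>i2\<close> of \<open>ch\<close> is holomorphic, and it carries the complex structure used
  below.\<close>

locale straight =
 fixes M :: "(complex^'n::finite) set" and i1 i2 :: 'n and U :: "(complex^'n) set" and ch g :: "complex^'n => complex^'n" and qv :: real
 assumes i12: "i1 ~= i2" and eps: "qv > 0" and oU: "open U" and U0: "0:U" and chi0: "ch 0 = 0"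
 and chiB: "!!x. x:U ==> norm (ch x) < qv" and gchi: "!!x. x:U ==> g (ch x) = x"
 and chic: "!!x i. x:U ==> cpx (%x. ch x$i) x" and chih: "!!x. x:U ==> cdiff (%x. ch x$i2) x"
 and chiM: "!!x. x:U ==> x:M <-> Im (ch x$i1) = 0 & Im (ch x$i2) = 0"
 and gU: "!!y. norm y < qv ==> g y:U" and chig: "!!y. norm y < qv ==> ch (g y) = y"
 and gc: "!!y i. norm y < qv ==> cpx (%y. g y$i) y"

lemma straight_exists:
 fixes M :: "(complex^'n::finite) set"
 assumes U: "0:U" and bh: "biholomorphic U V qz" and Psi0: "qz 0 = 0" and i: "i1 ~= i2" and nc: "in_normal_coordinates M U qz i1 i2"
 shows "EX U' ch g qv. straight M i1 i2 U' ch g qv"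
proof -
 obtain c qj wj wx where r: "qj > 0" and ser: "has_series (- {i1, i2}) c qj wj"
 and nm: "ALL z s. (ALL i:- {i1, i2}. norm (z$i) < qj) & \<bar>fst s\<bar> < qj & \<bar>snd s\<bar> < qj -->
 wj z (cnj_vec z) s = of_real (wx z s) & wj 0 (cnj_vec z) s = 0 & wj z 0 s = 0"
 and UD: "ALL x:U. (ALL i:- {i1, i2}. norm (qz x$i) < qj) & \<bar>Re (qz x$i1)\<bar> < qj & \<bar>Re (qz x$i2)\<bar> < qj"
 and MU: "M Int U = {x:U. Im (qz x$i1) = wx (qz x) (Re (qz x$i1), Re (qz x$i2)) & Im (qz x$i2) = 0}"
 using nc unfolding in_normal_coordinates_def by (elim exE conjE)
 define pt where "pt = (%z wq s. cpl (\<chi> i. if i = i1 then of_real (fst s) else if i = i2 then of_real (snd s) else z$i) (\<chi> i. if i:{i1,i2} then 0 else wq$i) :: complex^('n+'n))"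
 obtain F where F: "ALL Y:PD qj. cdiff F Y" "\<forall>z wq s. (ALL i:- {i1, i2}. norm (z$i) < qj & norm (wq$i) < qj) & \<bar>fst s\<bar> < qj & \<bar>snd s\<bar> < qj --> wj z wq s = F (pt z wq s)"
 using series_complexification[OF i r ser] unfolding pt_def by (elim exE conjE)
 define p where "p w = pt w (cnj_vec w) (Re (w$i1), Re (w$i2))" for w
 define D where "D = {w :: complex^'n. (ALL i:- {i1, i2}. norm (w$i) < qj) & \<bar>Re (w$i1)\<bar> < qj & \<bar>Re (w$i2)\<bar> < qj}"
 have oD: "open D"
 proof -
 have "D = (\<Inter>i\<in>- {i1, i2}. {w. norm (w$i) < qj}) Int ({w. \<bar>Re (w$i1)\<bar> < qj} Int {w. \<bar>Re (w$i2)\<bar> < qj})" by (auto simp: D_def)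
 also have "open \<dots>" by (intro open_Int open_INT ballI open_Collect_less continuous_intros) auto
 finally show ?thesis .
 qed
 have pn: "p w$Inl j = (if j = i1 | j = i2 then of_real (Re (w$j)) else w$j)" "p w$Inr j = (if j = i1 | j = i2 then 0 else cnj (w$j))" for w j
 using i by (auto simp: p_def pt_def)
 have pPD: "p w:PD qj" if "w:D" for w unfolding PD_def mem_Collect_eq
 proof
 fix j show "norm (p w$j) < qj" using that r by (cases j) (auto simp: pn D_def)
 qed
 have Fphi: "F (p w) = of_real (wx w (Re (w$i1), Re (w$i2)))" if "w:D" for w
 using F(2)[rule_format, of w "cnj_vec w" "(Re (w$i1), Re (w$i2))"] nm[rule_format, of w "(Re (w$i1), Re (w$i2))"] that by (simp add: p_def D_def)
 have D0: "0:D" using r by (simp add: D_def)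
 have F0: "F (p 0) = 0"
 proof -
 have "(0, 0) = (Re ((0::complex^'n)$i1), Re ((0::complex^'n)$i2))" "cnj_vec 0 = (0::complex^'n)" by simp_all
 thus ?thesis using F(2)[rule_format, of 0 0 "(0,0)"] nm[rule_format, of 0 "(0,0)"] r by (simp add: p_def)
 qed
 have cF: "cpx (%w. F (p w)) w" if "w:D" for w
 proof (rule cpx_compose[where f=p])
 have h: "cpx (%y. complex_of_real (Re (y$j))) w" for j
 proof -
 have e: "complex_of_real (Re z) = (z+cnj z) * (1/2)" for z by (simp add: ceq)
 show ?thesis unfolding e by (rule cpx_mult[OF cpx_add[OF cpx_nth cpx_cnj[OF cpx_nth]] cpx_const])
 qed
 show "cpx (%x. p x$j) w" for j
 proof (cases j)
 case (Inl k) thus ?thesis by (cases "k = i1 | k = i2") (auto simp: pn h)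
 next
 case (Inr k) thus ?thesis by (cases "k = i1 | k = i2") (auto simp: pn cpx_cnj)
 qed
 show "cpx F (p w)" by (rule cpx_hol[OF evm[OF evo[OF open_PD pPD[OF that]]]]) (use F(1) in blast)
 qed
 \<comment> \<open>A shear along the imaginary direction of the coordinate \<open>i1\<close>.
   \<open>F (p w)\<close> is real and sees w_i1 only through its real part, so it is unchanged by
   the shear, and \<open>sh (- s)\<close> inverts \<open>sh s\<close> for real s.\<close>
 define sh where "sh s w = (\<chi> j. if j = i1 then w$j+s * \<i> * F (p w) else w$j)" for s :: complex and w :: "complex^'n"
 have shn: "sh s w$j = (if j = i1 then w$j+s * \<i> * F (p w) else w$j)" for s w j by (simp add: sh_def)
 have psh: "p (sh s w) = p w" "sh s w:D" if w: "w:D" and s: "Im s = 0" for s w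
 proof -
 have "Re (sh s w$j) = Re (w$j)" for j using Fphi[OF w] s by (simp add: shn)
 moreover have "sh s w$j = w$j" if "j ~= i1" for j using that by (simp add: shn)
 ultimately show "p (sh s w) = p w" "sh s w:D" using w by (auto simp: veq2 pn D_def)
 qed
 have shsh: "sh (- s) (sh s w) = w" if w: "w:D" and s: "Im s = 0" for s w
 proof -
 have "F (p (sh s w)) = F (p w)" using psh(1)[OF w s] by simp
 thus ?thesis by (simp add: veq shn)
 qed
 have shc: "cpx (%w. sh s w$j) w" if "w:D" for s w j
 by (cases "j = i1") (auto simp: shn intro!: cpx_add cpx_mult cF that)
 have o: "open U" "open V" and bij: "bij_betw qz U V" and hP: "holomorphic_map_on qz U" and hG: "holomorphic_map_on (inv_into U qz) V"
 using bh by (auto simp: biholomorphic_def)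
 define jq where "jq = inv_into U qz"
 have vP: "vdiff qz x" if "x:U" for x using hP that unfolding holomorphic_map_on_def vdiff_alt by blast
 have vG: "vdiff jq y" if "y:V" for y using hG that unfolding holomorphic_map_on_def vdiff_alt jq_def by blast
 have PG: "qz (jq y) = y" "jq y:U" if "y:V" for y using bij that by (auto simp: bij_betw_def jq_def f_inv_into_f inv_into_into)
 have GP: "jq (qz x) = x" if "x:U" for x using bij that by (simp add: bij_betw_def jq_def)
 have PD': "qz x:D" if "x:U" for x using UD that by (auto simp: D_def)
 have PV: "qz x:V" if "x:U" for x using bij that by (auto simp: bij_betw_def)
 define ch where "ch x = sh (-1) (qz x)" for x
 define g where "g y = jq (sh 1 y)" for y
 have chic: "cpx (%x. ch x$j) x" if x: "x:U" for x j unfolding ch_def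
 proof (rule cpx_compose[where f=qz])
 show "cpx (%x. qz x$k) x" for k
 by (rule cpx_hol[OF evm[OF evo[OF o(1) x]]]) (rule vdiff_nth[OF vP])
 show "cpx (%w. sh (-1) w$j) (qz x)" by (rule shc[OF PD'[OF x]])
 qed
 have sc: "isCont (%w. sh 1 w) 0"
 proof -
 have "((%w. sh 1 w$j) HD dd (%w. sh 1 w$j) 0) (at 0)" for j
 using cpx_differentiable(1)[OF shc[OF D0]] by (simp add: fdw)
 hence "(sh 1 HD (%v. \<chi> j. dd (%w. sh 1 w$j) 0 v)) (at 0)" unfolding has_derivative_vec_iff by simp
 thus ?thesis using has_derivative_continuous by blast
 qed
 have s0: "sh s 0 = 0" for s by (simp add: veq shn F0)
 have V0: "0:V" using PV[OF U] Psi0 by simp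
 have "NEAR y. y:D & sh 1 y:V"
 by (intro eventually_conj evo[OF oD D0] ev_nhds_compose[OF sc s0 evo[OF o(2) V0]])
 then obtain qv where e: "qv > 0" "!!y. dist y 0 < qv ==> y:D & sh 1 y:V" unfolding eventually_nhds_metric by blast
 define U' where "U' = U Int ch -` ball 0 qv"
 have "con U ch"
 proof -
 have "Ck_on 0 ch U" by (rule Ck_on_vec[OF o(1) cpx_Ck_on[OF chic]])
 thus ?thesis by simp
 qed
 hence oU': "open U'" unfolding U'_def by (rule continuous_open_preimage[OF _ o(1)]) auto
 have chi0: "ch 0 = 0" by (simp add: ch_def Psi0 s0)
 have chin: "ch x$j = (if j = i1 then qz x$j - \<i> * F (p (qz x)) else qz x$j)" for x j by (simp add: ch_def shn)
 have chig: "ch (g y) = y" "g y:U" if "norm y < qv" for y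
 proof -
 have y: "y:D" "sh 1 y:V" using e(2)[of y] that by auto
 show "g y:U" using PG(2)[OF y(2)] by (simp add: g_def)
 show "ch (g y) = y" using PG(1)[OF y(2)] shsh[OF y(1), of 1] by (simp add: ch_def g_def)
 qed
 have "straight M i1 i2 U' ch g qv"
 proof
 show "0:U'" using U chi0 e(1) by (simp add: U'_def)
 show "norm (ch x) < qv" if "x:U'" for x using that by (simp add: U'_def)
 show "g (ch x) = x" if "x:U'" for x
 proof -
 have x: "x:U" using that by (simp add: U'_def)
 show ?thesis using shsh[OF PD'[OF x], of "-1"] GP[OF x] by (simp add: g_def ch_def)
 qed
 show "cpx (%x. ch x$j) x" if "x:U'" for x j using chic that by (simp add: U'_def)
 show "cdiff (%x. ch x$i2) x" if "x:U'" for x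
 using vdiff_nth[OF vP, of x i2] that i by (simp add: chin U'_def)
 show "x:M <-> Im (ch x$i1) = 0 & Im (ch x$i2) = 0" if "x:U'" for x
 proof -
 have x: "x:U" using that by (simp add: U'_def)
 have "x:M <-> x:M Int U" using x by simp
 thus ?thesis unfolding MU using x i Fphi[OF PD'[OF x]] by (simp add: chin)
 qed
 show "g y:U'" if "norm y < qv" for y using chig[OF that] that by (simp add: U'_def)
 show "ch (g y) = y" if "norm y < qv" for y by (rule chig(1)[OF that])
 show "cpx (%y. g y$j) y" if "norm y < qv" for y j unfolding g_def
 proof (rule cpx_compose[where f="sh 1"])
 have y: "y:D" "sh 1 y:V" using e(2)[of y] that by auto
 show "cpx (%x. sh 1 x$k) y" for k by (rule shc[OF y(1)])
 show "cpx (%w. jq w$j) (sh 1 y)"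
 by (rule cpx_hol[OF evm[OF evo[OF o(2) y(2)]]]) (rule vdiff_nth[OF vG])
 qed
 qed (fact i e(1) oU' chi0)+
 thus ?thesis by blast
qed

section \<open>Explicit hypersurfaces and leaves\<close>

lemma cpx_of_class:
 fixes f :: "complex^'n::finite => complex^'k::finite"
 assumes "open S" "!!x i. x:S ==> cpx (%x. f x$i) x" "r = C_infinity | r = C_omega" shows "of_class r f S"
 using assms(3) cpx_real_analytic[of S f, OF assms(2)] Ck_on_vec[OF assms(1) cpx_Ck_on[OF assms(2)]] by auto

lemma cpx_diffeo:
 fixes f g :: "complex^'n::finite => complex^'n"
 assumes o: "open U" "open V" and f: "!!x. x:U ==> f x:V" and g: "!!y. y:V ==> g y:U"
 and gf: "!!x. x:U ==> g (f x) = x" and fg: "!!y. y:V ==> f (g y) = y"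
 and cf: "!!x i. x:U ==> cpx (%x. f x$i) x" and cg: "!!y i. y:V ==> cpx (%y. g y$i) y"
 and r: "r = C_infinity | r = C_omega"
 shows "diffeo r U V f"
proof -
 have bij: "bij_betw f U V" by (rule bij_betw_byWitness[where f'=g]) (use f g gf fg in auto)
 have inv: "inv_into U f y = g y" if "y:V" for y
 by (rule inv_into_f_eq[OF bij_betw_imp_inj_on[OF bij] g[OF that] fg[OF that]])
 have "cpx (%y. inv_into U f y$i) y" if "y:V" for y i
 by (rule cpx_cong[OF cg[OF that] evm[OF evo[OF o(2) that]]]) (simp add: inv)
 thus ?thesis unfolding diffeo_def by (intro conjI o bij cpx_of_class cf r)
qed

lemma cpx_norm2: "cpx (%y::complex^'n::finite. of_real ((norm y)\<^sup>2)) p"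
proof -
 have e: "complex_of_real ((norm y)\<^sup>2) = (SUM i:UNIV. y$i * cnj (y$i))" for y :: "complex^'n"
 by (simp add: power2_norm_eq_inner inner_vec_def) (rule sum.cong, simp_all add: ceq inner_complex_def)
 have "cpx (%y::complex^'n. SUM i:I. y$i * cnj (y$i)) p" if "finite I" for I
 using that
 proof (induction I)
 case empty show ?case by simp
 next
 case (insert i I)
 have "cpx (%y::complex^'n. y$i * cnj (y$i)+(SUM i:I. y$i * cnj (y$i))) p"
 by (rule cpx_add[OF cpx_mult[OF cpx_nth cpx_cnj[OF cpx_nth]] insert(3)])
 thus ?case using insert by simp
 qed
 thus ?thesis unfolding e by simp
qed

lemma cpx_inverse_sqrt:
 fixes u :: "complex^'n::finite => real"
 assumes c: "cpx (%y. of_real (u y)) p" and p: "u p > 0"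
 shows "cpx (%y. of_real (inverse (sqrt (u y)))) p"
proof -
 \<comment> \<open>A function of one variable, placed on an arbitrary coordinate of a vector with
   all entries equal, so that \<open>cpx_compose\<close> applies to it.\<close>
 define G :: "complex^'n => complex" where "G v = inverse (csqrt (v$undefined))" for v
 define f :: "complex^'n => complex^'n" where "f y = (\<chi> j. of_real (u y))" for y
 have oH: "open {v :: complex^'n. Re (v$undefined) > 0}" by (intro open_Collect_less continuous_intros)
 have Gd: "cdiff G v" if "Re (v$undefined) > 0" for v unfolding G_def
 proof (rule cdiff_inverse[OF cdiff_field_compose[OF cdiff_nth field_differentiable_at_csqrt]])
 show "v$undefined ~: \<real>\<^sub>\<le>\<^sub>0" using that by (auto simp: complex_nonpos_Reals_iff)
 show "csqrt (v$undefined) ~= 0" using that by auto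
 qed
 have "cpx (%y. G (f y)) p"
 proof (rule cpx_compose)
 show "cpx (%x. f x$i) p" for i using c by (simp add: f_def)
 have fp: "f p:{v. Re (v$undefined) > 0}" using p by (simp add: f_def)
 show "cpx G (f p)" by (rule cpx_hol[OF evm[OF evo[OF oH fp]]]) (simp add: Gd)
 qed
 moreover have "\<forall>\<^sub>F y in nhds p. G (f y) = of_real (inverse (sqrt (u y)))"
 proof -
 have "isCont (%y. complex_of_real (u y)) p" by (rule cpx_isCont[OF c])
 hence "isCont (%y. Re (complex_of_real (u y))) p" by (rule isCont_Re)
 hence "isCont u p" by simp
 hence "\<forall>\<^sub>F y in nhds p. u y:{0<..}"
 by (rule ev_nhds_compose[OF _ refl evo[OF open_greaterThan]]) (simp add: p)
 thus ?thesis by eventually_elim (simp add: G_def f_def of_real_sqrt[symmetric] of_real_inverse[symmetric] del: of_real_inverse)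
 qed
 ultimately show ?thesis by (rule cpx_cong)
qed

text \<open>Boundary charts must map onto the whole space, while \<open>ch\<close> maps onto a ball.
  The radial map y / sqrt(qv^2 - |y|^2) bridges the two; its factor is positive, so zeros and signs
  of real coordinates are preserved.\<close>

lemma ball_UNIV_chart:
 assumes eps: "(qv::real) > 0"
 shows "\<exists>wz jw :: complex^'n::finite => complex^'n. (ALL y. norm y < qv --> jw (wz y) = y & (ALL i. cpx (%y. wz y$i) y)) &
 (ALL z. norm (jw z) < qv & wz (jw z) = z & (ALL i. cpx (%z. jw z$i) z) & (\<exists>t>0. jw z = t *R z))"
proof -
 let ?p = "%y::complex^'n. inverse (sqrt (qv\<^sup>2 - (norm y)\<^sup>2)) *R y"
 let ?k = "%z::complex^'n. (qv * inverse (sqrt (1+(norm z)\<^sup>2))) *R z"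
 have sc: "(s *R y)$i = of_real s * y$i" for s and y :: "complex^'n" and i
 unfolding vector_scaleR_component by (rule scaleR_conv_of_real)
 have q: "1+(norm z)\<^sup>2 > 0" for z :: "complex^'n" by (simp add: add_pos_nonneg)
 have h1: "?k (?p y) = y" if y: "norm y < qv" for y
 proof -
 define u where "u = qv\<^sup>2 - (norm y)\<^sup>2"
 have u: "u > 0" using y power_strict_mono[of "norm y" qv 2] by (simp add: u_def)
 have "1+(norm (?p y))\<^sup>2 = qv\<^sup>2 / u"
 using u by (simp add: u_def[symmetric] power_mult_distrib power_inverse) (simp add: u_def field_simps)
 hence "sqrt (1+(norm (?p y))\<^sup>2) = qv / sqrt u" using eps by (simp add: real_sqrt_divide)
 thus ?thesis using eps u by (simp add: u_def[symmetric])
 qed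
 have h2: "cpx (%y. ?p y$i) y" if y: "norm y < qv" for y i unfolding sc
 proof (rule cpx_mult[OF cpx_inverse_sqrt cpx_nth])
 show "qv\<^sup>2 - (norm y)\<^sup>2 > 0" using y power_strict_mono[of "norm y" qv 2] by simp
 show "cpx (%y. complex_of_real (qv\<^sup>2 - (norm y)\<^sup>2)) y" unfolding of_real_diff by (rule cpx_diff[OF cpx_const cpx_norm2])
 qed
 have h3: "norm (?k z) < qv" for z
 proof -
 have "norm z < sqrt (1+(norm z)\<^sup>2)" by (rule real_less_rsqrt) simp
 thus ?thesis using eps q[of z] by (simp add: field_simps)
 qed
 have h4: "?p (?k z) = z" for z
 proof -
 define u where "u = 1+(norm z)\<^sup>2"
 have u: "u > 0" using q by (simp add: u_def)
 have "qv\<^sup>2 - (norm (?k z))\<^sup>2 = qv\<^sup>2 / u"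
 using u by (simp add: u_def[symmetric] power_mult_distrib power_inverse) (simp add: u_def field_simps)
 hence "sqrt (qv\<^sup>2 - (norm (?k z))\<^sup>2) = qv / sqrt u" using eps by (simp add: real_sqrt_divide)
 thus ?thesis using eps u by (simp add: u_def[symmetric])
 qed
 have h5: "cpx (%z. ?k z$i) z" for z i unfolding sc of_real_mult
 proof (rule cpx_mult[OF cpx_mult[OF cpx_const cpx_inverse_sqrt] cpx_nth])
 show "1+(norm z)\<^sup>2 > 0" by (rule q)
 show "cpx (%y. complex_of_real (1+(norm y)\<^sup>2)) z" unfolding of_real_add by (rule cpx_add[OF cpx_const cpx_norm2])
 qed
 have h6: "\<exists>t>0. ?k z = t *R z" for z using eps q[of z] by (intro exI[of _ "qv * inverse (sqrt (1+(norm z)\<^sup>2))"]) simp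
 show ?thesis
 by (rule exI[of _ ?p], rule exI[of _ ?k], intro conjI allI impI) (erule h1 h2 | rule h3 h4 h5 h6)+
qed

lemma tangent_space_mono_local:
 assumes V: "open V" "q:V" and AB: "A Int V <= B" shows "tsp A q <= tsp B q"
proof
 fix v assume "v:tsp A q"
 then obtain g e where g: "e > 0" "g 0 = q" "!!t::real. \<bar>t\<bar> < e ==> g t:A" "(g has_vector_derivative v) (at 0)"
 unfolding tangent_space_def by blast
 have "isCont g 0" using g(4) has_derivative_continuous has_vector_derivative_def by blast
 from ev_nhds_compose[OF this g(2) evo[OF V]]
 obtain e' where e': "e' > 0" "!!t. dist t 0 < e' ==> g t:V" unfolding eventually_nhds_metric by blast
 have "g t:B" if "\<bar>t\<bar> < min e e'" for t using g(3)[of t] e'(2)[of t] that AB by auto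
 thus "v:tsp B q" unfolding tangent_space_def
 using g(1,2,4) e'(1) by (intro CollectI exI[of _ g] exI[of _ "min e e'"]) simp
qed

lemma slice_chart_restrict:
 fixes f :: "complex^'n::finite => complex^'n"
 assumes s: "slice_chart C_infinity M B V f" and V': "open V'" "V' <= V"
 shows "slice_chart C_infinity M B V' f"
proof -
 note S = slice_chartD[OF s]
 have oc: "of_class C_infinity f V" "of_class C_infinity (inv_into V f) (f ` V)" using S(1) by (auto simp: diffeo_def)
 have inj: "inj_on f V'" using inj_on_inverseI[of V "inv_into V f" f] S(4) V'(2) inj_on_subset by blast
 have "con (f ` V) (inv_into V f)" using of_class_Ck[OF S(8) oc(2), of 0] by simp
 from continuous_open_preimage[OF this S(8) V'(1)] have "open (f ` V Int inv_into V f -` V')" .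
 moreover have fV: "f ` V Int inv_into V f -` V' = f ` V'" using S(4) S(5) V'(2) by (auto simp: image_iff)
 ultimately have o: "open (f ` V')" by simp
 have inv: "inv_into V f y = inv_into V' f y" if yV: "y:f ` V'" for y
 proof -
 obtain x where x: "y = f x" "x:V'" using yV by (rule imageE)
 thus ?thesis using S(4)[of x] V'(2) inj by auto
 qed
 have i1: "Ck_on k (inv_into V' f) (f ` V')" for k
 by (rule Ck_on_cong[OF o Ck_on_mono[of k _ "f ` V"] inv]) (use oc(2) V'(2) in auto)
 have "f ` (M Int V') = {y:f ` V'. ALL b:B. y ~~ b = 0}"
 using S(3) V'(2) by (auto simp: image_iff)
 moreover have "bij_betw f V' (f ` V')" using inj by (simp add: bij_betw_def)
 moreover have "Ck_on k f V'" for k by (rule Ck_on_mono[of k f V]) (use oc(1) V'(2) in auto)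
 ultimately show ?thesis unfolding slice_chart_def diffeo_def using V'(1) o i1 S(2) by simp
qed

lemma submanifold_tangent:
 fixes S :: "(complex^'n::finite) set"
 assumes "submanifold r d S" "r = C_infinity | r = C_omega" "q:S"
 shows "subspace (tsp S q)" "dim (tsp S q) = DIM(complex^'n) - d" "d <= DIM(complex^'n)"
proof -
 obtain V f B where V: "q:V" "card B = d" and s: "slice_chart r S B V f" using assms(1,3) unfolding submanifold_def by blast
 note C = slice_chartD[OF s]
 obtain A D where AD: "(f HD A) (at q)" "(inv_into V f HD D) (at (f q))" "ALL w. A (D w) = w" "ALL v. D (A v) = v" "blin A" "blin D"
 by (rule diffeo_deriv[OF C(1) assms(2) V(1)])
 have T: "tsp S q = {v. ALL b:B. A v ~~ b = 0}" by (rule slice_chart_tangent[OF s assms(2,3) V(1) AD(1)])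
 note lin = bllin[OF AD(5)]
 show "subspace (tsp S q)" unfolding T subspace_def
 by (auto simp: linear_0[OF lin] linear_add[OF lin] linear_cmul[OF lin] inner_add_left)
 show "dim (tsp S q) = DIM(complex^'n) - d" unfolding T V(2)[symmetric]
 by (rule dim_coordinate_kernel[OF lin bllin[OF AD(6)] AD(3)[rule_format] AD(4)[rule_format] C(2)])
 show "d <= DIM(complex^'n)" unfolding V(2)[symmetric] by (rule card_mono[OF finite_Basis C(2)])
qed

text \<open>T and J T both have codimension 2 and together span everything, so their intersection
  has codimension 4.\<close>

lemma complex_tangent_dim:
 fixes M :: "(complex^'n::finite) set"
 assumes sub: "submanifold C_omega 2 M" and gen: "generic M" and q: "q:M"
 shows "subspace (cts M q)" "dim (cts M q)+4 = DIM(complex^'n)"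
proof -
 let ?T = "tsp M q"
 have rg: "C_omega = C_infinity | C_omega = C_omega" by simp
 note t = submanifold_tangent[OF sub rg q]
 have lJ: "linear (J :: complex^'n => _)" by (rule linearI) (simp_all add: J_def veq algebra_simps)
 have injJ: "inj (J :: complex^'n => _)" by (rule injI) (simp add: J_def veq)
 have dJ: "dim (J ` ?T) = dim ?T" by (rule dim_image_eq[OF lJ inj_on_subset[OF injJ subset_UNIV]])
 have sJ: "subspace (J ` ?T)" by (rule linear_subspace_image[OF lJ t(1)])
 show "subspace (cts M q)" unfolding cts_def by (rule subspace_inter[OF sJ t(1)])
 have U: "{u+v |u v. u:J ` ?T & v:?T} = UNIV"
 proof (intro set_eqI iffI UNIV_I)
 fix w :: "complex^'n"
 have "w:{u+v |u v. u:?T & v:J ` ?T}" using gen q unfolding generic_def by blast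
 then obtain u v where uv: "w = u+v" "u:?T" "v:J ` ?T" by blast
 have "w = v+u" using uv(1) by (simp add: add.commute)
 thus "w:{u+v |u v. u:J ` ?T & v:?T}" using uv(2,3) by blast
 qed
 have h: "DIM(complex^'n)+dim (J ` ?T Int ?T) = (DIM(complex^'n) - 2)+(DIM(complex^'n) - 2)"
 using dim_sums_Int[OF sJ t(1)] unfolding U dJ t(2) dim_UNIV .
 show "dim (cts M q)+4 = DIM(complex^'n)"
 unfolding cts_def using h t(3) by arith
qed

context straight
begin

definition b1 :: "complex^'n" where "b1 = axis i1 \<i>"
definition b2 :: "complex^'n" where "b2 = axis i2 \<i>"
definition b3 :: "complex^'n" where "b3 = axis i2 1"

lemma bB: "b1:Basis" "b2:Basis" "b3:Basis" "b1 ~= b2" "b1 ~= b3" "b2 ~= b3"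
 using i12 by (auto simp: b1_def b2_def b3_def Basis_complex_def axis_eq_axis ceq)

lemma inner_b: "y ~~ b1 = Im (y$i1)" "y ~~ b2 = Im (y$i2)" "y ~~ b3 = Re (y$i2)"
 by (simp_all add: b1_def b2_def b3_def inner_axis inner_complex_def)

lemma chart:
 assumes r: "r = C_infinity | r = C_omega" and W: "open W" "W <= U" and B: "B <= Basis" and A: "!!x. x:W ==> x:A <-> (ALL b:B. ch x ~~ b = 0)"
 shows "slice_chart r A B W ch"
proof -
 have e: "ch ` W = ball 0 qv Int g -` W"
 proof (intro set_eqI iffI)
 fix y assume "y:ch ` W" thus "y:ball 0 qv Int g -` W" using chiB gchi W(2) by auto
 next
 fix y assume "y:ball 0 qv Int g -` W" thus "y:ch ` W" using chig[of y] by (auto intro!: image_eqI[of y ch "g y"])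
 qed
 have "Ck_on 0 g (ball 0 qv)" by (rule Ck_on_vec[OF open_ball cpx_Ck_on[OF gc]]) simp
 hence "con (ball 0 qv) g" by simp
 from continuous_open_preimage[OF this open_ball W(1)] have o: "open (ch ` W)" unfolding e .
 have "diffeo r W (ch ` W) ch"
 by (rule cpx_diffeo[where g=g, OF W(1) o]) (use W(2) gchi chig gc chic r e in auto)
 moreover have "ch ` (A Int W) = {y:ch ` W. ALL b:B. y ~~ b = 0}" using A by auto
 ultimately show ?thesis using B by (simp add: slice_chart_def)
qed

lemma ch_deriv: assumes "x:U" shows "(ch HD (%v. \<chi> i. dd (%x. ch x$i) x v)) (at x)"
 unfolding has_derivative_vec_iff
 using cpx_differentiable(1)[OF chic[OF assms]] by (simp add: fdw)

abbreviation tau :: "complex^'n => complex" where "tau x \<equiv> ch x$i2"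

lemma tangent_H:
 assumes W: "open W" "W <= U" and A: "!!x. x:W ==> x:A <-> Im (tau x) = 0" and q: "q:A" "q:W"
 shows "tsp A q = {v. Im (dd tau q v) = 0}"
proof -
 have r: "C_omega = C_infinity | C_omega = C_omega" by simp
 have s: "slice_chart C_omega A {b2} W ch" by (rule chart[OF r W]) (use bB A in "auto simp: inner_b")
 have "q:U" using q W by auto
 from slice_chart_tangent[OF s r q ch_deriv[OF this]] show ?thesis by (simp add: inner_b)
qed

theorem straight_ii: "EX U H. open U & 0:U & H <= U & hypersurface C_omega H & Levi_flat H & M Int U <= H"
proof -
 define H where "H = {x:U. Im (tau x) = 0}"
 have r: "C_omega = C_infinity | C_omega = C_omega" by simp
 have "slice_chart C_omega H {b2} U ch" by (rule chart[OF r oU order.refl]) (use bB in "auto simp: inner_b H_def")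
 hence 1: "hypersurface C_omega H" unfolding hypersurface_def submanifold_def
 by (intro ballI exI[of _ U] exI[of _ ch] exI[of _ "{b2}"]) (auto simp: H_def)
 have T: "tsp H q = {v. Im (dd tau q v) = 0}" if "q:H" for q
 by (rule tangent_H[OF oU order.refl]) (use that in "auto simp: H_def")
 have 2: "Levi_flat H" by (rule levi_flat_holomorphic[OF oU _ chih T]) (auto simp: H_def)
 have "M Int U <= H" using chiM by (auto simp: H_def)
 thus ?thesis using oU U0 1 2 by (intro exI[of _ U] exI[of _ H]) (auto simp: H_def)
qed

text \<open>H is the half with nonnegative \<open>Im (ch x$i1)\<close> of the Levi-flat hypersurface
  on which Im tau vanishes, and its boundary is M inside U.\<close>

theorem straight_i: "EX H bd. hypersurface_with_boundary C_infinity H bd & Levi_flat (H - bd) & 0:bd & bd <= M"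
proof -
 define H where "H = {x:U. Im (ch x$i1) >= 0 & Im (tau x) = 0}"
 define bd where "bd = {x:U. Im (ch x$i1) = 0 & Im (tau x) = 0}"
 have r: "C_infinity = C_infinity | C_infinity = C_omega" by simp
 define W where "W = U Int (%x. Im (ch x$i1)) -` {0<..}"
 have "con U ch" using Ck_on_vec[OF oU cpx_Ck_on[OF chic], of 0] by simp
 hence oW: "open W" unfolding W_def by (intro continuous_open_preimage oU continuous_intros) auto
 have HW: "H - bd = {x:W. Im (tau x) = 0}" by (auto simp: H_def bd_def W_def)
 have WU: "W <= U" by (auto simp: W_def)
 have "slice_chart C_infinity (H - bd) {b2} W ch" by (rule chart[OF r oW WU]) (use bB in "auto simp: inner_b HW")
 hence 1: "hypersurface C_infinity (H - bd)" unfolding hypersurface_def submanifold_def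
 by (intro ballI exI[of _ W] exI[of _ ch] exI[of _ "{b2}"]) (auto simp: HW)
 have T: "tsp (H - bd) q = {v. Im (dd tau q v) = 0}" if "q:H - bd" for q
 by (rule tangent_H[OF oW WU]) (use that in "auto simp: HW")
 have 2: "Levi_flat (H - bd)" by (rule levi_flat_holomorphic[OF oU _ chih T]) (auto simp: H_def)
 obtain wz jw :: "complex^'n => complex^'n" where P: "ALL y. norm y < qv --> jw (wz y) = y & (ALL i. cpx (%y. wz y$i) y)"
 and K: "ALL z. norm (jw z) < qv & wz (jw z) = z & (ALL i. cpx (%z. jw z$i) z) & (\<exists>t>0. jw z = t *R z)"
 using ball_UNIV_chart[OF eps] by (elim exE conjE)
 define F where "F x = wz (ch x)" for x
 define G where "G z = g (jw z)" for z
 have df: "diffeo C_infinity U UNIV F"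
 proof (rule cpx_diffeo[where g=G, OF oU open_UNIV _ _ _ _ _ _ r])
 show "G y:U" for y using K gU by (simp add: G_def)
 show "x:U ==> G (F x) = x" for x using P chiB gchi by (simp add: F_def G_def)
 show "F (G y) = y" for y using K chig by (simp add: F_def G_def)
 show "x:U ==> cpx (%x. F x$i) x" for x i unfolding F_def
 by (rule cpx_compose[where f=ch, OF chic]) (use P chiB in auto)
 show "cpx (%y. G y$i) y" for y i unfolding G_def
 by (rule cpx_compose[where f=jw]) (use K gc in auto)
 qed auto
 have sg: "\<exists>t>0. ch x = t *R F x" if "x:U" for x
 using K[rule_format, of "F x"] P[rule_format, of "ch x"] chiB[OF that] by (auto simp: F_def)
 have sg': "(0 <= F x ~~ b1 <-> 0 <= Im (ch x$i1)) & (F x ~~ b1 = 0 <-> Im (ch x$i1) = 0) & (F x ~~ b2 = 0 <-> Im (tau x) = 0)" if x: "x:U" for x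
 proof -
 obtain t where t: "t > 0" "ch x = t *R F x" using sg[OF x] by blast
 have "ch x ~~ b1 = t * (F x ~~ b1)" "ch x ~~ b2 = t * (F x ~~ b2)" unfolding t(2) by simp_all
 thus ?thesis using t(1) by (simp add: inner_b[symmetric] zero_le_mult_iff)
 qed
 have surj: "EX x:U. F x = z" for z
 proof (rule bexI[of _ "G z"])
 show "F (G z) = z" "G z:U" using K chig gU by (simp_all add: F_def G_def)
 qed
 have i1: "F ` (H Int U) = {x. x ~~ b1 >= 0 & x ~~ b2 = 0}"
 proof (intro set_eqI iffI)
 fix z assume "z:{x. x ~~ b1 >= 0 & x ~~ b2 = 0}"
 moreover obtain x where "x:U" "F x = z" using surj by blast
 ultimately show "z:F ` (H Int U)" using sg'[of x] by (auto simp: H_def intro!: image_eqI[of z F x])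
 qed (use sg' in "auto simp: H_def")
 have i2: "F ` (bd Int U) = {x. x ~~ b1 = 0 & x ~~ b2 = 0}"
 proof (intro set_eqI iffI)
 fix z assume "z:{x. x ~~ b1 = 0 & x ~~ b2 = 0}"
 moreover obtain x where "x:U" "F x = z" using surj by blast
 ultimately show "z:F ` (bd Int U)" using sg'[of x] by (auto simp: bd_def intro!: image_eqI[of z F x])
 qed (use sg' in "auto simp: bd_def")
 have "hypersurface_with_boundary C_infinity H bd" unfolding hypersurface_with_boundary_def
 proof (intro conjI 1 ballI)
 show "bd <= H" by (auto simp: bd_def H_def)
 fix p assume "p:bd"
 hence "p:U" by (simp add: bd_def)
 thus "EX U wx. EX b1:Basis. EX b2:Basis. b1 ~= b2 & p:U & diffeo C_infinity U (UNIV :: (complex^'n) set) wx &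
 wx ` (H Int U) = {x. x ~~ b1 >= 0 & x ~~ b2 = 0} & wx ` (bd Int U) = {x. x ~~ b1 = 0 & x ~~ b2 = 0}"
 using df i1 i2 bB by (intro exI[of _ U] exI[of _ F] bexI[of _ b1] bexI[of _ b2]) auto
 qed
 moreover have "0:bd" "bd <= M" using U0 chi0 chiM by (auto simp: bd_def)
 ultimately show ?thesis using 2 by blast
qed

definition leaf :: "real => (complex^'n) set" where "leaf t = {x:U. Im (ch x$i1) = 0 & Im (tau x) = 0 & Re (tau x) = t}"

text \<open>Slice charts describe a set by vanishing coordinates, so the level t of Re tau is
  translated to 0.\<close>

lemma leaf_chart: "slice_chart r (leaf t) {b1,b2,b3} U (%x. ch x - of_real t *s b3)" if r: "r = C_infinity | r = C_omega"
proof -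
 define c where "c = of_real t *s b3"
 have b: "Im (c$i1) = 0" "Im (c$i2) = 0" "Re (c$i2) = t" using i12 by (simp_all add: c_def b3_def axis_def)
 let ?f = "%x. ch x - c"
 have o: "open ((%y. y - c) ` ball 0 qv)" using open_translation_subtract[OF open_ball] .
 have e: "?f ` U = (%y. y - c) ` ball 0 qv"
 proof (intro set_eqI iffI)
 fix y assume "y:?f ` U" thus "y:(%y. y - c) ` ball 0 qv" using chiB by auto
 next
 fix y assume "y:(%y. y - c) ` ball 0 qv"
 then obtain z where z: "norm z < qv" "y = z - c" by auto
 thus "y:?f ` U" using chig[OF z(1)] gU[OF z(1)] by (intro image_eqI[of y _ "g z"]) auto
 qed
 have "diffeo r U (?f ` U) ?f" unfolding e
 proof (rule cpx_diffeo[where g="%y. g (y+c)", OF oU o _ _ _ _ _ _ r])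
 show "x:U ==> cpx (%x. (ch x - c)$i) x" for x i using cpx_diff[OF chic cpx_const] by simp
 show "cpx (%y. g (y+c)$i) y" if "y:(%y. y - c) ` ball 0 qv" for y i
 by (rule cpx_compose[where f="%y. y+c"]) (use that gc in "auto intro: cpx_add")
 qed (use gchi chig gU chiB in auto)
 moreover have "?f ` (leaf t Int U) = {y:?f ` U. ALL b:{b1,b2,b3}. y ~~ b = 0}"
 by (auto simp: leaf_def inner_diff_left b inner_b intro!: imageI)
 ultimately show ?thesis using bB by (simp add: slice_chart_def c_def)
qed

lemma leaf_connected: "path_connected (leaf t)"
proof -
 define Z where "Z = {y :: complex^'n. norm y < qv & Im (y$i1) = 0 & Im (y$i2) = 0 & Re (y$i2) = t}"
 have e: "leaf t = g ` Z"
 proof (intro set_eqI iffI)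
 fix x assume "x:leaf t" thus "x:g ` Z" using gchi chiB by (intro image_eqI[of x g "ch x"]) (auto simp: leaf_def Z_def)
 next
 fix x assume "x:g ` Z" thus "x:leaf t" using chig gU by (auto simp: leaf_def Z_def)
 qed
 have "Z = ball 0 qv Int {y. y ~~ b1 = 0} Int {y. y ~~ b2 = 0} Int {y. y ~~ b3 = t}" by (auto simp: Z_def inner_b)
 moreover have "convex {y :: complex^'n. y ~~ b = s}" for b s using convex_hyperplane[of b s] by (simp add: inner_commute)
 ultimately have "convex Z" by (simp add: convex_Int convex_ball)
 hence "path_connected Z" by (rule convex_imp_path_connected)
 moreover have "con Z g"
 proof -
 have "Ck_on 0 g (ball 0 qv)" by (rule Ck_on_vec[OF open_ball cpx_Ck_on[OF gc]]) simp
 hence "con (ball 0 qv) g" by simp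
 thus ?thesis by (rule continuous_on_subset) (auto simp: Z_def)
 qed
 ultimately show ?thesis unfolding e by (rule path_connected_continuous_image[rotated])
qed

lemma leaf_ne: assumes "\<bar>t\<bar> < qv" shows "leaf t ~= {}"
proof -
 have n: "norm (of_real t *s b3) < qv" using assms by (simp add: norm_vector_scalar_mult b3_def)
 have "g (of_real t *s b3):leaf t" using chig[OF n] gU[OF n] i12 by (simp add: leaf_def b3_def axis_def)
 thus ?thesis by blast
qed

lemma straight_foliation: "foliation C_omega 1 (M Int U) (leaf ` {-qv<..<qv})"
 unfolding foliation_def
proof (intro conjI ballI)
 have MU: "x:M Int U <-> x:leaf (Re (tau x))" for x using chiM by (auto simp: leaf_def)
 show "partition_on (M Int U) (leaf ` {-qv<..<qv})"
 proof (unfold partition_on_def, intro conjI)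
 show "\<Union> (leaf ` {-qv<..<qv}) = M Int U"
 proof (intro set_eqI iffI)
 fix x assume x: "x:M Int U"
 hence "norm (ch x) < qv" using chiB by auto
 hence "\<bar>Re (tau x)\<bar> < qv" using abs_Re_le_cmod[of "tau x"] Finite_Cartesian_Product.norm_nth_le[of "ch x" i2] by linarith
 hence "Re (tau x):{-qv<..<qv}" by auto
 thus "x:\<Union> (leaf ` {-qv<..<qv})" using x MU by blast
 qed (use chiM in "auto simp: leaf_def")
 show "disjoint (leaf ` {-qv<..<qv})" unfolding disjoint_def by (auto simp: leaf_def)
 show "{} ~: leaf ` {-qv<..<qv}"
 proof
 assume "{}:leaf ` {-qv<..<qv}"
 then obtain t where "{} = leaf t" "t:{-qv<..<qv}" by (rule imageE)
 thus False using leaf_ne[of t] by (auto simp: abs_less_iff)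
 qed
 qed
 show "path_connected L" if "L:leaf ` {-qv<..<qv}" for L using that leaf_connected by auto
 fix p assume p: "p:M Int U"
 have r: "C_omega = C_infinity | C_omega = C_omega" by simp
 have s: "slice_chart C_omega (M Int U) {b1,b2} U ch" by (rule chart[OF r oU order.refl]) (use bB chiM in "auto simp: inner_b")
 have lf: "\<exists>c :: complex^'n => real. C = {x:(M Int U) Int U. ALL b:{b3}. ch x ~~ b = c b}"
 if L: "L:leaf ` {-qv<..<qv}" and C: "C:components (L Int U)" for L C
 proof -
 obtain t where t: "L = leaf t" "\<bar>t\<bar> < qv" using L by auto
 have LU: "L Int U = L" by (auto simp: t leaf_def)
 have "components L = {L}" using path_connected_imp_connected[OF leaf_connected] leaf_ne[OF t(2)] by (simp add: t components_eq_sing_iff)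
 hence "C = leaf t" using C LU t by simp
 thus ?thesis using chiM by (intro exI[of _ "%_. t"]) (auto simp: leaf_def inner_b)
 qed
 show "EX V wx B B'. p:V & slice_chart C_omega (M Int U) B V wx & B' <= Basis - B & card B' = 1 &
 (ALL L:leaf ` {-qv<..<qv}. ALL C:components (L Int V). \<exists>c :: complex^'n => real. C = {x:(M Int U) Int V. ALL b:B'. wx x ~~ b = c b})"
 using p s bB lf by (intro exI[of _ U] exI[of _ ch] exI[of _ "{b1,b2}"] exI[of _ "{b3}"]) auto
qed

end

section \<open>Leaves as unions of CR orbits\<close>

context straight
begin

lemma tangent_M:
 assumes q: "q:M" "q:U"
 shows "tsp M q = {v. Im (dd (%x. ch x$i1) q v) = 0 & Im (dd tau q v) = 0}"
proof -
 have r: "C_omega = C_infinity | C_omega = C_omega" by simp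
 have s: "slice_chart C_omega M {b1,b2} U ch" by (rule chart[OF r oU order.refl]) (use bB chiM in "auto simp: inner_b")
 from slice_chart_tangent[OF s r q ch_deriv[OF q(2)]] show ?thesis by (simp add: inner_b)
qed

lemma tangent_leaf:
 assumes q: "q:leaf t"
 shows "tsp (leaf t) q = {v. Im (dd (%x. ch x$i1) q v) = 0 & Im (dd tau q v) = 0 & Re (dd tau q v) = 0}"
proof -
 have r: "C_omega = C_infinity | C_omega = C_omega" by simp
 have qU: "q:U" using q by (simp add: leaf_def)
 have "((%x. ch x - of_real t *s b3) HD (%v. (\<chi> i. dd (%x. ch x$i) q v) - 0)) (at q)"
 by (rule has_derivative_diff[OF ch_deriv[OF qU] has_derivative_const])
 from slice_chart_tangent[OF leaf_chart[OF r] r q qU this] show ?thesis by (simp add: inner_b)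
qed

lemma leaf_M: "leaf t <= M Int U" using chiM by (auto simp: leaf_def)

lemma ctangent_kernel:
 assumes q: "q:M" "q:U" and v: "v:cts M q" shows "dd tau q v = 0"
proof -
 have "v:J ` tsp M q" "v:tsp M q" using v by (auto simp: cts_def)
 then obtain u where u: "v = J u" "u:tsp M q" "v:tsp M q" by blast
 hence "Im (dd tau q u) = 0" "Im (dd tau q v) = 0" using tangent_M[OF q] by auto
 thus ?thesis using cdiff_scale[OF chih[OF q(2)], of \<i> u] u(1) by (simp add: J_def ceq)
qed

text \<open>The derivative of tau is complex linear and real on tangent vectors of M, so it vanishes
  on a complex tangent vector and on its multiple by i; both are then tangent to the leaf.\<close>

lemma ctangent_leaf:
 assumes q: "q:leaf t" shows "cts (leaf t) q = cts M q"
proof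
 have qM: "q:M" "q:U" using q leaf_M by auto
 have "tsp (leaf t) q <= tsp M q" unfolding tangent_leaf[OF q] tangent_M[OF qM] by auto
 thus "cts (leaf t) q <= cts M q" unfolding cts_def by blast
 show "cts M q <= cts (leaf t) q"
 proof
 fix v assume v: "v:cts M q"
 have L: "w:tsp (leaf t) q" if "w:tsp M q" "dd tau q w = 0" for w
 using that unfolding tangent_leaf[OF q] tangent_M[OF qM] by auto
 have z: "dd tau q v = 0" by (rule ctangent_kernel[OF qM v])
 have "v:J ` tsp M q" "v:tsp M q" using v by (auto simp: cts_def)
 then obtain u where u: "v = J u" "u:tsp M q" "v:tsp M q" by blast
 have "\<i> * dd tau q u = 0" using cdiff_scale[OF chih[OF qM(2)], of \<i> u] z u(1) by (simp add: J_def)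
 hence "dd tau q u = 0" by simp
 thus "v:cts (leaf t) q" unfolding cts_def using u L z by blast
 qed
qed

context
 assumes sub: "submanifold C_omega 2 M" and gen: "generic M"
begin

lemma leaf_candidate: assumes p: "p:leaf t" shows "CR_orbit_candidate M p 3 (leaf t)"
 unfolding CR_orbit_candidate_def
proof (intro conjI ballI p)
 have r: "C_infinity = C_infinity | C_infinity = C_omega" by simp
 have "card {b1,b2,b3} = 3" using bB by auto
 moreover have "q:U" if "q:leaf t" for q using that by (simp add: leaf_def)
 ultimately show "submanifold C_infinity 3 (leaf t)" unfolding submanifold_def
 using leaf_chart[OF r, of t] by (intro ballI exI[of _ U] exI[of _ "%x. ch x - of_real t *s b3"] exI[of _ "{b1,b2,b3}"] conjI) auto
 have "dim (cts (leaf t) q) = DIM(complex^'n) - 4" if "q:leaf t" for q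
 proof -
 have "q:M" using that leaf_M by auto
 from complex_tangent_dim(2)[OF sub gen this] show ?thesis unfolding ctangent_leaf[OF that] by arith
 qed
 thus "CR (leaf t)" unfolding CR_def by blast
 show "leaf t <= M" using leaf_M by blast
 show "cts (leaf t) q = cts M q" if "q:leaf t" for q by (rule ctangent_leaf[OF that])
qed

text \<open>The tangent space of a candidate contains the complex tangent space of M, which has
  codimension 4.\<close>

lemma candidate_codim: assumes c: "CR_orbit_candidate M p d S" shows "d <= 4"
proof -
 have S: "submanifold C_infinity d S" "p:S" "S <= M" "cts S p = cts M p"
 using c by (auto simp: CR_orbit_candidate_def)
 have r: "C_infinity = C_infinity | C_infinity = C_omega" by simp
 note t = submanifold_tangent[OF S(1) r S(2)]
 have pM: "p:M" using S by auto
 have "cts M p <= tsp S p" using S(4) by (auto simp: cts_def)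
 from dim_subset[OF this] show ?thesis using complex_tangent_dim(2)[OF sub gen pM] t(2,3) by arith
qed

text \<open>A candidate of codimension 4 has the complex tangent space of \<open>M\<close> as its full tangent space, so
 \<open>Re tau\<close> is locally constant on it and its germ lies in a leaf.\<close>

lemma small_orbit:
 assumes c: "CR_orbit_candidate M x 4 S" and x: "x:leaf t"
 shows "EX S'. S' <= leaf t & x:S' & CR_orbit_candidate M x 4 S'"
proof -
 have S: "submanifold C_infinity 4 S" "CR S" "x:S" "S <= M" "!!q. q:S ==> cts S q = cts M q"
 using c by (auto simp: CR_orbit_candidate_def)
 have r: "C_infinity = C_infinity | C_infinity = C_omega" by simp
 have TS: "tsp S q = cts M q" if q: "q:S" for q
 proof -
 note t = submanifold_tangent[OF S(1) r q]
 have qM: "q:M" using S(4) q by auto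
 note d = complex_tangent_dim[OF sub gen qM]
 have "cts M q <= tsp S q" using S(5)[OF q] by (auto simp: cts_def)
 from subspace_dim_equal[OF d(1) t(1) this] show ?thesis using d(2) t(2) by simp
 qed
 obtain V f B where V: "x:V" "card B = 4" and s: "slice_chart C_infinity S B V f" using S(1,3) unfolding submanifold_def by blast
 have xU: "x:U" using x by (simp add: leaf_def)
 have oVU: "open (V Int U)" using slice_chartD(7)[OF s] oU by blast
 have s1: "slice_chart C_infinity S B (V Int U) f" by (rule slice_chart_restrict[OF s oVU]) auto
 note C = slice_chartD[OF s1]
 have xVU: "x:V Int U" using V xU by blast
 define k where "k = inv_into (V Int U) f"
 have "f x:f ` (V Int U)" using xVU by blast
 then obtain qx where de: "qx > 0" "ball (f x) qx <= f ` (V Int U)" using C(8) openE by blast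
 have oc: "of_class C_infinity f (V Int U)" "of_class C_infinity k (f ` (V Int U))" using C(1) by (auto simp: diffeo_def k_def)
 have cf: "con (V Int U) f" using of_class_Ck[OF C(7) oc(1) r, of 0] by simp
 \<comment> \<open>The preimage of a ball, so that in the chart the segment from x to any point of
   the shrunk set stays in the image, and tau can be followed along it.\<close>
 define V2 where "V2 = (V Int U) Int f -` ball (f x) qx"
 have oV2: "open V2" unfolding V2_def by (rule continuous_open_preimage[OF cf C(7) open_ball])
 have s2: "slice_chart C_infinity S B V2 f" by (rule slice_chart_restrict[OF s1 oV2]) (auto simp: V2_def)
 have xV2: "x:V2" using xVU de(1) by (simp add: V2_def)
 define S' where "S' = S Int V2"
 have kC: "(k HD dd k z) (at z)" if "z:f ` (V Int U)" for z
 by (rule Ck_has_derivative[OF of_class_Ck[OF C(8) oc(2) r, of "Suc 0"] that])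
 have const: "tau q = tau x" if q: "q:S'" for q
 proof -
 define w where "w = f q - f x"
 have qV: "q:V Int U" "q:S" "dist (f x) (f q) < qx" using q by (auto simp: S'_def V2_def)
 have nw: "norm w < qx" using qV(3) by (simp add: w_def dist_norm norm_minus_commute)
 have wB: "w ~~ b = 0" if "b:B" for b using C(3)[OF qV(1)] C(3)[OF xVU] qV(2) S(3) that by (simp add: w_def inner_diff_left)
 have inb: "f x+s *R w:f ` (V Int U)" if "s:{0..1}" for s
 proof -
 have "norm (s *R w) <= norm w" using that by (simp add: mult_left_le_one_le)
 hence "f x+s *R w:ball (f x) qx" using nw by (simp add: dist_norm)
 thus ?thesis using de(2) by blast
 qed
 define G where "G s = k (f x+s *R w)" for s
 have GS: "G s:S" "G s:V Int U" "f (G s) = f x+s *R w" if "s:{0..1}" for s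
 proof -
 note i = C(5,6)[OF inb[OF that]]
 show 1: "G s:V Int U" "f (G s) = f x+s *R w" using i by (auto simp: G_def k_def)
 show "G s:S" unfolding C(3)[OF 1(1)] 1(2) using C(3)[OF xVU] S(3) wB by (simp add: inner_add_left)
 qed
 have D: "((%s. tau (G s)) HD (%h. 0)) (at s within {0..1})" if s: "s:{0..1}" for s
 proof -
 let ?z = "f x+s *R w"
 note gs = GS[OF s]
 have sl: "((%s. f x+s *R w) HD (%h. h *R w)) (at s)" by (auto intro!: derivative_eq_intros)
 have Gd: "(G HD (%h. dd k ?z (h *R w))) (at s)" unfolding G_def
 by (rule hdc[OF sl kC[OF inb[OF s]]])
 obtain A E where AE: "(f HD A) (at (G s))" "(inv_into (V Int U) f HD E) (at (f (G s)))" "ALL w. A (E w) = w" "ALL v. E (A v) = v" "blin A" "blin E"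
 by (rule diffeo_deriv[OF C(1) r gs(2)])
 have "E = dd k ?z" using has_derivative_unique[OF AE(2)[unfolded gs(3)]] kC[OF inb[OF s]] by (simp add: k_def)
 hence A: "A (dd k ?z (h *R w)) = h *R w" for h using AE(3) by simp
 have "dd k ?z (h *R w):tsp S (G s)" for h
 unfolding slice_chart_tangent[OF s1 r gs(1,2) AE(1)] by (simp add: A wB)
 hence z: "dd tau (G s) (dd k ?z (h *R w)) = 0" for h
 using ctangent_kernel[of "G s"] TS[OF gs(1)] gs(1,2) S(4) by blast
 have "((%s. tau (G s)) HD (%h. dd tau (G s) (dd k ?z (h *R w)))) (at s)"
 by (rule hdc[OF Gd cdiffD[OF chih]]) (use gs(2) in blast)
 thus ?thesis unfolding z by (rule has_derivative_at_withinI)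
 qed
 obtain c where c: "ALL s:{0..1}. tau (G s) = c" using has_derivative_zero_constant[of "{0..1::real}", OF _ D] by auto
 have "G 0 = x" "G 1 = q" using C(4)[OF xVU] C(4)[OF qV(1)] by (simp_all add: G_def k_def w_def)
 thus ?thesis using c[rule_format, of 0] c[rule_format, of 1] by simp
 qed
 have S'U: "q:M" "q:U" "q:S" if "q:S'" for q using that S(4) by (auto simp: S'_def V2_def)
 have sub': "S' <= leaf t"
 proof
 fix q assume q: "q:S'"
 show "q:leaf t" using S'U[OF q] chiM const[OF q] x by (auto simp: leaf_def)
 qed
 have Tq: "tsp S' q = tsp S q" if q: "q:S'" for q
 proof
 have qV: "q:V2" using q by (simp add: S'_def)
 show "tsp S' q <= tsp S q" by (rule tangent_space_mono_local[OF oV2 qV]) (auto simp: S'_def)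
 show "tsp S q <= tsp S' q" by (rule tangent_space_mono_local[OF oV2 qV]) (auto simp: S'_def)
 qed
 have cT: "cts S' q = cts M q" if q: "q:S'" for q
 using S(5)[OF S'U(3)[OF q]] unfolding cts_def Tq[OF q] .
 have "CR_orbit_candidate M x 4 S'" unfolding CR_orbit_candidate_def
 proof (intro conjI ballI)
 have "S' Int V2 = S Int V2" by (auto simp: S'_def)
 hence "slice_chart C_infinity S' B V2 f" using s2 by (simp add: slice_chart_def)
 thus "submanifold C_infinity 4 S'" unfolding submanifold_def using V(2)
 by (intro ballI exI[of _ V2] exI[of _ f] exI[of _ B]) (auto simp: S'_def)
 have "dim (cts S' q) = DIM(complex^'n) - 4" if "q:S'" for q
 using complex_tangent_dim(2)[OF sub gen S'U(1)[OF that]] unfolding cT[OF that] by arith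
 thus "CR S'" unfolding CR_def by blast
 show "x:S'" using S(3) xV2 by (simp add: S'_def)
 show "S' <= M" using S'U(1) by blast
 show "cts S' q = cts M q" if "q:S'" for q by (rule cT[OF that])
 qed
 thus ?thesis using sub' S(3) xV2 by (intro exI[of _ S']) (simp add: S'_def)
qed

text \<open>The greatest codimension of a candidate is 3 or 4. At points with a candidate of
  codimension 4, a shrunk one lies inside the leaf; at the others the leaf itself, of codimension 3,
  represents the orbit.\<close>

lemma leaf_orbits: "\<exists>\<S>. leaf t = \<Union>\<S> & (ALL S:\<S>. EX p:M. represents_local_CR_orbit M p S)"
proof -
 define \<S> where "\<S> = {S. S <= leaf t & (EX p:M. represents_local_CR_orbit M p S)}"
 have "EX S:\<S>. x:S" if x: "x:leaf t" for x
 proof -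
 have xM: "x:M" using x leaf_M by blast
 show ?thesis
 proof (cases "EX S. CR_orbit_candidate M x 4 S")
 case True
 then obtain S where "CR_orbit_candidate M x 4 S" by blast
 from small_orbit[OF this x] obtain S' where S': "S' <= leaf t" "x:S'" "CR_orbit_candidate M x 4 S'" by blast
 have "represents_local_CR_orbit M x S'" unfolding represents_local_CR_orbit_def using S'(3) candidate_codim by blast
 thus ?thesis using S' xM by (auto simp: \<S>_def)
 next
 case False
 have "d' <= 3" if "CR_orbit_candidate M x d' S'" for d' S'
 proof -
 have "d' ~= 4" using False that by auto
 thus ?thesis using candidate_codim[OF that] by simp
 qed
 hence "represents_local_CR_orbit M x (leaf t)" unfolding represents_local_CR_orbit_def using leaf_candidate[OF x] by blast
 thus ?thesis using x xM by (auto simp: \<S>_def)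
 qed
 qed
 hence "leaf t = \<Union>\<S>" by (auto simp: \<S>_def)
 thus ?thesis by (intro exI[of _ \<S>]) (auto simp: \<S>_def)
qed

lemma straight_iv: "\<exists>U \<L>. open U & 0:U & foliation C_omega 1 (M Int U) \<L> &
 (ALL L:\<L>. \<exists>\<S>. L = \<Union>\<S> & (ALL S:\<S>. EX p:M. represents_local_CR_orbit M p S))"
 using oU U0 straight_foliation leaf_orbits by (intro exI[of _ U] exI[of _ "leaf ` {-qv<..<qv}"]) auto

end

end

theorem corollary1p3:
  fixes M :: "(complex^'n) set"
  assumes "connected M"
    and "submanifold C_omega 2 M"
    and "generic M"
    and "0 \<in> M"
  shows
    "let
       i = (\<exists>H bd. hypersurface_with_boundary C_infinity H bd \<and> Levi_flat (H - bd) \<and>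
              0 \<in> bd \<and> bd \<subseteq> M);
       ii = (\<exists>U H. open U \<and> 0 \<in> U \<and> H \<subseteq> U \<and> hypersurface C_omega H \<and> Levi_flat H \<and>
              M \<inter> U \<subseteq> H);
       iii = (\<exists>U V \<Psi> i1 i2. 0 \<in> U \<and> biholomorphic U V \<Psi> \<and> \<Psi> 0 = 0 \<and> i1 \<noteq> i2 \<and>
              in_normal_coordinates M U \<Psi> i1 i2);
       iv = (\<exists>U \<L>. open U \<and> 0 \<in> U \<and> foliation C_omega 1 (M \<inter> U) \<L> \<and>
              (\<forall>L\<in>\<L>. \<exists>\<S>. L = \<Union>\<S> \<and> (\<forall>S\<in>\<S>. \<exists>p\<in>M. represents_local_CR_orbit M p S)))
     in (i \<longleftrightarrow> ii) \<and> (i \<longleftrightarrow> iii) \<and> (i \<longleftrightarrow> iv)"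
proof -
 let ?i = "EX H bd. hypersurface_with_boundary C_infinity H bd & Levi_flat (H - bd) & 0:bd & bd <= M"
 let ?ii = "EX U H. open U & 0:U & H <= U & hypersurface C_omega H & Levi_flat H & M Int U <= H"
 let ?iii = "EX U V qz i1 i2. 0:U & biholomorphic U V qz & qz 0 = 0 & i1 ~= i2 & in_normal_coordinates M U qz i1 i2"
 let ?iv = "\<exists>U \<L>. open U & 0:U & foliation C_omega 1 (M Int U) \<L> &
 (ALL L:\<L>. \<exists>\<S>. L = \<Union>\<S> & (ALL S:\<S>. EX p:M. represents_local_CR_orbit M p S))"
 from nfM_exists[OF assms(2-4)] obtain a b W T qp jx h where nfM: "nfM a b W T M qp jx h" by (elim exE)
 interpret nfM a b W T M qp jx h by (rule nfM)
 have 1: "EX g. good_g g" if "?i" using that by (elim exE conjE) (rule i_good[OF assms(2)])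
 have 2: "EX g. good_g g" if "?ii" using that by (elim exE conjE) (rule ii_good[OF _ _ _ _ _ assms(4)])
 have 3: "EX g. good_g g" if "?iv" using that by (elim exE conjE) (rule iv_good[OF _ _ assms(4)])
 have 4: ?iii if "EX g. good_g g" using that by (elim exE) (rule good_iii)
 have 5: "?i & ?ii & ?iv" if ?iii
 proof -
 from that obtain U V qz i1 i2 where iii: "0:U" "biholomorphic U V qz" "qz 0 = 0" "i1 ~= i2" "in_normal_coordinates M U qz i1 i2"
 by (elim exE conjE)
 from straight_exists[OF iii] obtain U' ch g qv where s: "straight M i1 i2 U' ch g qv" by (elim exE)
 interpret s: straight M i1 i2 U' ch g qv by (rule s)
 show ?thesis by (intro conjI s.straight_i s.straight_ii s.straight_iv[OF assms(2,3)])
 qed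
 show ?thesis unfolding Let_def
 by (intro conjI iffI) (drule 1 2 3, drule 4, drule 5, (elim conjE, assumption)+ | drule 5, (elim conjE, assumption)+ | drule 1 2 3, erule 4)+
qed

end
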